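(* For a Riemann surface $X$, the Bergman metric is complete and has Gaussian curvature identically equal to $-2$ if and only if $X$ is biholomorphic to a disc.
   Context: Riemann surfaces are connected. For holomorphic 1-forms $\alpha,\beta$ on $X$ put $\langle\alpha,\beta\rangle:=\frac{\sqrt{-1}}{2}\int_X\alpha\wedge\bar\beta$. The Bergman kernel is $\kappa_X(z)=\sum_j e_j(z)\wedge\overline{e_j(z)}$, where $\{e_j\}$ is a complete orthonormal basis of the Hilbert space of square integrable holomorphic 1-forms on $X$. In a local coordinate $w$ one writes $\kappa_X(z)=K(z)|dw|^2$; thus if $e_j=a_j\,dw$ then $K=\sum_j|a_j|^2$. The form $g(z)|dw|^2$ with $g:=\frac{\partial^2\log K}{\partial w\,\partial\bar w}$ is called the Bergman metric if it is positive everywhere (in particular $K>0$ everywhere); the assertion about the Bergman metric includes that it exists in this sense. Its Gaussian curvature is $-2g^{-1}\frac{\partial^2\log g}{\partial w\,\partial\bar w}$. *)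

theory Defs
  imports "HOL-Analysis.Analysis"
begin

section \<open>Riemann surfaces\<close>

type_synonym 'a chart = "'a set \<times> ('a \<Rightarrow> complex)"

abbreviation chart_dom :: "'a chart \<Rightarrow> 'a set" where
  "chart_dom c \<equiv> fst c"

abbreviation coord :: "'a chart \<Rightarrow> 'a \<Rightarrow> complex" where
  "coord c \<equiv> snd c"

definition chart_inv :: "'a chart \<Rightarrow> complex \<Rightarrow> 'a" where
  "chart_inv c = inv_into (chart_dom c) (coord c)"

definition chart_of :: "'a topology \<Rightarrow> 'a chart \<Rightarrow> bool" where
  "chart_of X c \<longleftrightarrow>
     openin X (chart_dom c) \<and> open (coord c ` chart_dom c) \<and>
     homeomorphic_map (subtopology X (chart_dom c)) (top_of_set (coord c ` chart_dom c)) (coord c)"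

text \<open>The atlas need not be maximal.  Second countability is not required: it is automatic
  by Rado's theorem.\<close>

definition riemann_surface :: "'a topology \<Rightarrow> 'a chart set \<Rightarrow> bool" where
  "riemann_surface X A \<longleftrightarrow>
     topspace X \<noteq> {} \<and> connected_space X \<and> Hausdorff_space X \<and>
     (\<forall>c\<in>A. chart_of X c) \<and> (\<Union>c\<in>A. chart_dom c) = topspace X \<and>
     (\<forall>c\<in>A. \<forall>d\<in>A. (coord d \<circ> chart_inv c) holomorphic_on coord c ` (chart_dom c \<inter> chart_dom d))"

definition holomorphic_map ::
  "'a topology \<Rightarrow> 'a chart set \<Rightarrow> 'b topology \<Rightarrow> 'b chart set \<Rightarrow> ('a \<Rightarrow> 'b) \<Rightarrow> bool" where
  "holomorphic_map X A Y B f \<longleftrightarrow>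
     continuous_map X Y f \<and>
     (\<forall>c\<in>A. \<forall>d\<in>B. (coord d \<circ> f \<circ> chart_inv c) holomorphic_on
        coord c ` {p \<in> chart_dom c. f p \<in> chart_dom d})"

definition biholomorphic ::
  "'a topology \<Rightarrow> 'a chart set \<Rightarrow> 'b topology \<Rightarrow> 'b chart set \<Rightarrow> bool" where
  "biholomorphic X A Y B \<longleftrightarrow>
     (\<exists>f h. holomorphic_map X A Y B f \<and> holomorphic_map Y B X A h \<and>
        (\<forall>p\<in>topspace X. h (f p) = p) \<and> (\<forall>q\<in>topspace Y. f (h q) = q))"

definition plane_atlas :: "complex set \<Rightarrow> complex chart set" where
  "plane_atlas D = {(D, id)}"


section \<open>Differential forms\<close>

text \<open>A 1-form is given by its coefficients: \<open>\<alpha> c p\<close> is the number \<open>a\<close> with \<open>\<alpha> = a dw\<close> at the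
  point \<open>p\<close>, where \<open>w = coord c\<close>.  Similarly a 2-form is given by its coefficients with respect
  to \<open>dx \<and> dy\<close>, where \<open>w = x + i y\<close>.\<close>

type_synonym 'a form = "'a chart \<Rightarrow> 'a \<Rightarrow> complex"

definition holomorphic_form :: "'a chart set \<Rightarrow> 'a form \<Rightarrow> bool" where
  "holomorphic_form A \<alpha> \<longleftrightarrow>
     (\<forall>c\<in>A. (\<alpha> c \<circ> chart_inv c) holomorphic_on coord c ` chart_dom c) \<and>
     (\<forall>c\<in>A. \<forall>d\<in>A. \<forall>p \<in> chart_dom c \<inter> chart_dom d.
        \<alpha> c p = \<alpha> d p * deriv (coord d \<circ> chart_inv c) (coord c p))"

text \<open>The 2-form \<open>\<alpha> \<and> cnj \<beta>\<close>; recall that \<open>dw \<and> cnj dw = -2 i dx \<and> dy\<close>.\<close>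

definition wedge_cnj :: "'a form \<Rightarrow> 'a form \<Rightarrow> 'a form" where
  "wedge_cnj \<alpha> \<beta> = (\<lambda>c p. - 2 * \<i> * (\<alpha> c p * cnj (\<beta> c p)))"

text \<open>A 2-form is integrated by cutting the surface into countably many Borel pieces, each lying
  in the domain of a chart.\<close>

definition borel_partition ::
  "'a topology \<Rightarrow> 'a chart set \<Rightarrow> (nat \<Rightarrow> 'a set) \<Rightarrow> (nat \<Rightarrow> 'a chart) \<Rightarrow> bool" where
  "borel_partition X A S P \<longleftrightarrow>
     disjoint_family S \<and> (\<Union>n. S n) = topspace X \<and>
     (\<forall>n. P n \<in> A \<and> S n \<subseteq> chart_dom (P n) \<and> coord (P n) ` S n \<in> sets borel)"

definition has_form_integral ::
  "'a topology \<Rightarrow> 'a chart set \<Rightarrow> 'a form \<Rightarrow> complex \<Rightarrow> bool" where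
  "has_form_integral X A \<omega> I \<longleftrightarrow>
     (\<exists>S P. borel_partition X A S P \<and>
        (\<forall>n. set_integrable lborel (coord (P n) ` S n) (\<omega> (P n) \<circ> chart_inv (P n))) \<and>
        summable (\<lambda>n. LINT z:coord (P n) ` S n|lborel. cmod (\<omega> (P n) (chart_inv (P n) z))) \<and>
        (\<lambda>n. LINT z:coord (P n) ` S n|lborel. \<omega> (P n) (chart_inv (P n) z)) sums I)"

definition form_integral :: "'a topology \<Rightarrow> 'a chart set \<Rightarrow> 'a form \<Rightarrow> complex" where
  "form_integral X A \<omega> = (THE I. has_form_integral X A \<omega> I)"


section \<open>The Bergman kernel\<close>

definition form_inner :: "'a topology \<Rightarrow> 'a chart set \<Rightarrow> 'a form \<Rightarrow> 'a form \<Rightarrow> complex" where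
  "form_inner X A \<alpha> \<beta> = \<i> / 2 * form_integral X A (wedge_cnj \<alpha> \<beta>)"

definition form_norm :: "'a topology \<Rightarrow> 'a chart set \<Rightarrow> 'a form \<Rightarrow> real" where
  "form_norm X A \<alpha> = sqrt (Re (form_inner X A \<alpha> \<alpha>))"

definition L2_forms :: "'a topology \<Rightarrow> 'a chart set \<Rightarrow> 'a form set" where
  "L2_forms X A = {\<alpha>. holomorphic_form A \<alpha> \<and> (\<exists>I. has_form_integral X A (wedge_cnj \<alpha> \<alpha>) I)}"

text \<open>Orthonormal with dense linear span.\<close>

definition complete_orthonormal_basis :: "'a topology \<Rightarrow> 'a chart set \<Rightarrow> 'a form set \<Rightarrow> bool" where
  "complete_orthonormal_basis X A E \<longleftrightarrow>
     E \<subseteq> L2_forms X A \<and>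
     (\<forall>e\<in>E. \<forall>f\<in>E. form_inner X A e f = (if e = f then 1 else 0)) \<and>
     (\<forall>\<alpha>\<in>L2_forms X A. \<forall>\<epsilon>>0. \<exists>F u. finite F \<and> F \<subseteq> E \<and>
        form_norm X A (\<lambda>c p. \<alpha> c p - (\<Sum>e\<in>F. u e * e c p)) < \<epsilon>)"

text \<open>The function \<open>K\<close> with \<open>\<kappa> = K |dw|\<^sup>2\<close> for \<open>w = coord c\<close>; it does not depend on the basis.\<close>

definition bergman_kernel :: "'a topology \<Rightarrow> 'a chart set \<Rightarrow> 'a chart \<Rightarrow> 'a \<Rightarrow> real" where
  "bergman_kernel X A c p =
     (\<Sum>\<^sub>\<infinity>e\<in>(SOME E. complete_orthonormal_basis X A E). (cmod (e c p))\<^sup>2)"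


section \<open>Conformal metrics\<close>

definition d_dw :: "(complex \<Rightarrow> complex) \<Rightarrow> complex \<Rightarrow> complex" where
  "d_dw f z = (vector_derivative (\<lambda>t::real. f (z + of_real t)) (at 0)
      - \<i> * vector_derivative (\<lambda>t::real. f (z + \<i> * of_real t)) (at 0)) / 2"

definition d_dwbar :: "(complex \<Rightarrow> complex) \<Rightarrow> complex \<Rightarrow> complex" where
  "d_dwbar f z = (vector_derivative (\<lambda>t::real. f (z + of_real t)) (at 0)
      + \<i> * vector_derivative (\<lambda>t::real. f (z + \<i> * of_real t)) (at 0)) / 2"

text \<open>For a real \<open>C\<^sup>2\<close> function the mixed derivative is already real, so \<open>Re\<close> is only a
  coercion.\<close>

definition d2_dw_dwbar :: "(complex \<Rightarrow> real) \<Rightarrow> complex \<Rightarrow> real" where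
  "d2_dw_dwbar u z = Re (d_dw (d_dwbar (\<lambda>w. of_real (u w))) z)"

text \<open>A conformal metric \<open>g |dw|\<^sup>2\<close> is given by its coefficients \<open>g c p\<close>, for \<open>w = coord c\<close>.\<close>

type_synonym 'a conformal_metric = "'a chart \<Rightarrow> 'a \<Rightarrow> real"

definition gaussian_curvature :: "'a conformal_metric \<Rightarrow> 'a chart \<Rightarrow> 'a \<Rightarrow> real" where
  "gaussian_curvature g c p =
     - 2 * inverse (g c p) * d2_dw_dwbar (\<lambda>z. ln (g c (chart_inv c z))) (coord c p)"

definition piecewise_C1_curve :: "'a topology \<Rightarrow> 'a chart set \<Rightarrow> (real \<Rightarrow> 'a) \<Rightarrow> bool" where
  "piecewise_C1_curve X A \<gamma> \<longleftrightarrow>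
     pathin X \<gamma> \<and>
     (\<forall>c\<in>A. \<forall>s t. {s..t} \<subseteq> {0..1} \<and> \<gamma> ` {s..t} \<subseteq> chart_dom c \<longrightarrow>
        (coord c \<circ> \<gamma>) piecewise_C1_differentiable_on {s..t})"

text \<open>The speed does not depend on the chart used at \<open>\<gamma> t\<close>.  Lengths are extended real, since
  \<^const>\<open>piecewise_C1_differentiable_on\<close> does not bound the derivative near the break points.\<close>

definition curve_speed :: "'a chart set \<Rightarrow> 'a conformal_metric \<Rightarrow> (real \<Rightarrow> 'a) \<Rightarrow> real \<Rightarrow> real" where
  "curve_speed A g \<gamma> t =
     (let c = (SOME c. c \<in> A \<and> \<gamma> t \<in> chart_dom c)
      in sqrt (g c (\<gamma> t)) * cmod (vector_derivative (coord c \<circ> \<gamma>) (at t)))"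

definition curve_length :: "'a chart set \<Rightarrow> 'a conformal_metric \<Rightarrow> (real \<Rightarrow> 'a) \<Rightarrow> ennreal" where
  "curve_length A g \<gamma> = (\<integral>\<^sup>+t\<in>{0..1}. ennreal (curve_speed A g \<gamma> t) \<partial>lborel)"

definition metric_dist ::
  "'a topology \<Rightarrow> 'a chart set \<Rightarrow> 'a conformal_metric \<Rightarrow> 'a \<Rightarrow> 'a \<Rightarrow> real" where
  "metric_dist X A g p q =
     enn2real (INF \<gamma> \<in> {\<gamma>. piecewise_C1_curve X A \<gamma> \<and> \<gamma> 0 = p \<and> \<gamma> 1 = q}. curve_length A g \<gamma>)"

definition complete_metric :: "'a topology \<Rightarrow> 'a chart set \<Rightarrow> 'a conformal_metric \<Rightarrow> bool" where
  "complete_metric X A g \<longleftrightarrow> Metric_space.mcomplete (topspace X) (metric_dist X A g)"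


section \<open>The Bergman metric\<close>

definition bergman_metric :: "'a topology \<Rightarrow> 'a chart set \<Rightarrow> 'a conformal_metric" where
  "bergman_metric X A c p =
     d2_dw_dwbar (\<lambda>z. ln (bergman_kernel X A c (chart_inv c z))) (coord c p)"

definition bergman_metric_exists :: "'a topology \<Rightarrow> 'a chart set \<Rightarrow> bool" where
  "bergman_metric_exists X A \<longleftrightarrow>
     (\<forall>c\<in>A. \<forall>p\<in>chart_dom c. bergman_kernel X A c p > 0 \<and> bergman_metric X A c p > 0)"

end

theory Submission
  imports Defs "HOL-Complex_Analysis.Complex_Analysis"
begin

text \<open>Suppose that the Bergman metric has curvature \<open>-2\<close>.  Polarization turns the kernel \<open>K\<close> into a holomorphic
  function of two variables, and the curvature condition into Liouville's equation for the coefficient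
  \<open>g = (log K)\<^sub>z\<^sub>w\<close> of the metric.  Normalizing \<open>log K\<close> and \<open>log g\<close> to vanish on the axes through a point \<open>p\<close>, one can
  solve it explicitly: near \<open>p\<close>, \<open>K = |k|\<^sup>2 / (K(p) (1 - |T|\<^sup>2)\<^sup>2)\<close>, where \<open>k = K(\<cdot>, p)\<close> and \<open>T\<close> is, up to an
  affine map, the quotient of the derivative of \<open>K(\<cdot>, q)\<close> in \<open>q\<close> at \<open>p\<close> by \<open>k\<close>.  Both sides continue analytically over the surface, and by the
  maximum principle \<open>k\<close> has no zeros.  Hence \<open>T\<close> is a holomorphic map to the unit disc that pulls the
  metric \<open>2 |dz|\<^sup>2 / (1 - |z|\<^sup>2)\<^sup>2\<close> back to the Bergman metric.  If the latter is complete, a section of \<open>T\<close> over a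
  disc \<open>|z| < R < 1\<close> extends across every boundary point, so \<open>T\<close> has a section over the unit disc and is biholomorphic.

  Conversely, if \<open>T\<close> maps the surface biholomorphically to the unit disc, then by the mean value property
  the inner product of a form \<open>a(T) dT\<close> with \<open>dT\<close> is \<open>\<pi> a(0)\<close>.  Parseval's identity gives the kernel at \<open>T = 0\<close>, and composing
  \<open>T\<close> with the automorphisms of the disc gives it everywhere, whence the metric.\<close>

section \<open>Holomorphic functions of two variables\<close>

text \<open>Since the curvature carries a factor 2, the value \<open>-2\<close> says that
  \<open>log g\<close> and \<open>log K\<close> have the same mixed derivative \<open>g\<close>; so
  locally \<open>g / K\<close> splits into a function of \<open>z\<close> times a function of
  \<open>w\<close>, and the problem closes on \<open>log K\<close> alone. It is posed only on the
  diagonal \<open>w = cnj z\<close>; off it, one variable can be frozen and the other treated by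
  ordinary differential equations. The local formula determines a square only, and its denominators
  may vanish away from \<open>p\<close>. What is continued is therefore the cleared form
  \<open>K K(p) (|k|^2 - |m|^2)^2 = |k|^6\<close> with \<open>T = m / k\<close>: it keeps its
  meaning at zeros of \<open>k\<close>, and a change of chart scales both sides alike. That
  \<open>|m| < |k|\<close> everywhere needs a second open and closed argument. Integrals of forms
  ask for a countable Borel partition, while the surface is not given as second countable. A Bergman
  metric forces a partition to exist, because otherwise the kernel is \<open>0\<close>; a
  biholomorphism with a disc provides one by Lindeloef's theorem. Every integral is then taken
  against one measure glued from the pieces.\<close>

definition hol2 :: "complex set \<Rightarrow> complex set \<Rightarrow> (complex \<Rightarrow> complex \<Rightarrow> complex) \<Rightarrow> bool" where
  "hol2 U V G \<longleftrightarrow> open U \<and> open V \<and>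
     (\<forall>w\<in>V. (\<lambda>z. G z w) holomorphic_on U) \<and> (\<forall>z\<in>U. (\<lambda>w. G z w) holomorphic_on V) \<and>
     continuous_on (U \<times> V) (\<lambda>(z, w). G z w)"

definition D1 :: "(complex \<Rightarrow> complex \<Rightarrow> complex) \<Rightarrow> complex \<Rightarrow> complex \<Rightarrow> complex" where
  "D1 G z w = deriv (\<lambda>z. G z w) z"

definition D2 :: "(complex \<Rightarrow> complex \<Rightarrow> complex) \<Rightarrow> complex \<Rightarrow> complex \<Rightarrow> complex" where
  "D2 G z w = deriv (\<lambda>w. G z w) w"

lemma hol2_swap: "hol2 U V G \<Longrightarrow> hol2 V U (\<lambda>w z. G z w)"
proof -
  assume h: "hol2 U V G"
  have "continuous_on (V \<times> U) ((\<lambda>(z, w). G z w) \<circ> prod.swap)"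
    by (rule continuous_on_compose) (use h in \<open>auto simp: hol2_def product_swap intro!: continuous_intros\<close>)
  then show ?thesis using h by (auto simp: hol2_def o_def case_prod_unfold)
qed

lemma hol2_open: "hol2 U V G \<Longrightarrow> open U" "hol2 U V G \<Longrightarrow> open V"
  by (auto simp: hol2_def)

lemma hol2_holomorphic1: "hol2 U V G \<Longrightarrow> w \<in> V \<Longrightarrow> (\<lambda>z. G z w) holomorphic_on U"
  by (auto simp: hol2_def)

lemma hol2_holomorphic2: "hol2 U V G \<Longrightarrow> z \<in> U \<Longrightarrow> (\<lambda>w. G z w) holomorphic_on V"
  by (auto simp: hol2_def)

lemma hol2_continuous: "hol2 U V G \<Longrightarrow> continuous_on (U \<times> V) (\<lambda>(z, w). G z w)"
  by (auto simp: hol2_def)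

lemma hol2_subset: "hol2 U V G \<Longrightarrow> open U' \<Longrightarrow> open V' \<Longrightarrow> U' \<subseteq> U \<Longrightarrow> V' \<subseteq> V \<Longrightarrow> hol2 U' V' G"
  unfolding hol2_def
  by (auto intro: holomorphic_on_subset elim!: continuous_on_subset)

lemma hol2_D1:
  assumes "hol2 U V G" "z \<in> U" "w \<in> V"
  shows "((\<lambda>z. G z w) has_field_derivative D1 G z w) (at z)"
  using assms holomorphic_derivI[of "\<lambda>z. G z w" U z] by (auto simp: hol2_def D1_def)

lemma hol2_D2:
  assumes "hol2 U V G" "z \<in> U" "w \<in> V"
  shows "((\<lambda>w. G z w) has_field_derivative D2 G z w) (at w)"
  using assms holomorphic_derivI[of "\<lambda>w. G z w" V w] by (auto simp: hol2_def D2_def)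

lemma hol2_local_bound:
  assumes "hol2 U V G" "z \<in> U" "w \<in> V"
  obtains r M where "r > 0" "cball z r \<subseteq> U" "cball w r \<subseteq> V"
    "\<And>z' w'. z' \<in> cball z r \<Longrightarrow> w' \<in> cball w r \<Longrightarrow> norm (G z' w') \<le> M"
proof -
  obtain r1 where r1: "r1 > 0" "cball z r1 \<subseteq> U" using assms open_contains_cball hol2_open by metis
  obtain r2 where r2: "r2 > 0" "cball w r2 \<subseteq> V" using assms open_contains_cball hol2_open by metis
  define r where "r = min r1 r2"
  have r: "r > 0" "cball z r \<subseteq> U" "cball w r \<subseteq> V" using r1 r2 by (auto simp: r_def)
  have "compact ((\<lambda>(z, w). G z w) ` (cball z r \<times> cball w r))"
    by (intro compact_continuous_image compact_Times compact_cball continuous_on_subset[OF hol2_continuous[OF assms(1)]])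
       (use r in auto)
  then obtain M where M: "\<forall>x\<in>(\<lambda>(z, w). G z w) ` (cball z r \<times> cball w r). norm x \<le> M"
    using compact_imp_bounded bounded_iff by metis
  show thesis by (rule that[OF r, of M]) (use M in force)
qed

lemma cauchy_deriv_bound:
  assumes "f holomorphic_on S" "cball z r \<subseteq> S" "r > 0" "\<And>x. x \<in> cball z r \<Longrightarrow> norm (f x) \<le> M"
  shows "norm (deriv f z) \<le> M / r" "norm ((deriv ^^ 2) f z) \<le> 2 * M / r ^ 2"
proof -
  have *: "norm ((deriv ^^ n) f z) \<le> fact n * M / r ^ n" for n
  proof (rule Cauchy_inequality)
    show "f holomorphic_on ball z r" "continuous_on (cball z r) f"
      using assms ball_subset_cball holomorphic_on_imp_continuous_on holomorphic_on_subset
      by (meson order_trans)+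
  qed (use assms in \<open>auto simp: dist_norm\<close>)
  show "norm (deriv f z) \<le> M / r" using *[of 1] by simp
  show "norm ((deriv ^^ 2) f z) \<le> 2 * M / r ^ 2" using *[of 2] by simp
qed

text \<open>Every point of the smaller disc has a disc of radius \<open>r\<close> inside the larger
  one, so Cauchy's estimate bounds the derivative by \<open>M / r\<close> on a convex set.\<close>

lemma holomorphic_bounded_lipschitz:
  assumes "f holomorphic_on S" "cball z0 (2 * r) \<subseteq> S" "r > 0"
    "\<And>x. x \<in> cball z0 (2 * r) \<Longrightarrow> norm (f x) \<le> M" "x \<in> cball z0 r" "y \<in> cball z0 r"
  shows "norm (f x - f y) \<le> M / r * norm (x - y)"
proof (rule field_differentiable_bound[of "cball z0 r" f "deriv f"])
  fix u assume u: "u \<in> cball z0 r"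
  have s: "cball u r \<subseteq> cball z0 (2 * r)"
  proof
    fix y assume "y \<in> cball u r"
    then show "y \<in> cball z0 (2 * r)" using u dist_triangle[of z0 y u] by auto
  qed
  have sub: "cball z0 r \<subseteq> interior S"
    using assms(2,3) by (intro interior_maximal[of "ball z0 (2*r)", THEN order_trans[rotated]]) (auto simp: subset_iff)
  show "(f has_field_derivative deriv f u) (at u within cball z0 r)"
    by (rule has_field_derivative_at_within, rule holomorphic_derivI[of f "interior S" u])
       (use assms(1) sub u in \<open>auto intro: holomorphic_on_subset[OF _ interior_subset]\<close>)
  show "norm (deriv f u) \<le> M / r"
    by (rule cauchy_deriv_bound(1)[OF assms(1)]) (use s assms in auto)
qed (use assms in auto)

text \<open>Osgood's criterion. By Cauchy's estimate a local bound makes the slices in either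
  variable Lipschitz with a common constant; moving first \<open>z\<close>, then \<open>w\<close>,
  gives joint continuity.\<close>

lemma hol2I_bounded:
  assumes "open U" "open V" "\<And>w. w \<in> V \<Longrightarrow> (\<lambda>z. G z w) holomorphic_on U"
    "\<And>z. z \<in> U \<Longrightarrow> (\<lambda>w. G z w) holomorphic_on V"
    "\<And>z w. z \<in> U \<Longrightarrow> w \<in> V \<Longrightarrow> \<exists>r>0. \<exists>M. \<forall>z'\<in>cball z r \<inter> U. \<forall>w'\<in>cball w r \<inter> V. norm (G z' w') \<le> M"
  shows "hol2 U V G"
proof -
  have "((\<lambda>(z, w). G z w) \<longlongrightarrow> G z0 w0) (at (z0, w0))" if z0: "z0 \<in> U" and w0: "w0 \<in> V" for z0 w0
  proof -
    obtain r M where r: "r > 0" and M: "\<And>z' w'. z'\<in>cball z0 r \<inter> U \<Longrightarrow> w'\<in>cball w0 r \<inter> V \<Longrightarrow> norm (G z' w') \<le> M"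
      using assms(5)[OF z0 w0] by blast
    obtain r1 where r1: "r1 > 0" "cball z0 r1 \<subseteq> U" using assms z0 open_contains_cball by metis
    obtain r2 where r2: "r2 > 0" "cball w0 r2 \<subseteq> V" using assms w0 open_contains_cball by metis
    define s where "s = min r (min r1 r2) / 2"
    have s: "s > 0" "cball z0 (2 * s) \<subseteq> U" "cball w0 (2 * s) \<subseteq> V" "2 * s \<le> r" using r r1 r2 by (auto simp: s_def)
    have bd: "norm (G z w - G z0 w0) \<le> M / s * (norm (z - z0) + norm (w - w0))"
      if z: "z \<in> cball z0 s" and w: "w \<in> cball w0 s" for z w
    proof -
      have wV: "w \<in> V" using w s by auto
      have "norm (G z w - G z0 w) \<le> M / s * norm (z - z0)"
        by (rule holomorphic_bounded_lipschitz[OF assms(3)[OF wV], of z0 s M]) (use s z w wV in \<open>auto intro!: M\<close>)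
      moreover have "norm (G z0 w - G z0 w0) \<le> M / s * norm (w - w0)"
        by (rule holomorphic_bounded_lipschitz[OF assms(4)[OF z0], of w0 s M]) (use s z w z0 r in \<open>auto intro!: M\<close>)
      ultimately show ?thesis using norm_triangle_ineq[of "G z w - G z0 w" "G z0 w - G z0 w0"] by (simp add: algebra_simps)
    qed
    have ev: "eventually (\<lambda>x. x \<in> ball z0 s \<times> ball w0 s) (at (z0, w0))"
      by (rule eventually_at_in_open') (use s in \<open>auto intro: open_Times\<close>)
    have "((\<lambda>x. M / s * (norm (fst x - z0) + norm (snd x - w0))) \<longlongrightarrow> M / s * (norm (z0 - z0) + norm (w0 - w0))) (at (z0, w0))"
      by (intro tendsto_intros tendsto_eq_intros) auto
    then have "((\<lambda>x. M / s * (norm (fst x - z0) + norm (snd x - w0))) \<longlongrightarrow> 0) (at (z0, w0))" by simp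
    moreover have "eventually (\<lambda>x. norm (G (fst x) (snd x) - G z0 w0) \<le> M / s * (norm (fst x - z0) + norm (snd x - w0))) (at (z0, w0))"
      by (rule eventually_mono[OF ev]) (use bd in auto)
    ultimately have "((\<lambda>x. G (fst x) (snd x) - G z0 w0) \<longlongrightarrow> 0) (at (z0, w0))"
      by (rule Lim_null_comparison[rotated])
    then show ?thesis by (subst (asm) LIM_zero_iff) (simp add: case_prod_unfold)
  qed
  then have "continuous_on (U \<times> V) (\<lambda>(z, w). G z w)"
    by (subst continuous_on_eq_continuous_at) (auto simp: open_Times assms isCont_def)
  with assms show ?thesis by (auto simp: hol2_def)
qed

text \<open>The difference quotients in \<open>z\<close> along the null sequence \<open>h\<close>
  are holomorphic in \<open>w\<close> and converge to \<open>D1 G z0\<close> locally uniformly in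
  \<open>w\<close>, with an error of order \<open>norm (h n)\<close> by Taylor's formula. Hence the
  limit is holomorphic and the \<open>w\<close>-derivatives converge with it. The conclusion retains
  the sequence because it also yields the symmetry of the mixed derivatives.\<close>

lemma hol2_D1_aux:
  assumes G: "hol2 U V G" and z0: "z0 \<in> U"
  shows "\<exists>g'. \<forall>w\<in>V. ((\<lambda>w. D1 G z0 w) has_field_derivative g' w) (at w) \<and>
    (\<exists>h. h \<longlonglongrightarrow> 0 \<and> (\<forall>n. h n \<noteq> 0) \<and> (\<lambda>n. (D2 G (z0 + h n) w - D2 G z0 w) / h n) \<longlonglongrightarrow> g' w)"
proof -
  obtain r where r: "r > 0" "cball z0 (2 * r) \<subseteq> U"
  proof -
    obtain r where "r > 0" "cball z0 r \<subseteq> U" using G z0 open_contains_cball hol2_open by metis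
    then show thesis by (intro that[of "r/2"]) auto
  qed
  define h :: "nat \<Rightarrow> complex" where "h n = of_real (r / of_nat (Suc n))" for n
  have h0: "h n \<noteq> 0" for n using r by (auto simp: h_def simp del: of_nat_Suc)
  have hr: "norm (h n) \<le> r" for n
  proof -
    have "r / real (Suc n) \<le> r / 1" using r by (intro divide_left_mono) auto
    then show ?thesis using r by (simp add: h_def norm_divide del: of_nat_Suc)
  qed
  have hlim: "h \<longlonglongrightarrow> 0"
  proof -
    have "(\<lambda>n. r * inverse (real (Suc n))) \<longlonglongrightarrow> r * 0"
      by (intro tendsto_mult tendsto_const LIMSEQ_inverse_real_of_nat)
    then have "(\<lambda>n. of_real (r * inverse (real (Suc n)))) \<longlonglongrightarrow> (of_real (r * 0) :: complex)"
      by (rule tendsto_of_real)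
    then show ?thesis by (simp add: h_def[abs_def] divide_inverse del: of_nat_Suc)
  qed
  have zh: "z0 + h n \<in> U" for n using r hr[of n] by (auto simp: subset_iff dist_norm)
  have "\<exists>g'. \<forall>w\<in>V. ((\<lambda>w. D1 G z0 w) has_field_derivative g' w) (at w) \<and>
      (\<lambda>n. (D2 G (z0 + h n) w - D2 G z0 w) / h n) \<longlonglongrightarrow> g' w"
  proof (rule has_complex_derivative_uniform_sequence)
    show "open V" using G hol2_open by blast
    show "((\<lambda>w. (G (z0 + h n) w - G z0 w) / h n) has_field_derivative (D2 G (z0 + h n) w - D2 G z0 w) / h n) (at w)"
      if "w \<in> V" for n w
      by (intro DERIV_cdivide DERIV_diff hol2_D2[OF G] zh z0 that)
    fix w assume w: "w \<in> V"
    obtain r' M where r': "r' > 0" "cball z0 r' \<subseteq> U" "cball w r' \<subseteq> V"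
      "\<And>z' w'. z' \<in> cball z0 r' \<Longrightarrow> w' \<in> cball w r' \<Longrightarrow> norm (G z' w') \<le> M"
      using hol2_local_bound[OF G z0 w] by blast
    define s where "s = r' / 2"
    have s: "s > 0" "cball z0 (2 * s) \<subseteq> U" using r' by (auto simp: s_def)
    \<comment> \<open>Cauchy's bound for the second \<open>z\<close>-derivative on
      \<open>cball z0 s\<close>; halving \<open>r'\<close> leaves a disc of radius \<open>s\<close>
      around each point there.\<close>
    define B where "B = 2 * M / s ^ 2"
    have bd: "norm ((G (z0 + k) w' - G z0 w') / k - D1 G z0 w') \<le> B * norm k"
      if k: "norm k \<le> s" "k \<noteq> 0" and w': "w' \<in> cball w r'" for k w'
    proof -
      have w'V: "w' \<in> V" using w' r' by auto
      define f where "f = (\<lambda>z. G z w')"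
      have hf: "f holomorphic_on U" using G w'V by (auto simp: hol2_def f_def)
      have hdf: "((deriv ^^ i) f has_field_derivative (deriv ^^ Suc i) f x) (at x within cball z0 s)"
        if "x \<in> cball z0 s" for i x
      proof -
        have "x \<in> U" using that s by (auto simp: subset_iff)
        then show ?thesis
          using holomorphic_derivI[OF holomorphic_higher_deriv[OF hf], of x i] hol2_open(1)[OF G]
          by (auto intro: has_field_derivative_at_within)
      qed
      have 1: "norm ((deriv ^^ 0) f (z0 + k) - (\<Sum>i\<le>1. (deriv ^^ i) f z0 * (z0 + k - z0) ^ i / fact i))
        \<le> B * norm (z0 + k - z0) ^ Suc 1 / fact 1"
      proof (rule complex_Taylor[of "cball z0 s"])
        fix x assume x: "x \<in> cball z0 s"
        have "cball x s \<subseteq> cball z0 (2 * s)"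
          using x by (auto simp: subset_iff intro: order_trans[OF dist_triangle[of z0 _ x]])
        then show "norm ((deriv ^^ Suc 1) f x) \<le> B" unfolding B_def
          using cauchy_deriv_bound(2)[OF hf, of x s M] r'(4)[OF _ w'] s
          by (force simp: f_def s_def numeral_2_eq_2)
      qed (use s k hdf in \<open>auto simp: dist_norm\<close>)
      have eq: "(G (z0 + k) w' - G z0 w') / k - D1 G z0 w' = (f (z0 + k) - (f z0 + deriv f z0 * k)) / k"
        using k by (simp add: f_def D1_def field_simps)
      show ?thesis unfolding eq norm_divide
        using 1 k by (simp add: divide_le_eq power2_eq_square numeral_2_eq_2 mult.assoc)
    qed
    have "uniform_limit (cball w r') (\<lambda>n w. (G (z0 + h n) w - G z0 w) / h n) (\<lambda>w. D1 G z0 w) sequentially"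
      unfolding uniform_limit_iff
    proof (intro allI impI)
      fix e :: real assume e: "e > 0"
      \<comment> \<open>One admissible increment already forces \<open>B\<close> to be nonnegative,
        since the left side of \<open>bd\<close> is a norm.\<close>
      have "norm (of_real s :: complex) \<le> s" "of_real s \<noteq> (0::complex)" "w \<in> cball w r'" using s r' by auto
      from order_trans[OF norm_ge_zero bd[OF this]] have B0: "0 \<le> B" using s by (simp add: zero_le_mult_iff)
      have "(\<lambda>n. norm (h n)) \<longlonglongrightarrow> 0" using hlim by (rule tendsto_norm_zero)
      then have "eventually (\<lambda>n. norm (h n) < min s (e / (B + 1))) sequentially"
        using order_tendstoD(2)[of "\<lambda>n. norm (h n)" 0 sequentially "min s (e / (B + 1))"] s e B0 by auto
      then show "eventually (\<lambda>n. \<forall>x\<in>cball w r'. dist ((G (z0 + h n) x - G z0 x) / h n) (D1 G z0 x) < e) sequentially"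
      proof eventually_elim
        case (elim n)
        have "B * norm (h n) < e"
        proof -
          have "B * norm (h n) \<le> (B + 1) * norm (h n)" by (simp add: algebra_simps)
          also have "\<dots> < e" using elim B0 by (simp add: pos_less_divide_eq mult.commute)
          finally show ?thesis .
        qed
        then show ?case using bd[OF _ h0, of n] elim unfolding dist_norm by (meson le_less_trans less_imp_le min_less_iff_conj)
      qed
    qed
    then show "\<exists>d>0. cball w d \<subseteq> V \<and> uniform_limit (cball w d) (\<lambda>n w. (G (z0 + h n) w - G z0 w) / h n) (\<lambda>w. D1 G z0 w) sequentially"
      using r' by blast
  qed
  then show ?thesis using h0 hlim by blast
qed

lemma hol2_D1_holomorphic2:
  assumes "hol2 U V G" "z \<in> U" shows "(\<lambda>w. D1 G z w) holomorphic_on V"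
  using hol2_D1_aux[OF assms] hol2_open(2)[OF assms(1)]
  by (auto simp: holomorphic_on_open)

lemma D2_swap: "D2 G z w = D1 (\<lambda>w z. G z w) w z" by (simp add: D1_def D2_def)

text \<open>Cauchy's estimate on half the radius turns a local bound for \<open>G\<close> into one
  for \<open>D1 G\<close>, which is all that \<open>hol2I_bounded\<close> asks beyond separate
  holomorphy.\<close>

lemma hol2_hol2_D1:
  assumes G: "hol2 U V G" shows "hol2 U V (D1 G)"
proof (rule hol2I_bounded)
  show "open U" "open V" using G hol2_open by auto
  show "(\<lambda>z. D1 G z w) holomorphic_on U" if "w \<in> V" for w
    using holomorphic_deriv[OF hol2_holomorphic1[OF G that] hol2_open(1)[OF G]] by (simp add: D1_def)
  show "(\<lambda>w. D1 G z w) holomorphic_on V" if "z \<in> U" for z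
    by (rule hol2_D1_holomorphic2[OF G that])
  fix z0 w0 assume "z0 \<in> U" "w0 \<in> V"
  then obtain r M where r: "r > 0" "cball z0 r \<subseteq> U" "cball w0 r \<subseteq> V"
      "\<And>z' w'. z' \<in> cball z0 r \<Longrightarrow> w' \<in> cball w0 r \<Longrightarrow> norm (G z' w') \<le> M"
    using hol2_local_bound[OF G] by metis
  have "norm (D1 G z' w') \<le> M / (r / 2)" if "z' \<in> cball z0 (r / 2)" "w' \<in> cball w0 (r / 2)" for z' w'
    unfolding D1_def
  proof (rule cauchy_deriv_bound(1))
    show "(\<lambda>z. G z w') holomorphic_on U" using that r by (intro hol2_holomorphic1[OF G]) (auto simp: subset_iff)
    have s: "cball z' (r / 2) \<subseteq> cball z0 r"
    proof
      fix y assume "y \<in> cball z' (r / 2)"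
      then show "y \<in> cball z0 r" using that dist_triangle[of z0 y z'] by auto
    qed
    then show "cball z' (r / 2) \<subseteq> U" using r by auto
    show "norm (G x w') \<le> M" if "x \<in> cball z' (r / 2)" for x
      using that s \<open>w' \<in> _\<close> r by (intro r(4)) auto
  qed (use r in auto)
  then show "\<exists>r>0. \<exists>M. \<forall>z'\<in>cball z0 r \<inter> U. \<forall>w'\<in>cball w0 r \<inter> V. norm (D1 G z' w') \<le> M"
    using r(1) by (intro exI[of _ "r / 2"] conjI exI[of _ "M / (r / 2)"]) auto
qed

lemma hol2_hol2_D2:
  assumes G: "hol2 U V G" shows "hol2 U V (D2 G)"
  using hol2_swap[OF hol2_hol2_D1[OF hol2_swap[OF G]]] by (simp add: D2_swap[abs_def])

text \<open>Both sides are limits of the same difference quotients of \<open>D2 G\<close>: one by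
  definition of the derivative, the other by \<open>hol2_D1_aux\<close>.\<close>

lemma D1_D2_commute:
  assumes G: "hol2 U V G" and "z \<in> U" "w \<in> V"
  shows "D1 (D2 G) z w = D2 (D1 G) z w"
proof -
  obtain g' h where g': "((\<lambda>w. D1 G z w) has_field_derivative g') (at w)"
    and h: "h \<longlonglongrightarrow> 0" "\<And>n. h n \<noteq> 0" "(\<lambda>n. (D2 G (z + h n) w - D2 G z w) / h n) \<longlonglongrightarrow> g'"
    using hol2_D1_aux[OF G assms(2)] assms(3) by blast
  have "((\<lambda>z. D2 G z w) has_field_derivative D1 (D2 G) z w) (at z)"
    by (rule hol2_D1[OF hol2_hol2_D2[OF G]]) (use assms in auto)
  then have "((\<lambda>k. (D2 G (z + k) w - D2 G z w) / k) \<longlongrightarrow> D1 (D2 G) z w) (at 0)"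
    by (simp add: DERIV_def)
  then have "(\<lambda>n. (D2 G (z + h n) w - D2 G z w) / h n) \<longlonglongrightarrow> D1 (D2 G) z w"
    by (rule filterlim_compose) (use h in \<open>auto simp: filterlim_at\<close>)
  with h(3) have "D1 (D2 G) z w = g'" by (rule LIMSEQ_unique[symmetric])
  also have "g' = D2 (D1 G) z w" using DERIV_imp_deriv[OF g'] by (simp add: D2_def)
  finally show ?thesis .
qed

section \<open>Total derivative and chain rules\<close>

lemma hol2_has_derivative:
  assumes G: "hol2 U V G" and z: "z \<in> U" and w: "w \<in> V"
  shows "((\<lambda>(z, w). G z w) has_derivative (\<lambda>(h, k). D1 G z w * h + D2 G z w * k)) (at (z, w))"
proof -
  obtain r where r: "r > 0" "cball w r \<subseteq> V" using w G open_contains_cball hol2_open by metis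
  \<comment> \<open>The criterion with a continuous partial derivative asks for a convex domain in
    the second variable.\<close>
  define W where "W = ball w r"
  have W: "open W" "convex W" "w \<in> W" "W \<subseteq> V" using r by (auto simp: W_def)
  have U: "open U" using G hol2_open by auto
  have "((\<lambda>(x, y). G x y) has_derivative (\<lambda>(tx, ty). D1 G z w * tx + blinfun_mult_right (D2 G z w) ty))
     (at (z, w) within U \<times> W)"
  proof (rule has_derivative_partialsI)
    show "((\<lambda>x. G x w) has_derivative (*) (D1 G z w)) (at z within U)"
      using hol2_D1[OF G z w] has_field_derivative_imp_has_derivative has_derivative_at_withinI by blast
    show "((\<lambda>y. G x y) has_derivative blinfun_apply (blinfun_mult_right (D2 G x y))) (at y within W)"
      if "x \<in> U" "y \<in> W" for x y
      using hol2_D2[OF G, of x y] that W has_field_derivative_imp_has_derivative has_derivative_at_withinI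
      by (force simp: blinfun_mult_right.rep_eq)
    have "continuous_on (U \<times> W) (\<lambda>(x, y). D2 G x y)"
      by (rule continuous_on_subset[OF hol2_continuous[OF hol2_hol2_D2[OF G]]]) (use W in auto)
    then have "continuous_on (U \<times> W) (\<lambda>x. blinfun_mult_right (case x of (x, y) \<Rightarrow> D2 G x y))"
      by (intro continuous_intros)
    then show "continuous (at (z, w) within U \<times> W) (\<lambda>(x, y). blinfun_mult_right (D2 G x y))"
      using z W by (simp add: continuous_on_eq_continuous_within case_prod_unfold)
  qed (use W in auto)
  then show ?thesis
    using at_within_open[of "(z, w)" "U \<times> W"] U W z by (simp add: open_Times)
qed

lemma hol2_chain_field:
  assumes G: "hol2 U V G" and "a t \<in> U" "b t \<in> V"
    and a: "(a has_field_derivative a') (at t)" and b: "(b has_field_derivative b') (at t)"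
  shows "((\<lambda>t. G (a t) (b t)) has_field_derivative (D1 G (a t) (b t) * a' + D2 G (a t) (b t) * b')) (at t)"
proof -
  have ab: "((\<lambda>t. (a t, b t)) has_derivative (\<lambda>h. (a' * h, b' * h))) (at t)"
    using a b by (intro has_derivative_Pair) (auto simp: has_field_derivative_def)
  have "((\<lambda>(z, w). G z w) \<circ> (\<lambda>t. (a t, b t)) has_derivative
     (\<lambda>(h, k). D1 G (a t) (b t) * h + D2 G (a t) (b t) * k) \<circ> (\<lambda>h. (a' * h, b' * h))) (at t)"
    by (rule diff_chain_at[OF ab hol2_has_derivative[OF assms(1-3)]])
  moreover have "(\<lambda>(h, k). D1 G (a t) (b t) * h + D2 G (a t) (b t) * k) \<circ> (\<lambda>h. (a' * h, b' * h)) =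
     (*) (D1 G (a t) (b t) * a' + D2 G (a t) (b t) * b')" by (auto simp: fun_eq_iff algebra_simps)
  ultimately show ?thesis by (simp add: has_field_derivative_def o_def)
qed

lemma hol2_chain_vector:
  assumes G: "hol2 U V G" and "a t \<in> U" "b t \<in> V"
    and a: "(a has_vector_derivative a') (at t)" and b: "(b has_vector_derivative b') (at t)"
  shows "((\<lambda>t. G (a t) (b t)) has_vector_derivative (D1 G (a t) (b t) * a' + D2 G (a t) (b t) * b')) (at t)"
proof -
  have ab: "((\<lambda>t. (a t, b t)) has_derivative (\<lambda>h. (h *\<^sub>R a', h *\<^sub>R b'))) (at t)"
    using a b by (intro has_derivative_Pair) (auto simp: has_vector_derivative_def)
  have "((\<lambda>(z, w). G z w) \<circ> (\<lambda>t. (a t, b t)) has_derivative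
     (\<lambda>(h, k). D1 G (a t) (b t) * h + D2 G (a t) (b t) * k) \<circ> (\<lambda>h. (h *\<^sub>R a', h *\<^sub>R b'))) (at t)"
    by (rule diff_chain_at[OF ab hol2_has_derivative[OF assms(1-3)]])
  then show ?thesis by (simp add: has_vector_derivative_def o_def algebra_simps)
qed

lemma open_cnj_image: "open U \<Longrightarrow> open (cnj ` U)"
  unfolding image_cnj_conv_vimage_cnj by (intro open_vimage continuous_intros)

lemma cnj_image_iff [simp]: "w \<in> cnj ` U \<longleftrightarrow> cnj w \<in> U"
  by (auto simp: image_cnj_conv_vimage_cnj)

lemma connected_cnj_image: "connected U \<Longrightarrow> connected (cnj ` U)"
  by (intro connected_continuous_image continuous_intros)

subsection \<open>Polarization\<close>

lemma holomorphic_zero_on_reals: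
  assumes f: "f holomorphic_on ball 0 r" and "r > 0"
    and z: "\<And>x::real. \<bar>x\<bar> < r \<Longrightarrow> f (of_real x) = 0" and "w \<in> ball 0 r"
  shows "f w = 0"
proof (rule analytic_continuation[OF f, of "of_real ` {-r<..<r}" 0])
  have "(0::complex) islimpt (of_real ` {-r<..<r})"
    unfolding islimpt_approachable
  proof (intro allI impI)
    fix e :: real assume "e > 0"
    then show "\<exists>x'\<in>of_real ` {-r<..<r}. x' \<noteq> (0::complex) \<and> dist x' 0 < e"
      using \<open>r > 0\<close> by (intro bexI[of _ "of_real (min e r / 2)"]) (auto simp: norm_divide simp del: of_real_divide)
  qed
  then show "(0::complex) islimpt (of_real ` {-r<..<r})" .
qed (use assms in auto)

text \<open>In the coordinates \<open>z = z\<^sub>0 + s + i t\<close>, \<open>w = cnj z\<^sub>0 + s - i t\<close> with \<open>s\<close> and \<open>t\<close> complex, the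
  antidiagonal \<open>w = cnj z\<close> becomes the real plane.\<close>

lemma polarization_local:
  assumes G: "hol2 (ball z0 r) (ball (cnj z0) r) G" and r: "r > 0"
    and 0: "\<And>z. z \<in> ball z0 r \<Longrightarrow> G z (cnj z) = 0"
    and zw: "z \<in> ball z0 (r / 4)" "w \<in> ball (cnj z0) (r / 4)"
  shows "G z w = 0"
proof -
  define F where "F s t = G (z0 + s + \<i> * t) (cnj z0 + s - \<i> * t)" for s t
  have in1: "z0 + s + \<i> * t \<in> ball z0 r" if "norm s < r / 2" "norm t < r / 2" for s t
    using that norm_triangle_ineq[of s "\<i> * t"] norm_minus_cancel[of "s + \<i> * t"] by (simp add: dist_norm add.assoc norm_mult)
  have in2: "cnj z0 + s - \<i> * t \<in> ball (cnj z0) r" if "norm s < r / 2" "norm t < r / 2" for s t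
  proof -
    have "norm (s - \<i> * t) < r" using that norm_triangle_ineq4[of s "\<i> * t"] by (simp add: norm_mult)
    moreover have "dist (cnj z0) (cnj z0 + s - \<i> * t) = norm (s - \<i> * t)"
      by (metis add_diff_cancel_left' add_diff_eq dist_commute dist_norm)
    ultimately show ?thesis by simp
  qed
  have h1: "(\<lambda>s. F s t) holomorphic_on ball 0 (r / 2)" if "norm t < r / 2" for t
    unfolding holomorphic_on_open[OF open_ball] F_def
  proof (intro ballI exI)
    fix x :: complex assume "x \<in> ball 0 (r / 2)"
    then show "((\<lambda>s. G (z0 + s + \<i> * t) (cnj z0 + s - \<i> * t)) has_field_derivative
        D1 G (z0 + x + \<i> * t) (cnj z0 + x - \<i> * t) * 1 + D2 G (z0 + x + \<i> * t) (cnj z0 + x - \<i> * t) * 1) (at x)"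
      using that by (intro hol2_chain_field[OF G, where a = "\<lambda>s. z0 + s + \<i> * t" and b = "\<lambda>s. cnj z0 + s - \<i> * t"] in1 in2)
        (auto intro!: derivative_eq_intros)
  qed
  have h2: "(\<lambda>t. F s t) holomorphic_on ball 0 (r / 2)" if "norm s < r / 2" for s
    unfolding holomorphic_on_open[OF open_ball] F_def
  proof (intro ballI exI)
    fix x :: complex assume "x \<in> ball 0 (r / 2)"
    then show "((\<lambda>t. G (z0 + s + \<i> * t) (cnj z0 + s - \<i> * t)) has_field_derivative
        D1 G (z0 + s + \<i> * x) (cnj z0 + s - \<i> * x) * \<i> + D2 G (z0 + s + \<i> * x) (cnj z0 + s - \<i> * x) * (- \<i>)) (at x)"
      using that by (intro hol2_chain_field[OF G, where a = "\<lambda>t. z0 + s + \<i> * t" and b = "\<lambda>t. cnj z0 + s - \<i> * t"] in1 in2)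
        (auto intro!: derivative_eq_intros)
  qed
  have a: "F (of_real s) (of_real t) = 0" if "\<bar>s\<bar> < r / 2" "\<bar>t\<bar> < r / 2" for s t :: real
  proof -
    have "cnj z0 + of_real s - \<i> * of_real t = cnj (z0 + of_real s + \<i> * of_real t)"
      by (simp add: complex_eq_iff)
    then show ?thesis unfolding F_def using 0[OF in1, of "of_real s" "of_real t"] that by simp
  qed
  \<comment> \<open>The identity theorem frees \<open>s\<close> from the reals while
    \<open>t\<close> stays real; \<open>c\<close> then frees \<open>t\<close> as well.\<close>
  have b: "F s (of_real t) = 0" if "norm s < r / 2" "\<bar>t\<bar> < r / 2" for s and t :: real
    by (rule holomorphic_zero_on_reals[OF h1]) (use a that r in auto)
  have c: "F s t = 0" if "norm s < r / 2" "norm t < r / 2" for s t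
    by (rule holomorphic_zero_on_reals[OF h2]) (use b that r in auto)
  \<comment> \<open>The inverse of the change of coordinates; the radius \<open>r / 4\<close> keeps
    both values in the range of \<open>c\<close>.\<close>
  define s t where "s = ((z - z0) + (w - cnj z0)) / 2" and "t = ((z - z0) - (w - cnj z0)) / (2 * \<i>)"
  have "norm s < r / 2" "norm t < r / 2"
    using zw norm_triangle_ineq[of "z - z0" "w - cnj z0"] norm_triangle_ineq4[of "z - z0" "w - cnj z0"] r
    by (auto simp: s_def t_def norm_divide norm_mult dist_norm norm_minus_commute)
  from c[OF this] have "F s t = 0" .
  moreover have "\<i> * t = ((z - z0) - (w - cnj z0)) / 2"
    by (simp add: t_def field_simps)
  ultimately show ?thesis unfolding F_def s_def by (simp add: field_simps)
qed

text \<open>The local case covers a bidisc around one diagonal point over \<open>S\<close>. The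
  identity theorem spreads the vanishing over \<open>U\<close> in \<open>z\<close>, with
  \<open>w\<close> still near \<open>cnj z0\<close>, and after that over the conjugate of
  \<open>U\<close> in \<open>w\<close>.\<close>

lemma polarization:
  assumes G: "hol2 U (cnj ` U) G" and con: "connected U" and S: "open S" "S \<noteq> {}" "S \<subseteq> U"
    and 0: "\<And>z. z \<in> S \<Longrightarrow> G z (cnj z) = 0" and z: "z \<in> U" and w: "cnj w \<in> U"
  shows "G z w = 0"
proof -
  obtain z0 where z0: "z0 \<in> S" using S by blast
  obtain r where r: "r > 0" "ball z0 r \<subseteq> S" using S z0 open_contains_ball by blast
  have U: "open U" using G hol2_open by auto
  have cb: "ball (cnj z0) r \<subseteq> cnj ` U"
  proof
    fix x assume "x \<in> ball (cnj z0) r"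
    then have "cnj x \<in> ball z0 r" by (metis complex_cnj_cnj complex_cnj_diff complex_mod_cnj dist_norm mem_ball)
    then show "x \<in> cnj ` U" using r S by auto
  qed
  have loc: "G z w = 0" if "z \<in> ball z0 (r / 4)" "w \<in> ball (cnj z0) (r / 4)" for z w
  proof (rule polarization_local[of z0 r G])
    show "hol2 (ball z0 r) (ball (cnj z0) r) G"
      by (rule hol2_subset[OF G]) (use r S cb in auto)
  qed (use that r 0 in auto)
  have 1: "G z w = 0" if "z \<in> U" "w \<in> ball (cnj z0) (r / 4)" for z w
  proof (rule analytic_continuation_open[of "ball z0 (r / 4)" U "\<lambda>z. G z w" "\<lambda>_. 0"])
    show "(\<lambda>z. G z w) holomorphic_on U"
      by (rule hol2_holomorphic1[OF G]) (use that cb r in \<open>auto dest!: subsetD[of "ball _ _" "cnj ` U" w]\<close>)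
    show "ball z0 (r / 4) \<subseteq> U" using r S by (auto simp: subset_iff)
  qed (use r U con that loc in auto)
  show ?thesis
  proof (rule analytic_continuation_open[of "ball (cnj z0) (r / 4)" "cnj ` U" "\<lambda>w. G z w" "\<lambda>_. 0"])
    show "(\<lambda>w. G z w) holomorphic_on cnj ` U" by (rule hol2_holomorphic2[OF G z])
    show "ball (cnj z0) (r / 4) \<subseteq> cnj ` U" using cb r by auto
  qed (use r S U con z w 1 open_cnj_image connected_cnj_image in auto)
qed

subsection \<open>Wirtinger derivatives\<close>

text \<open>Along a line with direction \<open>c\<close> the first argument of \<open>G\<close>
  moves by \<open>c\<close> and the second by \<open>cnj c\<close>. The combinations of
  \<open>c = 1\<close> and \<open>c = \<i>\<close> in the Wirtinger derivatives isolate one partial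
  derivative each.\<close>

lemma d_dw_hol2:
  assumes G: "hol2 U (cnj ` U) G" and z: "z \<in> U" and f: "\<And>z. z \<in> U \<Longrightarrow> f z = G z (cnj z)"
  shows "d_dw f z = D1 G z (cnj z)" "d_dwbar f z = D2 G z (cnj z)"
proof -
  have U: "open U" using G hol2_open by auto
  have ev: "eventually (\<lambda>t::real. z + c * of_real t \<in> U) (nhds 0)" for c
  proof -
    have "((\<lambda>t::real. z + c * of_real t) \<longlongrightarrow> z + c * of_real 0) (nhds 0)"
      by (intro tendsto_intros filterlim_ident)
    then show ?thesis using U z by (auto simp: tendsto_def)
  qed
  have v: "vector_derivative (\<lambda>t::real. f (z + c * of_real t)) (at 0) = D1 G z (cnj z) * c + D2 G z (cnj z) * cnj c" for c
  proof -
    have "((\<lambda>t::real. G (z + c * of_real t) (cnj z + cnj c * of_real t)) has_vector_derivative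
       (D1 G (z + c * of_real 0) (cnj z + cnj c * of_real 0) * c + D2 G (z + c * of_real 0) (cnj z + cnj c * of_real 0) * cnj c)) (at 0)"
      by (rule hol2_chain_vector[OF G]) (use z in \<open>auto intro!: derivative_eq_intros\<close>)
    moreover have "eventually (\<lambda>t::real. f (z + c * of_real t) = G (z + c * of_real t) (cnj z + cnj c * of_real t)) (nhds 0)"
      by (rule eventually_mono[OF ev[of c]]) (simp add: f)
    ultimately have "((\<lambda>t::real. f (z + c * of_real t)) has_vector_derivative D1 G z (cnj z) * c + D2 G z (cnj z) * cnj c) (at 0)"
      by (subst has_vector_derivative_cong_ev) (auto elim: eventually_mono simp: f z)
    then show ?thesis by (rule vector_derivative_at)
  qed
  show "d_dw f z = D1 G z (cnj z)" "d_dwbar f z = D2 G z (cnj z)"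
    unfolding d_dw_def d_dwbar_def v[of 1, simplified] v[of \<i>] by (simp_all add: algebra_simps)
qed

lemma d2_hol2:
  assumes G: "hol2 U (cnj ` U) G" and z: "z \<in> U" and f: "\<And>z. z \<in> U \<Longrightarrow> of_real (u z) = G z (cnj z)"
  shows "d2_dw_dwbar u z = Re (D1 (D2 G) z (cnj z))"
  unfolding d2_dw_dwbar_def
  using d_dw_hol2(1)[OF hol2_hol2_D2[OF G] z] d_dw_hol2(2)[OF G _ f] by simp

subsection \<open>Calculus in two variables\<close>

lemma hol2_compose:
  assumes G: "hol2 U V G" and f: "f holomorphic_on T" and T: "\<And>z w. z \<in> U \<Longrightarrow> w \<in> V \<Longrightarrow> G z w \<in> T"
  shows "hol2 U V (\<lambda>z w. f (G z w))"
proof -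
  have "continuous_on (U \<times> V) (f \<circ> (\<lambda>(z, w). G z w))"
    by (intro continuous_on_compose hol2_continuous[OF G] continuous_on_subset[OF holomorphic_on_imp_continuous_on[OF f]])
       (use T in auto)
  moreover have "(f \<circ> (\<lambda>z. G z w)) holomorphic_on U" if "w \<in> V" for w
    by (rule holomorphic_on_compose_gen[OF hol2_holomorphic1[OF G that] f]) (use T that in auto)
  moreover have "(f \<circ> (\<lambda>w. G z w)) holomorphic_on V" if "z \<in> U" for z
    by (rule holomorphic_on_compose_gen[OF hol2_holomorphic2[OF G that] f]) (use T that in auto)
  ultimately show ?thesis using hol2_open[OF G] by (auto simp: hol2_def o_def case_prod_unfold)
qed

lemma hol2_fst: "open U \<Longrightarrow> open V \<Longrightarrow> f holomorphic_on U \<Longrightarrow> hol2 U V (\<lambda>z w. f z)"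
  unfolding hol2_def case_prod_unfold
  by (auto intro: continuous_on_compose2[OF holomorphic_on_imp_continuous_on continuous_on_fst[OF continuous_on_id]])

lemma hol2_snd: "open U \<Longrightarrow> open V \<Longrightarrow> f holomorphic_on V \<Longrightarrow> hol2 U V (\<lambda>z w. f w)"
  unfolding hol2_def case_prod_unfold
  by (auto intro: continuous_on_compose2[OF holomorphic_on_imp_continuous_on continuous_on_snd[OF continuous_on_id]])

lemma hol2_const: "open U \<Longrightarrow> open V \<Longrightarrow> hol2 U V (\<lambda>z w. c)"
  by (rule hol2_fst) auto

lemma hol2_diff: "hol2 U V F \<Longrightarrow> hol2 U V G \<Longrightarrow> hol2 U V (\<lambda>z w. F z w - G z w)"
  unfolding hol2_def case_prod_unfold by (auto intro: holomorphic_on_diff continuous_on_diff)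

lemma hol2_mult: "hol2 U V F \<Longrightarrow> hol2 U V G \<Longrightarrow> hol2 U V (\<lambda>z w. F z w * G z w)"
  unfolding hol2_def case_prod_unfold by (auto intro: holomorphic_on_mult continuous_on_mult)

lemma hol2_power: "hol2 U V F \<Longrightarrow> hol2 U V (\<lambda>z w. F z w ^ n)"
  unfolding hol2_def case_prod_unfold by (auto intro: holomorphic_on_power continuous_on_power)

lemma hol2_inverse:
  "hol2 U V F \<Longrightarrow> (\<And>z w. z \<in> U \<Longrightarrow> w \<in> V \<Longrightarrow> F z w \<noteq> 0) \<Longrightarrow> hol2 U V (\<lambda>z w. inverse (F z w))"
  by (erule hol2_compose[where T = "- {0}" and f = inverse]) (auto intro: holomorphic_intros)

lemma hol2_divide:
  "hol2 U V F \<Longrightarrow> hol2 U V G \<Longrightarrow> (\<And>z w. z \<in> U \<Longrightarrow> w \<in> V \<Longrightarrow> G z w \<noteq> 0) \<Longrightarrow> hol2 U V (\<lambda>z w. F z w / G z w)"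
  unfolding divide_inverse by (intro hol2_mult hol2_inverse)

lemma hol2_Ln:
  "hol2 U V F \<Longrightarrow> (\<And>z w. z \<in> U \<Longrightarrow> w \<in> V \<Longrightarrow> F z w \<notin> \<real>\<^sub>\<le>\<^sub>0) \<Longrightarrow> hol2 U V (\<lambda>z w. Ln (F z w))"
  by (erule hol2_compose[where T = "- \<real>\<^sub>\<le>\<^sub>0"]) (auto intro: holomorphic_intros)

lemma D1_eqI: "((\<lambda>z. G z w) has_field_derivative d) (at z) \<Longrightarrow> D1 G z w = d"
  by (simp add: D1_def DERIV_imp_deriv)

lemma D2_eqI: "((\<lambda>w. G z w) has_field_derivative d) (at w) \<Longrightarrow> D2 G z w = d"
  by (simp add: D2_def DERIV_imp_deriv)

lemma D1_cong: "open U \<Longrightarrow> z \<in> U \<Longrightarrow> (\<And>z. z \<in> U \<Longrightarrow> F z w = G z w) \<Longrightarrow> D1 F z w = D1 G z w"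
  unfolding D1_def by (rule deriv_cong_ev) (auto simp: eventually_nhds)

lemma D2_cong: "open V \<Longrightarrow> w \<in> V \<Longrightarrow> (\<And>w. w \<in> V \<Longrightarrow> F z w = G z w) \<Longrightarrow> D2 F z w = D2 G z w"
  unfolding D2_def by (rule deriv_cong_ev) (auto simp: eventually_nhds)

lemma hol2_localize:
  assumes G: "hol2 U V G" and z: "z0 \<in> U" and w: "w0 \<in> V" and T: "open T" "G z0 w0 \<in> T"
  obtains r where "r > 0" "ball z0 r \<subseteq> U" "ball w0 r \<subseteq> V"
    "\<And>z w. z \<in> ball z0 r \<Longrightarrow> w \<in> ball w0 r \<Longrightarrow> G z w \<in> T"
proof -
  have UV: "open U" "open V" using G hol2_open by auto
  obtain A B where AB: "open A" "open B" "z0 \<in> A" "w0 \<in> B" "A \<times> B \<subseteq> (\<lambda>(z, w). G z w) -` T \<inter> U \<times> V"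
  proof -
    have "open ((\<lambda>(z, w). G z w) -` T \<inter> U \<times> V)"
      using continuous_on_open_vimage[of "U \<times> V" "\<lambda>(z, w). G z w"] hol2_continuous[OF G] UV T by (auto simp: open_Times)
    moreover have "(z0, w0) \<in> (\<lambda>(z, w). G z w) -` T \<inter> U \<times> V" using z w T by auto
    ultimately show thesis by (rule open_prod_elim) (auto intro: that)
  qed
  obtain r1 where r1: "r1 > 0" "ball z0 r1 \<subseteq> A" using AB open_contains_ball by blast
  obtain r2 where r2: "r2 > 0" "ball w0 r2 \<subseteq> B" using AB open_contains_ball by blast
  have *: "z \<in> U \<and> w \<in> V \<and> G z w \<in> T" if "z \<in> ball z0 (min r1 r2)" "w \<in> ball w0 (min r1 r2)" for z w
    using AB(5) r1 r2 that by (auto simp: subset_iff)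
  have "z0 \<in> ball z0 (min r1 r2)" "w0 \<in> ball w0 (min r1 r2)" using r1 r2 by auto
  note * = * this
  show thesis by (rule that[of "min r1 r2"]) (use r1 r2 * in \<open>blast | simp\<close>)+
qed

lemma cnj_ball: "cnj ` ball z r = ball (cnj z) r"
proof (intro set_eqI)
  fix x show "x \<in> cnj ` ball z r \<longleftrightarrow> x \<in> ball (cnj z) r"
    using complex_mod_cnj[of "cnj z - x"] by (simp add: dist_norm)
qed

text \<open>If \<open>G\<close> is the polarization of \<open>K > 0\<close>, then \<open>lap2 G\<close> is that of the mixed derivative of \<open>log K\<close>.\<close>

definition lap2 :: "(complex \<Rightarrow> complex \<Rightarrow> complex) \<Rightarrow> complex \<Rightarrow> complex \<Rightarrow> complex" where
  "lap2 G z w = (G z w * D1 (D2 G) z w - D1 G z w * D2 G z w) / (G z w) ^ 2"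

lemma hol2_lap2:
  assumes "hol2 U V G" "\<And>z w. z \<in> U \<Longrightarrow> w \<in> V \<Longrightarrow> G z w \<noteq> 0"
  shows "hol2 U V (lap2 G)"
  unfolding lap2_def[abs_def] using assms
  by (intro hol2_divide hol2_diff hol2_mult hol2_hol2_D1 hol2_hol2_D2 hol2_power) auto

lemma D1_D2_Ln:
  assumes G: "hol2 U V G" and z: "z \<in> U" and w: "w \<in> V"
    and nz: "\<And>z w. z \<in> U \<Longrightarrow> w \<in> V \<Longrightarrow> G z w \<notin> \<real>\<^sub>\<le>\<^sub>0"
  shows "D1 (D2 (\<lambda>z w. Ln (G z w))) z w = lap2 G z w"
proof -
  have d2: "D2 (\<lambda>z w. Ln (G z w)) z w = D2 G z w / G z w" if "z \<in> U" "w \<in> V" for z w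
    by (rule D2_eqI) (use that nz[OF that] in \<open>auto intro!: derivative_eq_intros hol2_D2[OF G] simp: field_simps\<close>)
  have "D1 (D2 (\<lambda>z w. Ln (G z w))) z w = D1 (\<lambda>z w. D2 G z w / G z w) z w"
    by (rule D1_cong[of U]) (use d2 z w hol2_open[OF G] in auto)
  also have "\<dots> = lap2 G z w"
  proof (rule D1_eqI)
    have "G z w \<noteq> 0" using nz[OF z w] by auto
    then show "((\<lambda>z. D2 G z w / G z w) has_field_derivative lap2 G z w) (at z)"
      unfolding lap2_def
      by (auto intro!: derivative_eq_intros hol2_D1[OF G] hol2_D1[OF hol2_hol2_D2[OF G]] z w simp: power2_eq_square)
  qed
  finally show ?thesis .
qed

lemma d2_ln_hol2:
  assumes G: "hol2 U (cnj ` U) G" and z: "z \<in> U" and K: "\<And>z. z \<in> U \<Longrightarrow> G z (cnj z) = of_real (K z)"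
    and pos: "\<And>z. z \<in> U \<Longrightarrow> K z > 0"
  shows "d2_dw_dwbar (\<lambda>z. ln (K z)) z = Re (lap2 G z (cnj z))"
proof -
  \<comment> \<open>The value on the diagonal is positive, so there is a bidisc on which
    \<open>G\<close> avoids the branch cut of \<open>Ln\<close>.\<close>
  have "G z (cnj z) \<in> - \<real>\<^sub>\<le>\<^sub>0" using K[OF z] pos[OF z] by auto
  then obtain r where r: "r > 0" "ball z r \<subseteq> U" "ball (cnj z) r \<subseteq> cnj ` U"
    "\<And>x y. x \<in> ball z r \<Longrightarrow> y \<in> ball (cnj z) r \<Longrightarrow> G x y \<in> - \<real>\<^sub>\<le>\<^sub>0"
    using hol2_localize[OF G z, of "cnj z" "- \<real>\<^sub>\<le>\<^sub>0"] z by (auto simp: open_Compl)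
  have G': "hol2 (ball z r) (cnj ` ball z r) G"
    by (rule hol2_subset[OF G]) (use r in \<open>auto simp: cnj_ball simp del: cnj_image_iff\<close>)
  have nz: "G x y \<notin> \<real>\<^sub>\<le>\<^sub>0" if "x \<in> ball z r" "y \<in> cnj ` ball z r" for x y
    using r(4) that unfolding cnj_ball by blast
  have "d2_dw_dwbar (\<lambda>z. ln (K z)) z = Re (D1 (D2 (\<lambda>z w. Ln (G z w))) z (cnj z))"
  proof (rule d2_hol2)
    show "hol2 (ball z r) (cnj ` ball z r) (\<lambda>z w. Ln (G z w))" by (rule hol2_Ln[OF G' nz])
    show "complex_of_real (ln (K x)) = Ln (G x (cnj x))" if "x \<in> ball z r" for x
      using r(2) that K[of x] pos[of x] by (auto simp: Ln_of_real)
  qed (use r in auto)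
  also have "D1 (D2 (\<lambda>z w. Ln (G z w))) z (cnj z) = lap2 G z (cnj z)"
    by (rule D1_D2_Ln[OF G' _ _ nz]) (use r in auto)
  finally show ?thesis .
qed

text \<open>The right side is holomorphic in both arguments too, because the conjugations cancel. On
  the diagonal the claim says that \<open>G\<close> is real there, and polarization does the
  rest.\<close>

lemma hermitian_polarization:
  assumes G: "hol2 U (cnj ` U) G" and con: "connected U"
    and re: "\<And>z. z \<in> U \<Longrightarrow> G z (cnj z) \<in> \<real>" and z: "z \<in> U" and w: "cnj w \<in> U"
  shows "G z w = cnj (G (cnj w) (cnj z))"
proof -
  have U: "open U" using G hol2_open by auto
  have 1: "(\<lambda>z. cnj (G (cnj w) (cnj z))) holomorphic_on U" if "cnj w \<in> U" for w
    using holomorphic_on_compose_cnj_cnj[of "\<lambda>x. G (cnj w) x" U] hol2_holomorphic2[OF G that] U by (simp add: o_def)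
  have 2: "(\<lambda>w. cnj (G (cnj w) (cnj z))) holomorphic_on cnj ` U" if "z \<in> U" for z
    using holomorphic_on_compose_cnj_cnj[of "\<lambda>x. G x (cnj z)" "cnj ` U"] hol2_holomorphic1[OF G, of "cnj z"] U that
    by (simp add: o_def image_image open_cnj_image)
  have 3: "continuous_on (U \<times> cnj ` U) (\<lambda>(z, w). cnj (G (cnj w) (cnj z)))"
  proof -
    have "continuous_on (U \<times> cnj ` U) ((\<lambda>(z, w). G z w) \<circ> (\<lambda>(z, w). (cnj w, cnj z)))"
      by (intro continuous_on_compose continuous_on_subset[OF hol2_continuous[OF G]])
         (auto intro!: continuous_intros simp: case_prod_unfold)
    then show ?thesis by (auto intro!: continuous_intros simp: o_def case_prod_unfold)
  qed
  have G': "hol2 U (cnj ` U) (\<lambda>z w. cnj (G (cnj w) (cnj z)))"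
    using 1 2 3 U open_cnj_image by (auto simp: hol2_def)
  have "G z w - cnj (G (cnj w) (cnj z)) = 0"
    by (rule polarization[OF hol2_diff[OF G G'] con U]) (use z w re in \<open>auto simp: Reals_cnj_iff\<close>)
  then show ?thesis by simp
qed

text \<open>Hermitian symmetry exchanges \<open>D1\<close> and \<open>D2\<close> up to conjugation.
  On the diagonal the product of the first derivatives is thus real, and the mixed derivative is
  conjugate to the one in the other order, which is the same. The ball \<open>B\<close> supplies the
  connectedness behind the symmetry.\<close>

lemma lap2_real:
  assumes G: "hol2 U (cnj ` U) G" and re: "\<And>z. z \<in> U \<Longrightarrow> G z (cnj z) \<in> \<real>" and z: "z \<in> U"
  shows "lap2 G z (cnj z) \<in> \<real>"
proof -
  have "open U" using G hol2_open by auto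
  then obtain r where r: "r > 0" "ball z r \<subseteq> U" using z open_contains_ball by blast
  define B where "B = ball z r"
  have B: "open B" "connected B" "z \<in> B" "B \<subseteq> U" using r by (auto simp: B_def)
  have G': "hol2 B (cnj ` B) G" by (rule hol2_subset[OF G]) (use B open_cnj_image in auto)
  have re': "x \<in> B \<Longrightarrow> G x (cnj x) \<in> \<real>" for x using re B by auto
  note h = hermitian_polarization[OF G' B(2) re']
  have d2: "D2 G x y = cnj (D1 G (cnj y) (cnj x))" if "x \<in> B" "cnj y \<in> B" for x y
  proof -
    have "D2 G x y = D2 (\<lambda>x y. cnj (G (cnj y) (cnj x))) x y"
      by (rule D2_cong[of "cnj ` B"]) (use that B open_cnj_image in \<open>auto intro: h\<close>)
    also have "\<dots> = cnj (D1 G (cnj y) (cnj x))"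
      using has_field_derivative_cnj_cnj[OF hol2_D1[OF G', of "cnj y" "cnj x"]] that
      by (intro D2_eqI) (auto simp: o_def)
    finally show ?thesis .
  qed
  have d12: "D1 (D2 G) z (cnj z) = cnj (D1 (D2 G) z (cnj z))"
  proof -
    have "D1 (D2 G) z (cnj z) = D1 (\<lambda>x y. cnj (D1 G (cnj y) (cnj x))) z (cnj z)"
      by (rule D1_cong[of B]) (use d2 B in auto)
    also have "\<dots> = cnj (D2 (D1 G) z (cnj z))"
      using has_field_derivative_cnj_cnj[OF hol2_D2[OF hol2_hol2_D1[OF G'], of z "cnj z"]] B
      by (intro D1_eqI) (auto simp: o_def)
    also have "\<dots> = cnj (D1 (D2 G) z (cnj z))" using D1_D2_commute[OF G', of z "cnj z"] B by simp
    finally show ?thesis .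
  qed
  have "D2 G z (cnj z) = cnj (D1 G z (cnj z))" using d2[of z "cnj z"] B by simp
  then have "cnj (lap2 G z (cnj z)) = lap2 G z (cnj z)"
    using d12 re[OF z] unfolding lap2_def by (simp add: Reals_cnj_iff mult.commute)
  then show ?thesis by (simp add: Reals_cnj_iff)
qed

text \<open>Two integrations over convex sets: \<open>D2 f\<close> is constant in \<open>z\<close>,
  hence the difference of \<open>f z\<close> and \<open>f z0\<close> is constant in
  \<open>w\<close>.\<close>

lemma D1_D2_zero_split:
  assumes f: "hol2 B C f" and B: "convex B" "convex C" and 0: "\<And>z w. z \<in> B \<Longrightarrow> w \<in> C \<Longrightarrow> D1 (D2 f) z w = 0"
    and z: "z \<in> B" "z0 \<in> B" and w: "w \<in> C" "w0 \<in> C"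
  shows "f z w = f z w0 + f z0 w - f z0 w0"
proof -
  have a: "D2 f z v = D2 f z0 v" if "v \<in> C" for v
  proof -
    have "\<exists>c. \<forall>x\<in>B. D2 f x v = c"
      by (rule has_field_derivative_zero_constant[OF B(1)])
         (use hol2_D1[OF hol2_hol2_D2[OF f]] 0 that in \<open>auto intro: has_field_derivative_at_within\<close>)
    then show ?thesis using z by auto
  qed
  have "\<exists>c. \<forall>v\<in>C. f z v - f z0 v = c"
  proof (rule has_field_derivative_zero_constant[OF B(2)])
    fix v assume "v \<in> C"
    then have "((\<lambda>v. f z v - f z0 v) has_field_derivative (D2 f z v - D2 f z0 v)) (at v)"
      by (intro DERIV_diff hol2_D2[OF f] z)
    then show "((\<lambda>v. f z v - f z0 v) has_field_derivative 0) (at v within C)"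
      using a[OF \<open>v \<in> C\<close>] by (auto intro: has_field_derivative_at_within)
  qed
  then have "f z w - f z0 w = f z w0 - f z0 w0" using w by metis
  then show ?thesis by (simp add: algebra_simps)
qed

text \<open>The Schwarzian derivative of \<open>u\<close> with respect to the vector field \<open>exp (- \<alpha>) \<partial>\<^sub>z\<close> does not
  depend on \<open>w\<close>, so it vanishes along with its restriction to \<open>w = w\<^sub>0\<close>; hence \<open>exp (- u / 2)\<close> solves a linear equation.\<close>

lemma liouville_hol2:
  assumes u: "hol2 B C u" and h: "hol2 B C h" and B: "convex B" "convex C" "z0 \<in> B" "w0 \<in> C"
    and u1: "\<And>z. z \<in> B \<Longrightarrow> u z w0 = 0" and u2: "\<And>w. w \<in> C \<Longrightarrow> u z0 w = 0"
    and uh: "\<And>z w. z \<in> B \<Longrightarrow> w \<in> C \<Longrightarrow> D1 (D2 u) z w = exp (h z w)"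
    and hh: "\<And>z w. z \<in> B \<Longrightarrow> w \<in> C \<Longrightarrow> D1 (D2 h) z w = exp (h z w)"
    and z: "z \<in> B" and w: "w \<in> C"
  shows "exp (- u z w / 2) = 1 - D2 u z w0 * D1 u z0 w / (2 * exp (h z0 w0))"
proof -
  have oB: "open B" "open C" using hol2_open[OF u] by auto
  \<comment> \<open>\<open>h\<close> and \<open>u\<close> have the same mixed derivative
    \<open>exp (h z w)\<close>, so \<open>h - u\<close> splits into a function of each variable;
    \<open>\<alpha>\<close> and \<open>\<beta>\<close> are its two summands.\<close>
  define \<alpha> where "\<alpha> z = h z w0" for z
  define \<beta> where "\<beta> w = h z0 w - h z0 w0" for w
  have h_eq: "h z w = u z w + \<alpha> z + \<beta> w" if "z \<in> B" "w \<in> C" for z w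
  proof -
    have "D1 (D2 (\<lambda>z w. h z w - u z w)) z w = 0" if "z \<in> B" "w \<in> C" for z w
    proof -
      have "D1 (D2 (\<lambda>z w. h z w - u z w)) z w = D1 (\<lambda>z w. D2 h z w - D2 u z w) z w"
        by (rule D1_cong[OF oB(1)]) (use that in \<open>auto intro!: D2_eqI DERIV_diff hol2_D2[OF h] hol2_D2[OF u]\<close>)
      also have "\<dots> = D1 (D2 h) z w - D1 (D2 u) z w"
        by (rule D1_eqI) (use that in \<open>auto intro!: DERIV_diff hol2_D1 hol2_hol2_D2 h u\<close>)
      finally show ?thesis using uh hh that by simp
    qed
    from D1_D2_zero_split[OF hol2_diff[OF h u] B(1,2) this that(1) B(3) that(2) B(4)]
    show ?thesis using u1[OF that(1)] u2[OF that(2)] u1[OF B(3)] by (simp add: \<alpha>_def \<beta>_def algebra_simps)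
  qed
  have h\<alpha>: "hol2 B C (\<lambda>z w. \<alpha> z)"
    unfolding \<alpha>_def by (rule hol2_fst[OF oB hol2_holomorphic1[OF h B(4)]])
  have d\<alpha>: "((\<lambda>z. \<alpha> z) has_field_derivative D1 (\<lambda>z w. \<alpha> z) z w0) (at z)" if "z \<in> B" for z
    by (rule hol2_D1[OF h\<alpha> that B(4)])
  \<comment> \<open>The derivative of \<open>u\<close> along the weighted vector field. The weight
    cancels the factor \<open>exp (\<alpha> z)\<close> of \<open>exp (h z w)\<close>, so that
    \<open>D2 Q\<close> involves only \<open>u\<close> and \<open>\<beta>\<close>.\<close>
  define Q where "Q z w = exp (- \<alpha> z) * D1 u z w" for z w
  have hQ: "hol2 B C Q" unfolding Q_def[abs_def]
    by (intro hol2_mult hol2_hol2_D1 u hol2_compose[OF h\<alpha>, of "\<lambda>x. exp (- x)" UNIV] holomorphic_intros UNIV_I)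
  have D2Q: "D2 Q z w = exp (\<beta> w + u z w)" if "z \<in> B" "w \<in> C" for z w
  proof -
    have "D2 Q z w = exp (- \<alpha> z) * D2 (D1 u) z w" unfolding Q_def[abs_def]
      by (rule D2_eqI) (intro DERIV_cmult hol2_D2[OF hol2_hol2_D1[OF u]] that)
    also have "D2 (D1 u) z w = exp (h z w)" using D1_D2_commute[OF u that] uh[OF that] by simp
    also have "exp (- \<alpha> z) * exp (h z w) = exp (\<beta> w + u z w)" by (simp add: h_eq[OF that] add.commute flip: exp_add)
    finally show ?thesis .
  qed
  \<comment> \<open>The Schwarzian derivative: the derivative of \<open>Q\<close> along the same
    field minus half the square of \<open>Q\<close>. In the \<open>w\<close>-derivative both terms
    become \<open>Q z w * D2 Q z w\<close> and cancel.\<close>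
  define R where "R z w = exp (- \<alpha> z) * D1 Q z w - (Q z w)\<^sup>2 / 2" for z w
  have D2R: "((\<lambda>w. R z w) has_field_derivative 0) (at w)" if zw: "z \<in> B" "w \<in> C" for z w
  proof -
    have "D1 (D2 Q) z w = D1 (\<lambda>z w. exp (\<beta> w + u z w)) z w"
      by (rule D1_cong[OF oB(1)]) (use D2Q zw in auto)
    also have "\<dots> = exp (\<beta> w + u z w) * D1 u z w"
      by (rule D1_eqI) (auto intro!: derivative_eq_intros hol2_D1[OF u] zw)
    finally have "D2 (D1 Q) z w = exp (\<beta> w + u z w) * D1 u z w" using D1_D2_commute[OF hQ zw] by simp
    then have "exp (- \<alpha> z) * D2 (D1 Q) z w - Q z w * D2 Q z w = 0" by (simp add: D2Q[OF zw] Q_def)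
    moreover have "((\<lambda>w. R z w) has_field_derivative exp (- \<alpha> z) * D2 (D1 Q) z w - Q z w * D2 Q z w) (at w)"
      unfolding R_def
      by (auto intro!: derivative_eq_intros hol2_D2[OF hQ] hol2_D2[OF hol2_hol2_D1[OF hQ]] zw)
    ultimately show ?thesis by simp
  qed
  have D1u0: "D1 u z w0 = 0" if "z \<in> B" for z
  proof -
    have "D1 u z w0 = D1 (\<lambda>z w. 0) z w0" by (rule D1_cong[OF oB(1)]) (use u1 that in auto)
    then show ?thesis by (simp add: D1_def)
  qed
  have D1Q0: "D1 Q z w0 = 0" if "z \<in> B" for z
  proof -
    have "D1 Q z w0 = D1 (\<lambda>z w. 0) z w0" by (rule D1_cong[OF oB(1)]) (use D1u0 that in \<open>auto simp: Q_def\<close>)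
    then show ?thesis by (simp add: D1_def)
  qed
  \<comment> \<open>On the axis \<open>w = w0\<close> the function \<open>u\<close> vanishes, and
    with it \<open>Q\<close> and the \<open>z\<close>-derivative of \<open>Q\<close>.\<close>
  have R0: "R z w = 0" if zw: "z \<in> B" "w \<in> C" for z w
  proof -
    have "\<exists>c. \<forall>w\<in>C. R z w = c"
      by (rule has_field_derivative_zero_constant[OF B(2)]) (use D2R zw in \<open>auto intro: has_field_derivative_at_within\<close>)
    moreover have "R z w0 = 0" using D1Q0[OF zw(1)] D1u0[OF zw(1)] by (simp add: R_def Q_def)
    ultimately show ?thesis using zw B by metis
  qed
  have D1Q: "D1 Q z w = exp (\<alpha> z) * (Q z w)\<^sup>2 / 2" if "z \<in> B" "w \<in> C" for z w
    using R0[OF that] unfolding R_def by (simp add: exp_minus field_simps)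
  \<comment> \<open>The classical substitution that linearizes the Riccati equation
    \<open>D1Q\<close>; it makes \<open>Q z w * \<psi> z w\<close> independent of
    \<open>z\<close>.\<close>
  define \<psi> where "\<psi> z w = exp (- u z w / 2)" for z w
  have D1\<psi>: "((\<lambda>z. \<psi> z w) has_field_derivative (- (exp (\<alpha> z) * Q z w * \<psi> z w / 2))) (at z)" if "z \<in> B" "w \<in> C" for z w
    unfolding \<psi>_def by (auto intro!: derivative_eq_intros hol2_D1[OF u] that simp: Q_def exp_minus field_simps)
  have Q\<psi>: "Q z w * \<psi> z w = Q z0 w" if zw: "z \<in> B" "w \<in> C" for z w
  proof -
    have "\<exists>c. \<forall>z\<in>B. Q z w * \<psi> z w = c"
    proof (rule has_field_derivative_zero_constant[OF B(1)])
      fix z assume "z \<in> B"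
      then have "((\<lambda>z. Q z w * \<psi> z w) has_field_derivative 0) (at z)"
        using zw(2)
        by (auto intro!: derivative_eq_intros hol2_D1[OF hQ] D1\<psi> simp: D1Q power2_eq_square)
      then show "((\<lambda>z. Q z w * \<psi> z w) has_field_derivative 0) (at z within B)"
        by (rule has_field_derivative_at_within)
    qed
    moreover have "\<psi> z0 w = 1" using u2[OF zw(2)] by (simp add: \<psi>_def)
    ultimately show ?thesis using zw B by (metis mult.right_neutral)
  qed
  \<comment> \<open>The \<open>z\<close>-derivative of \<open>\<psi>\<close> is now
    \<open>exp (\<alpha> z)\<close> times a function of \<open>w\<close>, and
    \<open>D2 u z w0\<close> is a primitive of \<open>exp (\<alpha> z)\<close>. The constant is
    found at \<open>z0\<close>, where \<open>D2 u z0 w0\<close> vanishes because \<open>u\<close> is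
    zero on that axis.\<close>
  have "\<exists>c. \<forall>z\<in>B. \<psi> z w + D2 u z w0 * D1 u z0 w / (2 * exp (h z0 w0)) = c"
  proof (rule has_field_derivative_zero_constant[OF B(1)])
    fix z assume z: "z \<in> B"
    have e: "D1 (D2 u) z w0 = exp (\<alpha> z)" using uh[OF z B(4)] by (simp add: \<alpha>_def)
    have "((\<lambda>z. \<psi> z w + D2 u z w0 * D1 u z0 w / (2 * exp (h z0 w0))) has_field_derivative
      - (exp (\<alpha> z) * Q z w * \<psi> z w / 2) + D1 (D2 u) z w0 * D1 u z0 w / (2 * exp (h z0 w0))) (at z)"
      by (intro DERIV_add D1\<psi> z w DERIV_cdivide DERIV_cmult_right hol2_D1[OF hol2_hol2_D2[OF u]] B)
    moreover have "exp (\<alpha> z) * Q z w * \<psi> z w = exp (\<alpha> z) * Q z0 w" using Q\<psi>[OF z w] by (simp add: mult.assoc)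
    ultimately have "((\<lambda>z. \<psi> z w + D2 u z w0 * D1 u z0 w / (2 * exp (h z0 w0))) has_field_derivative 0) (at z)"
      unfolding e by (simp add: Q_def \<alpha>_def exp_minus field_simps)
    then show "((\<lambda>z. \<psi> z w + D2 u z w0 * D1 u z0 w / (2 * exp (h z0 w0))) has_field_derivative 0) (at z within B)"
      by (rule has_field_derivative_at_within)
  qed
  moreover have "\<psi> z0 w = 1" using u2[OF w] by (simp add: \<psi>_def)
  moreover have "D2 u z0 w0 = 0"
  proof -
    have "D2 u z0 w0 = D2 (\<lambda>z w. 0) z0 w0" by (rule D2_cong[OF oB(2)]) (use u2 B in auto)
    then show ?thesis by (simp add: D2_def)
  qed
  ultimately have "\<psi> z w + D2 u z w0 * D1 u z0 w / (2 * exp (h z0 w0)) = 1" using z B(3) by (metis add.right_neutral divide_eq_0_iff mult_eq_0_iff)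
  then show ?thesis by (simp add: \<psi>_def algebra_simps eq_diff_eq)
qed

text \<open>\<open>lap2\<close> is the mixed derivative of a logarithm where one exists, which
  explains the additivity; its form as a quotient makes the rule hold wherever the factors are
  nonzero, across branch cuts.\<close>

lemma lap2_mult:
  assumes F: "hol2 U V F" and G: "hol2 U V G" and z: "z \<in> U" and w: "w \<in> V"
    and nz: "F z w \<noteq> 0" "G z w \<noteq> 0"
  shows "lap2 (\<lambda>z w. F z w * G z w) z w = lap2 F z w + lap2 G z w"
proof -
  have d2: "D2 (\<lambda>z w. F z w * G z w) z w = F z w * D2 G z w + D2 F z w * G z w" if "z \<in> U" "w \<in> V" for z w
    by (rule D2_eqI) (auto intro!: derivative_eq_intros hol2_D2[OF F] hol2_D2[OF G] that)
  have d1: "D1 (\<lambda>z w. F z w * G z w) z w = F z w * D1 G z w + D1 F z w * G z w" if "z \<in> U" "w \<in> V" for z w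
    by (rule D1_eqI) (auto intro!: derivative_eq_intros hol2_D1[OF F] hol2_D1[OF G] that)
  have "D1 (D2 (\<lambda>z w. F z w * G z w)) z w = D1 (\<lambda>z w. F z w * D2 G z w + D2 F z w * G z w) z w"
    by (rule D1_cong[of U]) (use d2 z w hol2_open[OF F] in auto)
  also have "\<dots> = F z w * D1 (D2 G) z w + D1 F z w * D2 G z w + (D2 F z w * D1 G z w + D1 (D2 F) z w * G z w)"
    by (rule D1_eqI) (auto intro!: derivative_eq_intros hol2_D1[OF F] hol2_D1[OF G]
        hol2_D1[OF hol2_hol2_D2[OF F]] hol2_D1[OF hol2_hol2_D2[OF G]] z w)
  finally show ?thesis using nz unfolding lap2_def d1[OF z w] d2[OF z w]
    by (simp add: divide_simps) (simp add: algebra_simps power2_eq_square)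
qed

lemma lap2_const: "lap2 (\<lambda>z w. c) z w = 0"
  by (simp add: lap2_def D1_def D2_def)

lemma lap2_fst: "lap2 (\<lambda>z w. f z) z w = 0"
  by (simp add: lap2_def D1_def D2_def)

lemma lap2_snd: "lap2 (\<lambda>z w. f w) z w = 0"
  by (simp add: lap2_def D1_def D2_def)

lemma lap2_cong:
  assumes "open U" "open V" "z \<in> U" "w \<in> V" and eq: "\<And>z w. z \<in> U \<Longrightarrow> w \<in> V \<Longrightarrow> F z w = G z w"
  shows "lap2 F z w = lap2 G z w"
proof -
  have "D2 F z w = D2 G z w" if "z \<in> U" for z by (rule D2_cong[of V]) (use assms that in auto)
  moreover have "D1 (D2 F) z w = D1 (D2 G) z w" by (rule D1_cong[of U]) (use assms calculation in auto)
  moreover have "D1 F z w = D1 G z w" by (rule D1_cong[of U]) (use assms in auto)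
  ultimately show ?thesis using assms by (simp add: lap2_def)
qed

lemma lap2_inverse:
  assumes F: "hol2 U V F" and z: "z \<in> U" and w: "w \<in> V" and nz: "\<And>z w. z \<in> U \<Longrightarrow> w \<in> V \<Longrightarrow> F z w \<noteq> 0"
  shows "lap2 (\<lambda>z w. inverse (F z w)) z w = - lap2 F z w"
proof -
  have "lap2 F z w + lap2 (\<lambda>z w. inverse (F z w)) z w = lap2 (\<lambda>z w. F z w * inverse (F z w)) z w"
    by (rule lap2_mult[symmetric, OF F hol2_inverse[OF F nz] z w]) (use nz z w in auto)
  also have "\<dots> = lap2 (\<lambda>z w. 1) z w"
    by (rule lap2_cong[of U V]) (use z w nz hol2_open[OF F] in auto)
  finally show ?thesis by (simp add: lap2_const eq_neg_iff_add_eq_0 add.commute)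
qed

lemma lap2_one_minus:
  assumes f: "(f has_field_derivative f') (at z)" "(g has_field_derivative g') (at w)"
    and U: "open U" "z \<in> U" "f holomorphic_on U" and nz: "f z * g w \<noteq> 1"
  shows "lap2 (\<lambda>z w. 1 - f z * g w) z w = - f' * g' / (1 - f z * g w)\<^sup>2"
proof -
  have d2: "D2 (\<lambda>z w. 1 - f z * g w) z w = - f z * g'" for z
    by (rule D2_eqI) (auto intro!: derivative_eq_intros f)
  have d1: "D1 (\<lambda>z w. 1 - f z * g w) z w = - f' * g w"
    by (rule D1_eqI) (auto intro!: derivative_eq_intros f)
  have d12: "D1 (D2 (\<lambda>z w. 1 - f z * g w)) z w = - f' * g'"
    unfolding D1_def d2 by (rule DERIV_imp_deriv) (auto intro!: derivative_eq_intros f)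
  show ?thesis unfolding lap2_def d1 d12 d2 by (simp add: algebra_simps)
qed

lemma cnj_holomorphic:
  assumes "f holomorphic_on U" "open U"
  shows "(\<lambda>w. cnj (f (cnj w))) holomorphic_on cnj ` U"
  using holomorphic_on_compose_cnj_cnj[of f "cnj ` U"] assms by (simp add: o_def image_image open_cnj_image)

text \<open>The polarization of \<open>K\<close> is a product of functions of one variable, which
  \<open>lap2\<close> annihilates, and of two factors \<open>1 / (1 - f f')\<close>, each of which
  contributes \<open>|deriv f|^2 / (1 - |f|^2)^2\<close>. Hence the factor \<open>2\<close>.\<close>

lemma d2_ln_pullback:
  assumes k: "k holomorphic_on U" and f: "f holomorphic_on U" and U: "open U" "z \<in> U"
    and k0: "\<And>z. z \<in> U \<Longrightarrow> k z \<noteq> 0" and f1: "\<And>z. z \<in> U \<Longrightarrow> norm (f z) < 1" and C: "C > 0"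
    and K: "\<And>z. z \<in> U \<Longrightarrow> K z = C * (norm (k z))\<^sup>2 / (1 - (norm (f z))\<^sup>2)\<^sup>2"
  shows "d2_dw_dwbar (\<lambda>z. ln (K z)) z = 2 * (norm (deriv f z))\<^sup>2 / (1 - (norm (f z))\<^sup>2)\<^sup>2"
proof -
  define V where "V = cnj ` U"
  have V: "open V" "cnj z \<in> V" using U by (auto simp: V_def open_cnj_image)
  define k' where "k' w = cnj (k (cnj w))" for w
  define f' where "f' w = cnj (f (cnj w))" for w
  have h: "k' holomorphic_on V" "f' holomorphic_on V"
    unfolding k'_def f'_def V_def by (intro cnj_holomorphic k f U)+
  define A where "A z w = of_real C * k z * k' w" for z w
  define Q where "Q z w = 1 - f z * f' w" for z w
  have hA: "hol2 U V A" unfolding A_def[abs_def]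
    by (intro hol2_mult hol2_const hol2_fst hol2_snd k h U V)
  have hQ: "hol2 U V Q" unfolding Q_def[abs_def]
    by (intro hol2_diff hol2_mult hol2_const hol2_fst hol2_snd f h U V)
  have Q0: "Q z w \<noteq> 0" if "z \<in> U" "w \<in> V" for z w
  proof -
    have "norm (f z) < 1" "norm (f (cnj w)) < 1" using f1 that by (auto simp: V_def)
    then have "norm (f z * f' w) < 1 * 1"
      unfolding norm_mult f'_def complex_mod_cnj by (intro mult_strict_mono) auto
    then show ?thesis unfolding Q_def by auto
  qed
  have A0: "A z w \<noteq> 0" if "z \<in> U" "w \<in> V" for z w
    using k0 that C by (auto simp: A_def k'_def V_def)
  define G where "G z w = A z w * (inverse (Q z w) * inverse (Q z w))" for z w
  have hi: "hol2 U V (\<lambda>z w. inverse (Q z w))" by (rule hol2_inverse[OF hQ Q0])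
  have hii: "hol2 U V (\<lambda>z w. inverse (Q z w) * inverse (Q z w))" by (intro hol2_mult hi)
  have hG: "hol2 U V G" unfolding G_def[abs_def] by (intro hol2_mult hA hii)
  have q: "1 - f z * cnj (f z) = of_real (1 - (norm (f z))\<^sup>2)" for z
    by (simp flip: complex_norm_square)
  have pos: "1 - (norm (f z))\<^sup>2 > 0" if "z \<in> U" for z
    using f1[OF that] by (simp add: power_less_one_iff abs_square_less_1)
  have GK: "G z (cnj z) = of_real (K z)" if "z \<in> U" for z
  proof -
    have "k z * cnj (k z) = of_real ((norm (k z))\<^sup>2)" by (simp flip: complex_norm_square)
    then show ?thesis
      unfolding G_def A_def Q_def k'_def f'_def K[OF that] complex_cnj_cnj q mult.assoc
      by (simp add: divide_inverse power2_eq_square)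
  qed
  have "d2_dw_dwbar (\<lambda>z. ln (K z)) z = Re (lap2 G z (cnj z))"
  proof (rule d2_ln_hol2[of U G])
    show "K z > 0" if "z \<in> U" for z using K[OF that] pos[OF that] C k0[OF that] by simp
  qed (use hG GK U in \<open>auto simp: V_def\<close>)
  also have "lap2 G z (cnj z) = lap2 A z (cnj z) + (- lap2 Q z (cnj z) - lap2 Q z (cnj z))"
    unfolding G_def[abs_def] using U V A0 Q0
    by (simp add: lap2_mult[OF hA hii] lap2_mult[OF hi hi] lap2_inverse[OF hQ])
  also have "lap2 A z (cnj z) = 0"
  proof -
    have "k z \<noteq> 0" "k' (cnj z) \<noteq> 0" using k0 U by (auto simp: k'_def)
    then show ?thesis unfolding A_def[abs_def] using C
      by (subst lap2_mult[where U = U and V = V])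
         (auto intro!: hol2_mult hol2_const hol2_fst hol2_snd k h U V simp: lap2_fst lap2_snd)
  qed
  also have "lap2 Q z (cnj z) = - deriv f z * cnj (deriv f z) / (1 - f z * f' (cnj z))\<^sup>2"
    unfolding Q_def[abs_def]
  proof (rule lap2_one_minus[where U = U])
    show "(f has_field_derivative deriv f z) (at z)" using holomorphic_derivI[OF f U] .
    then show "(f' has_field_derivative cnj (deriv f z)) (at (cnj z))"
      using has_field_derivative_cnj_cnj[of f "deriv f z" "cnj z"] by (simp add: f'_def[abs_def] o_def)
    show "f z * f' (cnj z) \<noteq> 1" using Q0[OF U(2) V(2)] by (simp add: Q_def)
  qed (use U f in auto)
  also have "Re (0 + (- (- deriv f z * cnj (deriv f z) / (1 - f z * f' (cnj z))\<^sup>2) - - deriv f z * cnj (deriv f z) / (1 - f z * f' (cnj z))\<^sup>2))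
    = Re (of_real (2 * (norm (deriv f z))\<^sup>2 / (1 - (norm (f z))\<^sup>2)\<^sup>2))"
    unfolding f'_def complex_cnj_cnj q using cmod_power2[of "deriv f z"] by (simp add: mult.assoc) (simp add: power2_eq_square)
  finally show ?thesis by simp
qed

text \<open>A positive \<open>K\<close> whose metric \<open>g\<close> has curvature \<open>-2\<close> satisfies \<open>K = |k|\<^sup>2 / (K(z\<^sub>0) (1 - |T|\<^sup>2)\<^sup>2)\<close> near \<open>z\<^sub>0\<close>,
  where \<open>T\<close> is the Bergman representative coordinate, suitably scaled.\<close>

lemma bergman_local:
  assumes G: "hol2 U (cnj ` U) G" and z0: "z0 \<in> U"
    and K: "\<And>z. z \<in> U \<Longrightarrow> G z (cnj z) = of_real (K z)" and Kpos: "\<And>z. z \<in> U \<Longrightarrow> K z > 0"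
    and g: "\<And>z. z \<in> U \<Longrightarrow> g z = d2_dw_dwbar (\<lambda>z. ln (K z)) z" and gpos: "\<And>z. z \<in> U \<Longrightarrow> g z > 0"
    and curv: "\<And>z. z \<in> U \<Longrightarrow> d2_dw_dwbar (\<lambda>z. ln (g z)) z = g z"
  obtains r where "r > 0" "ball z0 r \<subseteq> U" "\<And>z. z \<in> ball z0 r \<Longrightarrow> G z (cnj z0) \<noteq> 0"
    "\<And>z A. z \<in> ball z0 r \<Longrightarrow> A = D2 G z (cnj z0) / G z (cnj z0) - D2 G z0 (cnj z0) / of_real (K z0) \<Longrightarrow>
       K z * K z0 * (1 - (norm A)\<^sup>2 / (2 * g z0))\<^sup>2 = (norm (G z (cnj z0)))\<^sup>2"
proof -
  define w0 where "w0 = cnj z0"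
  have U: "open U" using hol2_open[OF G] by auto
  have w0: "w0 \<in> cnj ` U" using z0 by (auto simp: w0_def)
  have lap: "lap2 G z (cnj z) = of_real (g z)" if "z \<in> U" for z
    using lap2_real[OF G _ that] d2_ln_hol2[OF G that K Kpos] g[OF that] K by (auto simp: complex_eq_iff complex_is_Real_iff)
  have "G z0 w0 \<in> - {0}" using K[OF z0] Kpos[OF z0] by (simp add: w0_def)
  then obtain r1 where r1: "r1 > 0" "ball z0 r1 \<subseteq> U" "ball w0 r1 \<subseteq> cnj ` U"
     and G1: "\<And>z w. z \<in> ball z0 r1 \<Longrightarrow> w \<in> ball w0 r1 \<Longrightarrow> G z w \<in> - {0}"
    using hol2_localize[OF G z0 w0, of "- {0}"] by (metis open_Compl closed_singleton)
  have hG1: "hol2 (ball z0 r1) (ball w0 r1) G" by (rule hol2_subset[OF G]) (use r1 in auto)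
  have hH1: "hol2 (ball z0 r1) (ball w0 r1) (lap2 G)" by (rule hol2_lap2[OF hG1]) (use G1 in auto)
  \<comment> \<open>Division by the values on the two axes through the base point makes
    \<open>Ln N\<close> vanish on both. The divisor is a product of functions of one variable, so
    \<open>lap2\<close> does not change.\<close>
  define N where "N z w = (G z w * G z0 w0) / (G z w0 * G z0 w)" for z w
  have hN1: "hol2 (ball z0 r1) (ball w0 r1) N"
    unfolding N_def[abs_def]
    by (intro hol2_divide hol2_mult hol2_const hol2_fst hol2_snd hG1 hol2_holomorphic1[OF hG1] hol2_holomorphic2[OF hG1])
       (use r1 G1 in auto)
  have z1: "z0 \<in> ball z0 r1" and w1: "w0 \<in> ball w0 r1" using r1 by auto
  have "lap2 G z0 w0 \<in> - \<real>\<^sub>\<le>\<^sub>0" using lap[OF z0] gpos[OF z0] by (auto simp: w0_def)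
  then obtain r2 where r2: "r2 > 0" "ball z0 r2 \<subseteq> ball z0 r1" "ball w0 r2 \<subseteq> ball w0 r1"
     and G2: "\<And>z w. z \<in> ball z0 r2 \<Longrightarrow> w \<in> ball w0 r2 \<Longrightarrow> lap2 G z w \<in> - \<real>\<^sub>\<le>\<^sub>0"
    using hol2_localize[OF hH1 z1 w1, of "- \<real>\<^sub>\<le>\<^sub>0"] by (metis open_Compl closed_nonpos_Reals_complex)
  have "N z0 w0 = 1" using G1[OF z1 w1] by (simp add: N_def)
  then have "N z0 w0 \<in> - \<real>\<^sub>\<le>\<^sub>0" by simp
  then obtain r3 where r3: "r3 > 0" "ball z0 r3 \<subseteq> ball z0 r1" "ball w0 r3 \<subseteq> ball w0 r1"
     and G3: "\<And>z w. z \<in> ball z0 r3 \<Longrightarrow> w \<in> ball w0 r3 \<Longrightarrow> N z w \<in> - \<real>\<^sub>\<le>\<^sub>0"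
    using hol2_localize[OF hN1 z1 w1, of "- \<real>\<^sub>\<le>\<^sub>0"] by (metis open_Compl closed_nonpos_Reals_complex)
  define r where "r = min r2 r3"
  define B where "B = ball z0 r"
  define C where "C = ball w0 r"
  have BC: "open B" "open C" "convex B" "convex C" "connected B" "z0 \<in> B" "w0 \<in> C" and CB: "C = cnj ` B"
    using r2 r3 by (auto simp: B_def C_def r_def w0_def cnj_ball simp del: cnj_image_iff)
  have sub: "B \<subseteq> ball z0 r1" "C \<subseteq> ball w0 r1" "B \<subseteq> ball z0 r2" "C \<subseteq> ball w0 r2" "B \<subseteq> ball z0 r3" "C \<subseteq> ball w0 r3"
    using r2 r3 by (auto simp: B_def C_def r_def)
  have BU: "B \<subseteq> U" using sub r1 by auto
  have nz: "G z w \<noteq> 0" if "z \<in> B" "w \<in> C" for z w using G1[of z w] subsetD[OF sub(1) that(1)] subsetD[OF sub(2) that(2)] by auto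
  have hG: "hol2 B C G" by (rule hol2_subset[OF hG1]) (use BC sub in auto)
  have hH: "hol2 B C (lap2 G)" by (rule hol2_subset[OF hH1]) (use BC sub in auto)
  have hN: "hol2 B C N" by (rule hol2_subset[OF hN1]) (use BC sub in auto)
  have Hn: "lap2 G z w \<notin> \<real>\<^sub>\<le>\<^sub>0" if "z \<in> B" "w \<in> C" for z w using G2[of z w] subsetD[OF sub(3) that(1)] subsetD[OF sub(4) that(2)] by auto
  have Nn: "N z w \<notin> \<real>\<^sub>\<le>\<^sub>0" if "z \<in> B" "w \<in> C" for z w using G3[of z w] subsetD[OF sub(5) that(1)] subsetD[OF sub(6) that(2)] by auto
  have Hnz: "lap2 G z w \<noteq> 0" if "z \<in> B" "w \<in> C" for z w using Hn[OF that] by auto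
  \<comment> \<open>Liouville's equation. On the diagonal it is the curvature condition, and
    polarization extends it to the bidisc.\<close>
  have llap: "lap2 (lap2 G) z w = lap2 G z w" if "z \<in> B" "w \<in> C" for z w
  proof -
    have d: "lap2 (lap2 G) z (cnj z) = lap2 G z (cnj z)" if z: "z \<in> B" for z
    proof -
      have hH': "hol2 B (cnj ` B) (lap2 G)" using hH CB by simp
      have 1: "lap2 G z (cnj z) = of_real (g z)" "g z > 0" if "z \<in> B" for z
        using lap gpos BU that by auto
      have "Re (lap2 (lap2 G) z (cnj z)) = g z"
        using d2_ln_hol2[OF hH' z 1] curv[of z] z BU by auto
      moreover have "lap2 (lap2 G) z (cnj z) \<in> \<real>" by (rule lap2_real[OF hH' _ z]) (simp add: 1)
      ultimately show ?thesis using 1(1)[OF z] by (auto simp: complex_eq_iff complex_is_Real_iff)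
    qed
    have "lap2 (lap2 G) z w - lap2 G z w = 0"
    proof (rule polarization[of B "\<lambda>z w. lap2 (lap2 G) z w - lap2 G z w" B])
      show "hol2 B (cnj ` B) (\<lambda>z w. lap2 (lap2 G) z w - lap2 G z w)"
        unfolding CB[symmetric] by (intro hol2_diff hol2_lap2 hH Hnz)
    qed (use BC d that in \<open>auto simp: CB\<close>)
    then show ?thesis by simp
  qed
  have lapN: "lap2 N z w = lap2 G z w" if zw: "z \<in> B" "w \<in> C" for z w
  proof -
    define a where "a z = G z0 w0 / G z w0" for z
    define b where "b w = inverse (G z0 w)" for w
    have ha: "a holomorphic_on B" "b holomorphic_on C"
      unfolding a_def b_def using BC nz
      by (auto intro!: holomorphic_intros hol2_holomorphic1[OF hG] hol2_holomorphic2[OF hG])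
    have hab: "hol2 B C (\<lambda>z w. a z * b w)" by (intro hol2_mult hol2_fst hol2_snd ha BC)
    have ab0: "a z \<noteq> 0" "b w \<noteq> 0" using nz BC zw by (auto simp: a_def b_def)
    have "N = (\<lambda>z w. G z w * (a z * b w))" by (auto simp: N_def a_def b_def fun_eq_iff field_simps)
    then have "lap2 N z w = lap2 G z w + lap2 (\<lambda>z w. a z * b w) z w"
      using lap2_mult[OF hG hab zw] nz zw ab0 by simp
    also have "lap2 (\<lambda>z w. a z * b w) z w = 0"
      using lap2_mult[OF hol2_fst[OF BC(1,2) ha(1)] hol2_snd[OF BC(1,2) ha(2)] zw] ab0 by (simp add: lap2_fst lap2_snd)
    finally show ?thesis by simp
  qed
  define u where "u z w = Ln (N z w)" for z w
  define h where "h z w = Ln (lap2 G z w)" for z w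
  have hu: "hol2 B C u" unfolding u_def[abs_def] by (rule hol2_Ln[OF hN Nn])
  have hh: "hol2 B C h" unfolding h_def[abs_def] by (rule hol2_Ln[OF hH Hn])
  have eh: "exp (h z w) = lap2 G z w" if "z \<in> B" "w \<in> C" for z w using Hnz[OF that] by (simp add: h_def)
  have key: "exp (- u z w / 2) = 1 - D2 u z w0 * D1 u z0 w / (2 * exp (h z0 w0))" if "z \<in> B" "w \<in> C" for z w
  proof (rule liouville_hol2[OF hu hh])
    show "u z w0 = 0" if "z \<in> B" for z using nz that BC by (simp add: u_def N_def)
    show "u z0 w = 0" if "w \<in> C" for w using nz that BC by (simp add: u_def N_def)
    show "D1 (D2 u) z w = exp (h z w)" if "z \<in> B" "w \<in> C" for z w
      unfolding u_def[abs_def] using D1_D2_Ln[OF hN that Nn] lapN[OF that] eh[OF that] by simp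
    show "D1 (D2 h) z w = exp (h z w)" if "z \<in> B" "w \<in> C" for z w
      unfolding h_def[abs_def] using D1_D2_Ln[OF hH that Hn] llap[OF that] Hnz[OF that] by (simp)
  qed (use that BC in auto)
  have D2u: "D2 u z w0 = D2 G z w0 / G z w0 - D2 G z0 w0 / G z0 w0" if z: "z \<in> B" for z
  proof (rule D2_eqI)
    have n: "G z w0 \<noteq> 0" "G z0 w0 \<noteq> 0" using nz z BC by auto
    then have N1: "N z w0 = 1" by (simp add: N_def)
    have "((\<lambda>w. N z w) has_field_derivative (D2 G z w0 / G z w0 - D2 G z0 w0 / G z0 w0)) (at w0)"
      unfolding N_def using n BC z
      by (auto intro!: derivative_eq_intros hol2_D2[OF hG] simp: field_simps power2_eq_square)
    then show "((\<lambda>w. u z w) has_field_derivative (D2 G z w0 / G z w0 - D2 G z0 w0 / G z0 w0)) (at w0)"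
      unfolding u_def using N1 by (auto intro!: derivative_eq_intros)
  qed
  have herm: "G z w = cnj (G (cnj w) (cnj z))" if "z \<in> B" "w \<in> C" for z w
    by (rule hermitian_polarization[of B G]) (use hG BC K BU that CB in auto)
  \<comment> \<open>Hermitian symmetry of \<open>N\<close> makes the two derivatives in
    \<open>key\<close> conjugate to each other at a diagonal point, so that their product is the
    square of a norm.\<close>
  have D1u: "D1 u z0 (cnj z) = cnj (D2 u z w0)" if z: "z \<in> B" for z
  proof -
    have nh: "N x w = cnj (N (cnj w) (cnj x))" if "x \<in> B" "w \<in> C" for x w
    proof -
      have "cnj (G (cnj w) (cnj x)) = G x w" "cnj (G (cnj w) w0) = G z0 w" "cnj (G z0 (cnj x)) = G x w0" "cnj (G z0 w0) = G z0 w0"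
        using herm[OF that] herm[OF that(1) BC(7)] herm[OF BC(6) that(2)] herm[OF BC(6,7)] by (simp_all add: w0_def)
      then show ?thesis unfolding N_def by (simp add: mult.commute)
    qed
    have uh: "u x w = cnj (u (cnj w) (cnj x))" if "x \<in> B" "w \<in> C" for x w
    proof -
      have "N (cnj w) (cnj x) \<notin> \<real>\<^sub>\<le>\<^sub>0" using Nn[of "cnj w" "cnj x"] that CB by auto
      then have "Ln (cnj (N (cnj w) (cnj x))) = cnj (u (cnj w) (cnj x))" unfolding u_def by (rule cnj_Ln[symmetric])
      then show ?thesis unfolding u_def nh[OF that, symmetric] .
    qed
    have "D1 u z0 (cnj z) = D1 (\<lambda>x w. cnj (u (cnj w) (cnj x))) z0 (cnj z)"
      by (rule D1_cong[of B]) (use BC z CB uh[of _ "cnj z"] in auto)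
    also have "\<dots> = cnj (D2 u z w0)"
      using has_field_derivative_cnj_cnj[OF hol2_D2[OF hu, of z "cnj z0"]] z BC
      by (intro D1_eqI) (auto simp: o_def w0_def)
    finally show ?thesis .
  qed
  show thesis
  proof (rule that[of r])
    show "r > 0" using r2 r3 by (auto simp: r_def)
    show "ball z0 r \<subseteq> U" using BU by (simp add: B_def)
    show "G z (cnj z0) \<noteq> 0" if "z \<in> ball z0 r" for z using nz[of z w0] that BC by (auto simp: B_def w0_def)
    fix z A assume "z \<in> ball z0 r" and A: "A = D2 G z (cnj z0) / G z (cnj z0) - D2 G z0 (cnj z0) / of_real (K z0)"
    then have z: "z \<in> B" and cz: "cnj z \<in> C" by (auto simp: B_def CB)
    have A': "A = D2 u z w0" using D2u[OF z] A K[OF z0] by (simp add: w0_def)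
    have e: "exp (- u z (cnj z) / 2) = of_real (1 - (norm A)\<^sup>2 / (2 * g z0))"
      using key[OF z cz] D1u[OF z] eh[OF BC(6,7)] lap[OF z0] A' complex_norm_square[of A] by (simp add: w0_def)
    \<comment> \<open>Squaring removes the half in the exponent, and \<open>exp (- u)\<close> is the
      reciprocal of \<open>N\<close>, whose diagonal value involves only \<open>K z\<close>,
      \<open>K z0\<close> and \<open>G z w0\<close> by symmetry.\<close>
    have "of_real ((1 - (norm A)\<^sup>2 / (2 * g z0))\<^sup>2) = exp (- u z (cnj z) / 2) ^ 2" unfolding e by simp
    also have "\<dots> = exp (- u z (cnj z))" by (simp add: power2_eq_square flip: exp_add)
    also have "\<dots> = inverse (N z (cnj z))" using Nn[OF z cz] exp_Ln[of "N z (cnj z)"] by (cases "N z (cnj z) = 0") (auto simp: u_def exp_minus)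
    also have "\<dots> = (G z w0 * cnj (G z w0)) / (of_real (K z) * of_real (K z0))"
      using herm[OF BC(6) cz] K[of z] K[OF z0] z BU by (auto simp: N_def w0_def)
    also have "\<dots> = of_real ((norm (G z w0))\<^sup>2 / (K z * K z0))" by (simp flip: complex_norm_square)
    finally have "(1 - (norm A)\<^sup>2 / (2 * g z0))\<^sup>2 = (norm (G z w0))\<^sup>2 / (K z * K z0)" by (simp only: of_real_eq_iff)
    then show "K z * K z0 * (1 - (norm A)\<^sup>2 / (2 * g z0))\<^sup>2 = (norm (G z (cnj z0)))\<^sup>2"
      using Kpos[OF z0] Kpos[of z] z BU by (auto simp: w0_def field_simps)
  qed
qed

section \<open>Area and holomorphic maps\<close>

text \<open>Identification of the plane with \<open>real ^ 2\<close>, where the change of variables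
  formula is phrased with determinants of matrices.\<close>

definition vec_to_complex :: "real ^ 2 \<Rightarrow> complex" where "vec_to_complex x = Complex (x $ 1) (x $ 2)"
definition complex_to_vec :: "complex \<Rightarrow> real ^ 2" where "complex_to_vec z = (\<chi> i. if i = 1 then Re z else Im z)"

lemma vec_complex_inverse [simp]: "vec_to_complex (complex_to_vec z) = z" "complex_to_vec (vec_to_complex x) = x"
  by (auto simp: vec_to_complex_def complex_to_vec_def vec_eq_iff forall_2)

lemma bounded_linear_vec_to_complex: "bounded_linear vec_to_complex"
proof -
  have "linear vec_to_complex" by (auto intro!: linearI simp: vec_to_complex_def complex_eq_iff)
  then show ?thesis by (rule linear_conv_bounded_linear[THEN iffD1])
qed

lemma bounded_linear_complex_to_vec: "bounded_linear complex_to_vec"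
proof -
  have "linear complex_to_vec" by (auto intro!: linearI simp: complex_to_vec_def vec_eq_iff)
  then show ?thesis by (rule linear_conv_bounded_linear[THEN iffD1])
qed

lemma measurable_vec_to_complex [measurable]: "vec_to_complex \<in> borel_measurable borel"
  by (intro borel_measurable_continuous_onI linear_continuous_on bounded_linear_vec_to_complex)

lemma measurable_complex_to_vec [measurable]: "complex_to_vec \<in> borel_measurable borel"
  by (intro borel_measurable_continuous_onI linear_continuous_on bounded_linear_complex_to_vec)

text \<open>Boxes correspond to boxes with the same side lengths, and Lebesgue measure is determined
  by its values on boxes.\<close>

lemma lborel_complex_eq: "lborel = distr lborel borel vec_to_complex"
proof (rule lborel_eqI)
  fix l u :: complex assume lu: "\<And>b. b \<in> Basis \<Longrightarrow> l \<bullet> b \<le> u \<bullet> b"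
  have B: "(Basis :: (real^2) set) = {axis 1 1, axis 2 1}"
    by (auto simp: Basis_vec_def axis_eq_axis UNIV_2)
  have ne: "axis 1 1 \<noteq> (axis 2 1 :: real ^ 2)" by (simp add: axis_eq_axis)
  have "vec_to_complex -` box l u = box (complex_to_vec l) (complex_to_vec u)"
    by (auto simp: vec_to_complex_def complex_to_vec_def mem_box B inner_axis Basis_complex_def inner_complex_def)
  then have "emeasure (distr lborel borel vec_to_complex) (box l u) = emeasure lborel (box (complex_to_vec l) (complex_to_vec u))"
    by (subst emeasure_distr) auto
  also have "\<dots> = (\<Prod>b\<in>Basis. (complex_to_vec u - complex_to_vec l) \<bullet> b)"
    using lu[of 1] lu[of \<i>] by (intro emeasure_lborel_box) (auto simp: B inner_axis complex_to_vec_def Basis_complex_def inner_complex_def)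
  also have "\<dots> = (\<Prod>b\<in>Basis. (u - l) \<bullet> b)"
    using ne by (simp add: B Basis_complex_def inner_axis complex_to_vec_def inner_complex_def inner_diff_left complex_eq_iff)
  finally show "emeasure (distr lborel borel vec_to_complex) (box l u) = (\<Prod>b\<in>Basis. (u - l) \<bullet> b)" .
qed simp

lemma matrix_complex_mult:
  "det (matrix (\<lambda>h. complex_to_vec (a * vec_to_complex h))) = (norm a)\<^sup>2"
proof -
  have "matrix (\<lambda>h. complex_to_vec (a * vec_to_complex h)) $ i $ j =
     (if i = 1 then if j = 1 then Re a else - Im a else if j = 1 then Im a else Re a)" for i j
    unfolding matrix_def by (cases j rule: exhaust_2[THEN disjE]) (auto simp: complex_to_vec_def vec_to_complex_def axis_def)
  then show ?thesis using cmod_power2[of a] by (simp add: det_2 power2_eq_square)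
qed

text \<open>The inverse map is holomorphic on the open image, so the image of \<open>S\<close> is a
  preimage of \<open>S\<close> under a continuous map.\<close>

lemma holomorphic_image_borel:
  assumes f: "f holomorphic_on U" and U: "open U" and inj: "inj_on f U" and S: "S \<subseteq> U" "S \<in> sets borel"
  shows "f ` S \<in> sets borel"
proof -
  obtain g where g: "g holomorphic_on f ` U" "\<And>z. z \<in> U \<Longrightarrow> g (f z) = z"
    using holomorphic_has_inverse[OF f U inj] by metis
  have o: "open (f ` U)" by (rule open_mapping_thm3[OF f U inj])
  have "f ` S = g -` S \<inter> f ` U" using g S by (auto simp: image_iff)
  moreover have "g -` S \<inter> f ` U \<in> sets (restrict_space borel (f ` U))"
    using measurable_sets[OF borel_measurable_continuous_on_restrict[OF holomorphic_on_imp_continuous_on[OF g(1)]] S(2)]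
    by (simp add: space_restrict_space)
  ultimately show ?thesis using o by (simp add: sets_restrict_space_iff)
qed

lemma holomorphic_emeasure_image:
  assumes f: "f holomorphic_on U" and U: "open U" and inj: "inj_on f U" and S: "S \<subseteq> U" "S \<in> sets borel"
  shows "emeasure lborel (f ` S) = (\<integral>\<^sup>+z\<in>S. ennreal ((norm (deriv f z))\<^sup>2) \<partial>lborel)"
proof -
  define F where "F = complex_to_vec \<circ> f \<circ> vec_to_complex"
  define T where "T = vec_to_complex -` S"
  define D where "D x = (norm (deriv f (vec_to_complex x)))\<^sup>2" for x
  define F' where "F' x = (\<lambda>h. complex_to_vec (deriv f (vec_to_complex x) * vec_to_complex h))" for x
  have T: "T \<in> sets borel" using measurable_sets[OF measurable_vec_to_complex S(2)] by (simp add: T_def)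
  then have Tl: "T \<in> sets lebesgue" by simp
  have FT: "F ` T = vec_to_complex -` (f ` S)"
  proof (intro set_eqI iffI)
    fix y assume "y \<in> vec_to_complex -` (f ` S)"
    then obtain s where s: "s \<in> S" "vec_to_complex y = f s" by auto
    then have "y = F (complex_to_vec s)" by (simp add: F_def) (metis vec_complex_inverse(2))
    then show "y \<in> F ` T" using s by (auto simp: T_def)
  qed (auto simp: F_def T_def)
  have fS: "f ` S \<in> sets borel" by (rule holomorphic_image_borel[OF assms])
  have FTb: "F ` T \<in> sets borel" unfolding FT using measurable_sets[OF measurable_vec_to_complex fS] by simp
  have der: "(F has_derivative F' x) (at x within T)" if "x \<in> T" for x
  proof -
    have "(f has_derivative (\<lambda>h. deriv f (vec_to_complex x) * h)) (at (vec_to_complex x))"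
      using holomorphic_derivI[OF f U, of "vec_to_complex x"] that S by (auto simp: T_def has_field_derivative_def)
    then show ?thesis unfolding F_def F'_def comp_def
      using bounded_linear.has_derivative[OF bounded_linear_complex_to_vec]
        has_derivative_compose[OF bounded_linear_imp_has_derivative[OF bounded_linear_vec_to_complex], of f "\<lambda>h. deriv f (vec_to_complex x) * h" x T]
      by blast
  qed
  have detD: "\<bar>det (matrix (F' x))\<bar> = D x" for x by (simp add: F'_def matrix_complex_mult D_def)
  have injF: "inj_on F T"
    using inj S by (auto simp: inj_on_def F_def T_def) (metis subsetD vec_complex_inverse)
  have D0: "0 \<le> D x" for x by (simp add: D_def)
  have dm: "(\<lambda>z. indicator S z * (norm (deriv f z))\<^sup>2) \<in> borel_measurable borel"
  proof -
    have "continuous_on U (\<lambda>z. (norm (deriv f z))\<^sup>2)"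
      using holomorphic_deriv[OF f U] by (intro continuous_intros holomorphic_on_imp_continuous_on)
    then have "(\<lambda>z. indicator U z *\<^sub>R (norm (deriv f z))\<^sup>2) \<in> borel_measurable borel"
      using U by (intro borel_measurable_continuous_on_indicator) auto
    then have "(\<lambda>z. indicator S z * (indicator U z *\<^sub>R (norm (deriv f z))\<^sup>2)) \<in> borel_measurable borel"
      using S(2) by (intro borel_measurable_times borel_measurable_indicator) auto
    moreover have "(\<lambda>z. indicator S z * (indicator U z *\<^sub>R (norm (deriv f z))\<^sup>2)) = (\<lambda>z. indicator S z * (norm (deriv f z))\<^sup>2)"
      using S(1) by (auto simp: indicator_def fun_eq_iff)
    ultimately show ?thesis by (simp only:)
  qed
  have qm: "(\<lambda>x. indicator T x * D x) \<in> borel_measurable borel"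
    using measurable_compose[OF measurable_vec_to_complex dm] by (simp add: T_def D_def indicator_vimage)
  define J where "J = (\<integral>\<^sup>+x. ennreal (indicator T x * D x) \<partial>lborel)"
  have J: "(\<integral>\<^sup>+z\<in>S. ennreal ((norm (deriv f z))\<^sup>2) \<partial>lborel) = J"
  proof -
    have "(\<integral>\<^sup>+z\<in>S. ennreal ((norm (deriv f z))\<^sup>2) \<partial>lborel) = (\<integral>\<^sup>+z. ennreal (indicator S z * (norm (deriv f z))\<^sup>2) \<partial>lborel)"
      by (intro nn_integral_cong) (auto simp: indicator_def)
    also have "\<dots> = (\<integral>\<^sup>+z. ennreal (indicator S z * (norm (deriv f z))\<^sup>2) \<partial>distr lborel borel vec_to_complex)"
      by (simp add: lborel_complex_eq[symmetric])
    also have "\<dots> = J"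
      using dm by (subst nn_integral_distr) (auto simp: J_def T_def D_def indicator_vimage)
    finally show ?thesis .
  qed
  have lhs: "emeasure lborel (f ` S) = emeasure lborel (F ` T)"
    by (subst lborel_complex_eq, subst emeasure_distr) (use fS FT in auto)
  have int_iff: "D integrable_on T \<longleftrightarrow> (\<lambda>x. indicator T x * D x) integrable_on UNIV"
  proof -
    have "(\<lambda>x. indicator T x * D x) = (\<lambda>x. if x \<in> T then D x else 0)" by (auto simp: indicator_def)
    then show ?thesis by (simp add: integrable_restrict_UNIV)
  qed
  have nn: "(\<integral>\<^sup>+x. ennreal (indicator T x * D x) \<partial>lborel) = ennreal (integral T D)" if "D integrable_on T"
    using nn_integral_has_integral_lebesgue[OF D0 integrable_integral[OF that]] by simp
  note eq = measurable_differentiable_image_eq[OF Tl der injF, unfolded detD]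
  show ?thesis
  \<comment> \<open>Finite area of the image is equivalent to integrability of the Jacobian, so the
    infinite case follows by contraposition.\<close>
  proof (cases "J < \<infinity>")
    case True
    then have int: "D integrable_on T" unfolding int_iff J_def
      by (intro nn_integral_integrable_on[OF qm]) (auto simp: D0)
    then have "F ` T \<in> lmeasurable" using eq by simp
    then have "emeasure lebesgue (F ` T) = ennreal (measure lebesgue (F ` T))"
      by (rule emeasure_eq_measure2)
    also have "measure lebesgue (F ` T) = integral T D"
      by (rule measure_differentiable_image_eq[OF Tl der injF, unfolded detD]) (use int in auto)
    also have "emeasure lebesgue (F ` T) = emeasure lborel (F ` T)"
      using FTb by (simp add: emeasure_completion)
    finally show ?thesis using nn[OF int] unfolding J lhs J_def by simp
  next
    case False
    then have "\<not> D integrable_on T" using nn by (auto simp: J_def)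
    then have "F ` T \<notin> lmeasurable" using eq by simp
    then have "emeasure lebesgue (F ` T) = \<infinity>" using FTb
      by (auto simp: fmeasurable_def not_less top_unique)
    then have "emeasure lborel (F ` T) = \<infinity>" using FTb by simp
    moreover have "J = \<infinity>" using False by (simp add: not_less top_unique)
    ultimately show ?thesis unfolding J lhs by simp
  qed
qed

section \<open>Mean value property over discs\<close>

lemma lborel_rotation: "norm w = 1 \<Longrightarrow> distr lborel borel (\<lambda>z. a + w * (z - a)) = (lborel :: complex measure)"
proof (rule measure_eqI)
  fix B :: "complex set" assume w: "norm w = 1" and "B \<in> sets (distr lborel borel (\<lambda>z. a + w * (z - a)))"
  then have B: "B \<in> sets borel" by simp
  have w0: "w \<noteq> 0" using w by auto
  define f where "f z = a + inverse w * (z - a)" for z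
  have m: "(\<lambda>z. a + w * (z - a)) \<in> borel_measurable borel" by measurable
  have df: "deriv f z = inverse w" for z
    unfolding f_def by (rule DERIV_imp_deriv) (auto intro!: derivative_eq_intros)
  have vim: "(\<lambda>z. a + w * (z - a)) -` B = f ` B"
  proof (intro set_eqI iffI)
    fix z assume "z \<in> (\<lambda>z. a + w * (z - a)) -` B"
    moreover have "f (a + w * (z - a)) = z" using w0 by (simp add: f_def field_simps)
    ultimately show "z \<in> f ` B" by (metis imageI vimageD)
  qed (use w0 in \<open>auto simp: f_def mult.assoc[symmetric]\<close>)
  have "emeasure (distr lborel borel (\<lambda>z. a + w * (z - a))) B = emeasure lborel (f ` B)"
    using B m vim by (subst emeasure_distr) auto
  also have "\<dots> = (\<integral>\<^sup>+z\<in>B. ennreal ((norm (deriv f z))\<^sup>2) \<partial>lborel)"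
    by (rule holomorphic_emeasure_image[of _ UNIV]) (use B w0 in \<open>auto simp: f_def[abs_def] inj_on_def intro!: holomorphic_intros\<close>)
  also have "\<dots> = emeasure lborel B"
    using B w by (simp add: df norm_inverse)
  finally show "emeasure (distr lborel borel (\<lambda>z. a + w * (z - a))) B = emeasure lborel B" .
qed simp

lemma emeasure_ball_complex: "r \<ge> 0 \<Longrightarrow> emeasure lborel (ball (z::complex) r) = ennreal (pi * r\<^sup>2)"
  by (simp add: emeasure_ball unit_ball_vol_2)

text \<open>Rotation about \<open>a\<close> by the angle \<open>pi / n\<close> preserves the disc
  and Lebesgue measure and changes the sign of the integrand.\<close>

lemma integral_power_ball:
  assumes n: "n > 0" and r: "r > 0"
  shows "(LINT z:ball a r|lborel. (z - a) ^ n) = (0 :: complex)"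
proof -
  define I where "I = (LINT z:ball a r|lborel. (z - a) ^ n)"
  define w where "w = cis (pi / n)"
  have wn: "w ^ n = - 1" unfolding w_def using n by (subst Complex.DeMoivre) simp
  have w1: "norm w = 1" by (simp add: w_def)
  have "I = (LINT z|distr lborel borel (\<lambda>z. a + w * (z - a)). indicator (ball a r) z *\<^sub>R (z - a) ^ n)"
    unfolding I_def set_lebesgue_integral_def lborel_rotation[OF w1] ..
  also have "\<dots> = (LINT z|lborel. indicator (ball a r) (a + w * (z - a)) *\<^sub>R (w * (z - a)) ^ n)"
    by (subst integral_distr) (auto intro!: borel_measurable_scaleR borel_measurable_indicator borel_measurable_power)
  also have "\<dots> = (LINT z|lborel. w ^ n * (indicator (ball a r) z *\<^sub>R (z - a) ^ n))"
    by (intro Bochner_Integration.integral_cong refl)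
       (auto simp: indicator_def dist_norm norm_mult w1 norm_minus_commute power_mult_distrib)
  also have "\<dots> = - I" unfolding I_def set_lebesgue_integral_def by (simp add: wn)
  finally show ?thesis unfolding I_def by simp
qed

text \<open>Termwise integration of the power series at \<open>a\<close>, whose nonconstant terms
  integrate to zero. The room between \<open>r\<close> and \<open>R\<close> makes the norms of the
  terms summable uniformly on the disc, as the exchange requires.\<close>

lemma mean_value_ball_aux:
  assumes f: "f holomorphic_on ball a R" and r: "0 < r" "r < R"
  shows "(LINT z:ball a r|lborel. f z) = of_real (pi * r\<^sup>2) * f a"
proof -
  define c where "c n = (deriv ^^ n) f a / fact n" for n
  have sums: "(\<lambda>n. c n * (z - a) ^ n) sums f z" if "z \<in> ball a R" for z
    unfolding c_def by (rule holomorphic_power_series[OF f that])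
  have summ: "summable (\<lambda>n. norm (c n) * r ^ n)"
  proof -
    define s where "s = (r + R) / 2"
    have s: "r < s" "s < R" "0 < s" using r by (auto simp: s_def)
    have "summable (\<lambda>n. c n * of_real s ^ n)"
      using sums_summable[OF sums[of "a + of_real s"]] s by (auto simp: dist_norm)
    then have "summable (\<lambda>n. norm (c n * of_real r ^ n))"
      by (rule powser_insidea) (use s r in auto)
    then show ?thesis using r by (simp add: norm_mult norm_power)
  qed
  define g where "g n z = indicator (ball a r) z *\<^sub>R (c n * (z - a) ^ n)" for n z
  have fin: "emeasure lborel (ball a r) < \<infinity>" using r by (simp add: emeasure_ball_complex)
  have gb: "norm (g n z) \<le> indicator (ball a r) z * (norm (c n) * r ^ n)" for n z
    using r by (auto simp: g_def indicator_def norm_mult norm_power dist_norm norm_minus_commute intro!: mult_left_mono power_mono)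
  have gm: "g n \<in> borel_measurable lborel" for n unfolding g_def
    by (intro borel_measurable_scaleR borel_measurable_indicator borel_measurable_times borel_measurable_power) auto
  have ii: "integrable lborel (\<lambda>z. indicator (ball a r) z * (norm (c n) * r ^ n))" for n
    using fin by (intro integrable_mult_left integrable_real_indicator) auto
  have gi: "integrable lborel (g n)" for n
    by (rule Bochner_Integration.integrable_bound[OF ii gm]) (use gb[of n] r in \<open>auto intro!: AE_I2 simp: abs_mult\<close>)
  have nb: "norm (LINT z|lborel. norm (g n z)) \<le> pi * r\<^sup>2 * (norm (c n) * r ^ n)" for n
  proof -
    have "(LINT z|lborel. norm (g n z)) \<le> (LINT z|lborel. indicator (ball a r) z * (norm (c n) * r ^ n))"
      by (intro integral_mono ii integrable_norm gi gb)
    also have "\<dots> = pi * r\<^sup>2 * (norm (c n) * r ^ n)"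
      using r by (simp add: measure_def emeasure_ball_complex)
    finally show ?thesis by simp
  qed
  have "(\<lambda>n. integral\<^sup>L lborel (g n)) sums (LINT z|lborel. (\<Sum>n. g n z))"
  proof (rule sums_integral[OF gi])
    show "AE z in lborel. summable (\<lambda>n. norm (g n z))"
    proof (rule AE_I2)
      fix z show "summable (\<lambda>n. norm (g n z))"
        by (rule summable_comparison_test'[OF summable_mult[OF summ, of "indicator (ball a r) z"]]) (use gb in auto)
    qed
    show "summable (\<lambda>n. LINT z|lborel. norm (g n z))"
      by (rule summable_comparison_test'[OF summable_mult[OF summ, of "pi * r\<^sup>2"]]) (use nb in auto)
  qed
  moreover have "(\<Sum>n. g n z) = indicator (ball a r) z *\<^sub>R f z" for z
  proof (cases "z \<in> ball a r")
    case True
    then show ?thesis using sums[of z] r by (auto simp: g_def sums_iff)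
  qed (simp add: g_def)
  moreover have "integral\<^sup>L lborel (g n) = (if n = 0 then of_real (pi * r\<^sup>2) * f a else 0)" for n
  proof (cases "n = 0")
    case True
    have "integral\<^sup>L lborel (g n) = (LINT z|lborel. indicator (ball a r) z *\<^sub>R f a)"
      by (simp add: g_def[abs_def] True c_def)
    also have "\<dots> = measure lborel (ball a r) *\<^sub>R f a" using fin by (subst integral_scaleR_left) auto
    also have "\<dots> = of_real (pi * r\<^sup>2) * f a" using r by (simp add: measure_def emeasure_ball_complex scaleR_conv_of_real)
    finally show ?thesis using True by simp
  next
    case False
    have "integral\<^sup>L lborel (g n) = (LINT z|lborel. c n * (indicator (ball a r) z *\<^sub>R (z - a) ^ n))"
      by (simp add: g_def[abs_def])
    also have "\<dots> = c n * (LINT z:ball a r|lborel. (z - a) ^ n)" unfolding set_lebesgue_integral_def by (subst integral_mult_right_zero[symmetric]) simp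
    also have "\<dots> = 0" using integral_power_ball[of n r a] False r by simp
    finally show ?thesis using False by simp
  qed
  ultimately have "(\<lambda>n. if n = 0 then of_real (pi * r\<^sup>2) * f a else 0) sums (LINT z:ball a r|lborel. f z)"
    by (simp add: set_lebesgue_integral_def)
  moreover have "(\<lambda>n. if n = 0 then of_real (pi * r\<^sup>2) * f a else 0) sums (of_real (pi * r\<^sup>2) * f a)"
    using sums_single[of 0 "\<lambda>n. of_real (pi * r\<^sup>2) * f a"] by simp
  ultimately show ?thesis by (rule sums_unique2)
qed

text \<open>The function may be unbounded near the circle. The integrals over the discs of radius
  \<open>s n\<close>, which tends to \<open>r\<close> from below, converge by domination with the
  norm of \<open>f\<close>.\<close>

lemma mean_value_ball:
  assumes f: "f holomorphic_on ball a r" and r: "0 < r" and int: "set_integrable lborel (ball a r) f"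
  shows "(LINT z:ball a r|lborel. f z) = of_real (pi * r\<^sup>2) * f a"
proof -
  define s where "s n = r * (1 - 1 / real (n + 2))" for n :: nat
  have s: "0 < s n" "s n < r" for n
  proof -
    have "0 < 1 - 1 / real (n + 2)" "1 - 1 / real (n + 2) < 1" by (auto simp: field_simps)
    then show "0 < s n" "s n < r" using r unfolding s_def by (auto simp: mult_less_cancel_left2 simp del: of_nat_add)
  qed
  have sl: "s \<longlonglongrightarrow> r * (1 - 0)"
    unfolding s_def by (intro tendsto_intros LIMSEQ_ignore_initial_segment[OF lim_1_over_n[where 'a = real], of 2])
  then have sl: "s \<longlonglongrightarrow> r" by simp
  have "(\<lambda>n. LINT z|lborel. indicator (ball a (s n)) z *\<^sub>R f z) \<longlonglongrightarrow> (LINT z|lborel. indicator (ball a r) z *\<^sub>R f z)"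
  proof (rule integral_dominated_convergence[where w = "\<lambda>z. norm (indicator (ball a r) z *\<^sub>R f z)"])
    show m: "(\<lambda>z. indicator (ball a r) z *\<^sub>R f z) \<in> borel_measurable lborel"
      using int unfolding set_integrable_def by auto
    show "(\<lambda>z. indicator (ball a (s n)) z *\<^sub>R f z) \<in> borel_measurable lborel" for n
    proof -
      have eq: "(\<lambda>z. indicator (ball a (s n)) z *\<^sub>R f z) = (\<lambda>z. indicator (ball a (s n)) z *\<^sub>R (indicator (ball a r) z *\<^sub>R f z))"
        using s[of n] by (auto simp: indicator_def)
      show ?thesis unfolding eq by (rule borel_measurable_scaleR[OF borel_measurable_indicator m]) simp
    qed
    show "integrable lborel (\<lambda>z. norm (indicator (ball a r) z *\<^sub>R f z))"
      using int unfolding set_integrable_def by (rule integrable_norm)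
    show "AE z in lborel. norm (indicator (ball a (s n)) z *\<^sub>R f z) \<le> norm (indicator (ball a r) z *\<^sub>R f z)" for n
      using s[of n] by (intro AE_I2) (auto simp: indicator_def)
    show "AE z in lborel. (\<lambda>n. indicator (ball a (s n)) z *\<^sub>R f z) \<longlonglongrightarrow> indicator (ball a r) z *\<^sub>R f z"
    proof (rule AE_I2)
      fix z show "(\<lambda>n. indicator (ball a (s n)) z *\<^sub>R f z) \<longlonglongrightarrow> indicator (ball a r) z *\<^sub>R f z"
      proof (cases "z \<in> ball a r")
        case True
        then have "eventually (\<lambda>n. dist a z < s n) sequentially" using order_tendstoD(1)[OF sl] by auto
        then have "eventually (\<lambda>n. indicator (ball a (s n)) z *\<^sub>R f z = indicator (ball a r) z *\<^sub>R f z) sequentially"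
          by eventually_elim (use True in auto)
        then show ?thesis by (rule tendsto_eventually)
      next
        case False
        then have "z \<notin> ball a (s n)" for n using s[of n] by auto
        then show ?thesis using False by simp
      qed
    qed
  qed
  then have "(\<lambda>n. of_real (pi * (s n)\<^sup>2) * f a) \<longlonglongrightarrow> (LINT z:ball a r|lborel. f z)"
    using mean_value_ball_aux[OF f s] by (simp add: set_lebesgue_integral_def)
  moreover have "(\<lambda>n. of_real (pi * (s n)\<^sup>2) * f a) \<longlonglongrightarrow> of_real (pi * r\<^sup>2) * f a"
    by (intro tendsto_intros sl)
  ultimately show ?thesis by (rule LIMSEQ_unique)
qed

text \<open>The mean value property is applied to the square of \<open>f\<close>; the triangle
  inequality for integrals then gives the bound at once.\<close>

lemma sub_mean_value_ball:
  assumes f: "f holomorphic_on ball a r" and r: "0 < r" and int: "set_integrable lborel (ball a r) (\<lambda>z. (norm (f z))\<^sup>2)"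
  shows "pi * r\<^sup>2 * (norm (f a))\<^sup>2 \<le> (LINT z:ball a r|lborel. (norm (f z))\<^sup>2)"
proof -
  have m: "set_borel_measurable lborel (ball a r) (\<lambda>z. (f z)\<^sup>2)"
  proof -
    have "(\<lambda>z. indicator (ball a r) z *\<^sub>R (f z)\<^sup>2) \<in> borel_measurable borel"
      using holomorphic_on_imp_continuous_on[OF f]
      by (intro borel_measurable_continuous_on_indicator continuous_intros) auto
    then show ?thesis unfolding set_borel_measurable_def by simp
  qed
  have int2: "set_integrable lborel (ball a r) (\<lambda>z. (f z)\<^sup>2)"
    by (rule set_integrable_bound[OF int]) (use m in \<open>auto simp: norm_power set_borel_measurable_def\<close>)
  have "(LINT z:ball a r|lborel. (f z)\<^sup>2) = of_real (pi * r\<^sup>2) * (f a)\<^sup>2"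
    by (rule mean_value_ball[OF _ r int2]) (intro holomorphic_intros f)
  then have "pi * r\<^sup>2 * (norm (f a))\<^sup>2 = norm (LINT z:ball a r|lborel. (f z)\<^sup>2)"
    using r by (simp add: norm_mult norm_power)
  also have "\<dots> \<le> (LINT z:ball a r|lborel. norm ((f z)\<^sup>2))"
    using int2 by (rule set_integral_norm_bound)
  finally show ?thesis by (simp add: norm_power)
qed

section \<open>Charts\<close>

lemma
  assumes c: "chart_of X c"
  shows chart_openin: "openin X (chart_dom c)"
    and chart_open: "open (coord c ` chart_dom c)"
    and chart_subset: "chart_dom c \<subseteq> topspace X"
    and chart_inj: "inj_on (coord c) (chart_dom c)"
proof -
  show o: "openin X (chart_dom c)" "open (coord c ` chart_dom c)" using c unfolding chart_of_def by blast+
  show s: "chart_dom c \<subseteq> topspace X" using o(1) by (rule openin_subset)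
  show "inj_on (coord c) (chart_dom c)"
  proof -
    have "homeomorphic_map (subtopology X (chart_dom c)) (top_of_set (coord c ` chart_dom c)) (coord c)"
      using c unfolding chart_of_def by blast
    from homeomorphic_imp_injective_map[OF this] show ?thesis using s by (simp add: Int_absorb1)
  qed
qed

lemma chart_inv_coord: "chart_of X c \<Longrightarrow> p \<in> chart_dom c \<Longrightarrow> chart_inv c (coord c p) = p"
  unfolding chart_inv_def by (rule inv_into_f_f[OF chart_inj])

lemma coord_chart_inv: "z \<in> coord c ` chart_dom c \<Longrightarrow> coord c (chart_inv c z) = z"
  unfolding chart_inv_def by (rule f_inv_into_f)

lemma chart_inv_in: "z \<in> coord c ` chart_dom c \<Longrightarrow> chart_inv c z \<in> chart_dom c"
  unfolding chart_inv_def by (rule inv_into_into)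

lemma coord_image_iff:
  assumes "chart_of X c" "B \<subseteq> chart_dom c"
  shows "z \<in> coord c ` B \<longleftrightarrow> z \<in> coord c ` chart_dom c \<and> chart_inv c z \<in> B"
 proof
  assume "z \<in> coord c ` B"
  then obtain p where "p \<in> B" "z = coord c p" by blast
  then show "z \<in> coord c ` chart_dom c \<and> chart_inv c z \<in> B"
    using assms(2) chart_inv_coord[OF assms(1), of p] by auto
next
  assume "z \<in> coord c ` chart_dom c \<and> chart_inv c z \<in> B"
  then show "z \<in> coord c ` B" using coord_chart_inv[of z c] by (metis imageI)
qed

lemma chart_image_open:
  assumes c: "chart_of X c" and "openin X V" shows "open (coord c ` (chart_dom c \<inter> V))"
proof -
  have "open_map (subtopology X (chart_dom c)) (top_of_set (coord c ` chart_dom c)) (coord c)"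
    using c unfolding chart_of_def by (blast intro: homeomorphic_imp_open_map)
  moreover have "openin (subtopology X (chart_dom c)) (chart_dom c \<inter> V)"
    using assms by (simp add: openin_subtopology_Int2)
  ultimately have "openin (top_of_set (coord c ` chart_dom c)) (coord c ` (chart_dom c \<inter> V))"
    by (auto simp: open_map_def)
  then show ?thesis using chart_open[OF c] by (rule openin_open_trans)
qed

lemma chart_preimage_open:
  assumes c: "chart_of X c" and "open W" shows "openin X {p \<in> chart_dom c. coord c p \<in> W}"
proof -
  have "continuous_map (subtopology X (chart_dom c)) (top_of_set (coord c ` chart_dom c)) (coord c)"
    using c unfolding chart_of_def by (blast intro: homeomorphic_imp_continuous_map)
  then have "continuous_map (subtopology X (chart_dom c)) euclidean (coord c)"
    by (simp add: continuous_map_in_subtopology)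
  from openin_continuous_map_preimage[OF this, of W]
  have "openin (subtopology X (chart_dom c)) {p \<in> chart_dom c. coord c p \<in> W}"
    using assms chart_subset[OF c] by (simp add: Int_absorb1)
  then show ?thesis using chart_openin[OF c] by (simp add: openin_open_subtopology)
qed

lemma chart_inv_continuous:
  assumes c: "chart_of X c" shows "continuous_map (top_of_set (coord c ` chart_dom c)) X (chart_inv c)"
  unfolding continuous_map_def
proof (intro conjI allI impI)
  show "chart_inv c \<in> topspace (top_of_set (coord c ` chart_dom c)) \<rightarrow> topspace X"
    using chart_inv_in[of _ c] chart_subset[OF c] by (simp add: Pi_iff subset_iff del: image_iff)
  fix V assume V: "openin X V"
  have "{x \<in> topspace (top_of_set (coord c ` chart_dom c)). chart_inv c x \<in> V} = coord c ` (chart_dom c \<inter> V)"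
    using coord_image_iff[OF c, of "chart_dom c \<inter> V"] chart_inv_in[of _ c] by (simp add: set_eq_iff del: image_iff) blast
  then show "openin (top_of_set (coord c ` chart_dom c)) {x \<in> topspace (top_of_set (coord c ` chart_dom c)). chart_inv c x \<in> V}"
    using chart_image_open[OF c V] by (simp add: open_subset image_mono)
qed

definition transition :: "'a chart \<Rightarrow> 'a chart \<Rightarrow> 'a \<Rightarrow> complex" where
  "transition c d p = deriv (coord d \<circ> chart_inv c) (coord c p)"

lemma transition_inj:
  assumes "chart_of X c" "chart_of X d"
  shows "inj_on (coord d \<circ> chart_inv c) (coord c ` (chart_dom c \<inter> chart_dom d))"
proof (rule inj_onI)
  fix x y assume "x \<in> coord c ` (chart_dom c \<inter> chart_dom d)" "y \<in> coord c ` (chart_dom c \<inter> chart_dom d)"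
    and eq: "(coord d \<circ> chart_inv c) x = (coord d \<circ> chart_inv c) y"
  then obtain p q where pq: "p \<in> chart_dom c" "p \<in> chart_dom d" "x = coord c p" "q \<in> chart_dom c" "q \<in> chart_dom d" "y = coord c q"
    by blast
  then have "coord d p = coord d q" using eq by (simp add: chart_inv_coord[OF assms(1)])
  then show "x = y" using inj_onD[OF chart_inj[OF assms(2)], of p q] pq by simp
qed

lemma transition_nonzero:
  assumes "chart_of X c" "chart_of X d" "p \<in> chart_dom c" "p \<in> chart_dom d"
    and "(coord d \<circ> chart_inv c) holomorphic_on coord c ` (chart_dom c \<inter> chart_dom d)"
  shows "transition c d p \<noteq> 0"
  unfolding transition_def
  by (rule holomorphic_injective_imp_regular[OF assms(5) _ transition_inj[OF assms(1,2)]])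
     (use assms chart_image_open[OF assms(1) chart_openin[OF assms(2)]] in auto)

lemma transition_has_derivative:
  assumes "chart_of X c" "chart_of X d" "p \<in> chart_dom c" "p \<in> chart_dom d"
    and "(coord d \<circ> chart_inv c) holomorphic_on coord c ` (chart_dom c \<inter> chart_dom d)"
  shows "((coord d \<circ> chart_inv c) has_field_derivative transition c d p) (at (coord c p))"
  unfolding transition_def
  by (rule holomorphic_derivI[OF assms(5) chart_image_open[OF assms(1) chart_openin[OF assms(2)]]]) (use assms in auto)

lemma transition_chain:
  assumes c: "chart_of X c" and d: "chart_of X d" and e: "chart_of X e"
    and p: "p \<in> chart_dom c" "p \<in> chart_dom d" "p \<in> chart_dom e"
    and cd: "(coord d \<circ> chart_inv c) holomorphic_on coord c ` (chart_dom c \<inter> chart_dom d)"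
    and de: "(coord e \<circ> chart_inv d) holomorphic_on coord d ` (chart_dom d \<inter> chart_dom e)"
  shows "transition c e p = transition d e p * transition c d p"
proof -
  have 1: "((coord d \<circ> chart_inv c) has_field_derivative transition c d p) (at (coord c p))"
    by (rule transition_has_derivative[OF c d p(1,2) cd])
  have 2: "((coord e \<circ> chart_inv d) has_field_derivative transition d e p) (at ((coord d \<circ> chart_inv c) (coord c p)))"
    using transition_has_derivative[OF d e p(2,3) de] chart_inv_coord[OF c p(1)] by simp
  have "((coord e \<circ> chart_inv d) \<circ> (coord d \<circ> chart_inv c) has_field_derivative transition d e p * transition c d p) (at (coord c p))"
    by (rule DERIV_chain[OF 2 1])
  then have "((coord e \<circ> chart_inv c) has_field_derivative transition d e p * transition c d p) (at (coord c p))"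
  proof (rule has_field_derivative_transform_within_open[OF _ chart_image_open[OF c chart_openin[OF d]]])
    show "coord c p \<in> coord c ` (chart_dom c \<inter> chart_dom d)" using p by auto
  qed (auto simp: chart_inv_coord[OF c] chart_inv_coord[OF d])
  then show ?thesis unfolding transition_def by (rule DERIV_imp_deriv)
qed

locale surface =
  fixes X :: "'a topology" and A :: "'a chart set"
  assumes surface: "riemann_surface X A"
begin

lemma chart: "c \<in> A \<Longrightarrow> chart_of X c"
  using surface unfolding riemann_surface_def by blast+

lemma holomorphic_transition:
  "c \<in> A \<Longrightarrow> d \<in> A \<Longrightarrow> (coord d \<circ> chart_inv c) holomorphic_on coord c ` (chart_dom c \<inter> chart_dom d)"
  using surface unfolding riemann_surface_def by blast+

lemma chart_cover: "p \<in> topspace X \<Longrightarrow> \<exists>c\<in>A. p \<in> chart_dom c"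
  using surface unfolding riemann_surface_def by blast+

lemma in_topspace: "c \<in> A \<Longrightarrow> p \<in> chart_dom c \<Longrightarrow> p \<in> topspace X"
  using chart chart_subset by blast

lemma connected: "connected_space X" and Hausdorff: "Hausdorff_space X" and nonempty: "topspace X \<noteq> {}"
  using surface unfolding riemann_surface_def by blast+

text \<open>The charts of the maximal atlas.\<close>

definition admissible :: "'a chart \<Rightarrow> bool" where
  "admissible c \<longleftrightarrow> chart_of X c \<and>
     (\<forall>d\<in>A. (coord c \<circ> chart_inv d) holomorphic_on coord d ` (chart_dom d \<inter> chart_dom c))"

lemma admissible_chart: "admissible c \<Longrightarrow> chart_of X c"
  by (simp add: admissible_def)

lemma admissible_atlas: "c \<in> A \<Longrightarrow> admissible c"
  unfolding admissible_def using chart holomorphic_transition by blast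

lemma form_transition:
  "holomorphic_form A \<alpha> \<Longrightarrow> c \<in> A \<Longrightarrow> d \<in> A \<Longrightarrow> p \<in> chart_dom c \<Longrightarrow> p \<in> chart_dom d \<Longrightarrow>
     \<alpha> c p = \<alpha> d p * transition c d p"
  unfolding holomorphic_form_def transition_def by blast

lemma form_holomorphic:
  "holomorphic_form A \<alpha> \<Longrightarrow> c \<in> A \<Longrightarrow> (\<lambda>z. \<alpha> c (chart_inv c z)) holomorphic_on coord c ` chart_dom c"
  unfolding holomorphic_form_def o_def by blast

text \<open>Propagation over a connected surface: the last hypothesis says that \<open>Z\<close>
  contains every point of its closure, so \<open>Z\<close> is open and closed.\<close>

lemma connected_induct:
  assumes Z: "openin X Z" "Z \<noteq> {}"
    and cl: "\<And>q. q \<in> topspace X \<Longrightarrow> (\<And>V. openin X V \<Longrightarrow> q \<in> V \<Longrightarrow> V \<inter> Z \<noteq> {}) \<Longrightarrow> q \<in> Z"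
  shows "Z = topspace X"
proof -
  have "closedin X Z"
    unfolding closedin_def
  proof
    show ZX: "Z \<subseteq> topspace X" using Z openin_subset by blast
    show "openin X (topspace X - Z)"
    proof (subst openin_subopen, intro ballI)
      fix q assume "q \<in> topspace X - Z"
      then obtain V where "openin X V" "q \<in> V" "V \<inter> Z = {}" using cl by blast
      then show "\<exists>T. openin X T \<and> q \<in> T \<and> T \<subseteq> topspace X - Z" using openin_subset by blast
    qed
  qed
  then show ?thesis using connected Z unfolding connected_space_clopen_in by blast
qed

end

section \<open>Integration on a Riemann surface\<close>

text \<open>The topology is a value on a carrier set rather than an instance on a type, so
  \<open>borel\<close> does not apply to it.\<close>

definition borel_space :: "'a topology \<Rightarrow> 'a measure" where
  "borel_space X = sigma (topspace X) {U. openin X U}"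

lemma space_borel_space [simp]: "space (borel_space X) = topspace X"
  unfolding borel_space_def by (rule space_measure_of) (auto dest: openin_subset)

lemma openin_borel_space: "openin X U \<Longrightarrow> U \<in> sets (borel_space X)"
  unfolding borel_space_def by (subst sets_measure_of) (auto dest: openin_subset)

lemma chart_borel_iff:
  assumes c: "chart_of X c" and B: "B \<subseteq> chart_dom c"
  shows "B \<in> sets (borel_space X) \<longleftrightarrow> coord c ` B \<in> sets borel"
proof
  let ?U = "coord c ` chart_dom c"
  have m: "chart_inv c \<in> measurable (restrict_space borel ?U) (borel_space X)"
    unfolding borel_space_def
  proof (rule measurable_measure_of)
    fix V assume "V \<in> {U. openin X U}"
    then have V: "openin X V" by simp
    have "chart_inv c -` V \<inter> space (restrict_space borel ?U) = coord c ` (chart_dom c \<inter> V)"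
      using coord_image_iff[OF c, of "chart_dom c \<inter> V"] chart_inv_in[of _ c] by (auto simp: space_restrict_space)
    then show "chart_inv c -` V \<inter> space (restrict_space borel ?U) \<in> sets (restrict_space borel ?U)"
      using chart_image_open[OF c V] chart_open[OF c] by (auto simp: sets_restrict_space_iff)
  next
    show "{U. openin X U} \<subseteq> Pow (topspace X)" by (auto dest: openin_subset)
    show "chart_inv c \<in> space (restrict_space borel ?U) \<rightarrow> topspace X"
      using chart_inv_in[of _ c] chart_subset[OF c] by (simp add: space_restrict_space Pi_iff subset_iff del: image_iff)
  qed
  have "chart_inv c -` B \<inter> space (restrict_space borel ?U) = coord c ` B"
    using coord_image_iff[OF c B] by (auto simp: space_restrict_space)
  then show "coord c ` B \<in> sets borel" if "B \<in> sets (borel_space X)"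
    using measurable_sets[OF m that] chart_open[OF c] by (simp add: sets_restrict_space_iff)
next
  assume im: "coord c ` B \<in> sets borel"
  have dom: "chart_dom c \<in> sets (borel_space X)" using chart_openin[OF c] by (rule openin_borel_space)
  have "coord c \<in> borel_measurable (restrict_space (borel_space X) (chart_dom c))"
  proof (rule borel_measurableI)
    fix W :: "complex set" assume "open W"
    moreover have "coord c -` W \<inter> space (restrict_space (borel_space X) (chart_dom c)) = {p \<in> chart_dom c. coord c p \<in> W}"
      using chart_subset[OF c] by (auto simp: space_restrict_space)
    ultimately show "coord c -` W \<inter> space (restrict_space (borel_space X) (chart_dom c)) \<in> sets (restrict_space (borel_space X) (chart_dom c))"
      using chart_preimage_open[OF c] dom chart_subset[OF c]
      by (auto simp: sets_restrict_space_iff Int_absorb2 intro!: openin_borel_space)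
  qed
  from measurable_sets[OF this im]
  have "coord c -` (coord c ` B) \<inter> chart_dom c \<in> sets (borel_space X)"
    using dom chart_subset[OF c] by (simp add: sets_restrict_space_iff space_restrict_space Int_absorb1 Int_absorb2)
  moreover have "coord c -` (coord c ` B) \<inter> chart_dom c = B"
    using B chart_inj[OF c] by (auto simp: inj_on_def)
  ultimately show "B \<in> sets (borel_space X)" by simp
qed

section \<open>The measure glued from a partition\<close>

locale partitioned_surface = surface +
  fixes S :: "nat \<Rightarrow> 'a set" and P :: "nat \<Rightarrow> 'a chart"
  assumes partition: "borel_partition X A S P"
begin

lemma P_atlas: "P n \<in> A" and S_dom: "S n \<subseteq> chart_dom (P n)" and S_image_borel: "coord (P n) ` S n \<in> sets borel"
  and S_disjoint: "disjoint_family S" and S_cover: "(\<Union>n. S n) = topspace X"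
  using partition unfolding borel_partition_def by blast+

lemma P_chart: "chart_of X (P n)"
  by (rule chart[OF P_atlas])

lemma S_borel: "S n \<in> sets (borel_space X)"
  using chart_borel_iff[OF P_chart S_dom] S_image_borel by simp

definition piece :: "'a \<Rightarrow> nat" where "piece x = (THE n. x \<in> S n)"

lemma piece_eq: "x \<in> S n \<Longrightarrow> piece x = n"
  unfolding piece_def using S_disjoint unfolding disjoint_family_on_def by (intro the_equality) blast+

lemma piece_dom: "x \<in> topspace X \<Longrightarrow> x \<in> S (piece x) \<and> x \<in> chart_dom (P (piece x))"
  using piece_eq S_cover S_dom by blast

definition pieces :: "(nat \<times> complex) set" where
  "pieces = (SIGMA n:UNIV. coord (P n) ` S n)"

definition glue :: "nat \<times> complex \<Rightarrow> 'a" where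
  "glue = (\<lambda>(n, z). chart_inv (P n) z)"

text \<open>Lebesgue measure of the coordinate \<open>P n\<close> on each piece \<open>S n\<close>.
  It depends on the partition; integrands built from forms compensate for this, since their
  coefficient is taken in the chart of the piece.\<close>

definition \<mu> :: "'a measure" where
  "\<mu> = distr (restrict_space (count_space UNIV \<Otimes>\<^sub>M lborel) pieces) (borel_space X) glue"

lemma sets_mu [simp]: "sets \<mu> = sets (borel_space X)" and space_mu [simp]: "space \<mu> = topspace X"
  by (simp_all add: \<mu>_def)

lemma pieces_sets: "pieces \<in> sets (count_space UNIV \<Otimes>\<^sub>M lborel)"
proof -
  have "pieces = (\<Union>n. {n} \<times> coord (P n) ` S n)" by (auto simp: pieces_def)
  also have "\<dots> \<in> sets (count_space UNIV \<Otimes>\<^sub>M lborel)"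
    by (intro sets.countable_UN' pair_measureI) (use S_image_borel in auto)
  finally show ?thesis .
qed

lemma measurable_glue: "glue \<in> measurable (restrict_space (count_space UNIV \<Otimes>\<^sub>M lborel) pieces) (borel_space X)"
proof -
  let ?N = "count_space (UNIV :: nat set) \<Otimes>\<^sub>M (lborel :: complex measure)"
  have sp: "space (restrict_space ?N pieces) = pieces" by (simp add: space_restrict_space space_pair_measure)
  have 1: "glue x \<in> topspace X" if x: "x \<in> pieces" for x
  proof -
    obtain n p where p: "p \<in> S n" "x = (n, coord (P n) p)" using x by (auto simp: pieces_def)
    then have "glue x = p" using S_dom chart_inv_coord[OF P_chart] by (auto simp: glue_def)
    then show ?thesis using p S_cover by blast
  qed
  have 2: "glue -` B \<inter> pieces \<in> sets ?N" if B: "B \<in> sets (borel_space X)" for B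
  proof -
    have "x \<in> glue -` B \<inter> pieces \<longleftrightarrow> x \<in> (\<Union>n. {n} \<times> coord (P n) ` (S n \<inter> B))" for x
    proof -
      obtain n z where x: "x = (n, z)" by fastforce
      have "z \<in> coord (P n) ` S n \<and> chart_inv (P n) z \<in> B \<longleftrightarrow> z \<in> coord (P n) ` (S n \<inter> B)"
        using coord_image_iff[OF P_chart S_dom, of z n] coord_image_iff[OF P_chart, of "S n \<inter> B" n z] S_dom[of n] by blast
      then show ?thesis by (auto simp: x pieces_def glue_def)
    qed
    then have "glue -` B \<inter> pieces = (\<Union>n. {n} \<times> coord (P n) ` (S n \<inter> B))" by blast
    also have "\<dots> \<in> sets ?N"
    proof -
      have "coord (P n) ` (S n \<inter> B) \<in> sets borel" for n
        using chart_borel_iff[OF P_chart, of "S n \<inter> B" n] S_dom[of n] S_borel[of n] B by auto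
      then show ?thesis by (intro sets.countable_UN' pair_measureI) auto
    qed
    finally show ?thesis .
  qed
  show ?thesis
    by (rule measurableI) (use 1 2 pieces_sets in \<open>auto simp: sp sets_restrict_space_iff\<close>)
qed

lemma nn_integral_mu:
  assumes h: "h \<in> borel_measurable \<mu>"
  shows "(\<integral>\<^sup>+x. h x \<partial>\<mu>) = (\<Sum>n. \<integral>\<^sup>+z\<in>coord (P n) ` S n. h (chart_inv (P n) z) \<partial>lborel)"
proof -
  let ?N = "count_space (UNIV :: nat set) \<Otimes>\<^sub>M (lborel :: complex measure)"
  have h': "h \<in> borel_measurable (borel_space X)" using h by (simp add: measurable_def)
  have hg: "(\<lambda>y. h (glue y)) \<in> borel_measurable (restrict_space ?N pieces)"
    using measurable_compose[OF measurable_glue h'] .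
  have m: "(\<lambda>y. h (glue y) * indicator pieces y) \<in> borel_measurable ?N"
    using hg borel_measurable_restrict_space_iff_ennreal[of pieces ?N "\<lambda>y. h (glue y)"] pieces_sets by simp
  have "(\<integral>\<^sup>+x. h x \<partial>\<mu>) = (\<integral>\<^sup>+y. h (glue y) \<partial>restrict_space ?N pieces)"
    using h unfolding \<mu>_def by (rule nn_integral_distr[OF measurable_glue])
  also have "\<dots> = (\<integral>\<^sup>+y. h (glue y) * indicator pieces y \<partial>?N)"
    by (rule nn_integral_restrict_space) (use pieces_sets in auto)
  also have "\<dots> = (\<integral>\<^sup>+n. \<integral>\<^sup>+z. h (glue (n, z)) * indicator pieces (n, z) \<partial>lborel \<partial>count_space UNIV)"
    by (rule lborel.nn_integral_fst[OF m, symmetric])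
  also have "\<dots> = (\<Sum>n. \<integral>\<^sup>+z\<in>coord (P n) ` S n. h (chart_inv (P n) z) \<partial>lborel)"
    unfolding nn_integral_count_space_nat
    by (intro suminf_cong nn_integral_cong) (auto simp: glue_def pieces_def indicator_def)
  finally show ?thesis .
qed

lemma coord_measurable: "coord (P n) \<in> measurable (restrict_space \<mu> (S n)) (restrict_space borel (coord (P n) ` S n))"
proof (rule measurable_restrict_space2)
  show "coord (P n) \<in> space (restrict_space \<mu> (S n)) \<rightarrow> coord (P n) ` S n"
    by (auto simp: space_restrict_space)
  show "coord (P n) \<in> borel_measurable (restrict_space \<mu> (S n))"
  proof (rule measurableI)
    fix W :: "complex set" assume W: "W \<in> sets borel"
    define B where "B = coord (P n) -` W \<inter> S n"
    have "coord (P n) ` B = W \<inter> coord (P n) ` S n" by (auto simp: B_def)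
    then have "B \<in> sets (borel_space X)"
      using chart_borel_iff[OF P_chart, of B n] S_dom[of n] W S_image_borel by (auto simp: B_def)
    moreover have "coord (P n) -` W \<inter> space (restrict_space \<mu> (S n)) = B"
      using S_dom[of n] chart_subset[OF P_chart] by (auto simp: B_def space_restrict_space)
    ultimately show "coord (P n) -` W \<inter> space (restrict_space \<mu> (S n)) \<in> sets (restrict_space \<mu> (S n))"
      using S_borel[of n] sets.sets_into_space[OF S_borel[of n]] by (auto simp: sets_restrict_space_iff B_def Int_absorb2)
  qed auto
qed

lemma measurable_mu:
  assumes "\<And>n. (\<lambda>z. f (chart_inv (P n) z)) \<in> measurable (restrict_space borel (coord (P n) ` S n)) N"
  shows "f \<in> measurable \<mu> N"
proof (rule measurable_piecewise_restrict[of "range S"])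
  fix \<Omega> assume "\<Omega> \<in> range S"
  then obtain n where n: "\<Omega> = S n" by auto
  show "\<Omega> \<inter> space \<mu> \<in> sets \<mu>" using S_borel[of n] n sets.sets_into_space[OF S_borel[of n]] by (auto simp: Int_absorb2)
  have "(\<lambda>x. f (chart_inv (P n) (coord (P n) x))) \<in> measurable (restrict_space \<mu> (S n)) N"
    by (rule measurable_compose[OF coord_measurable assms])
  also have "(\<lambda>x. f (chart_inv (P n) (coord (P n) x))) \<in> measurable (restrict_space \<mu> (S n)) N \<longleftrightarrow> f \<in> measurable (restrict_space \<mu> (S n)) N"
    by (rule measurable_cong) (use S_dom[of n] chart_inv_coord[OF P_chart] in \<open>auto simp: space_restrict_space\<close>)
  finally show "f \<in> measurable (restrict_space \<mu> \<Omega>) N" unfolding n .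
qed (use S_cover in auto)

text \<open>On the domain of \<open>c\<close>, the density with respect to \<open>\<mu>\<close> of
  Lebesgue measure in the coordinate of \<open>c\<close>.\<close>

definition jac :: "'a chart \<Rightarrow> 'a \<Rightarrow> real" where
  "jac c x = (norm (transition (P (piece x)) c x))\<^sup>2"

lemma jac_nonneg: "0 \<le> jac c x" by (simp add: jac_def)

lemma admissible_piece:
  assumes "admissible c"
  shows "(coord c \<circ> chart_inv (P n)) holomorphic_on coord (P n) ` (chart_dom (P n) \<inter> chart_dom c)"
    "open (coord (P n) ` (chart_dom (P n) \<inter> chart_dom c))"
proof -
  show "(coord c \<circ> chart_inv (P n)) holomorphic_on coord (P n) ` (chart_dom (P n) \<inter> chart_dom c)"
    using assms P_atlas unfolding admissible_def by blast
  show "open (coord (P n) ` (chart_dom (P n) \<inter> chart_dom c))"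
    by (rule chart_image_open[OF P_chart chart_openin[OF admissible_chart[OF assms]]])
qed

lemma jac_chart_inv:
  assumes "z \<in> coord (P n) ` S n"
  shows "jac c (chart_inv (P n) z) = (norm (deriv (coord c \<circ> chart_inv (P n)) z))\<^sup>2"
proof -
  have z: "chart_inv (P n) z \<in> S n" "coord (P n) (chart_inv (P n) z) = z"
    using assms coord_image_iff[OF P_chart S_dom, of z n] coord_chart_inv[of z "P n"] by auto
  show ?thesis unfolding jac_def piece_eq[OF z(1)] transition_def z(2) ..
qed

lemma measurable_jac:
  assumes c: "admissible c" shows "(\<lambda>x. indicator (chart_dom c) x * jac c x) \<in> borel_measurable \<mu>"
proof (rule measurable_mu)
  fix n
  define V where "V = coord (P n) ` (chart_dom (P n) \<inter> chart_dom c)"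
  have V: "(coord c \<circ> chart_inv (P n)) holomorphic_on V" "open V"
    using admissible_piece[OF c] by (auto simp: V_def)
  have "(\<lambda>z. indicator V z *\<^sub>R (norm (deriv (coord c \<circ> chart_inv (P n)) z))\<^sup>2) \<in> borel_measurable borel"
    using V holomorphic_on_imp_continuous_on[OF holomorphic_deriv[OF V]]
    by (intro borel_measurable_continuous_on_indicator continuous_intros) auto
  then have "(\<lambda>z. indicator V z *\<^sub>R (norm (deriv (coord c \<circ> chart_inv (P n)) z))\<^sup>2) \<in> borel_measurable (restrict_space borel (coord (P n) ` S n))"
    by (rule measurable_restrict_space1)
  then show "(\<lambda>z. indicator (chart_dom c) (chart_inv (P n) z) * jac c (chart_inv (P n) z)) \<in> borel_measurable (restrict_space borel (coord (P n) ` S n))"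
  proof (subst (asm) measurable_cong)
    fix z assume "z \<in> space (restrict_space borel (coord (P n) ` S n))"
    then have z: "z \<in> coord (P n) ` S n" by (simp add: space_restrict_space)
    moreover have "z \<in> V \<longleftrightarrow> chart_inv (P n) z \<in> chart_dom c"
      using z S_dom[of n] coord_image_iff[OF P_chart, of "chart_dom (P n) \<inter> chart_dom c" n z] chart_inv_in[of z "P n"] by (auto simp: V_def)
    ultimately show "indicator V z *\<^sub>R (norm (deriv (coord c \<circ> chart_inv (P n)) z))\<^sup>2 = indicator (chart_dom c) (chart_inv (P n) z) * jac c (chart_inv (P n) z)"
      by (auto simp: jac_chart_inv indicator_def)
  qed
qed

lemma measurable_jac_subset:
  assumes c: "admissible c" and B: "B \<in> sets (borel_space X)" "B \<subseteq> chart_dom c"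
  shows "(\<lambda>x. indicator B x * jac c x) \<in> borel_measurable \<mu>"
proof -
  have "(\<lambda>x. indicator B x * (indicator (chart_dom c) x * jac c x)) \<in> borel_measurable \<mu>"
    by (intro borel_measurable_times borel_measurable_indicator measurable_jac[OF c]) (use B in simp)
  moreover have "(\<lambda>x. indicator B x * (indicator (chart_dom c) x * jac c x)) = (\<lambda>x. indicator B x * jac c x)"
    using B(2) by (auto simp: indicator_def fun_eq_iff)
  ultimately show ?thesis by (simp only:)
qed

text \<open>Piece by piece this is the area formula for the change of coordinates from
  \<open>P n\<close> to \<open>c\<close>.\<close>

lemma emeasure_chart_image:
  assumes c: "admissible c" and B: "B \<in> sets (borel_space X)" "B \<subseteq> chart_dom c"
  shows "emeasure lborel (coord c ` B) = (\<integral>\<^sup>+x. ennreal (indicator B x * jac c x) \<partial>\<mu>)"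
proof -
  have cc: "chart_of X c" using c by (rule admissible_chart)
  have "(\<integral>\<^sup>+x. ennreal (indicator B x * jac c x) \<partial>\<mu>) =
    (\<Sum>n. \<integral>\<^sup>+z\<in>coord (P n) ` S n. ennreal (indicator B (chart_inv (P n) z) * jac c (chart_inv (P n) z)) \<partial>lborel)"
    using measurable_jac_subset[OF assms] by (intro nn_integral_mu) simp
  also have "\<dots> = (\<Sum>n. emeasure lborel (coord c ` (S n \<inter> B)))"
  proof (intro suminf_cong)
    fix n
    let ?f = "coord c \<circ> chart_inv (P n)"
    let ?E = "coord (P n) ` (S n \<inter> B)"
    have "coord c ` (S n \<inter> B) = ?f ` ?E"
      using chart_inv_coord[OF P_chart] S_dom[of n] by (force simp: image_image)
    also have "emeasure lborel (?f ` ?E) = (\<integral>\<^sup>+z\<in>?E. ennreal ((norm (deriv ?f z))\<^sup>2) \<partial>lborel)"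
    proof (rule holomorphic_emeasure_image[OF admissible_piece[OF c, of n] transition_inj[OF P_chart cc]])
      show "?E \<subseteq> coord (P n) ` (chart_dom (P n) \<inter> chart_dom c)" using S_dom B by blast
      show "?E \<in> sets borel" using chart_borel_iff[OF P_chart, of "S n \<inter> B" n] S_dom[of n] S_borel[of n] B by auto
    qed
    also have "\<dots> = (\<integral>\<^sup>+z\<in>coord (P n) ` S n. ennreal (indicator B (chart_inv (P n) z) * jac c (chart_inv (P n) z)) \<partial>lborel)"
    proof (intro nn_integral_cong)
      fix z
      have "z \<in> ?E \<longleftrightarrow> z \<in> coord (P n) ` S n \<and> chart_inv (P n) z \<in> B"
        using coord_image_iff[OF P_chart, of "S n \<inter> B" n z] coord_image_iff[OF P_chart S_dom, of z n] S_dom[of n] by auto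
      then show "ennreal ((norm (deriv ?f z))\<^sup>2) * indicator ?E z =
        ennreal (indicator B (chart_inv (P n) z) * jac c (chart_inv (P n) z)) * indicator (coord (P n) ` S n) z"
        using jac_chart_inv[of z n c] by (auto simp: indicator_def)
    qed
    finally show "(\<integral>\<^sup>+z\<in>coord (P n) ` S n. ennreal (indicator B (chart_inv (P n) z) * jac c (chart_inv (P n) z)) \<partial>lborel)
        = emeasure lborel (coord c ` (S n \<inter> B))" by simp
  qed
  also have "\<dots> = emeasure lborel (\<Union>n. coord c ` (S n \<inter> B))"
  proof (rule suminf_emeasure)
    show "range (\<lambda>n. coord c ` (S n \<inter> B)) \<subseteq> sets lborel"
    proof -
      have "coord c ` (S n \<inter> B) \<in> sets borel" for n
        using chart_borel_iff[OF cc, of "S n \<inter> B"] S_borel[of n] B by auto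
      then show ?thesis by auto
    qed
    show "disjoint_family (\<lambda>n. coord c ` (S n \<inter> B))"
      using S_disjoint chart_inj[OF cc] B(2) unfolding disjoint_family_on_def inj_on_def by (auto; metis IntI empty_iff subsetD)
  qed
  also have "(\<Union>n. coord c ` (S n \<inter> B)) = coord c ` B"
  proof -
    have "(\<Union>n. S n \<inter> B) = B" using S_cover sets.sets_into_space[OF B(1)] by auto
    then show ?thesis by (metis image_UN)
  qed
  finally show ?thesis by simp
qed

text \<open>The formula for areas as an equality of measures, from which integrability and integrals
  in a chart follow together. The value \<open>0\<close> outside \<open>B\<close> makes
  \<open>g\<close> measurable on the whole surface.\<close>

lemma chart_density:
  assumes c: "admissible c" and B: "B \<in> sets (borel_space X)" "B \<subseteq> chart_dom c"
  defines "g \<equiv> \<lambda>x. if x \<in> B then coord c x else 0"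
  shows "g \<in> borel_measurable \<mu>"
    "density lborel (\<lambda>z. ennreal (indicator (coord c ` B) z)) = distr (density \<mu> (\<lambda>x. ennreal (indicator B x * jac c x))) borel g"
proof -
  have cc: "chart_of X c" using c by (rule admissible_chart)
  have cB: "coord c ` B \<in> sets borel" using chart_borel_iff[OF cc B(2)] B by simp
  have sub: "{x \<in> B. coord c x \<in> W} \<in> sets (borel_space X)" if "W \<in> sets borel" for W
  proof -
    have "coord c ` {x \<in> B. coord c x \<in> W} = coord c ` B \<inter> W" by auto
    then show ?thesis using chart_borel_iff[OF cc, of "{x \<in> B. coord c x \<in> W}"] B cB that by auto
  qed
  show gm: "g \<in> borel_measurable \<mu>"
  proof (rule measurableI)
    fix W :: "complex set" assume W: "W \<in> sets borel"
    have "g -` W \<inter> space \<mu> = {x \<in> B. coord c x \<in> W} \<union> (if 0 \<in> W then space \<mu> - B else {})"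
      using sets.sets_into_space[OF B(1)] by (auto simp: g_def split: if_splits)
    also have "\<dots> \<in> sets \<mu>" using sub[OF W] sets.compl_sets[OF B(1)] by auto
    finally show "g -` W \<inter> space \<mu> \<in> sets \<mu>" .
  qed auto
  show "density lborel (\<lambda>z. ennreal (indicator (coord c ` B) z)) = distr (density \<mu> (\<lambda>x. ennreal (indicator B x * jac c x))) borel g"
  proof (rule measure_eqI)
    fix W :: "complex set" assume "W \<in> sets (density lborel (\<lambda>z. ennreal (indicator (coord c ` B) z)))"
    then have W: "W \<in> sets borel" by simp
    define B' where "B' = {x \<in> B. coord c x \<in> W}"
    have B': "B' \<in> sets (borel_space X)" "B' \<subseteq> chart_dom c" using sub[OF W] B by (auto simp: B'_def)
    have "emeasure (density lborel (\<lambda>z. ennreal (indicator (coord c ` B) z))) W = (\<integral>\<^sup>+z. ennreal (indicator (coord c ` B) z) * indicator W z \<partial>lborel)"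
      using W cB by (subst emeasure_density) auto
    also have "\<dots> = (\<integral>\<^sup>+z. indicator (coord c ` B') z \<partial>lborel)"
      by (intro nn_integral_cong) (auto simp: indicator_def B'_def)
    also have "\<dots> = emeasure lborel (coord c ` B')"
      using chart_borel_iff[OF cc B'(2)] B' by (intro nn_integral_indicator) simp
    also have "\<dots> = (\<integral>\<^sup>+x. ennreal (indicator B' x * jac c x) \<partial>\<mu>)"
      by (rule emeasure_chart_image[OF c B'])
    also have "\<dots> = (\<integral>\<^sup>+x. ennreal (indicator B x * jac c x) * indicator (g -` W \<inter> space \<mu>) x \<partial>\<mu>)"
      using sets.sets_into_space[OF B(1)] by (intro nn_integral_cong) (auto simp: indicator_def B'_def g_def)
    also have "\<dots> = emeasure (density \<mu> (\<lambda>x. ennreal (indicator B x * jac c x))) (g -` W \<inter> space \<mu>)"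
      using measurable_jac_subset[OF c B] measurable_sets[OF gm W] by (subst emeasure_density) auto
    also have "\<dots> = emeasure (distr (density \<mu> (\<lambda>x. ennreal (indicator B x * jac c x))) borel g) W"
      using W gm by (subst emeasure_distr) auto
    finally show "emeasure (density lborel (\<lambda>z. ennreal (indicator (coord c ` B) z))) W = \<dots>" .
  qed simp
qed

lemma chart_integral:
  fixes h :: "complex \<Rightarrow> 'b :: {banach, second_countable_topology}"
  assumes c: "admissible c" and B: "B \<in> sets (borel_space X)" "B \<subseteq> chart_dom c"
    and h: "set_borel_measurable lborel (coord c ` B) h"
  shows "set_integrable lborel (coord c ` B) h \<longleftrightarrow> set_integrable \<mu> B (\<lambda>x. jac c x *\<^sub>R h (coord c x))"
    and "(LINT z:coord c ` B|lborel. h z) = (LINT x:B|\<mu>. jac c x *\<^sub>R h (coord c x))"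
proof -
  define g where "g = (\<lambda>x. if x \<in> B then coord c x else 0)"
  define h' where "h' z = indicator (coord c ` B) z *\<^sub>R h z" for z
  have cB: "coord c ` B \<in> sets borel" using chart_borel_iff[OF admissible_chart[OF c] B(2)] B by simp
  have h': "h' \<in> borel_measurable borel" using h by (simp add: set_borel_measurable_def h'_def[abs_def])
  note g = chart_density[OF c B, folded g_def]
  have jm: "(\<lambda>x. indicator B x * jac c x) \<in> borel_measurable \<mu>" by (rule measurable_jac_subset[OF c B])
  have gm: "g \<in> measurable (density \<mu> (\<lambda>x. ennreal (indicator B x * jac c x))) borel" using g(1) by simp
  have hg: "(\<lambda>x. h' (g x)) \<in> borel_measurable \<mu>" by (rule measurable_compose[OF g(1) h'])
  have e1: "indicator (coord c ` B) z *\<^sub>R h' z = indicator (coord c ` B) z *\<^sub>R h z" for z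
    by (auto simp: h'_def indicator_def)
  have e2: "(indicator B x * jac c x) *\<^sub>R h' (g x) = indicator B x *\<^sub>R (jac c x *\<^sub>R h (coord c x))" for x
    by (auto simp: h'_def indicator_def g_def)
  have hl: "h' \<in> borel_measurable lborel" using h' by simp
  have il: "(\<lambda>z. indicator (coord c ` B) z :: real) \<in> borel_measurable lborel" using cB by simp
  show "set_integrable lborel (coord c ` B) h \<longleftrightarrow> set_integrable \<mu> B (\<lambda>x. jac c x *\<^sub>R h (coord c x))"
    using integrable_density[OF hl il] integrable_distr_eq[OF gm h'] integrable_density[OF hg jm] g(2)
    by (auto simp: set_integrable_def e1 e2 jac_nonneg)
  show "(LINT z:coord c ` B|lborel. h z) = (LINT x:B|\<mu>. jac c x *\<^sub>R h (coord c x))"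
    using integral_density[OF hl il] integral_distr[OF gm h'] integral_density[OF hg jm] g(2)
    by (auto simp: set_lebesgue_integral_def e1 e2 jac_nonneg)
qed

end

section \<open>Orthonormal bases in spaces with a semi-definite inner product\<close>

text \<open>A form also has values at charts outside the atlas and at points outside the domain of a
  chart, which no integral sees. Norm zero therefore does not mean equality, and the product is only
  semi-definite.\<close>

locale semi_hilbert =
  fixes V :: "('c \<Rightarrow> 'p \<Rightarrow> complex) set" and ip :: "('c \<Rightarrow> 'p \<Rightarrow> complex) \<Rightarrow> ('c \<Rightarrow> 'p \<Rightarrow> complex) \<Rightarrow> complex"
  assumes zero: "(\<lambda>c p. 0) \<in> V"
    and comb: "\<alpha> \<in> V \<Longrightarrow> \<beta> \<in> V \<Longrightarrow> (\<lambda>c p. u * \<alpha> c p + v * \<beta> c p) \<in> V"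
    and linear: "\<alpha> \<in> V \<Longrightarrow> \<beta> \<in> V \<Longrightarrow> \<gamma> \<in> V \<Longrightarrow> ip (\<lambda>c p. u * \<alpha> c p + v * \<beta> c p) \<gamma> = u * ip \<alpha> \<gamma> + v * ip \<beta> \<gamma>"
    and hermitian: "\<alpha> \<in> V \<Longrightarrow> \<beta> \<in> V \<Longrightarrow> ip \<alpha> \<beta> = cnj (ip \<beta> \<alpha>)"
    and nonneg: "\<alpha> \<in> V \<Longrightarrow> 0 \<le> Re (ip \<alpha> \<alpha>)"
begin

definition sqn :: "('c \<Rightarrow> 'p \<Rightarrow> complex) \<Rightarrow> real" where "sqn \<alpha> = Re (ip \<alpha> \<alpha>)"

definition orthonormal :: "('c \<Rightarrow> 'p \<Rightarrow> complex) set \<Rightarrow> bool" where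
  "orthonormal E \<longleftrightarrow> E \<subseteq> V \<and> (\<forall>e\<in>E. \<forall>f\<in>E. ip e f = (if e = f then 1 else 0))"

abbreviation lsum :: "('c \<Rightarrow> 'p \<Rightarrow> complex) set \<Rightarrow> (('c \<Rightarrow> 'p \<Rightarrow> complex) \<Rightarrow> complex) \<Rightarrow> 'c \<Rightarrow> 'p \<Rightarrow> complex" where
  "lsum F u \<equiv> \<lambda>c p. \<Sum>e\<in>F. u e * e c p"

lemma ip_self: "\<alpha> \<in> V \<Longrightarrow> ip \<alpha> \<alpha> = of_real (sqn \<alpha>)"
proof -
  assume "\<alpha> \<in> V"
  then have "Im (ip \<alpha> \<alpha>) = Im (cnj (ip \<alpha> \<alpha>))" by (intro arg_cong[of _ _ Im] hermitian)
  then show ?thesis by (simp add: sqn_def complex_eq_iff)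
qed

lemma diff_in: "\<alpha> \<in> V \<Longrightarrow> \<beta> \<in> V \<Longrightarrow> (\<lambda>c p. \<alpha> c p - \<beta> c p) \<in> V"
  using comb[of \<alpha> \<beta> 1 "-1"] by simp

lemma linear2:
  assumes "\<alpha> \<in> V" "\<beta> \<in> V" "\<gamma> \<in> V"
  shows "ip \<gamma> (\<lambda>c p. u * \<alpha> c p + v * \<beta> c p) = cnj u * ip \<gamma> \<alpha> + cnj v * ip \<gamma> \<beta>"
proof -
  have "ip \<gamma> (\<lambda>c p. u * \<alpha> c p + v * \<beta> c p) = cnj (u * ip \<alpha> \<gamma> + v * ip \<beta> \<gamma>)"
    unfolding linear[OF assms, symmetric] by (rule hermitian[OF assms(3) comb[OF assms(1,2)]])
  then show ?thesis using hermitian[OF assms(3,1), symmetric] hermitian[OF assms(3,2), symmetric] by simp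
qed

lemma ip_diff:
  assumes "\<alpha> \<in> V" "\<beta> \<in> V" "\<gamma> \<in> V"
  shows "ip (\<lambda>c p. \<alpha> c p - \<beta> c p) \<gamma> = ip \<alpha> \<gamma> - ip \<beta> \<gamma>" "ip \<gamma> (\<lambda>c p. \<alpha> c p - \<beta> c p) = ip \<gamma> \<alpha> - ip \<gamma> \<beta>"
proof -
  show "ip (\<lambda>c p. \<alpha> c p - \<beta> c p) \<gamma> = ip \<alpha> \<gamma> - ip \<beta> \<gamma>" using linear[OF assms, of 1 "-1"] by simp
  show "ip \<gamma> (\<lambda>c p. \<alpha> c p - \<beta> c p) = ip \<gamma> \<alpha> - ip \<gamma> \<beta>" using linear2[OF assms, of 1 "-1"] by simp
qed

text \<open>The parallelogram law, with the norm of the difference dropped.\<close>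

lemma sqn_add_le:
  assumes "\<alpha> \<in> V" "\<beta> \<in> V"
  shows "sqn (\<lambda>c p. \<alpha> c p + \<beta> c p) \<le> 2 * sqn \<alpha> + 2 * sqn \<beta>"
proof -
  have s: "(\<lambda>c p. \<alpha> c p + \<beta> c p) \<in> V" using comb[OF assms, of 1 1] by simp
  have p: "ip (\<lambda>c p. \<alpha> c p + \<beta> c p) (\<lambda>c p. \<alpha> c p + \<beta> c p) = ip \<alpha> \<alpha> + ip \<alpha> \<beta> + (ip \<beta> \<alpha> + ip \<beta> \<beta>)"
    using linear[OF assms s, of 1 1] linear2[OF assms assms(1), of 1 1] linear2[OF assms assms(2), of 1 1] by simp
  have m: "ip (\<lambda>c p. \<alpha> c p - \<beta> c p) (\<lambda>c p. \<alpha> c p - \<beta> c p) = ip \<alpha> \<alpha> - ip \<alpha> \<beta> - (ip \<beta> \<alpha> - ip \<beta> \<beta>)"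
    using ip_diff(1)[OF assms diff_in[OF assms]] ip_diff(2)[OF assms assms(1)] ip_diff(2)[OF assms assms(2)] by simp
  have "0 \<le> Re (ip (\<lambda>c p. \<alpha> c p - \<beta> c p) (\<lambda>c p. \<alpha> c p - \<beta> c p))" by (rule nonneg[OF diff_in[OF assms]])
  then show ?thesis unfolding sqn_def p m by simp
qed

lemma lsum_in:
  assumes "finite F" "F \<subseteq> V" shows "lsum F u \<in> V"
  using assms
proof (induction F rule: finite_induct)
  case (insert e F)
  then have "(\<lambda>c p. u e * e c p + 1 * lsum F u c p) \<in> V" by (intro comb) auto
  then show ?case using insert by simp
qed (simp add: zero)

lemma ip_zero: "\<gamma> \<in> V \<Longrightarrow> ip (\<lambda>c p. 0) \<gamma> = 0"
  using linear[OF zero zero, of \<gamma> 0 0] by simp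

lemma ip_lsum:
  assumes "finite F" "F \<subseteq> V" "\<gamma> \<in> V" shows "ip (lsum F u) \<gamma> = (\<Sum>e\<in>F. u e * ip e \<gamma>)"
  using assms
proof (induction F rule: finite_induct)
  case (insert e F)
  then have "ip (\<lambda>c p. u e * e c p + 1 * lsum F u c p) \<gamma> = u e * ip e \<gamma> + 1 * ip (lsum F u) \<gamma>"
    by (intro linear lsum_in) auto
  then show ?case using insert by simp
qed (simp add: ip_zero)

lemma ip_lsum_orthonormal:
  assumes E: "orthonormal E" and F: "finite F" "F \<subseteq> E" and e: "e \<in> E"
  shows "ip (lsum F u) e = (if e \<in> F then u e else 0)"
proof -
  have "ip (lsum F u) e = (\<Sum>f\<in>F. u f * ip f e)" by (rule ip_lsum) (use E F e in \<open>auto simp: orthonormal_def\<close>)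
  also have "\<dots> = (\<Sum>f\<in>F. if f = e then u f else 0)"
    by (rule sum.cong) (use E F e in \<open>auto simp: orthonormal_def subset_iff\<close>)
  also have "\<dots> = (if e \<in> F then u e else 0)" using F by simp
  finally show ?thesis .
qed

text \<open>Pythagoras' theorem for an arbitrary combination: the last sum measures the deviation
  from the best approximation, whose coefficients are \<open>ip \<alpha> e\<close>. Bessel's
  inequality, Parseval's identity and the Cauchy property of Fourier sums are all read off from
  it.\<close>

lemma sqn_diff_lsum:
  assumes E: "orthonormal E" and F: "finite F" "F \<subseteq> E" and \<alpha>: "\<alpha> \<in> V"
  shows "sqn (\<lambda>c p. \<alpha> c p - lsum F u c p) = sqn \<alpha> - (\<Sum>e\<in>F. (norm (ip \<alpha> e))\<^sup>2) + (\<Sum>e\<in>F. (norm (u e - ip \<alpha> e))\<^sup>2)"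
proof -
  have FV: "F \<subseteq> V" using E F by (auto simp: orthonormal_def)
  let ?s = "lsum F u"
  have s: "?s \<in> V" by (rule lsum_in[OF F(1) FV])
  have a: "ip \<alpha> ?s = (\<Sum>e\<in>F. cnj (u e) * ip \<alpha> e)"
  proof -
    have "ip \<alpha> ?s = cnj (\<Sum>e\<in>F. u e * ip e \<alpha>)" using hermitian[OF \<alpha> s] ip_lsum[OF F(1) FV \<alpha>, of u] by simp
    also have "\<dots> = (\<Sum>e\<in>F. cnj (u e) * ip \<alpha> e)" using hermitian[OF \<alpha>] FV by (auto intro!: sum.cong)
    finally show ?thesis .
  qed
  have b: "ip ?s ?s = (\<Sum>e\<in>F. u e * cnj (u e))"
  proof -
    have "ip ?s ?s = (\<Sum>e\<in>F. u e * ip e ?s)" by (rule ip_lsum[OF F(1) FV s])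
    also have "\<dots> = (\<Sum>e\<in>F. u e * cnj (u e))"
    proof (rule sum.cong[OF refl])
      fix e assume e: "e \<in> F"
      have "ip e ?s = cnj (ip ?s e)" by (rule hermitian[OF _ s]) (use e FV in auto)
      also have "ip ?s e = u e" using ip_lsum_orthonormal[OF E F, of e u] e F by auto
      finally show "u e * ip e ?s = u e * cnj (u e)" by simp
    qed
    finally show ?thesis .
  qed
  have "ip (\<lambda>c p. \<alpha> c p - ?s c p) (\<lambda>c p. \<alpha> c p - ?s c p) = ip \<alpha> \<alpha> - ip \<alpha> ?s - (cnj (ip \<alpha> ?s) - ip ?s ?s)"
    using ip_diff(1)[OF \<alpha> s diff_in[OF \<alpha> s]] ip_diff(2)[OF \<alpha> s \<alpha>] ip_diff(2)[OF \<alpha> s s] hermitian[OF s \<alpha>] by simp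
  then have "sqn (\<lambda>c p. \<alpha> c p - ?s c p) = sqn \<alpha> + Re ((\<Sum>e\<in>F. u e * cnj (u e)) - (\<Sum>e\<in>F. cnj (u e) * ip \<alpha> e) - cnj (\<Sum>e\<in>F. cnj (u e) * ip \<alpha> e))"
    unfolding sqn_def a b by simp
  also have "\<dots> = sqn \<alpha> + (\<Sum>e\<in>F. Re (u e * cnj (u e) - cnj (u e) * ip \<alpha> e - u e * cnj (ip \<alpha> e)))"
  proof -
    have "(\<Sum>e\<in>F. u e * cnj (u e)) - (\<Sum>e\<in>F. cnj (u e) * ip \<alpha> e) - cnj (\<Sum>e\<in>F. cnj (u e) * ip \<alpha> e)
      = (\<Sum>e\<in>F. u e * cnj (u e) - cnj (u e) * ip \<alpha> e - u e * cnj (ip \<alpha> e))"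
      by (simp add: sum_subtractf)
    then show ?thesis by (simp only: Re_sum)
  qed
  also have "(\<Sum>e\<in>F. Re (u e * cnj (u e) - cnj (u e) * ip \<alpha> e - u e * cnj (ip \<alpha> e))) = (\<Sum>e\<in>F. (norm (u e - ip \<alpha> e))\<^sup>2 - (norm (ip \<alpha> e))\<^sup>2)"
    unfolding cmod_power2 by (rule sum.cong[OF refl]) (simp add: power2_eq_square algebra_simps)
  finally show ?thesis by (simp add: sum_subtractf)
qed

lemma bessel:
  assumes E: "orthonormal E" and F: "finite F" "F \<subseteq> E" and \<alpha>: "\<alpha> \<in> V"
  shows "(\<Sum>e\<in>F. (norm (ip \<alpha> e))\<^sup>2) \<le> sqn \<alpha>"
proof -
  have "0 \<le> sqn (\<lambda>c p. \<alpha> c p - lsum F (ip \<alpha>) c p)"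
    unfolding sqn_def by (rule nonneg[OF diff_in[OF \<alpha> lsum_in]]) (use E F in \<open>auto simp: orthonormal_def\<close>)
  then show ?thesis using sqn_diff_lsum[OF assms, of "ip \<alpha>"] by simp
qed

section \<open>Parseval's identity and existence of a basis\<close>

definition dense_basis :: "('c \<Rightarrow> 'p \<Rightarrow> complex) set \<Rightarrow> bool" where
  "dense_basis E \<longleftrightarrow> orthonormal E \<and> (\<forall>\<alpha>\<in>V. \<forall>\<epsilon>>0. \<exists>F u. finite F \<and> F \<subseteq> E \<and> sqn (\<lambda>c p. \<alpha> c p - lsum F u c p) < \<epsilon>)"

text \<open>Bessel's inequality bounds all finite partial sums from above, and a single good
  approximation over \<open>F\<close> bounds from below those over all larger index sets.\<close>

lemma parseval:
  assumes E: "dense_basis E" and \<alpha>: "\<alpha> \<in> V"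
  shows "((\<lambda>e. (norm (ip \<alpha> e))\<^sup>2) has_sum sqn \<alpha>) E"
  unfolding has_sum_def
proof (rule tendstoI)
  fix \<epsilon> :: real assume "\<epsilon> > 0"
  have on: "orthonormal E" using E by (simp add: dense_basis_def)
  obtain F u where F: "finite F" "F \<subseteq> E" "sqn (\<lambda>c p. \<alpha> c p - lsum F u c p) < \<epsilon>"
    using E \<alpha> \<open>\<epsilon> > 0\<close> unfolding dense_basis_def by blast
  have "0 \<le> (\<Sum>e\<in>F. (norm (u e - ip \<alpha> e))\<^sup>2)" by (intro sum_nonneg) auto
  then have lo: "sqn \<alpha> - (\<Sum>e\<in>F. (norm (ip \<alpha> e))\<^sup>2) < \<epsilon>" using F(3) sqn_diff_lsum[OF on F(1,2) \<alpha>, of u] by linarith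
  show "\<forall>\<^sub>F G in finite_subsets_at_top E. dist (\<Sum>e\<in>G. (norm (ip \<alpha> e))\<^sup>2) (sqn \<alpha>) < \<epsilon>"
    unfolding eventually_finite_subsets_at_top
  proof (intro exI[of _ F] conjI allI impI F)
    fix G assume G: "finite G \<and> F \<subseteq> G \<and> G \<subseteq> E"
    have "(\<Sum>e\<in>F. (norm (ip \<alpha> e))\<^sup>2) \<le> (\<Sum>e\<in>G. (norm (ip \<alpha> e))\<^sup>2)" using G by (intro sum_mono2) auto
    moreover have "(\<Sum>e\<in>G. (norm (ip \<alpha> e))\<^sup>2) \<le> sqn \<alpha>" using G by (intro bessel[OF on _ _ \<alpha>]) auto
    ultimately show "dist (\<Sum>e\<in>G. (norm (ip \<alpha> e))\<^sup>2) (sqn \<alpha>) < \<epsilon>" using lo by (simp add: dist_real_def)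
  qed
qed

lemma ex_maximal_orthonormal:
  obtains E where "orthonormal E" "\<And>E'. orthonormal E' \<Longrightarrow> E \<subseteq> E' \<Longrightarrow> E' = E"
proof -
  have "\<exists>M\<in>{E. orthonormal E}. \<forall>E\<in>{E. orthonormal E}. M \<subseteq> E \<longrightarrow> E = M"
  proof (rule subset_Zorn')
    fix C assume C: "subset.chain {E. orthonormal E} C"
    have "orthonormal (\<Union>C)"
      unfolding orthonormal_def
    proof (intro conjI ballI)
      show "\<Union>C \<subseteq> V" using C by (auto simp: subset.chain_def orthonormal_def)
      fix e f assume "e \<in> \<Union>C" "f \<in> \<Union>C"
      then obtain E1 E2 where 12: "E1 \<in> C" "E2 \<in> C" "e \<in> E1" "f \<in> E2" by blast
      then have "E1 \<subseteq> E2 \<or> E2 \<subseteq> E1" using C unfolding subset.chain_def by blast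
      then obtain E where "E \<in> C" "e \<in> E" "f \<in> E" using 12 by blast
      moreover have "orthonormal E" using C \<open>E \<in> C\<close> by (auto simp: subset.chain_def)
      ultimately show "ip e f = (if e = f then 1 else 0)" unfolding orthonormal_def by blast
    qed
    then show "\<Union>C \<in> {E. orthonormal E}" by simp
  qed
  then show thesis using that by blast
qed

text \<open>In a complete space a maximal orthonormal set has dense span: the Fourier series of \<open>\<alpha>\<close>
  converges, and the remainder, being orthogonal to the set, has norm zero.\<close>

lemma ex_dense_basis:
  assumes complete: "\<And>\<alpha> :: nat \<Rightarrow> _. (\<And>n. \<alpha> n \<in> V) \<Longrightarrow>
      (\<And>m n. n \<le> m \<Longrightarrow> sqn (\<lambda>c p. \<alpha> m c p - \<alpha> n c p) \<le> 1 / real (Suc n)) \<Longrightarrow>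
      \<exists>\<beta>\<in>V. (\<lambda>n. sqn (\<lambda>c p. \<alpha> n c p - \<beta> c p)) \<longlonglongrightarrow> 0"
  shows "\<exists>E. dense_basis E"
proof -
  obtain E where E: "orthonormal E" and max: "\<And>E'. orthonormal E' \<Longrightarrow> E \<subseteq> E' \<Longrightarrow> E' = E"
    using ex_maximal_orthonormal by blast
  have "\<exists>F u. finite F \<and> F \<subseteq> E \<and> sqn (\<lambda>c p. \<alpha> c p - lsum F u c p) < \<epsilon>" if \<alpha>: "\<alpha> \<in> V" and \<epsilon>: "\<epsilon> > 0" for \<alpha> \<epsilon>
  proof -
    have EV: "E \<subseteq> V" using E by (simp add: orthonormal_def)
    define s where "s F = (\<Sum>e\<in>F. (norm (ip \<alpha> e))\<^sup>2)" for F
    define T where "T = s ` {F. finite F \<and> F \<subseteq> E}"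
    have bdd: "bdd_above T" unfolding T_def s_def using bessel[OF E _ _ \<alpha>] by (intro bdd_aboveI2) auto
    have Tne: "T \<noteq> {}" by (auto simp: T_def)
    have le: "s F \<le> Sup T" if "finite F" "F \<subseteq> E" for F
      by (rule cSup_upper[OF _ bdd]) (use that in \<open>auto simp: T_def\<close>)
    have "\<exists>F. finite F \<and> F \<subseteq> E \<and> Sup T - 1 / real (Suc n) < s F" for n
    proof -
      have "Sup T - 1 / real (Suc n) < Sup T" by simp
      then obtain t where "t \<in> T" "Sup T - 1 / real (Suc n) < t" using less_cSup_iff[OF Tne bdd] by blast
      then show ?thesis by (auto simp: T_def)
    qed
    then obtain F where F: "\<And>n. finite (F n)" "\<And>n. F n \<subseteq> E" "\<And>n. Sup T - 1 / real (Suc n) < s (F n)" by metis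
    \<comment> \<open>Unions make the index sets increase with \<open>n\<close>. Their sums of
      squares stay within \<open>1 / (n + 1)\<close> of the supremum, which makes the Fourier sums a
      Cauchy sequence.\<close>
    define G where "G n = (\<Union>k\<le>n. F k)" for n
    have G: "finite (G n)" "G n \<subseteq> E" for n using F by (auto simp: G_def)
    have GV: "G n \<subseteq> V" for n using G EV by blast
    have Gmono: "G n \<subseteq> G m" if "n \<le> m" for n m using that by (fastforce simp: G_def)
    have sG: "Sup T - 1 / real (Suc n) < s (G n)" for n
    proof -
      have "s (F n) \<le> s (G n)" unfolding s_def using G by (intro sum_mono2) (auto simp: G_def)
      then show ?thesis using F(3)[of n] by linarith
    qed
    define a where "a n = lsum (G n) (ip \<alpha>)" for n
    have aV: "a n \<in> V" for n unfolding a_def by (rule lsum_in[OF G(1) GV])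
    have a_ip: "ip (a n) e = (if e \<in> G n then ip \<alpha> e else 0)" if "e \<in> E" for n e
      unfolding a_def by (rule ip_lsum_orthonormal[OF E G that])
    have a_sqn: "sqn (a n) = s (G n)" for n
    proof -
      have "sqn (\<lambda>c p. a n c p - lsum (G n) (ip \<alpha>) c p) = sqn (a n) - s (G n)"
        using sqn_diff_lsum[OF E G(1)[of n] G(2)[of n] aV[of n], of "ip \<alpha>"] a_ip G(2)[of n] unfolding s_def
        by (simp add: subset_iff cong: sum.cong)
      moreover have "sqn (\<lambda>c p. 0) = 0" by (simp add: sqn_def ip_zero zero)
      ultimately show ?thesis by (simp add: a_def)
    qed
    have "sqn (\<lambda>c p. a m c p - a n c p) \<le> 1 / real (Suc n)" if "n \<le> m" for m n
    proof -
      have "sqn (\<lambda>c p. a m c p - lsum (G n) (ip \<alpha>) c p) = sqn (a m) - s (G n)"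
        using sqn_diff_lsum[OF E G(1)[of n] G(2)[of n] aV[of m], of "ip \<alpha>"] a_ip G(2)[of n] Gmono[OF that] unfolding s_def
        by (simp add: subset_iff cong: sum.cong)
      then have "sqn (\<lambda>c p. a m c p - a n c p) = s (G m) - s (G n)" unfolding a_sqn by (simp add: a_def[of n])
      then show ?thesis using le[OF G, of m] sG[of n] by simp
    qed
    from complete[of a, OF aV this] obtain \<beta> where \<beta>: "\<beta> \<in> V" "(\<lambda>n. sqn (\<lambda>c p. a n c p - \<beta> c p)) \<longlonglongrightarrow> 0" by blast
    define \<gamma> where "\<gamma> = (\<lambda>c p. \<alpha> c p - \<beta> c p)"
    have \<gamma>V: "\<gamma> \<in> V" unfolding \<gamma>_def by (rule diff_in[OF \<alpha> \<beta>(1)])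
    have orth: "ip \<gamma> e = 0" if e: "e \<in> E" for e
    proof -
      have eV: "e \<in> V" using e EV by blast
      \<comment> \<open>If \<open>e\<close> is missing from \<open>G n\<close>, adding it cannot
        push the sum of squares beyond the supremum, so its coefficient is small.\<close>
      have 1: "(norm (ip \<alpha> e - ip (a n) e))\<^sup>2 \<le> 1 / real (Suc n)" for n
      proof (cases "e \<in> G n")
        case False
        have "s (insert e (G n)) \<le> Sup T" by (rule le) (use e G in auto)
        then have "(norm (ip \<alpha> e))\<^sup>2 + s (G n) \<le> Sup T" using False G(1) by (simp add: s_def)
        then show ?thesis using sG[of n] False by (simp add: a_ip[OF e])
      qed (simp add: a_ip[OF e])
      have 2: "(norm (ip (a n) e - ip \<beta> e))\<^sup>2 \<le> sqn (\<lambda>c p. a n c p - \<beta> c p)" for n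
        using bessel[OF E, of "{e}" "\<lambda>c p. a n c p - \<beta> c p"] e diff_in[OF aV \<beta>(1)] by (simp add: ip_diff(1)[OF aV \<beta>(1) eV])
      have "(\<lambda>n. (norm (ip \<alpha> e - ip (a n) e))\<^sup>2) \<longlonglongrightarrow> 0"
        by (rule tendsto_sandwich[OF _ _ tendsto_const LIMSEQ_inverse_real_of_nat])
           (use 1 in \<open>auto simp: inverse_eq_divide\<close>)
      then have 3: "(\<lambda>n. ip \<alpha> e - ip (a n) e) \<longlonglongrightarrow> 0"
        using tendsto_real_sqrt[of "\<lambda>n. (norm (ip \<alpha> e - ip (a n) e))\<^sup>2" 0] by (simp add: tendsto_norm_zero_iff)
      have "(\<lambda>n. (norm (ip (a n) e - ip \<beta> e))\<^sup>2) \<longlonglongrightarrow> 0"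
        by (rule tendsto_sandwich[OF _ _ tendsto_const \<beta>(2)]) (use 2 in auto)
      then have 4: "(\<lambda>n. ip (a n) e - ip \<beta> e) \<longlonglongrightarrow> 0"
        using tendsto_real_sqrt[of "\<lambda>n. (norm (ip (a n) e - ip \<beta> e))\<^sup>2" 0] by (simp add: tendsto_norm_zero_iff)
      have "(\<lambda>n. ip \<alpha> e - ip \<beta> e) \<longlonglongrightarrow> 0" using tendsto_add[OF 3 4] by simp
      then have "ip \<alpha> e - ip \<beta> e = 0" by (simp add: LIMSEQ_const_iff)
      then show ?thesis unfolding \<gamma>_def by (simp add: ip_diff(1)[OF \<alpha> \<beta>(1) eV])
    qed
    have \<gamma>0: "sqn \<gamma> = 0"
    proof (rule ccontr)
      assume "sqn \<gamma> \<noteq> 0"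
      then have pos: "sqn \<gamma> > 0" using nonneg[OF \<gamma>V] by (simp add: sqn_def)
      define r where "r = 1 / sqrt (sqn \<gamma>)"
      \<comment> \<open>The unit vector along the remainder, which would enlarge the maximal set.
        The summand with coefficient \<open>0\<close> only fits the shape of \<open>comb\<close> and
        \<open>linear\<close>.\<close>
      define e where "e = (\<lambda>c p. complex_of_real r * \<gamma> c p + 0 * \<gamma> c p)"
      have eV: "e \<in> V" unfolding e_def by (rule comb[OF \<gamma>V \<gamma>V])
      have ef: "ip e f = of_real r * ip \<gamma> f" if "f \<in> V" for f
        unfolding e_def using linear[OF \<gamma>V \<gamma>V that, of "of_real r" 0] by simp
      have ee: "ip e e = 1"
      proof -
        have "ip e e = of_real r * cnj (of_real r * ip \<gamma> \<gamma>)" using ef[OF eV] hermitian[OF \<gamma>V eV] ef[OF \<gamma>V] by simp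
        also have "\<dots> = of_real (r * r * sqn \<gamma>)" using ip_self[OF \<gamma>V] by simp
        also have "r * r * sqn \<gamma> = 1" using pos by (simp add: r_def real_sqrt_mult_self field_simps)
        finally show ?thesis by simp
      qed
      have eE: "ip e f = 0 \<and> ip f e = 0" if "f \<in> E" for f
      proof -
        have "ip e f = 0" using ef[of f] orth[OF that] that EV by auto
        moreover have "ip f e = cnj (ip e f)" by (rule hermitian) (use eV that EV in auto)
        ultimately show ?thesis by simp
      qed
      have "orthonormal (insert e E)"
        unfolding orthonormal_def
      proof (intro conjI ballI)
        show "insert e E \<subseteq> V" using eV EV by auto
        fix f g assume fg: "f \<in> insert e E" "g \<in> insert e E"
        have "e \<notin> E" using eE[of e] ee by auto
        then show "ip f g = (if f = g then 1 else 0)"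
          using fg ee eE E unfolding orthonormal_def by (cases "f = e"; cases "g = e") auto
      qed
      then have "e \<in> E" using max[of "insert e E"] by auto
      then show False using eE[of e] ee by simp
    qed
    have "(\<lambda>n. 2 * sqn \<gamma> + 2 * sqn (\<lambda>c p. a n c p - \<beta> c p)) \<longlonglongrightarrow> 2 * sqn \<gamma> + 2 * 0"
      by (intro tendsto_intros \<beta>(2))
    then have "eventually (\<lambda>n. 2 * sqn \<gamma> + 2 * sqn (\<lambda>c p. a n c p - \<beta> c p) < \<epsilon>) sequentially"
      using \<epsilon> by (intro order_tendstoD(2)) (auto simp: \<gamma>0)
    then obtain n where n: "2 * sqn \<gamma> + 2 * sqn (\<lambda>c p. a n c p - \<beta> c p) < \<epsilon>" by (auto simp: eventually_sequentially)
    have mV: "(\<lambda>c p. \<beta> c p - a n c p) \<in> V" by (rule diff_in[OF \<beta>(1) aV])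
    have neg: "sqn (\<lambda>c p. \<beta> c p - a n c p) = sqn (\<lambda>c p. a n c p - \<beta> c p)"
    proof -
      have "ip (\<lambda>c p. \<beta> c p - a n c p) (\<lambda>c p. \<beta> c p - a n c p) = ip (\<lambda>c p. a n c p - \<beta> c p) (\<lambda>c p. a n c p - \<beta> c p)"
        using ip_diff(1)[OF \<beta>(1) aV diff_in[OF \<beta>(1) aV]] ip_diff(1)[OF aV \<beta>(1) diff_in[OF aV \<beta>(1)]]
          ip_diff(2)[OF \<beta>(1) aV \<beta>(1)] ip_diff(2)[OF \<beta>(1) aV aV] ip_diff(2)[OF aV \<beta>(1) \<beta>(1)] ip_diff(2)[OF aV \<beta>(1) aV]
        by simp
      then show ?thesis by (simp add: sqn_def)
    qed
    have "sqn (\<lambda>c p. \<alpha> c p - a n c p) = sqn (\<lambda>c p. \<gamma> c p + (\<beta> c p - a n c p))" by (simp add: \<gamma>_def)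
    also have "\<dots> \<le> 2 * sqn \<gamma> + 2 * sqn (\<lambda>c p. \<beta> c p - a n c p)" by (rule sqn_add_le[OF \<gamma>V mV])
    also have "\<dots> < \<epsilon>" using n neg by simp
    finally have "sqn (\<lambda>c p. \<alpha> c p - lsum (G n) (ip \<alpha>) c p) < \<epsilon>" by (simp add: a_def)
    then show ?thesis using G by blast
  qed
  then show ?thesis using E unfolding dense_basis_def by blast
qed

end

section \<open>Square integrable holomorphic forms\<close>

lemma
  fixes f :: "'x \<Rightarrow> 'b :: {banach, second_countable_topology}"
  assumes T: "\<And>n::nat. T n \<in> sets M" "disjoint_family T" "(\<Union>n. T n) = space M" and f: "f \<in> borel_measurable M"
  shows integrable_partition: "integrable M f \<longleftrightarrow> (\<forall>n. set_integrable M (T n) f) \<and> summable (\<lambda>n. LINT x:T n|M. norm (f x))"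
    and integral_partition: "integrable M f \<Longrightarrow> (\<lambda>n. LINT x:T n|M. f x) sums integral\<^sup>L M f"
proof -
  have nn: "(\<integral>\<^sup>+x. ennreal (norm (f x)) \<partial>M) = (\<Sum>n. \<integral>\<^sup>+x. ennreal (norm (indicator (T n) x *\<^sub>R f x)) \<partial>M)"
  proof -
    have "(\<integral>\<^sup>+x. ennreal (norm (f x)) \<partial>M) = (\<integral>\<^sup>+x\<in>(\<Union>n. T n). ennreal (norm (f x)) \<partial>M)"
      unfolding T(3) by (intro nn_integral_cong) (auto simp: indicator_def)
    also have "\<dots> = (\<Sum>n. \<integral>\<^sup>+x\<in>T n. ennreal (norm (f x)) \<partial>M)"
      by (rule nn_integral_disjoint_family) (use T f in auto)
    also have "\<dots> = (\<Sum>n. \<integral>\<^sup>+x. ennreal (norm (indicator (T n) x *\<^sub>R f x)) \<partial>M)"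
      by (intro suminf_cong nn_integral_cong) (auto simp: indicator_def)
    finally show ?thesis .
  qed
  have si: "set_integrable M (T n) f" if "integrable M f" for n
    using that T(1) unfolding set_integrable_def by (intro integrable_mult_indicator)
  have e: "(\<integral>\<^sup>+x. ennreal (norm (indicator (T n) x *\<^sub>R f x)) \<partial>M) = ennreal (LINT x:T n|M. norm (f x))"
    if "set_integrable M (T n) f" for n
  proof -
    have "(\<integral>\<^sup>+x. ennreal (norm (indicator (T n) x *\<^sub>R f x)) \<partial>M) = ennreal (LINT x|M. norm (indicator (T n) x *\<^sub>R f x))"
      using that unfolding set_integrable_def by (intro nn_integral_eq_integral integrable_norm) auto
    also have "(LINT x|M. norm (indicator (T n) x *\<^sub>R f x)) = (LINT x:T n|M. norm (f x))"
      unfolding set_lebesgue_integral_def by (intro Bochner_Integration.integral_cong) (auto simp: indicator_def)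
    finally show ?thesis .
  qed
  have nneg: "0 \<le> (LINT x:T n|M. norm (f x))" for n
    unfolding set_lebesgue_integral_def by (rule integral_nonneg_AE) auto
  have fwd: "summable (\<lambda>n. LINT x:T n|M. norm (f x))" if i: "integrable M f"
  proof -
    have "(\<integral>\<^sup>+x. ennreal (norm (f x)) \<partial>M) < \<infinity>" using i by (simp add: integrable_iff_bounded)
    then have "(\<Sum>n. ennreal (LINT x:T n|M. norm (f x))) \<noteq> top" unfolding nn using e[OF si[OF i]] by simp
    then show ?thesis by (rule summable_suminf_not_top[OF nneg])
  qed
  show "integrable M f \<longleftrightarrow> (\<forall>n. set_integrable M (T n) f) \<and> summable (\<lambda>n. LINT x:T n|M. norm (f x))"
  proof
    assume h: "(\<forall>n. set_integrable M (T n) f) \<and> summable (\<lambda>n. LINT x:T n|M. norm (f x))"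
    then have "(\<Sum>n. ennreal (LINT x:T n|M. norm (f x))) < \<infinity>"
      using suminf_ennreal2[OF nneg] by simp
    then have "(\<integral>\<^sup>+x. ennreal (norm (f x)) \<partial>M) < \<infinity>" unfolding nn using e h by simp
    then show "integrable M f" using f by (simp add: integrable_iff_bounded)
  qed (use si fwd in auto)
  assume i: "integrable M f"
  have "summable (\<lambda>n. LINT x:T n|M. f x)"
  proof (rule summable_comparison_test'[OF fwd[OF i]])
    show "norm (LINT x:T n|M. f x) \<le> (LINT x:T n|M. norm (f x))" for n
      by (rule set_integral_norm_bound[OF si[OF i]])
  qed
  moreover have "(LINT x:(\<Union>n. T n)|M. f x) = (\<Sum>n. LINT x:T n|M. f x)"
  proof (rule lebesgue_integral_countable_add)
    show "T i \<inter> T j = {}" if "i \<noteq> j" for i j using T(2) that by (auto simp: disjoint_family_on_def)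
    show "set_integrable M (\<Union>n. T n) f" using i T(1) unfolding set_integrable_def by (intro integrable_mult_indicator) auto
  qed (use T in auto)
  moreover have "(LINT x:(\<Union>n. T n)|M. f x) = integral\<^sup>L M f" unfolding T(3) by (rule set_integral_space[OF i])
  ultimately show "(\<lambda>n. LINT x:T n|M. f x) sums integral\<^sup>L M f" by (simp add: sums_iff)
qed

section \<open>Integrals of 2-forms and the space of square integrable forms\<close>

context partitioned_surface
begin

text \<open>Turns a form into a function on the surface by means of the chart attached to the piece
  containing \<open>x\<close>, ready for integration against \<open>\<mu>\<close>.\<close>

definition pull :: "'a form \<Rightarrow> 'a \<Rightarrow> complex" where "pull \<omega> x = \<omega> (P (piece x)) x"

definition two_form :: "'a form \<Rightarrow> bool" where
  "two_form \<omega> \<longleftrightarrow> (\<forall>c\<in>A. continuous_on (coord c ` chart_dom c) (\<lambda>z. \<omega> c (chart_inv c z))) \<and>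
     (\<forall>c\<in>A. \<forall>d\<in>A. \<forall>p\<in>chart_dom c \<inter> chart_dom d. \<omega> c p = (norm (transition c d p))\<^sup>2 *\<^sub>R \<omega> d p)"

lemma pull_measurable:
  assumes "\<And>c. c \<in> A \<Longrightarrow> continuous_on (coord c ` chart_dom c) (\<lambda>z. \<omega> c (chart_inv c z))"
  shows "pull \<omega> \<in> borel_measurable \<mu>"
proof (rule measurable_mu)
  fix n
  have "(\<lambda>z. \<omega> (P n) (chart_inv (P n) z)) \<in> borel_measurable (restrict_space borel (coord (P n) ` S n))"
    by (intro borel_measurable_continuous_on_restrict continuous_on_subset[OF assms[OF P_atlas]] image_mono S_dom)
  then show "(\<lambda>z. pull \<omega> (chart_inv (P n) z)) \<in> borel_measurable (restrict_space borel (coord (P n) ` S n))"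
  proof (subst (asm) measurable_cong)
    fix z assume "z \<in> space (restrict_space borel (coord (P n) ` S n))"
    then have "z \<in> coord (P n) ` S n" by (simp add: space_restrict_space)
    then have "chart_inv (P n) z \<in> S n" using coord_image_iff[OF P_chart S_dom, of z n] by blast
    then show "\<omega> (P n) (chart_inv (P n) z) = pull \<omega> (chart_inv (P n) z)" by (simp add: pull_def piece_eq)
  qed
qed

lemma form_pull_measurable: "holomorphic_form A \<alpha> \<Longrightarrow> pull \<alpha> \<in> borel_measurable \<mu>"
  by (intro pull_measurable holomorphic_on_imp_continuous_on form_holomorphic)

lemma jac_pull:
  assumes "two_form \<omega>" "c \<in> A" "x \<in> chart_dom c" shows "jac c x *\<^sub>R \<omega> c x = pull \<omega> x"
proof -
  have "x \<in> chart_dom (P (piece x))" using piece_dom[of x] in_topspace assms by blast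
  then show ?thesis using assms P_atlas[of "piece x"] unfolding two_form_def pull_def jac_def by (metis IntI)
qed

text \<open>The factor \<open>jac c\<close> converts the coefficient in a chart \<open>c\<close>
  into \<open>pull\<close>. Every partition therefore computes the same integral against
  \<open>\<mu>\<close>, which is the uniqueness behind \<open>form_integral\<close>.\<close>

lemma has_form_integral_iff:
  assumes \<omega>: "two_form \<omega>"
  shows "has_form_integral X A \<omega> I \<longleftrightarrow> integrable \<mu> (pull \<omega>) \<and> I = integral\<^sup>L \<mu> (pull \<omega>)"
proof -
  have cont: "continuous_on (coord c ` chart_dom c) (\<lambda>z. \<omega> c (chart_inv c z))" if "c \<in> A" for c
    using \<omega> that unfolding two_form_def by blast
  have m: "pull \<omega> \<in> borel_measurable \<mu>" by (rule pull_measurable[OF cont])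
  have loc: "set_integrable lborel (coord c ` B) (\<omega> c \<circ> chart_inv c) \<longleftrightarrow> set_integrable \<mu> B (pull \<omega>)"
     "(LINT z:coord c ` B|lborel. \<omega> c (chart_inv c z)) = (LINT x:B|\<mu>. pull \<omega> x)"
     "(LINT z:coord c ` B|lborel. norm (\<omega> c (chart_inv c z))) = (LINT x:B|\<mu>. norm (pull \<omega> x))"
    if c: "c \<in> A" and B: "B \<subseteq> chart_dom c" "coord c ` B \<in> sets borel" for c B
  proof -
    have Bs: "B \<in> sets (borel_space X)" using chart_borel_iff[OF chart[OF c] B(1)] B(2) by simp
    have "continuous_on (coord c ` B) (\<lambda>z. \<omega> c (chart_inv c z))"
      by (rule continuous_on_subset[OF cont[OF c] image_mono[OF B(1)]])
    then have "(\<lambda>z. indicator (coord c ` B) z *\<^sub>R \<omega> c (chart_inv c z)) \<in> borel_measurable borel"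
      by (intro borel_measurable_continuous_on_indicator B(2))
    then have bm: "set_borel_measurable lborel (coord c ` B) (\<lambda>z. \<omega> c (chart_inv c z))"
      by (simp add: set_borel_measurable_def)
    have bm': "set_borel_measurable lborel (coord c ` B) (\<lambda>z. norm (\<omega> c (chart_inv c z)))"
    proof -
      have "(\<lambda>z. norm (indicator (coord c ` B) z *\<^sub>R \<omega> c (chart_inv c z))) \<in> borel_measurable lborel"
        using bm unfolding set_borel_measurable_def by (rule measurable_compose[OF _ borel_measurable_norm])
      then show ?thesis unfolding set_borel_measurable_def by simp
    qed
    have e: "jac c x *\<^sub>R \<omega> c (chart_inv c (coord c x)) = pull \<omega> x" if "x \<in> B" for x
    proof -
      have "x \<in> chart_dom c" using that B by blast
      then show ?thesis using jac_pull[OF \<omega> c, of x] chart_inv_coord[OF chart[OF c], of x] by simp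
    qed
    have e': "jac c x *\<^sub>R norm (\<omega> c (chart_inv c (coord c x))) = norm (pull \<omega> x)" if "x \<in> B" for x
      unfolding e[OF that, symmetric] by (simp add: jac_nonneg)
    note ci = chart_integral[OF admissible_atlas[OF c] Bs B(1) bm]
    note ci' = chart_integral[OF admissible_atlas[OF c] Bs B(1) bm']
    show "set_integrable lborel (coord c ` B) (\<omega> c \<circ> chart_inv c) \<longleftrightarrow> set_integrable \<mu> B (pull \<omega>)"
    proof -
      have "(\<lambda>x. indicator B x *\<^sub>R jac c x *\<^sub>R \<omega> c (chart_inv c (coord c x))) = (\<lambda>x. indicator B x *\<^sub>R pull \<omega> x)"
        using e by (auto simp: indicator_def fun_eq_iff)
      then show ?thesis using ci(1) unfolding set_integrable_def o_def by simp
    qed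
    show "(LINT z:coord c ` B|lborel. \<omega> c (chart_inv c z)) = (LINT x:B|\<mu>. pull \<omega> x)"
      unfolding ci(2) by (rule set_lebesgue_integral_cong) (use Bs e in auto)
    show "(LINT z:coord c ` B|lborel. norm (\<omega> c (chart_inv c z))) = (LINT x:B|\<mu>. norm (pull \<omega> x))"
      unfolding ci'(2) by (rule set_lebesgue_integral_cong) (use Bs e' in auto)
  qed
  show ?thesis
  proof
    assume "has_form_integral X A \<omega> I"
    then obtain S' P' where bp: "borel_partition X A S' P'"
      and h1: "\<And>n. set_integrable lborel (coord (P' n) ` S' n) (\<omega> (P' n) \<circ> chart_inv (P' n))"
      and h2: "summable (\<lambda>n. LINT z:coord (P' n) ` S' n|lborel. norm (\<omega> (P' n) (chart_inv (P' n) z)))"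
      and h3: "(\<lambda>n. LINT z:coord (P' n) ` S' n|lborel. \<omega> (P' n) (chart_inv (P' n) z)) sums I"
      unfolding has_form_integral_def by blast
    have bp': "P' n \<in> A" "S' n \<subseteq> chart_dom (P' n)" "coord (P' n) ` S' n \<in> sets borel" "disjoint_family S'" "(\<Union>n. S' n) = topspace X" for n
      using bp unfolding borel_partition_def by blast+
    have S's: "S' n \<in> sets \<mu>" for n using chart_borel_iff[OF chart[OF bp'(1)] bp'(2), of n] bp'(3)[of n] by simp
    note l = loc[OF bp'(1) bp'(2) bp'(3)]
    have int: "integrable \<mu> (pull \<omega>)"
      using h1 h2 unfolding l integrable_partition[OF S's bp'(4) bp'(5)[folded space_mu] m] by blast
    from integral_partition[OF S's bp'(4) bp'(5)[folded space_mu] m int]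
    have "I = integral\<^sup>L \<mu> (pull \<omega>)" using h3 unfolding l by (metis sums_unique2)
    with int show "integrable \<mu> (pull \<omega>) \<and> I = integral\<^sup>L \<mu> (pull \<omega>)" by blast
  next
    assume h: "integrable \<mu> (pull \<omega>) \<and> I = integral\<^sup>L \<mu> (pull \<omega>)"
    note l = loc[OF P_atlas S_dom S_image_borel]
    have Ss: "S n \<in> sets \<mu>" for n using S_borel by simp
    have sp: "(\<Union>n. S n) = space \<mu>" using S_cover by simp
    show "has_form_integral X A \<omega> I"
      unfolding has_form_integral_def
    proof (intro exI[of _ S] exI[of _ P] conjI)
      show "\<forall>n. set_integrable lborel (coord (P n) ` S n) (\<omega> (P n) \<circ> chart_inv (P n))"
        using h unfolding l integrable_partition[OF Ss S_disjoint sp m] by blast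
      show "summable (\<lambda>n. LINT z:coord (P n) ` S n|lborel. norm (\<omega> (P n) (chart_inv (P n) z)))"
        using h unfolding l integrable_partition[OF Ss S_disjoint sp m] by blast
      show "(\<lambda>n. LINT z:coord (P n) ` S n|lborel. \<omega> (P n) (chart_inv (P n) z)) sums I"
        using integral_partition[OF Ss S_disjoint sp m] h unfolding l by blast
    qed (rule partition)
  qed
qed

lemma two_form_wedge:
  assumes "holomorphic_form A \<alpha>" "holomorphic_form A \<beta>" shows "two_form (wedge_cnj \<alpha> \<beta>)"
  unfolding two_form_def
proof (intro conjI ballI)
  fix c assume c: "c \<in> A"
  show "continuous_on (coord c ` chart_dom c) (\<lambda>z. wedge_cnj \<alpha> \<beta> c (chart_inv c z))"
    unfolding wedge_cnj_def
    by (intro continuous_intros holomorphic_on_imp_continuous_on form_holomorphic[OF assms(1) c] form_holomorphic[OF assms(2) c])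
next
  fix c d p assume c: "c \<in> A" "d \<in> A" and "p \<in> chart_dom c \<inter> chart_dom d"
  then have p: "p \<in> chart_dom c" "p \<in> chart_dom d" by auto
  show "wedge_cnj \<alpha> \<beta> c p = (norm (transition c d p))\<^sup>2 *\<^sub>R wedge_cnj \<alpha> \<beta> d p"
    unfolding wedge_cnj_def form_transition[OF assms(1) c p] form_transition[OF assms(2) c p] scaleR_conv_of_real complex_norm_square
    by (simp add: algebra_simps)
qed

lemma pull_wedge: "pull (wedge_cnj \<alpha> \<beta>) x = - 2 * \<i> * (pull \<alpha> x * cnj (pull \<beta> x))"
  by (simp add: pull_def wedge_cnj_def)

lemma L2_iff: "\<alpha> \<in> L2_forms X A \<longleftrightarrow> holomorphic_form A \<alpha> \<and> integrable \<mu> (\<lambda>x. (norm (pull \<alpha> x))\<^sup>2)"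
proof (cases "holomorphic_form A \<alpha>")
  case True
  have "integrable \<mu> (pull (wedge_cnj \<alpha> \<alpha>)) \<longleftrightarrow> integrable \<mu> (\<lambda>x. (norm (pull \<alpha> x))\<^sup>2)"
  proof
    assume "integrable \<mu> (pull (wedge_cnj \<alpha> \<alpha>))"
    then have "integrable \<mu> (\<lambda>x. norm (pull (wedge_cnj \<alpha> \<alpha>) x) / 2)" by (intro integrable_divide integrable_norm)
    then show "integrable \<mu> (\<lambda>x. (norm (pull \<alpha> x))\<^sup>2)" by (simp add: pull_wedge norm_mult power2_eq_square)
  next
    assume "integrable \<mu> (\<lambda>x. (norm (pull \<alpha> x))\<^sup>2)"
    then have "integrable \<mu> (\<lambda>x. - 2 * \<i> * complex_of_real ((norm (pull \<alpha> x))\<^sup>2))" by (intro integrable_mult_right integrable_of_real)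
    moreover have "(\<lambda>x. - 2 * \<i> * complex_of_real ((norm (pull \<alpha> x))\<^sup>2)) = pull (wedge_cnj \<alpha> \<alpha>)"
      by (rule ext) (simp only: pull_wedge complex_norm_square)
    ultimately show "integrable \<mu> (pull (wedge_cnj \<alpha> \<alpha>))" by (simp only:)
  qed
  then show ?thesis using True has_form_integral_iff[OF two_form_wedge[OF True True]] by (auto simp: L2_forms_def)
qed (simp add: L2_forms_def)

lemma L2_product_integrable:
  assumes "\<alpha> \<in> L2_forms X A" "\<beta> \<in> L2_forms X A"
  shows "integrable \<mu> (\<lambda>x. pull \<alpha> x * cnj (pull \<beta> x))"
proof (rule Bochner_Integration.integrable_bound)
  show "integrable \<mu> (\<lambda>x. (norm (pull \<alpha> x))\<^sup>2 + (norm (pull \<beta> x))\<^sup>2)" using assms by (simp add: L2_iff)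
  have "pull \<alpha> \<in> borel_measurable \<mu>" "pull \<beta> \<in> borel_measurable \<mu>" using assms by (auto simp: L2_iff form_pull_measurable)
  then show "(\<lambda>x. pull \<alpha> x * cnj (pull \<beta> x)) \<in> borel_measurable \<mu>"
    by (intro borel_measurable_times) (auto intro: measurable_compose[OF _ borel_measurable_continuous_onI[OF continuous_on_cnj[OF continuous_on_id]]])
  show "AE x in \<mu>. norm (pull \<alpha> x * cnj (pull \<beta> x)) \<le> norm ((norm (pull \<alpha> x))\<^sup>2 + (norm (pull \<beta> x))\<^sup>2)"
  proof (rule AE_I2)
    fix x
    have "0 \<le> (norm (pull \<alpha> x) - norm (pull \<beta> x))\<^sup>2" by simp
    then have "2 * (norm (pull \<alpha> x) * norm (pull \<beta> x)) \<le> (norm (pull \<alpha> x))\<^sup>2 + (norm (pull \<beta> x))\<^sup>2"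
      by (simp add: power2_diff)
    moreover have "0 \<le> norm (pull \<alpha> x) * norm (pull \<beta> x)" by simp
    ultimately have "norm (pull \<alpha> x) * norm (pull \<beta> x) \<le> (norm (pull \<alpha> x))\<^sup>2 + (norm (pull \<beta> x))\<^sup>2" by linarith
    then show "norm (pull \<alpha> x * cnj (pull \<beta> x)) \<le> norm ((norm (pull \<alpha> x))\<^sup>2 + (norm (pull \<beta> x))\<^sup>2)"
      unfolding norm_mult complex_mod_cnj by simp
  qed
qed

lemma form_inner_eq:
  assumes "\<alpha> \<in> L2_forms X A" "\<beta> \<in> L2_forms X A"
  shows "form_inner X A \<alpha> \<beta> = (LINT x|\<mu>. pull \<alpha> x * cnj (pull \<beta> x))"
proof -
  have w: "two_form (wedge_cnj \<alpha> \<beta>)" using assms by (intro two_form_wedge) (auto simp: L2_forms_def)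
  have i: "integrable \<mu> (pull (wedge_cnj \<alpha> \<beta>))"
    unfolding pull_wedge[abs_def] by (intro integrable_mult_right L2_product_integrable[OF assms])
  have "form_integral X A (wedge_cnj \<alpha> \<beta>) = integral\<^sup>L \<mu> (pull (wedge_cnj \<alpha> \<beta>))"
    unfolding form_integral_def has_form_integral_iff[OF w] using i by (intro the_equality) auto
  also have "\<dots> = - 2 * \<i> * (LINT x|\<mu>. pull \<alpha> x * cnj (pull \<beta> x))"
    unfolding pull_wedge[abs_def] by (rule integral_mult_right_zero)
  finally show ?thesis by (simp add: form_inner_def)
qed

lemma form_norm_square:
  assumes "\<alpha> \<in> L2_forms X A" shows "form_inner X A \<alpha> \<alpha> = of_real (LINT x|\<mu>. (norm (pull \<alpha> x))\<^sup>2)"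
proof -
  have "(\<lambda>x. pull \<alpha> x * cnj (pull \<alpha> x)) = (\<lambda>x. complex_of_real ((norm (pull \<alpha> x))\<^sup>2))"
    by (rule ext) (simp only: complex_norm_square)
  then show ?thesis unfolding form_inner_eq[OF assms assms] by (simp only: integral_complex_of_real)
qed

lemma holomorphic_form_comb:
  assumes "holomorphic_form A \<alpha>" "holomorphic_form A \<beta>"
  shows "holomorphic_form A (\<lambda>c p. u * \<alpha> c p + v * \<beta> c p)"
  unfolding holomorphic_form_def
proof (intro conjI ballI)
  fix c assume c: "c \<in> A"
  show "(\<lambda>p. u * \<alpha> c p + v * \<beta> c p) \<circ> chart_inv c holomorphic_on coord c ` chart_dom c"
    unfolding o_def by (intro holomorphic_intros form_holomorphic assms c)
next
  fix c d p assume cd: "c \<in> A" "d \<in> A" and "p \<in> chart_dom c \<inter> chart_dom d"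
  then have p: "p \<in> chart_dom c" "p \<in> chart_dom d" by auto
  show "u * \<alpha> c p + v * \<beta> c p = (u * \<alpha> d p + v * \<beta> d p) * deriv (coord d \<circ> chart_inv c) (coord c p)"
    unfolding form_transition[OF assms(1) cd p] form_transition[OF assms(2) cd p] transition_def by (simp add: algebra_simps)
qed

lemma pull_comb: "pull (\<lambda>c p. u * \<alpha> c p + v * \<beta> c p) x = u * pull \<alpha> x + v * pull \<beta> x"
  by (simp add: pull_def)

lemma L2_comb:
  assumes "\<alpha> \<in> L2_forms X A" "\<beta> \<in> L2_forms X A"
  shows "(\<lambda>c p. u * \<alpha> c p + v * \<beta> c p) \<in> L2_forms X A"
proof -
  have h: "holomorphic_form A (\<lambda>c p. u * \<alpha> c p + v * \<beta> c p)"
    using assms by (intro holomorphic_form_comb) (auto simp: L2_iff)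
  have "integrable \<mu> (\<lambda>x. (norm (pull (\<lambda>c p. u * \<alpha> c p + v * \<beta> c p) x))\<^sup>2)"
  proof (rule Bochner_Integration.integrable_bound)
    show "integrable \<mu> (\<lambda>x. 2 * (norm u)\<^sup>2 * (norm (pull \<alpha> x))\<^sup>2 + 2 * (norm v)\<^sup>2 * (norm (pull \<beta> x))\<^sup>2)"
      using assms by (intro Bochner_Integration.integrable_add integrable_mult_right) (auto simp: L2_iff)
    show "(\<lambda>x. (norm (pull (\<lambda>c p. u * \<alpha> c p + v * \<beta> c p) x))\<^sup>2) \<in> borel_measurable \<mu>"
      by (rule borel_measurable_power[OF measurable_compose[OF form_pull_measurable[OF h] borel_measurable_norm]])
    show "AE x in \<mu>. norm ((norm (pull (\<lambda>c p. u * \<alpha> c p + v * \<beta> c p) x))\<^sup>2) \<le>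
      norm (2 * (norm u)\<^sup>2 * (norm (pull \<alpha> x))\<^sup>2 + 2 * (norm v)\<^sup>2 * (norm (pull \<beta> x))\<^sup>2)"
    proof (rule AE_I2)
      fix x
      let ?a = "norm u * norm (pull \<alpha> x)" and ?b = "norm v * norm (pull \<beta> x)"
      have "norm (u * pull \<alpha> x + v * pull \<beta> x) \<le> ?a + ?b"
        using norm_triangle_ineq[of "u * pull \<alpha> x" "v * pull \<beta> x"] by (simp add: norm_mult)
      then have "(norm (u * pull \<alpha> x + v * pull \<beta> x))\<^sup>2 \<le> (?a + ?b)\<^sup>2" by (intro power_mono) auto
      also have "\<dots> \<le> 2 * ?a\<^sup>2 + 2 * ?b\<^sup>2"
        using zero_le_power2[of "?a - ?b"] by (simp add: power2_eq_square algebra_simps)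
      finally show "norm ((norm (pull (\<lambda>c p. u * \<alpha> c p + v * \<beta> c p) x))\<^sup>2) \<le>
          norm (2 * (norm u)\<^sup>2 * (norm (pull \<alpha> x))\<^sup>2 + 2 * (norm v)\<^sup>2 * (norm (pull \<beta> x))\<^sup>2)"
        by (simp add: pull_comb power_mult_distrib)
    qed
  qed
  with h show ?thesis by (simp add: L2_iff)
qed

lemma L2_zero: "(\<lambda>c p. 0) \<in> L2_forms X A"
  by (simp add: L2_iff holomorphic_form_def pull_def o_def)

text \<open>Evaluation at a point is bounded in the norm of the space: the sub-mean value inequality
  holds on a coordinate disc, and the integral over that disc is part of the integral over the
  surface.\<close>

lemma form_eval_bound:
  assumes \<alpha>: "\<alpha> \<in> L2_forms X A" and c: "c \<in> A" and r: "r > 0" "ball z r \<subseteq> coord c ` chart_dom c"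
  shows "pi * r\<^sup>2 * (norm (\<alpha> c (chart_inv c z)))\<^sup>2 \<le> (LINT x|\<mu>. (norm (pull \<alpha> x))\<^sup>2)"
proof -
  have hf: "holomorphic_form A \<alpha>" and int: "integrable \<mu> (\<lambda>x. (norm (pull \<alpha> x))\<^sup>2)" using \<alpha> by (auto simp: L2_iff)
  define f where "f z = \<alpha> c (chart_inv c z)" for z
  define B where "B = {p \<in> chart_dom c. coord c p \<in> ball z r}"
  have f: "f holomorphic_on ball z r" unfolding f_def by (rule holomorphic_on_subset[OF form_holomorphic[OF hf c] r(2)])
  have cB: "coord c ` B = ball z r" using r(2) by (auto simp: B_def)
  have B: "B \<subseteq> chart_dom c" "B \<in> sets (borel_space X)"
    using chart_preimage_open[OF chart[OF c], of "ball z r"] openin_borel_space by (auto simp: B_def)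
  have "(\<lambda>w. indicator (ball z r) w *\<^sub>R (norm (f w))\<^sup>2) \<in> borel_measurable borel"
    by (intro borel_measurable_continuous_on_indicator continuous_intros holomorphic_on_imp_continuous_on[OF f]) auto
  then have bm: "set_borel_measurable lborel (coord c ` B) (\<lambda>w. (norm (f w))\<^sup>2)"
    unfolding cB set_borel_measurable_def by simp
  have e: "jac c x *\<^sub>R (norm (f (coord c x)))\<^sup>2 = (norm (pull \<alpha> x))\<^sup>2" if "x \<in> B" for x
  proof -
    have x: "x \<in> chart_dom c" using that B by blast
    then have p: "x \<in> chart_dom (P (piece x))" using piece_dom[of x] in_topspace c by blast
    show ?thesis unfolding pull_def form_transition[OF hf P_atlas c p x] f_def jac_def chart_inv_coord[OF chart[OF c] x]
      by (simp add: norm_mult power_mult_distrib mult.commute)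
  qed
  note ci = chart_integral[OF admissible_atlas[OF c] B(2,1) bm]
  have si: "set_integrable \<mu> B (\<lambda>x. (norm (pull \<alpha> x))\<^sup>2)"
    using int B(2) unfolding set_integrable_def by (intro integrable_mult_indicator) auto
  have eqs: "(\<lambda>x. indicator B x *\<^sub>R jac c x *\<^sub>R (norm (f (coord c x)))\<^sup>2) = (\<lambda>x. indicator B x *\<^sub>R (norm (pull \<alpha> x))\<^sup>2)"
    using e by (auto simp: indicator_def fun_eq_iff)
  have "set_integrable lborel (ball z r) (\<lambda>w. (norm (f w))\<^sup>2)"
    using ci(1) si unfolding cB set_integrable_def eqs by simp
  from sub_mean_value_ball[OF f r(1) this]
  have "pi * r\<^sup>2 * (norm (f z))\<^sup>2 \<le> (LINT w:ball z r|lborel. (norm (f w))\<^sup>2)" .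
  also have "\<dots> = (LINT x:B|\<mu>. (norm (pull \<alpha> x))\<^sup>2)"
    using ci(2) unfolding cB set_lebesgue_integral_def eqs .
  also have "\<dots> \<le> (LINT x|\<mu>. (norm (pull \<alpha> x))\<^sup>2)"
    unfolding set_lebesgue_integral_def
    by (intro integral_mono int) (use si in \<open>auto simp: set_integrable_def indicator_def\<close>)
  finally show ?thesis by (simp add: f_def)
qed

lemma semi_hilbert: "semi_hilbert (L2_forms X A) (form_inner X A)"
proof
  show "(\<lambda>c p. 0) \<in> L2_forms X A" by (rule L2_zero)
  show "(\<lambda>c p. u * \<alpha> c p + v * \<beta> c p) \<in> L2_forms X A" if "\<alpha> \<in> L2_forms X A" "\<beta> \<in> L2_forms X A" for \<alpha> \<beta> u v
    by (rule L2_comb[OF that])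
  show "form_inner X A (\<lambda>c p. u * \<alpha> c p + v * \<beta> c p) \<gamma> = u * form_inner X A \<alpha> \<gamma> + v * form_inner X A \<beta> \<gamma>"
    if "\<alpha> \<in> L2_forms X A" "\<beta> \<in> L2_forms X A" "\<gamma> \<in> L2_forms X A" for \<alpha> \<beta> \<gamma> u v
  proof -
    have "form_inner X A (\<lambda>c p. u * \<alpha> c p + v * \<beta> c p) \<gamma> =
        (LINT x|\<mu>. u * (pull \<alpha> x * cnj (pull \<gamma> x)) + v * (pull \<beta> x * cnj (pull \<gamma> x)))"
      unfolding form_inner_eq[OF L2_comb[OF that(1,2)] that(3)] pull_comb by (simp add: algebra_simps)
    also have "\<dots> = (LINT x|\<mu>. u * (pull \<alpha> x * cnj (pull \<gamma> x))) + (LINT x|\<mu>. v * (pull \<beta> x * cnj (pull \<gamma> x)))"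
      by (intro Bochner_Integration.integral_add integrable_mult_right L2_product_integrable that)
    finally show ?thesis by (simp add: form_inner_eq that)
  qed
  show "form_inner X A \<alpha> \<beta> = cnj (form_inner X A \<beta> \<alpha>)" if "\<alpha> \<in> L2_forms X A" "\<beta> \<in> L2_forms X A" for \<alpha> \<beta>
    unfolding form_inner_eq[OF that] form_inner_eq[OF that(2,1)]
  proof -
    have "(LINT x|\<mu>. pull \<alpha> x * cnj (pull \<beta> x)) = (LINT x|\<mu>. cnj (pull \<beta> x * cnj (pull \<alpha> x)))"
      by (simp add: mult.commute)
    then show "(LINT x|\<mu>. pull \<alpha> x * cnj (pull \<beta> x)) = cnj (LINT x|\<mu>. pull \<beta> x * cnj (pull \<alpha> x))"
      by (simp only: Bochner_Integration.integral_cnj)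
  qed
  show "0 \<le> Re (form_inner X A \<alpha> \<alpha>)" if "\<alpha> \<in> L2_forms X A" for \<alpha>
    unfolding form_norm_square[OF that] by simp
qed

lemma sqn_eq: "\<alpha> \<in> L2_forms X A \<Longrightarrow> semi_hilbert.sqn (form_inner X A) \<alpha> = (LINT x|\<mu>. (norm (pull \<alpha> x))\<^sup>2)"
  using semi_hilbert.sqn_def[OF semi_hilbert, of \<alpha>] form_norm_square[of \<alpha>] by simp

lemma L2_diff: "\<alpha> \<in> L2_forms X A \<Longrightarrow> \<beta> \<in> L2_forms X A \<Longrightarrow> (\<lambda>c p. \<alpha> c p - \<beta> c p) \<in> L2_forms X A"
  using L2_comb[of \<alpha> \<beta> 1 "-1"] by simp

lemma form_eval_local_bound:
  assumes c: "c \<in> A" and z: "z0 \<in> coord c ` chart_dom c"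
  obtains r C where "r > 0" "C > 0" "cball z0 r \<subseteq> coord c ` chart_dom c"
    "\<And>\<alpha> z. \<alpha> \<in> L2_forms X A \<Longrightarrow> z \<in> cball z0 r \<Longrightarrow> (norm (\<alpha> c (chart_inv c z)))\<^sup>2 \<le> C * (LINT x|\<mu>. (norm (pull \<alpha> x))\<^sup>2)"
proof -
  obtain R where R: "R > 0" "ball z0 R \<subseteq> coord c ` chart_dom c"
    using chart_open[OF chart[OF c]] z open_contains_ball by blast
  define r where "r = R / 3"
  have r: "r > 0" using R by (simp add: r_def)
  have sub: "ball z r \<subseteq> coord c ` chart_dom c" if "z \<in> cball z0 r" for z
  proof
    fix x assume "x \<in> ball z r"
    then have "x \<in> ball z0 R" using that R dist_triangle[of z0 x z] by (simp add: r_def)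
    then show "x \<in> coord c ` chart_dom c" using R by blast
  qed
  show thesis
  proof (rule that[of r "1 / (pi * r\<^sup>2)"])
    have "cball z0 r \<subseteq> ball z0 R" using R by (auto simp: r_def)
    then show "cball z0 r \<subseteq> coord c ` chart_dom c" using R by blast
    fix \<alpha> z assume "\<alpha> \<in> L2_forms X A" and z: "z \<in> cball z0 r"
    from form_eval_bound[OF this(1) c r sub[OF z]] r
    show "(norm (\<alpha> c (chart_inv c z)))\<^sup>2 \<le> 1 / (pi * r\<^sup>2) * (LINT x|\<mu>. (norm (pull \<alpha> x))\<^sup>2)"
      by (simp add: field_simps)
  qed (use r in auto)
qed

text \<open>Bounded evaluation turns an \<open>L^2\<close> Cauchy sequence into a locally uniform
  Cauchy sequence of coefficients. Holomorphy and the transition rule survive in the limit, and the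
  estimate of the norms passes to it as well.\<close>

lemma L2_complete:
  fixes \<alpha> :: "nat \<Rightarrow> 'a form"
  assumes \<alpha>: "\<And>n. \<alpha> n \<in> L2_forms X A"
    and cauchy: "\<And>m n. n \<le> m \<Longrightarrow> semi_hilbert.sqn (form_inner X A) (\<lambda>c p. \<alpha> m c p - \<alpha> n c p) \<le> 1 / real (Suc n)"
  shows "\<exists>\<beta>\<in>L2_forms X A. (\<lambda>n. semi_hilbert.sqn (form_inner X A) (\<lambda>c p. \<alpha> n c p - \<beta> c p)) \<longlonglongrightarrow> 0"
proof -
  have hf: "holomorphic_form A (\<alpha> n)" for n using \<alpha> by (simp add: L2_iff)
  have dL: "(\<lambda>c p. \<alpha> m c p - \<alpha> n c p) \<in> L2_forms X A" for m n by (rule L2_diff[OF \<alpha> \<alpha>])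
  have cau: "(LINT x|\<mu>. (norm (pull (\<lambda>c p. \<alpha> m c p - \<alpha> n c p) x))\<^sup>2) \<le> 1 / real (Suc n)" if "n \<le> m" for m n
    using cauchy[OF that] sqn_eq[OF dL] by simp
  have bound: "\<exists>r>0. \<exists>C>0. cball z0 r \<subseteq> coord c ` chart_dom c \<and>
      (\<forall>m n. \<forall>z\<in>cball z0 r. n \<le> m \<longrightarrow> (norm (\<alpha> m c (chart_inv c z) - \<alpha> n c (chart_inv c z)))\<^sup>2 \<le> C / real (Suc n))"
    if c: "c \<in> A" and z: "z0 \<in> coord c ` chart_dom c" for c z0
  proof -
    obtain r C where r: "r > 0" "C > 0" "cball z0 r \<subseteq> coord c ` chart_dom c"
      "\<And>\<alpha> z. \<alpha> \<in> L2_forms X A \<Longrightarrow> z \<in> cball z0 r \<Longrightarrow> (norm (\<alpha> c (chart_inv c z)))\<^sup>2 \<le> C * (LINT x|\<mu>. (norm (pull \<alpha> x))\<^sup>2)"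
      using form_eval_local_bound[OF c z] by metis
    have "(norm (\<alpha> m c (chart_inv c z) - \<alpha> n c (chart_inv c z)))\<^sup>2 \<le> C / real (Suc n)" if "z \<in> cball z0 r" "n \<le> m" for m n z
    proof -
      have "(norm (\<alpha> m c (chart_inv c z) - \<alpha> n c (chart_inv c z)))\<^sup>2 \<le> C * (LINT x|\<mu>. (norm (pull (\<lambda>c p. \<alpha> m c p - \<alpha> n c p) x))\<^sup>2)"
        by (rule r(4)[OF dL that(1)])
      also have "\<dots> \<le> C * (1 / real (Suc n))" by (intro mult_left_mono cau that) (use r in auto)
      finally show ?thesis by simp
    qed
    then show ?thesis using r by blast
  qed
  have ucauchy: "\<exists>r>0. cball z0 r \<subseteq> coord c ` chart_dom c \<and>
     uniformly_Cauchy_on (cball z0 r) (\<lambda>n z. \<alpha> n c (chart_inv c z))" if c: "c \<in> A" "z0 \<in> coord c ` chart_dom c" for c z0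
  proof -
    obtain r C where r: "r > 0" "C > 0" "cball z0 r \<subseteq> coord c ` chart_dom c"
      "\<And>m n z. z \<in> cball z0 r \<Longrightarrow> n \<le> m \<Longrightarrow> (norm (\<alpha> m c (chart_inv c z) - \<alpha> n c (chart_inv c z)))\<^sup>2 \<le> C / real (Suc n)"
      using bound[OF c] by metis
    have "uniformly_Cauchy_on (cball z0 r) (\<lambda>n z. \<alpha> n c (chart_inv c z))"
    proof (rule uniformly_Cauchy_onI')
      fix e :: real assume e: "e > 0"
      obtain M where M: "C / e\<^sup>2 < real M" using reals_Archimedean2 by blast
      show "\<exists>M. \<forall>x\<in>cball z0 r. \<forall>m\<ge>M. \<forall>n>m. dist (\<alpha> m c (chart_inv c x)) (\<alpha> n c (chart_inv c x)) < e"
      proof (intro exI[of _ M] ballI allI impI)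
        fix x m n assume x: "x \<in> cball z0 r" and mn: "M \<le> m" "m < n"
        have "(norm (\<alpha> n c (chart_inv c x) - \<alpha> m c (chart_inv c x)))\<^sup>2 \<le> C / real (Suc m)" by (rule r(4)[OF x]) (use mn in simp)
        also have "\<dots> < e\<^sup>2"
        proof -
          have "C < e\<^sup>2 * real M" using M e by (simp add: field_simps)
          also have "\<dots> \<le> e\<^sup>2 * real (Suc m)" using mn by (intro mult_left_mono) auto
          finally show ?thesis by (simp add: field_simps)
        qed
        finally show "dist (\<alpha> m c (chart_inv c x)) (\<alpha> n c (chart_inv c x)) < e"
          using power2_less_imp_less[of _ e] e by (simp add: dist_norm norm_minus_commute)
      qed
    qed
    then show ?thesis using r by blast
  qed
  define \<beta> where "\<beta> c p = lim (\<lambda>n. \<alpha> n c p)" for c p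
  have ulim: "\<exists>r>0. cball z0 r \<subseteq> coord c ` chart_dom c \<and>
      uniform_limit (cball z0 r) (\<lambda>n z. \<alpha> n c (chart_inv c z)) (\<lambda>z. \<beta> c (chart_inv c z)) sequentially"
    if c: "c \<in> A" "z0 \<in> coord c ` chart_dom c" for c z0
    using ucauchy[OF c] Cauchy_uniformly_convergent[of _ "\<lambda>n z. \<alpha> n c (chart_inv c z)"]
    unfolding \<beta>_def uniformly_convergent_uniform_limit_iff by blast
  have lim: "(\<lambda>n. \<alpha> n c p) \<longlonglongrightarrow> \<beta> c p" if c: "c \<in> A" "p \<in> chart_dom c" for c p
  proof -
    have "coord c p \<in> coord c ` chart_dom c" using c by blast
    from ulim[OF c(1) this] obtain r where "r > 0"
      "uniform_limit (cball (coord c p) r) (\<lambda>n z. \<alpha> n c (chart_inv c z)) (\<lambda>z. \<beta> c (chart_inv c z)) sequentially" by blast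
    from tendsto_uniform_limitI[OF this(2), of "coord c p"] this(1)
    show ?thesis using chart_inv_coord[OF chart[OF c(1)] c(2)] by simp
  qed
  have \<beta>: "holomorphic_form A \<beta>"
    unfolding holomorphic_form_def
  proof (intro conjI ballI)
    fix c assume c: "c \<in> A"
    show "\<beta> c \<circ> chart_inv c holomorphic_on coord c ` chart_dom c"
      unfolding o_def
      by (rule holomorphic_uniform_sequence[OF chart_open[OF chart[OF c]] form_holomorphic[OF hf c] ulim[OF c]])
  next
    fix c d p assume cd: "c \<in> A" "d \<in> A" and "p \<in> chart_dom c \<inter> chart_dom d"
    then have p: "p \<in> chart_dom c" "p \<in> chart_dom d" by auto
    have "(\<lambda>n. \<alpha> n c p) \<longlonglongrightarrow> \<beta> d p * transition c d p"
      unfolding form_transition[OF hf cd p] by (intro tendsto_intros lim cd p)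
    with lim[OF cd(1) p(1)] show "\<beta> c p = \<beta> d p * deriv (coord d \<circ> chart_inv c) (coord c p)"
      unfolding transition_def by (rule LIMSEQ_unique)
  qed
  have plim: "(\<lambda>n. pull (\<alpha> n) x) \<longlonglongrightarrow> pull \<beta> x" if "x \<in> space \<mu>" for x
    unfolding pull_def using lim[OF P_atlas] piece_dom[of x] that by auto
  have mea: "(\<lambda>x. (norm (pull \<alpha>' x))\<^sup>2) \<in> borel_measurable \<mu>" if "holomorphic_form A \<alpha>'" for \<alpha>'
    by (rule borel_measurable_power[OF measurable_compose[OF form_pull_measurable[OF that] borel_measurable_norm]])
  have hd: "holomorphic_form A (\<lambda>c p. \<alpha> n c p - \<beta> c p)" for n
    using holomorphic_form_comb[OF hf[of n] \<beta>, of 1 "-1"] by simp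
  text \<open>Fatou's lemma, letting the second index tend to infinity.\<close>
  have fatou: "(\<integral>\<^sup>+x. ennreal ((norm (pull (\<lambda>c p. \<alpha> n c p - \<beta> c p) x))\<^sup>2) \<partial>\<mu>) \<le> ennreal (1 / real (Suc n))" for n
  proof -
    have nd: "(norm (pull (\<lambda>c p. \<alpha> m c p - \<alpha> n c p) x))\<^sup>2 = (norm (pull (\<alpha> n) x - pull (\<alpha> m) x))\<^sup>2" for m x
      by (simp add: pull_def norm_minus_commute)
    have "(\<integral>\<^sup>+x. ennreal ((norm (pull (\<lambda>c p. \<alpha> n c p - \<beta> c p) x))\<^sup>2) \<partial>\<mu>)
       = (\<integral>\<^sup>+x. liminf (\<lambda>m. ennreal ((norm (pull (\<alpha> n) x - pull (\<alpha> m) x))\<^sup>2)) \<partial>\<mu>)"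
    proof (rule nn_integral_cong)
      fix x assume x: "x \<in> space \<mu>"
      have "(\<lambda>m. ennreal ((norm (pull (\<alpha> n) x - pull (\<alpha> m) x))\<^sup>2)) \<longlonglongrightarrow> ennreal ((norm (pull (\<alpha> n) x - pull \<beta> x))\<^sup>2)"
        by (intro tendsto_ennrealI tendsto_intros plim[OF x])
      from lim_imp_Liminf[OF _ this] show "ennreal ((norm (pull (\<lambda>c p. \<alpha> n c p - \<beta> c p) x))\<^sup>2) =
          liminf (\<lambda>m. ennreal ((norm (pull (\<alpha> n) x - pull (\<alpha> m) x))\<^sup>2))"
        by (simp add: pull_def)
    qed
    also have "\<dots> \<le> liminf (\<lambda>m. \<integral>\<^sup>+x. ennreal ((norm (pull (\<alpha> n) x - pull (\<alpha> m) x))\<^sup>2) \<partial>\<mu>)"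
    proof (rule nn_integral_liminf)
      fix m
      have "(\<lambda>x. ennreal ((norm (pull (\<lambda>c p. \<alpha> m c p - \<alpha> n c p) x))\<^sup>2)) \<in> borel_measurable \<mu>"
        using mea[of "\<lambda>c p. \<alpha> m c p - \<alpha> n c p"] dL by (intro measurable_compose[OF _ measurable_ennreal]) (auto simp: L2_iff)
      then show "(\<lambda>x. ennreal ((norm (pull (\<alpha> n) x - pull (\<alpha> m) x))\<^sup>2)) \<in> borel_measurable \<mu>" unfolding nd .
    qed
    also have "\<dots> \<le> ennreal (1 / real (Suc n))"
    proof (rule Liminf_le)
      show "\<forall>\<^sub>F m in sequentially. (\<integral>\<^sup>+x. ennreal ((norm (pull (\<alpha> n) x - pull (\<alpha> m) x))\<^sup>2) \<partial>\<mu>) \<le> ennreal (1 / real (Suc n))"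
        unfolding eventually_sequentially
      proof (intro exI[of _ n] allI impI)
        fix m assume "n \<le> m"
        have "(\<integral>\<^sup>+x. ennreal ((norm (pull (\<lambda>c p. \<alpha> m c p - \<alpha> n c p) x))\<^sup>2) \<partial>\<mu>) = ennreal (LINT x|\<mu>. (norm (pull (\<lambda>c p. \<alpha> m c p - \<alpha> n c p) x))\<^sup>2)"
          by (rule nn_integral_eq_integral) (use dL in \<open>auto simp: L2_iff\<close>)
        also have "\<dots> \<le> ennreal (1 / real (Suc n))" by (rule ennreal_leI[OF cau[OF \<open>n \<le> m\<close>]])
        finally show "(\<integral>\<^sup>+x. ennreal ((norm (pull (\<alpha> n) x - pull (\<alpha> m) x))\<^sup>2) \<partial>\<mu>) \<le> ennreal (1 / real (Suc n))" unfolding nd .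
      qed
    qed simp
    finally show ?thesis .
  qed
  have dL2: "(\<lambda>c p. \<alpha> n c p - \<beta> c p) \<in> L2_forms X A" for n
    unfolding L2_iff
  proof (intro conjI hd)
    have "(\<integral>\<^sup>+x. ennreal (norm ((norm (pull (\<lambda>c p. \<alpha> n c p - \<beta> c p) x))\<^sup>2)) \<partial>\<mu>) < \<infinity>"
      using le_less_trans[OF fatou[of n] ennreal_less_top] by simp
    then show "integrable \<mu> (\<lambda>x. (norm (pull (\<lambda>c p. \<alpha> n c p - \<beta> c p) x))\<^sup>2)"
      using mea[OF hd[of n]] by (simp add: integrable_iff_bounded)
  qed
  have "\<beta> \<in> L2_forms X A" using L2_diff[OF \<alpha>[of 0] dL2[of 0]] by simp
  moreover have "(\<lambda>n. semi_hilbert.sqn (form_inner X A) (\<lambda>c p. \<alpha> n c p - \<beta> c p)) \<longlonglongrightarrow> 0"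
  proof (rule tendsto_sandwich[OF _ _ tendsto_const LIMSEQ_inverse_real_of_nat])
    have "(LINT x|\<mu>. (norm (pull (\<lambda>c p. \<alpha> n c p - \<beta> c p) x))\<^sup>2) \<le> inverse (real (Suc n))" for n
    proof -
      have "ennreal (LINT x|\<mu>. (norm (pull (\<lambda>c p. \<alpha> n c p - \<beta> c p) x))\<^sup>2) = (\<integral>\<^sup>+x. ennreal ((norm (pull (\<lambda>c p. \<alpha> n c p - \<beta> c p) x))\<^sup>2) \<partial>\<mu>)"
        by (rule nn_integral_eq_integral[symmetric]) (use dL2[of n] in \<open>auto simp: L2_iff\<close>)
      with fatou[of n] have "ennreal (LINT x|\<mu>. (norm (pull (\<lambda>c p. \<alpha> n c p - \<beta> c p) x))\<^sup>2) \<le> ennreal (1 / real (Suc n))" by (simp only:)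
      then show ?thesis by (subst (asm) ennreal_le_iff) (simp_all add: inverse_eq_divide)
    qed
    then show "\<forall>\<^sub>F n in sequentially. semi_hilbert.sqn (form_inner X A) (\<lambda>c p. \<alpha> n c p - \<beta> c p) \<le> inverse (real (Suc n))"
      by (simp add: sqn_eq[OF dL2])
    show "\<forall>\<^sub>F n in sequentially. 0 \<le> semi_hilbert.sqn (form_inner X A) (\<lambda>c p. \<alpha> n c p - \<beta> c p)"
      by (simp add: sqn_eq[OF dL2])
  qed
  ultimately show ?thesis by blast
qed

lemma complete_orthonormal_basis_iff:
  "complete_orthonormal_basis X A E \<longleftrightarrow> semi_hilbert.dense_basis (L2_forms X A) (form_inner X A) E"
proof -
  interpret H: semi_hilbert "L2_forms X A" "form_inner X A" by (rule semi_hilbert)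
  have fn: "form_norm X A \<alpha> < \<epsilon> \<longleftrightarrow> H.sqn \<alpha> < \<epsilon>\<^sup>2" if "\<epsilon> > 0" for \<alpha> and \<epsilon> :: real
    unfolding form_norm_def H.sqn_def using real_sqrt_less_iff[of "Re (form_inner X A \<alpha> \<alpha>)" "\<epsilon>\<^sup>2"] that by simp
  show ?thesis
    unfolding complete_orthonormal_basis_def H.dense_basis_def H.orthonormal_def conj_assoc
  proof (intro conj_cong refl ball_cong iffI allI impI)
    fix \<alpha> and \<epsilon> :: real
    assume h: "\<forall>\<epsilon>>0. \<exists>F u. finite F \<and> F \<subseteq> E \<and> form_norm X A (\<lambda>c p. \<alpha> c p - (\<Sum>e\<in>F. u e * e c p)) < \<epsilon>" and "\<epsilon> > 0"
    then have "sqrt \<epsilon> > 0" by simp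
    with h obtain F u where "finite F \<and> F \<subseteq> E \<and> form_norm X A (\<lambda>c p. \<alpha> c p - (\<Sum>e\<in>F. u e * e c p)) < sqrt \<epsilon>" by blast
    then show "\<exists>F u. finite F \<and> F \<subseteq> E \<and> H.sqn (\<lambda>c p. \<alpha> c p - (\<Sum>e\<in>F. u e * e c p)) < \<epsilon>"
      using fn[OF \<open>sqrt \<epsilon> > 0\<close>] \<open>\<epsilon> > 0\<close> by (intro exI[of _ F] exI[of _ u]) simp
  next
    fix \<alpha> and \<epsilon> :: real
    assume h: "\<forall>\<epsilon>>0. \<exists>F u. finite F \<and> F \<subseteq> E \<and> H.sqn (\<lambda>c p. \<alpha> c p - (\<Sum>e\<in>F. u e * e c p)) < \<epsilon>" and \<epsilon>: "\<epsilon> > 0"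
    then have "\<epsilon>\<^sup>2 > 0" by simp
    with h obtain F u where "finite F \<and> F \<subseteq> E \<and> H.sqn (\<lambda>c p. \<alpha> c p - (\<Sum>e\<in>F. u e * e c p)) < \<epsilon>\<^sup>2" by blast
    then show "\<exists>F u. finite F \<and> F \<subseteq> E \<and> form_norm X A (\<lambda>c p. \<alpha> c p - (\<Sum>e\<in>F. u e * e c p)) < \<epsilon>"
      using fn[OF \<epsilon>] by (intro exI[of _ F] exI[of _ u]) simp
  qed
qed

definition basis :: "'a form set" where "basis = (SOME E. complete_orthonormal_basis X A E)"

lemma basis: "complete_orthonormal_basis X A basis"
proof -
  have "\<exists>E. complete_orthonormal_basis X A E"
    unfolding complete_orthonormal_basis_iff by (rule semi_hilbert.ex_dense_basis[OF semi_hilbert L2_complete])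
  then show ?thesis unfolding basis_def by (rule someI_ex)
qed

lemma bergman_kernel_basis: "bergman_kernel X A c p = (\<Sum>\<^sub>\<infinity>e\<in>basis. (norm (e c p))\<^sup>2)"
  by (simp add: bergman_kernel_def basis_def)

end

section \<open>The polarized Bergman kernel\<close>

context partitioned_surface
begin

sublocale H: semi_hilbert "L2_forms X A" "form_inner X A"
  by (rule semi_hilbert)

lemma basis_orthonormal: "H.orthonormal basis"
  using basis unfolding complete_orthonormal_basis_iff H.dense_basis_def by blast

lemma basis_L2: "e \<in> basis \<Longrightarrow> e \<in> L2_forms X A"
  using basis_orthonormal by (auto simp: H.orthonormal_def)

lemma basis_form: "e \<in> basis \<Longrightarrow> holomorphic_form A e"
  using basis_L2 by (auto simp: L2_forms_def)

text \<open>The extremal form for evaluation at \<open>z\<close> is the combination of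
  \<open>F\<close> with the conjugate values as coefficients. Its value at \<open>z\<close> and its
  squared norm both equal the sum \<open>s\<close> in question, so the evaluation bound reads
  \<open>s^2 \<le> C * s\<close>.\<close>

lemma basis_local_bound:
  assumes c: "c \<in> A" and z: "z0 \<in> coord c ` chart_dom c"
  obtains r C where "r > 0" "C > 0" "cball z0 r \<subseteq> coord c ` chart_dom c"
    "\<And>F z. finite F \<Longrightarrow> F \<subseteq> basis \<Longrightarrow> z \<in> cball z0 r \<Longrightarrow> (\<Sum>e\<in>F. (norm (e c (chart_inv c z)))\<^sup>2) \<le> C"
proof -
  obtain r C where r: "r > 0" "C > 0" "cball z0 r \<subseteq> coord c ` chart_dom c"
    "\<And>\<alpha> z. \<alpha> \<in> L2_forms X A \<Longrightarrow> z \<in> cball z0 r \<Longrightarrow> (norm (\<alpha> c (chart_inv c z)))\<^sup>2 \<le> C * (LINT x|\<mu>. (norm (pull \<alpha> x))\<^sup>2)"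
    using form_eval_local_bound[OF c z] by metis
  show thesis
  proof (rule that[OF r(1-3)])
    fix F z assume F: "finite F" "F \<subseteq> basis" and z: "z \<in> cball z0 r"
    define u where "u e = cnj (e c (chart_inv c z))" for e :: "'a form"
    define s where "s = (\<Sum>e\<in>F. (norm (e c (chart_inv c z)))\<^sup>2)"
    have FV: "F \<subseteq> L2_forms X A" using F basis_L2 by blast
    have L: "H.lsum F u \<in> L2_forms X A" by (rule H.lsum_in[OF F(1) FV])
    have "H.sqn (\<lambda>c p. H.lsum F u c p - H.lsum F u c p) = H.sqn (H.lsum F u) - (\<Sum>e\<in>F. (norm (form_inner X A (H.lsum F u) e))\<^sup>2)
        + (\<Sum>e\<in>F. (norm (u e - form_inner X A (H.lsum F u) e))\<^sup>2)"
      by (rule H.sqn_diff_lsum[OF basis_orthonormal F L])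
    moreover have "form_inner X A (H.lsum F u) e = u e" if "e \<in> F" for e
      using H.ip_lsum_orthonormal[OF basis_orthonormal F, of e u] that F by auto
    moreover have "H.sqn (\<lambda>c p. 0) = 0" using H.ip_zero[OF H.zero] by (simp add: H.sqn_def)
    ultimately have "H.sqn (H.lsum F u) = (\<Sum>e\<in>F. (norm (u e))\<^sup>2)" by simp
    then have sq: "(LINT x|\<mu>. (norm (pull (H.lsum F u) x))\<^sup>2) = s"
      using sqn_eq[OF L] by (simp add: s_def u_def)
    have "H.lsum F u c (chart_inv c z) = of_real s"
      unfolding s_def u_def of_real_sum complex_norm_square by (simp add: mult.commute)
    then have "s\<^sup>2 \<le> C * s" using r(4)[OF L z] unfolding sq by simp
    moreover have "s \<ge> 0" unfolding s_def by (intro sum_nonneg) auto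
    ultimately have "s \<le> C" using r(2) unfolding power2_eq_square by (cases "s = 0") auto
    then show "(\<Sum>e\<in>F. (norm (e c (chart_inv c z)))\<^sup>2) \<le> C" by (simp add: s_def)
  qed
qed

lemma basis_summable:
  assumes c: "c \<in> A" and p: "p \<in> chart_dom c"
  shows "(\<lambda>e. (norm (e c p))\<^sup>2) summable_on basis"
proof -
  have "coord c p \<in> coord c ` chart_dom c" using p by blast
  from basis_local_bound[OF c this] obtain r C where r: "r > 0"
    "\<And>F z. finite F \<Longrightarrow> F \<subseteq> basis \<Longrightarrow> z \<in> cball (coord c p) r \<Longrightarrow> (\<Sum>e\<in>F. (norm (e c (chart_inv c z)))\<^sup>2) \<le> C" by metis
  have "(\<Sum>e\<in>F. (norm (e c p))\<^sup>2) \<le> C" if "finite F" "F \<subseteq> basis" for F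
    using r(2)[OF that, of "coord c p"] r(1) chart_inv_coord[OF chart[OF c] p] by simp
  then show ?thesis by (intro nonneg_bdd_above_summable_on bdd_aboveI2[of _ _ C]) auto
qed

definition ker :: "'a chart \<Rightarrow> 'a chart \<Rightarrow> 'a \<Rightarrow> 'a \<Rightarrow> complex" where
  "ker c d p q = (\<Sum>\<^sub>\<infinity>e\<in>basis. e c p * cnj (e d q))"

text \<open>The conjugate in the second coordinate makes this holomorphic, not antiholomorphic, in
  \<open>w\<close>; the diagonal is \<open>w = cnj z\<close>.\<close>

definition kernel :: "'a chart \<Rightarrow> 'a chart \<Rightarrow> complex \<Rightarrow> complex \<Rightarrow> complex" where
  "kernel c d z w = ker c d (chart_inv c z) (chart_inv d (cnj w))"

lemma norm_mult_le_squares: "norm (a * b :: complex) \<le> ((norm a)\<^sup>2 + (norm b)\<^sup>2) / 2"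
proof -
  have "0 \<le> (norm a - norm b)\<^sup>2" by simp
  then show ?thesis by (simp add: norm_mult power2_diff)
qed

lemma ker_abs_summable:
  assumes "c \<in> A" "p \<in> chart_dom c" "d \<in> A" "q \<in> chart_dom d"
  shows "(\<lambda>e. norm (e c p * cnj (e d q))) summable_on basis"
proof (rule summable_on_comparison_test)
  show "(\<lambda>e. ((norm (e c p))\<^sup>2 + (norm (e d q))\<^sup>2) * (1 / 2)) summable_on basis"
    by (intro summable_on_cmult_left summable_on_add basis_summable assms)
  show "norm (e c p * cnj (e d q)) \<le> ((norm (e c p))\<^sup>2 + (norm (e d q))\<^sup>2) * (1 / 2)" for e
    using norm_mult_le_squares[of "e c p" "cnj (e d q)"] by simp
qed auto

lemma ker_hermitian: "ker c d p q = cnj (ker d c q p)"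
  unfolding ker_def infsum_cnj[symmetric] by (simp add: mult.commute)

lemma ker_transition:
  assumes "c \<in> A" "p \<in> chart_dom c" "d \<in> A" "p \<in> chart_dom d"
  shows "ker c b p q = transition c d p * ker d b p q"
proof -
  have "ker c b p q = (\<Sum>\<^sub>\<infinity>e\<in>basis. transition c d p * (e d p * cnj (e b q)))"
    unfolding ker_def
  proof (rule infsum_cong)
    fix e assume "e \<in> basis"
    from form_transition[OF basis_form[OF this] assms(1,3,2,4)]
    show "e c p * cnj (e b q) = transition c d p * (e d p * cnj (e b q))" by simp
  qed
  then show ?thesis unfolding ker_def by (simp add: infsum_cmult_right')
qed

lemma ker_diagonal:
  assumes "c \<in> A" "p \<in> chart_dom c"
  shows "ker c c p p = of_real (bergman_kernel X A c p)"
proof -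
  have "((\<lambda>e. complex_of_real ((norm (e c p))\<^sup>2)) has_sum of_real (bergman_kernel X A c p)) basis"
    unfolding bergman_kernel_basis by (intro has_sum_of_real has_sum_infsum basis_summable assms)
  then show ?thesis unfolding ker_def complex_norm_square by (rule infsumI)
qed

text \<open>The finite partial sums converge uniformly near \<open>z0\<close>. In the tail, the
  squares of the first factors have sums bounded uniformly in \<open>z\<close>, while those of the
  second have a small sum at the fixed point \<open>q\<close>.\<close>

lemma kernel_holomorphic1:
  assumes c: "c \<in> A" and d: "d \<in> A" and q: "q \<in> chart_dom d"
  shows "(\<lambda>z. ker c d (chart_inv c z) q) holomorphic_on coord c ` chart_dom c"
  unfolding holomorphic_on_open[OF chart_open[OF chart[OF c]]]
proof (intro ballI)
  fix z0 assume z0: "z0 \<in> coord c ` chart_dom c"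
  obtain r C where r: "r > 0" "C > 0" "cball z0 r \<subseteq> coord c ` chart_dom c"
    and bd: "\<And>F z. finite F \<Longrightarrow> F \<subseteq> basis \<Longrightarrow> z \<in> cball z0 r \<Longrightarrow> (\<Sum>e\<in>F. (norm (e c (chart_inv c z)))\<^sup>2) \<le> C"
    using basis_local_bound[OF c z0] by metis
  define f where "f F z = (\<Sum>e\<in>F. e c (chart_inv c z) * cnj (e d q))" for F z
  have zin: "chart_inv c z \<in> chart_dom c" if "z \<in> cball z0 r" for z using chart_inv_in[of z c] r(3) that by blast
  have Ef: "\<forall>\<^sub>F F in finite_subsets_at_top basis. finite F \<and> F \<subseteq> basis"
    unfolding eventually_finite_subsets_at_top by blast
  have "uniform_limit (cball z0 r) f (\<lambda>z. ker c d (chart_inv c z) q) (finite_subsets_at_top basis)"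
  proof (rule uniform_limitI)
    fix \<epsilon> :: real assume \<epsilon>: "\<epsilon> > 0"
    \<comment> \<open>The weight in
      \<open>|x y| \<le> \<delta> |x|^2 / 2 + |y|^2 / (2 \<delta>)\<close>: the first parts sum to
      at most \<open>\<epsilon> / 2\<close>, and a tail below \<open>\<epsilon> * \<delta>\<close>
      leaves less than \<open>\<epsilon> / 2\<close> for the second.\<close>
    define \<delta> where "\<delta> = \<epsilon> / C"
    have \<delta>: "\<delta> > 0" using \<epsilon> r by (simp add: \<delta>_def)
    define b where "b e = (norm (e d q))\<^sup>2" for e :: "'a form"
    have bs: "b summable_on basis" unfolding b_def by (rule basis_summable[OF d q])
    have "eventually (\<lambda>F. dist (sum b F) (infsum b basis) < \<epsilon> * \<delta>) (finite_subsets_at_top basis)"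
      using has_sum_infsum[OF bs] \<epsilon> \<delta> unfolding has_sum_def by (intro tendstoD) auto
    then show "\<forall>\<^sub>F F in finite_subsets_at_top basis. \<forall>z\<in>cball z0 r. dist (f F z) (ker c d (chart_inv c z) q) < \<epsilon>"
      using Ef
    proof eventually_elim
      case (elim F)
      then have F: "finite F" "F \<subseteq> basis" by auto
      show ?case
      proof
        fix z assume z: "z \<in> cball z0 r"
        define a where "a e = (norm (e c (chart_inv c z)))\<^sup>2" for e :: "'a form"
        define t where "t e = e c (chart_inv c z) * cnj (e d q)" for e :: "'a form"
        have as: "a summable_on basis" unfolding a_def by (rule basis_summable[OF c zin[OF z]])
        have ts: "(\<lambda>e. norm (t e)) summable_on basis" unfolding t_def by (rule ker_abs_summable[OF c zin[OF z] d q])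
        have sub: "g summable_on (basis - F)" if "g summable_on basis" for g :: "'a form \<Rightarrow> real"
          using summable_on_subset_banach[OF that] by blast
        have eq: "infsum g basis = sum g F + infsum g (basis - F)" if "g summable_on basis" for g :: "'a form \<Rightarrow> 'b :: banach"
        proof -
          have "infsum g (F \<union> (basis - F)) = infsum g F + infsum g (basis - F)"
            by (rule infsum_Un_disjoint) (use F that summable_on_subset_banach[OF that] in auto)
          moreover have "F \<union> (basis - F) = basis" using F by blast
          ultimately show ?thesis using F by simp
        qed
        have "dist (f F z) (ker c d (chart_inv c z) q) = norm (infsum t (basis - F))"
          using eq[OF abs_summable_summable[OF ts]] unfolding f_def ker_def t_def[symmetric] by (simp add: dist_norm)
        also have "\<dots> \<le> infsum (\<lambda>e. norm (t e)) (basis - F)"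
          by (rule norm_infsum_bound) (use sub[OF ts] in simp)
        also have "\<dots> \<le> infsum (\<lambda>e. \<delta> / 2 * a e + 1 / (2 * \<delta>) * b e) (basis - F)"
        proof (rule infsum_mono[OF sub[OF ts]])
          show "(\<lambda>e. \<delta> / 2 * a e + 1 / (2 * \<delta>) * b e) summable_on (basis - F)"
            by (intro summable_on_add summable_on_cmult_right sub as bs)
          fix e
          define s where "s = sqrt \<delta>"
          have s: "s > 0" "s\<^sup>2 = \<delta>" using \<delta> by (auto simp: s_def)
          have "norm (t e) = norm ((of_real s * e c (chart_inv c z)) * (of_real (1 / s) * cnj (e d q)))"
            using s by (simp add: t_def norm_mult)
          also have "\<dots> \<le> ((norm (of_real s * e c (chart_inv c z)))\<^sup>2 + (norm (of_real (1 / s) * cnj (e d q)))\<^sup>2) / 2"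
            by (rule norm_mult_le_squares)
          also have "\<dots> = \<delta> / 2 * a e + 1 / (2 * \<delta>) * b e"
            using s by (simp add: a_def b_def norm_mult power_mult_distrib norm_divide power_divide add_divide_distrib)
          finally show "norm (t e) \<le> \<delta> / 2 * a e + 1 / (2 * \<delta>) * b e" .
        qed
        also have "\<dots> = \<delta> / 2 * infsum a (basis - F) + 1 / (2 * \<delta>) * infsum b (basis - F)"
          unfolding infsum_add[OF summable_on_cmult_right[OF sub[OF as]] summable_on_cmult_right[OF sub[OF bs]]] infsum_cmult_right' ..
        also have "\<dots> < \<epsilon>"
        proof -
          have "infsum a (basis - F) \<le> C"
            by (rule infsum_le_finite_sums[OF sub[OF as]]) (use bd z in \<open>auto simp: a_def\<close>)
          then have 1: "\<delta> / 2 * infsum a (basis - F) \<le> \<epsilon> / 2"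
            using \<delta> r(2) mult_left_mono[of "infsum a (basis - F)" C "\<delta> / 2"] by (simp add: \<delta>_def)
          have "0 \<le> infsum b (basis - F)" by (rule infsum_nonneg) (simp add: b_def)
          then have "infsum b (basis - F) < \<epsilon> * \<delta>" using elim eq[OF bs] by (simp add: dist_real_def)
          then have 2: "1 / (2 * \<delta>) * infsum b (basis - F) < \<epsilon> / 2" using \<delta> by (simp add: field_simps)
          show ?thesis using 1 2 by linarith
        qed
        finally show "dist (f F z) (ker c d (chart_inv c z) q) < \<epsilon>" .
      qed
    qed
  qed
  moreover have "\<forall>\<^sub>F F in finite_subsets_at_top basis. continuous_on (cball z0 r) (f F) \<and> f F holomorphic_on ball z0 r"
    using Ef
  proof eventually_elim
    case (elim F)
    have "f F holomorphic_on coord c ` chart_dom c"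
      unfolding f_def using elim by (intro holomorphic_intros form_holomorphic[OF basis_form c]) auto
    then show ?case using r(3) ball_subset_cball[of z0 r]
      by (meson holomorphic_on_imp_continuous_on holomorphic_on_subset order_trans)
  qed
  ultimately have "(\<lambda>z. ker c d (chart_inv c z) q) holomorphic_on ball z0 r"
    using holomorphic_uniform_limit[of z0 r f "finite_subsets_at_top basis"] by auto
  then show "\<exists>f'. ((\<lambda>z. ker c d (chart_inv c z) q) has_field_derivative f') (at z0)"
    using r(1) by (meson centre_in_ball holomorphic_on_open open_ball)
qed

text \<open>Hermitian symmetry carries holomorphy from the first variable over to the second, and
  bounding products by squares gives the local bound for \<open>hol2I_bounded\<close>.\<close>

lemma kernel_hol2:
  assumes c: "c \<in> A" and d: "d \<in> A"
  shows "hol2 (coord c ` chart_dom c) (cnj ` coord d ` chart_dom d) (kernel c d)"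
proof (rule hol2I_bounded)
  show "open (coord c ` chart_dom c)" "open (cnj ` coord d ` chart_dom d)"
    using chart_open chart c d open_cnj_image by blast+
  show "(\<lambda>z. kernel c d z w) holomorphic_on coord c ` chart_dom c" if "w \<in> cnj ` coord d ` chart_dom d" for w
  proof -
    have "cnj w \<in> coord d ` chart_dom d" using that by (simp only: cnj_image_iff)
    then show ?thesis unfolding kernel_def by (intro kernel_holomorphic1[OF c d] chart_inv_in)
  qed
  show "(\<lambda>w. kernel c d z w) holomorphic_on cnj ` coord d ` chart_dom d" if z: "z \<in> coord c ` chart_dom c" for z
  proof -
    have "(\<lambda>w. cnj (ker d c (chart_inv d (cnj w)) (chart_inv c z))) holomorphic_on cnj ` coord d ` chart_dom d"
      by (rule cnj_holomorphic[OF kernel_holomorphic1[OF d c chart_inv_in[OF z]] chart_open[OF chart[OF d]]])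
    then show ?thesis unfolding kernel_def by (subst ker_hermitian)
  qed
  fix z0 w0 assume z0: "z0 \<in> coord c ` chart_dom c" and w0: "w0 \<in> cnj ` coord d ` chart_dom d"
  obtain r C where r: "r > 0" "C > 0" "cball z0 r \<subseteq> coord c ` chart_dom c"
    and bd: "\<And>F z. finite F \<Longrightarrow> F \<subseteq> basis \<Longrightarrow> z \<in> cball z0 r \<Longrightarrow> (\<Sum>e\<in>F. (norm (e c (chart_inv c z)))\<^sup>2) \<le> C"
    using basis_local_bound[OF c z0] by metis
  have "cnj w0 \<in> coord d ` chart_dom d" using w0 by (simp only: cnj_image_iff)
  from basis_local_bound[OF d this] obtain r' C' where r': "r' > 0" "C' > 0" "cball (cnj w0) r' \<subseteq> coord d ` chart_dom d"
    and bd': "\<And>F z. finite F \<Longrightarrow> F \<subseteq> basis \<Longrightarrow> z \<in> cball (cnj w0) r' \<Longrightarrow> (\<Sum>e\<in>F. (norm (e d (chart_inv d z)))\<^sup>2) \<le> C'"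
    by metis
  have "norm (kernel c d z w) \<le> (C + C') / 2" if z: "z \<in> cball z0 (min r r')" and w: "w \<in> cball w0 (min r r')" for z w
  proof -
    have zr: "z \<in> cball z0 r" using z by simp
    have "dist (cnj w0) (cnj w) = dist w0 w" unfolding dist_norm by (metis complex_cnj_diff complex_mod_cnj)
    then have wr: "cnj w \<in> cball (cnj w0) r'" using w by simp
    have p: "chart_inv c z \<in> chart_dom c" using chart_inv_in[of z c] r(3) zr by blast
    have q: "chart_inv d (cnj w) \<in> chart_dom d" using chart_inv_in[of "cnj w" d] r'(3) wr by blast
    note ts = ker_abs_summable[OF c p d q]
    have "norm (kernel c d z w) \<le> infsum (\<lambda>e. norm (e c (chart_inv c z) * cnj (e d (chart_inv d (cnj w))))) basis"
      unfolding kernel_def ker_def by (rule norm_infsum_bound[OF ts])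
    also have "\<dots> \<le> (C + C') / 2"
    proof (rule infsum_le_finite_sums[OF ts])
      fix F assume F: "finite F" "F \<subseteq> basis"
      have "(\<Sum>e\<in>F. norm (e c (chart_inv c z) * cnj (e d (chart_inv d (cnj w)))))
        \<le> (\<Sum>e\<in>F. ((norm (e c (chart_inv c z)))\<^sup>2 + (norm (cnj (e d (chart_inv d (cnj w)))))\<^sup>2) / 2)"
        by (intro sum_mono norm_mult_le_squares)
      also have "\<dots> = ((\<Sum>e\<in>F. (norm (e c (chart_inv c z)))\<^sup>2) + (\<Sum>e\<in>F. (norm (e d (chart_inv d (cnj w))))\<^sup>2)) / 2"
        by (simp add: sum.distrib sum_divide_distrib[symmetric])
      also have "\<dots> \<le> (C + C') / 2" using bd[OF F zr] bd'[OF F wr] by simp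
      finally show "(\<Sum>e\<in>F. norm (e c (chart_inv c z) * cnj (e d (chart_inv d (cnj w))))) \<le> (C + C') / 2" .
    qed
    finally show ?thesis .
  qed
  then show "\<exists>r>0. \<exists>M. \<forall>z'\<in>cball z0 r \<inter> coord c ` chart_dom c. \<forall>w'\<in>cball w0 r \<inter> cnj ` coord d ` chart_dom d. norm (kernel c d z' w') \<le> M"
    using r(1) r'(1) by (intro exI[of _ "min r r'"] conjI exI[of _ "(C + C') / 2"]) auto
qed

lemma kernel_diagonal:
  assumes "c \<in> A" "z \<in> coord c ` chart_dom c"
  shows "kernel c c z (cnj z) = of_real (bergman_kernel X A c (chart_inv c z))"
  unfolding kernel_def complex_cnj_cnj by (rule ker_diagonal[OF assms(1) chart_inv_in[OF assms(2)]])

lemma bergman_kernel_transition: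
  assumes "c \<in> A" "p \<in> chart_dom c" "d \<in> A" "p \<in> chart_dom d"
  shows "bergman_kernel X A c p = (norm (transition c d p))\<^sup>2 * bergman_kernel X A d p"
proof -
  have "ker c c p p = transition c d p * cnj (transition c d p * ker d d p p)"
    using ker_transition[OF assms, of c p] ker_transition[OF assms, of d p] ker_hermitian[of d c p p] by simp
  then have "complex_of_real (bergman_kernel X A c p) = of_real ((norm (transition c d p))\<^sup>2 * bergman_kernel X A d p)"
    unfolding ker_diagonal[OF assms(1,2)] ker_diagonal[OF assms(3,4)] of_real_mult complex_norm_square by simp
  then show ?thesis by (simp only: of_real_eq_iff)
qed

end

section \<open>The map to the disc\<close>

text \<open>Where \<open>f\<close> has a zero, \<open>|h / f|\<close> would tend to \<open>1\<close> from below, against the maximum principle.\<close>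

lemma no_zero_by_maximum_principle:
  fixes f h :: "complex \<Rightarrow> complex" and K :: "complex \<Rightarrow> real"
  assumes f: "f holomorphic_on ball z1 r" and h: "h holomorphic_on ball z1 r" and r: "r > 0"
    and K: "continuous_on (ball z1 r) K" "\<And>z. z \<in> ball z1 r \<Longrightarrow> K z > 0"
    and id: "\<And>z. z \<in> ball z1 r \<Longrightarrow> K z * ((norm (f z))\<^sup>2 - (norm (h z))\<^sup>2)\<^sup>2 = norm (f z) ^ 6"
    and near: "\<And>\<rho>. \<rho> > 0 \<Longrightarrow> \<exists>z\<in>ball z1 \<rho>. norm (h z) < norm (f z)"
  shows "norm (h z1) < norm (f z1)"
proof (cases "f z1 = 0")
  case False
  have z1: "z1 \<in> ball z1 r" using r by simp
  show ?thesis
  proof (rule ccontr)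
    assume "\<not> norm (h z1) < norm (f z1)"
    \<comment> \<open>Equality would make the left side of the identity vanish, but not the
      right.\<close>
    moreover have "norm (h z1) \<noteq> norm (f z1)" using id[OF z1] False by auto
    ultimately have gt: "0 < norm (h z1) - norm (f z1)" by simp
    define u where "u z = norm (h z) - norm (f z)" for z
    have "continuous_on (ball z1 r) u" unfolding u_def
      by (intro continuous_intros holomorphic_on_imp_continuous_on f h)
    then have "(u \<longlongrightarrow> u z1) (at z1)"
      using z1 by (simp add: continuous_on_eq_continuous_at isCont_def)
    then have "(u \<longlongrightarrow> u z1) (nhds z1)" by (simp add: tendsto_at_iff_tendsto_nhds)
    moreover have "0 < u z1" using gt by (simp add: u_def)
    ultimately have "eventually (\<lambda>z. 0 < u z) (nhds z1)" by (rule order_tendstoD(1))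
    then obtain \<rho> where \<rho>: "\<rho> > 0" "\<And>z. dist z z1 < \<rho> \<Longrightarrow> 0 < u z"
      unfolding eventually_nhds_metric by blast
    obtain z where "z \<in> ball z1 \<rho>" "norm (h z) < norm (f z)" using near[OF \<rho>(1)] by blast
    then show False using \<rho>(2)[of z] by (simp add: dist_commute u_def)
  qed
next
  case True
  have z1: "z1 \<in> ball z1 r" using r by simp
  obtain b where b: "b \<in> ball z1 r" "f b \<noteq> 0" using near[OF r] by force
  have "\<forall>\<^sub>F w in at z1. f w \<noteq> 0 \<and> w \<in> ball z1 r"
    by (rule non_zero_neighbour_alt[OF f open_ball connected_ball z1 b])
  then obtain s where s: "s > 0" "\<And>w. w \<noteq> z1 \<Longrightarrow> dist w z1 < s \<Longrightarrow> f w \<noteq> 0 \<and> w \<in> ball z1 r"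
    unfolding eventually_at by blast
  define B where "B = ball z1 s - {z1}"
  have Bf: "f w \<noteq> 0" "w \<in> ball z1 r" if "w \<in> B" for w using s(2)[of w] that by (auto simp: B_def dist_commute)
  define T where "T w = h w / f w" for w
  have Tsq: "K w * (1 - (norm (T w))\<^sup>2)\<^sup>2 = (norm (f w))\<^sup>2" if "w \<in> B" for w
  proof -
    have n: "norm (f w) \<noteq> 0" using Bf[OF that] by simp
    have e: "(norm (f w))\<^sup>2 - (norm (h w))\<^sup>2 = (norm (f w))\<^sup>2 * (1 - (norm (T w))\<^sup>2)"
      using n by (simp add: T_def norm_divide power_divide field_simps)
    have "(K w * (1 - (norm (T w))\<^sup>2)\<^sup>2) * norm (f w) ^ 4 = (norm (f w))\<^sup>2 * norm (f w) ^ 4"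
      using id[OF Bf(2)[OF that]] unfolding e by algebra
    moreover have "norm (f w) ^ 4 \<noteq> 0" using n by simp
    ultimately show ?thesis by (metis mult_right_cancel)
  qed
  have T1: "norm (T w) \<noteq> 1" if "w \<in> B" for w using Tsq[OF that] Bf(1)[OF that] by auto
  have TB: "T holomorphic_on B" unfolding T_def
    by (intro holomorphic_intros holomorphic_on_subset[OF f] holomorphic_on_subset[OF h]) (use Bf in auto)
  obtain z2 where z2: "z2 \<in> ball z1 s" "norm (h z2) < norm (f z2)" using near[OF s(1)] by blast
  have z2B: "z2 \<in> B" using z2 True by (auto simp: B_def)
  have T2: "norm (T z2) < 1" using z2 by (simp add: T_def norm_divide divide_less_eq)
  have conB: "connected B" unfolding B_def
    by (intro connected_open_delete) auto
  \<comment> \<open>The punctured disc is connected, and \<open>norm (T w)\<close> never takes the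
    value \<open>1\<close> on it and is smaller at \<open>z2\<close>.\<close>
  have Tlt: "norm (T w) < 1" if w: "w \<in> B" for w
  proof (rule ccontr)
    assume "\<not> norm (T w) < 1"
    then have "norm (T w) > 1" using T1[OF w] by simp
    moreover have "connected ((\<lambda>w. norm (T w)) ` B)"
      by (intro connected_continuous_image conB continuous_intros holomorphic_on_imp_continuous_on TB)
    ultimately have "1 \<in> (\<lambda>w. norm (T w)) ` B"
      using connectedD_interval[of "(\<lambda>w. norm (T w)) ` B" "norm (T z2)" "norm (T w)" 1] T2 z2B w by auto
    then show False using T1 by auto
  qed
  have "\<exists>c. (T \<longlongrightarrow> c) (at z1)"
  proof -
    obtain G where G: "G holomorphic_on ball z1 s" "\<And>z. z \<in> ball z1 s - {z1} \<Longrightarrow> G z = T z"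
    proof -
      have "eventually (\<lambda>z. norm (T z) \<le> 1) (at z1)"
        unfolding eventually_at using s(1) Tlt by (intro exI[of _ s]) (auto simp: B_def dist_commute less_imp_le)
      then have "\<exists>B. \<forall>\<^sub>F z in at z1. norm (T z) \<le> B" by blast
      then show thesis
        using holomorphic_on_extend_bounded[of T "ball z1 s" z1] TB s(1) that unfolding B_def by auto
    qed
    have "(G \<longlongrightarrow> G z1) (at z1)"
      using holomorphic_on_imp_continuous_on[OF G(1)] s(1) by (simp add: continuous_on_eq_continuous_at isCont_def)
    moreover have "eventually (\<lambda>z. G z = T z) (at z1)"
      unfolding eventually_at using s(1) G(2) by (intro exI[of _ s]) (auto simp: dist_commute)
    ultimately show ?thesis using tendsto_cong by blast
  qed
  then obtain c where c: "(T \<longlongrightarrow> c) (at z1)" by blast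
  define G where "G w = (if w = z1 then c else T w)" for w
  have G: "G holomorphic_on ball z1 s"
    unfolding G_def by (rule removable_singularity[OF TB[unfolded B_def] open_ball c])
  have evB: "eventually (\<lambda>w. w \<in> B) (at z1)"
    unfolding eventually_at using s(1) by (intro exI[of _ s]) (auto simp: B_def dist_commute)
  \<comment> \<open>In the limit the identity becomes \<open>K z1 * (1 - |c|^2)^2 = 0\<close>, where
    \<open>K z1\<close> is positive.\<close>
  have c1: "norm c = 1"
  proof -
    have Kl: "(K \<longlongrightarrow> K z1) (at z1)" using K(1) z1 by (simp add: continuous_on_eq_continuous_at isCont_def)
    have fl: "(f \<longlongrightarrow> f z1) (at z1)" using holomorphic_on_imp_continuous_on[OF f] z1 by (simp add: continuous_on_eq_continuous_at isCont_def)
    have l1: "((\<lambda>w. K w * (1 - (norm (T w))\<^sup>2)\<^sup>2) \<longlongrightarrow> K z1 * (1 - (norm c)\<^sup>2)\<^sup>2) (at z1)"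
      by (intro tendsto_intros Kl c)
    have l2: "((\<lambda>w. (norm (f w))\<^sup>2) \<longlongrightarrow> (norm (f z1))\<^sup>2) (at z1)" by (intro tendsto_intros fl)
    have ev: "eventually (\<lambda>w. K w * (1 - (norm (T w))\<^sup>2)\<^sup>2 = (norm (f w))\<^sup>2) (at z1)"
      using evB by eventually_elim (rule Tsq)
    have "K z1 * (1 - (norm c)\<^sup>2)\<^sup>2 = (norm (f z1))\<^sup>2"
      by (rule tendsto_unique[OF at_neq_bot l1 tendsto_cong[OF ev, THEN iffD2, OF l2]])
    then have "(norm c)\<^sup>2 = 1" using True K(2)[OF z1] by simp
    then show ?thesis by (metis abs_norm_cancel power2_eq_1_iff abs_1 abs_minus_cancel)
  qed
  have "G constant_on ball z1 s"
  proof (rule maximum_modulus_principle[OF G open_ball connected_ball open_ball order_refl])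
    show "z1 \<in> ball z1 s" using s(1) by simp
    show "norm (G z) \<le> norm (G z1)" if "z \<in> ball z1 s" for z
      using Tlt[of z] that c1 by (auto simp: G_def B_def less_imp_le)
  qed
  then have "G z2 = G z1" using z2(1) s(1) unfolding constant_on_def by auto
  then have "T z2 = c" using z2B by (auto simp: G_def B_def split: if_splits)
  then show ?thesis using T2 c1 by simp
qed

section \<open>Continuation of the local formula and construction of \<open>T\<close>\<close>

locale bergman_hyperbolic = partitioned_surface +
  assumes metric_exists: "bergman_metric_exists X A"
    and curvature: "\<And>c p. c \<in> A \<Longrightarrow> p \<in> chart_dom c \<Longrightarrow> gaussian_curvature (bergman_metric X A) c p = - 2"
begin

lemma kernel_pos: "c \<in> A \<Longrightarrow> p \<in> chart_dom c \<Longrightarrow> bergman_kernel X A c p > 0"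
  and metric_pos: "c \<in> A \<Longrightarrow> p \<in> chart_dom c \<Longrightarrow> bergman_metric X A c p > 0"
  using metric_exists unfolding bergman_metric_exists_def by blast+

lemma metric_eq:
  assumes "z \<in> coord c ` chart_dom c"
  shows "bergman_metric X A c (chart_inv c z) = d2_dw_dwbar (\<lambda>z. ln (bergman_kernel X A c (chart_inv c z))) z"
  unfolding bergman_metric_def coord_chart_inv[OF assms] ..

lemma curvature_eq:
  assumes c: "c \<in> A" and z: "z \<in> coord c ` chart_dom c"
  shows "d2_dw_dwbar (\<lambda>z. ln (bergman_metric X A c (chart_inv c z))) z = bergman_metric X A c (chart_inv c z)"
proof -
  have "bergman_metric X A c (chart_inv c z) > 0" by (rule metric_pos[OF c chart_inv_in[OF z]])
  then show ?thesis
    using curvature[OF c chart_inv_in[OF z]] unfolding gaussian_curvature_def coord_chart_inv[OF z]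
    by (simp add: field_simps)
qed

theorem ex_disc_map:
  obtains T p\<^sub>0 where "p\<^sub>0 \<in> topspace X" "T p\<^sub>0 = 0"
    "\<And>c. c \<in> A \<Longrightarrow> (\<lambda>z. T (chart_inv c z)) holomorphic_on coord c ` chart_dom c"
    "\<And>p. p \<in> topspace X \<Longrightarrow> norm (T p) < 1"
    "\<And>c p. c \<in> A \<Longrightarrow> p \<in> chart_dom c \<Longrightarrow>
       bergman_metric X A c p = 2 * (norm (deriv (\<lambda>z. T (chart_inv c z)) (coord c p)))\<^sup>2 / (1 - (norm (T p))\<^sup>2)\<^sup>2"
proof -
  obtain p0 where p0X: "p0 \<in> topspace X" using nonempty by blast
  then obtain c0 where c0: "c0 \<in> A" and p0: "p0 \<in> chart_dom c0" using chart_cover by blast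
  let ?G = "kernel c0 c0"
  define z0 where "z0 = coord c0 p0"
  define w0 where "w0 = cnj z0"
  define K0 where "K0 = bergman_kernel X A c0 p0"
  define g0 where "g0 = bergman_metric X A c0 p0"
  have K0: "K0 > 0" and g0: "g0 > 0" using kernel_pos[OF c0 p0] metric_pos[OF c0 p0] by (auto simp: K0_def g0_def)
  have z0: "z0 \<in> coord c0 ` chart_dom c0" using p0 by (simp add: z0_def)
  have inv0: "chart_inv c0 z0 = p0" unfolding z0_def by (rule chart_inv_coord[OF chart[OF c0] p0])
  have w0: "w0 \<in> cnj ` coord c0 ` chart_dom c0" using z0 unfolding w0_def by blast
  obtain r where r: "r > 0" "ball z0 r \<subseteq> coord c0 ` chart_dom c0"
    and nz: "\<And>z. z \<in> ball z0 r \<Longrightarrow> ?G z (cnj z0) \<noteq> 0"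
    and loc: "\<And>z a. z \<in> ball z0 r \<Longrightarrow> a = D2 ?G z (cnj z0) / ?G z (cnj z0) - D2 ?G z0 (cnj z0) / of_real (bergman_kernel X A c0 (chart_inv c0 z0)) \<Longrightarrow>
       bergman_kernel X A c0 (chart_inv c0 z) * bergman_kernel X A c0 (chart_inv c0 z0) * (1 - (norm a)\<^sup>2 / (2 * bergman_metric X A c0 (chart_inv c0 z0)))\<^sup>2 = (norm (?G z (cnj z0)))\<^sup>2"
    by (rule bergman_local[OF kernel_hol2[OF c0 c0] z0 kernel_diagonal[OF c0] kernel_pos[OF c0 chart_inv_in] metric_eq
        metric_pos[OF c0 chart_inv_in] curvature_eq[OF c0]]) auto
  \<comment> \<open>\<open>\<tau>\<close> is subtracted so that \<open>T\<close> vanishes at the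
    base point, and \<open>\<kappa>\<close> absorbs the factor \<open>1 / (2 * g0)\<close> of the
    local formula.\<close>
  define \<tau> where "\<tau> = D2 ?G z0 w0 / of_real K0"
  define \<kappa> where "\<kappa> = 1 / sqrt (2 * g0)"
  have \<kappa>: "\<kappa>\<^sup>2 = 1 / (2 * g0)" using g0 by (simp add: \<kappa>_def power_divide)
  \<comment> \<open>With the second point and its chart \<open>c0\<close> held fixed,
    \<open>k\<close>, \<open>dk\<close> and \<open>m\<close> transform like 1-forms in
    \<open>p\<close>, so their quotients are independent of the chart \<open>c\<close>.\<close>
  define k where "k c p = ker c c0 p p0" for c p
  define dk where "dk c p = D2 (kernel c c0) (coord c p) w0" for c p
  define m where "m c p = of_real \<kappa> * (dk c p - \<tau> * k c p)" for c p
  have k_trans: "k c p = transition c d p * k d p" if "c \<in> A" "p \<in> chart_dom c" "d \<in> A" "p \<in> chart_dom d" for c d p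
    unfolding k_def by (rule ker_transition[OF that])
  have dk_trans: "dk c p = transition c d p * dk d p" if h: "c \<in> A" "p \<in> chart_dom c" "d \<in> A" "p \<in> chart_dom d" for c d p
  proof -
    have "kernel c c0 (coord c p) w = transition c d p * kernel d c0 (coord d p) w" for w
      unfolding kernel_def chart_inv_coord[OF chart[OF h(1)] h(2)] chart_inv_coord[OF chart[OF h(3)] h(4)]
      by (rule ker_transition[OF h])
    then have "dk c p = deriv (\<lambda>w. transition c d p * kernel d c0 (coord d p) w) w0" by (simp add: dk_def D2_def)
    also have "\<dots> = transition c d p * dk d p"
    proof (rule DERIV_imp_deriv, rule DERIV_cmult)
      show "((\<lambda>w. kernel d c0 (coord d p) w) has_field_derivative dk d p) (at w0)"
        unfolding dk_def by (rule hol2_D2[OF kernel_hol2[OF h(3) c0] _ w0]) (use h in blast)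
    qed
    finally show ?thesis .
  qed
  have m_trans: "m c p = transition c d p * m d p" if "c \<in> A" "p \<in> chart_dom c" "d \<in> A" "p \<in> chart_dom d" for c d p
    unfolding m_def k_trans[OF that] dk_trans[OF that] by (simp add: algebra_simps)
  have k_hol: "(\<lambda>z. k c (chart_inv c z)) holomorphic_on coord c ` chart_dom c" if "c \<in> A" for c
    unfolding k_def by (rule kernel_holomorphic1[OF that c0 p0])
  have dk_hol: "(\<lambda>z. dk c (chart_inv c z)) holomorphic_on coord c ` chart_dom c" if "c \<in> A" for c
  proof -
    have "(\<lambda>z. D2 (kernel c c0) z w0) holomorphic_on coord c ` chart_dom c"
      by (rule hol2_holomorphic1[OF hol2_hol2_D2[OF kernel_hol2[OF that c0]] w0])
    then show ?thesis by (rule holomorphic_transform) (simp add: dk_def coord_chart_inv)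
  qed
  have m_hol: "(\<lambda>z. m c (chart_inv c z)) holomorphic_on coord c ` chart_dom c" if "c \<in> A" for c
    unfolding m_def by (intro holomorphic_intros k_hol dk_hol that)
  \<comment> \<open>The local formula multiplied by the fourth power of the norm of
    \<open>k\<close>. No quotient remains, and both sides scale by the sixth power of the norm of
    the transition factor, so the truth of \<open>Id\<close> does not depend on the chart.\<close>
  define Id where "Id c p \<longleftrightarrow> bergman_kernel X A c p * K0 * ((norm (k c p))\<^sup>2 - (norm (m c p))\<^sup>2)\<^sup>2 = norm (k c p) ^ 6" for c p
  have Id_trans: "Id c p" if h: "c \<in> A" "p \<in> chart_dom c" "d \<in> A" "p \<in> chart_dom d" "Id d p" for c d p
  proof -
    define t where "t = norm (transition c d p)"
    have "bergman_kernel X A c p * K0 * ((norm (k c p))\<^sup>2 - (norm (m c p))\<^sup>2)\<^sup>2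
      = t ^ 6 * (bergman_kernel X A d p * K0 * ((norm (k d p))\<^sup>2 - (norm (m d p))\<^sup>2)\<^sup>2)"
      unfolding bergman_kernel_transition[OF h(1-4)] k_trans[OF h(1-4)] m_trans[OF h(1-4)] norm_mult t_def[symmetric]
      by algebra
    also have "\<dots> = t ^ 6 * norm (k d p) ^ 6" using h(5) by (simp add: Id_def)
    also have "\<dots> = norm (k c p) ^ 6" unfolding k_trans[OF h(1-4)] norm_mult t_def[symmetric] by (simp add: power_mult_distrib)
    finally show ?thesis by (simp add: Id_def)
  qed
  have Id_near: "Id c0 p" if p: "p \<in> chart_dom c0" "coord c0 p \<in> ball z0 r" for p
  proof -
    define z where "z = coord c0 p"
    have iz: "chart_inv c0 z = p" unfolding z_def by (rule chart_inv_coord[OF chart[OF c0] p(1)])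
    have kz: "?G z w0 = k c0 p" unfolding kernel_def k_def iz w0_def complex_cnj_cnj inv0 ..
    have k0: "k c0 p \<noteq> 0" using nz[of z] p kz by (simp add: z_def w0_def)
    define a where "a = dk c0 p / k c0 p - \<tau>"
    have ma: "m c0 p = of_real \<kappa> * (k c0 p * a)" unfolding m_def a_def using k0 by (simp add: field_simps)
    have "bergman_kernel X A c0 p * K0 * (1 - (norm a)\<^sup>2 / (2 * g0))\<^sup>2 = (norm (k c0 p))\<^sup>2"
      using loc[of z a] p unfolding a_def \<tau>_def dk_def w0_def[symmetric] kz inv0 iz K0_def g0_def by (simp add: z_def)
    moreover have "(norm (m c0 p))\<^sup>2 = (norm (k c0 p))\<^sup>2 * ((norm a)\<^sup>2 / (2 * g0))"
      unfolding ma norm_mult power_mult_distrib norm_of_real power2_abs \<kappa> by simp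
    then have "(norm (k c0 p))\<^sup>2 - (norm (m c0 p))\<^sup>2 = (norm (k c0 p))\<^sup>2 * (1 - (norm a)\<^sup>2 / (2 * g0))"
      by (simp add: algebra_simps)
    then have "bergman_kernel X A c0 p * K0 * ((norm (k c0 p))\<^sup>2 - (norm (m c0 p))\<^sup>2)\<^sup>2
      = norm (k c0 p) ^ 4 * (bergman_kernel X A c0 p * K0 * (1 - (norm a)\<^sup>2 / (2 * g0))\<^sup>2)"
      by (simp add: power_mult_distrib flip: power_mult)
    ultimately show ?thesis unfolding Id_def by (simp flip: power_add)
  qed
  \<comment> \<open>Openness is built into the definition, so the work lies in showing
    closedness.\<close>
  define Z where "Z = {q. \<exists>V. openin X V \<and> q \<in> V \<and> (\<forall>p\<in>V. \<forall>c\<in>A. p \<in> chart_dom c \<longrightarrow> Id c p)}"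
  have "Z = topspace X"
  proof (rule connected_induct)
    show "openin X Z"
    proof (subst openin_subopen, intro ballI)
      fix q assume "q \<in> Z"
      then obtain V where "openin X V" "q \<in> V" "\<forall>p\<in>V. \<forall>c\<in>A. p \<in> chart_dom c \<longrightarrow> Id c p" by (auto simp: Z_def)
      then show "\<exists>T. openin X T \<and> q \<in> T \<and> T \<subseteq> Z" by (intro exI[of _ V]) (auto simp: Z_def)
    qed
    define V where "V = {p \<in> chart_dom c0. coord c0 p \<in> ball z0 r}"
    have "openin X V" unfolding V_def by (rule chart_preimage_open[OF chart[OF c0] open_ball])
    moreover have "p0 \<in> V" using p0 r(1) by (simp add: V_def z0_def)
    moreover have "Id c p" if "p \<in> V" "c \<in> A" "p \<in> chart_dom c" for c p
      by (rule Id_trans[OF that(2,3) c0]) (use that Id_near in \<open>auto simp: V_def\<close>)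
    ultimately have "p0 \<in> Z" unfolding Z_def by blast
    then show "Z \<noteq> {}" by blast
    fix q assume q: "q \<in> topspace X" and near: "\<And>V. openin X V \<Longrightarrow> q \<in> V \<Longrightarrow> V \<inter> Z \<noteq> {}"
    obtain c where c: "c \<in> A" "q \<in> chart_dom c" using chart_cover[OF q] by blast
    obtain \<rho> where \<rho>: "\<rho> > 0" "ball (coord c q) \<rho> \<subseteq> coord c ` chart_dom c"
      using chart_open[OF chart[OF c(1)]] c(2) open_contains_ball by blast
    define B where "B = ball (coord c q) \<rho>"
    define V' where "V' = {p \<in> chart_dom c. coord c p \<in> B}"
    have V': "openin X V'" unfolding V'_def B_def by (rule chart_preimage_open[OF chart[OF c(1)] open_ball])
    have qV': "q \<in> V'" using c \<rho>(1) by (simp add: V'_def B_def)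
    obtain p1 where p1: "p1 \<in> V'" "p1 \<in> Z" using near[OF V' qV'] by blast
    then obtain V1 where V1: "openin X V1" "p1 \<in> V1" "\<And>p c. p \<in> V1 \<Longrightarrow> c \<in> A \<Longrightarrow> p \<in> chart_dom c \<Longrightarrow> Id c p"
      by (auto simp: Z_def)
    define W where "W = coord c ` (chart_dom c \<inter> (V' \<inter> V1))"
    have W: "open W" unfolding W_def by (rule chart_image_open[OF chart[OF c(1)] openin_Int[OF V' V1(1)]])
    have Wne: "W \<noteq> {}" using p1 V1(2) unfolding W_def V'_def by blast
    have WB: "W \<subseteq> B" by (auto simp: W_def V'_def)
    define f where "f z = k c (chart_inv c z)" for z
    define h where "h z = m c (chart_inv c z)" for z
    define f' where "f' w = cnj (f (cnj w))" for w
    define h' where "h' w = cnj (h (cnj w))" for w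
    have fh: "f holomorphic_on B" "h holomorphic_on B"
      unfolding f_def h_def using k_hol[OF c(1)] m_hol[OF c(1)] \<rho>(2) holomorphic_on_subset by (auto simp: B_def)
    have B: "open B" "connected B" "open (cnj ` B)" by (auto simp: B_def open_cnj_image simp del: cnj_image_iff)
    have fh': "f' holomorphic_on cnj ` B" "h' holomorphic_on cnj ` B"
      unfolding f'_def h'_def by (intro cnj_holomorphic fh B)+
    \<comment> \<open>The polarization of \<open>Id\<close> in the chart \<open>c\<close>: each
      squared norm becomes a product of a function of \<open>z\<close> and one of \<open>w\<close>.
      Only even powers of norms occur in \<open>Id\<close>, which is what permits this.\<close>
    define Q where "Q z w = kernel c c z w * of_real K0 * (f z * f' w - h z * h' w) ^ 2 - (f z * f' w) ^ 3" for z w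
    have hk: "hol2 B (cnj ` B) (kernel c c)"
      by (rule hol2_subset[OF kernel_hol2[OF c(1) c(1)] B(1,3)]) (use \<rho>(2) in \<open>auto simp: B_def intro!: image_mono simp del: cnj_image_iff\<close>)
    have hQ: "hol2 B (cnj ` B) Q"
      unfolding Q_def[abs_def] by (intro hol2_diff hol2_mult hol2_power hk hol2_const hol2_fst hol2_snd fh fh' B)
    have Qd: "Q z (cnj z) = of_real (bergman_kernel X A c (chart_inv c z) * K0 * ((norm (f z))\<^sup>2 - (norm (h z))\<^sup>2)\<^sup>2 - norm (f z) ^ 6)"
      if "z \<in> B" for z
    proof -
      have zU: "z \<in> coord c ` chart_dom c" using that \<rho>(2) by (auto simp: B_def)
      have e: "f z * f' (cnj z) = of_real ((norm (f z))\<^sup>2)" "h z * h' (cnj z) = of_real ((norm (h z))\<^sup>2)"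
        unfolding f'_def h'_def complex_cnj_cnj complex_norm_square by simp_all
      have "norm (f z) ^ 6 = ((norm (f z))\<^sup>2) ^ 3" by (simp flip: power_mult)
      then show ?thesis unfolding Q_def e kernel_diagonal[OF c(1) zU] by simp
    qed
    have "Q z (cnj z) = 0" if "z \<in> W" for z
    proof -
      obtain p where p: "p \<in> chart_dom c" "p \<in> V1" "z = coord c p" using \<open>z \<in> W\<close> by (auto simp: W_def)
      have "Id c p" by (rule V1(3)[OF p(2) c(1) p(1)])
      then show ?thesis using Qd[of z] that WB p chart_inv_coord[OF chart[OF c(1)] p(1)]
        by (auto simp: Id_def f_def h_def)
    qed
    from polarization[OF hQ B(2) W Wne WB this]
    have Q0: "Q z (cnj z) = 0" if "z \<in> B" for z using that by simp
    have "Id c p" if "p \<in> V'" for p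
    proof -
      have "p \<in> chart_dom c" "coord c p \<in> B" using that by (auto simp: V'_def)
      then show ?thesis using Q0[of "coord c p"] Qd[of "coord c p"] chart_inv_coord[OF chart[OF c(1)], of p]
        by (auto simp: Id_def f_def h_def simp flip: of_real_mult of_real_diff of_real_power)
    qed
    then have "Id d p" if "p \<in> V'" "d \<in> A" "p \<in> chart_dom d" for d p
      using Id_trans[OF that(2,3) c(1), of] that(1) by (auto simp: V'_def)
    then show "q \<in> Z" unfolding Z_def using V' qV' by blast
  qed
  then have Id: "Id c p" if "c \<in> A" "p \<in> chart_dom c" for c p
    using that in_topspace[OF that] unfolding Z_def by blast
  \<comment> \<open>\<open>Id\<close> fixes the difference of the squared norms only up to sign. It
    is positive at \<open>p0\<close>, and this has to be propagated.\<close>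
  define Y where "Y = {q \<in> topspace X. \<exists>c\<in>A. q \<in> chart_dom c \<and> norm (m c q) < norm (k c q)}"
  have Y_chart: "norm (m c q) < norm (k c q)" if cq: "c \<in> A" "q \<in> chart_dom c" "q \<in> Y" for c q
  proof -
    obtain d where d: "d \<in> A" "q \<in> chart_dom d" "norm (m d q) < norm (k d q)" using cq(3) unfolding Y_def by blast
    have "transition c d q \<noteq> 0"
      by (rule transition_nonzero[OF chart[OF cq(1)] chart[OF d(1)] cq(2) d(2) holomorphic_transition[OF cq(1) d(1)]])
    then show ?thesis unfolding k_trans[OF cq(1,2) d(1,2)] m_trans[OF cq(1,2) d(1,2)] norm_mult
      using d(3) by simp
  qed
  have "Y = topspace X"
  proof (rule connected_induct)
    show "openin X Y"
    proof (subst openin_subopen, intro ballI)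
      fix q assume q: "q \<in> Y"
      then obtain c where c: "c \<in> A" "q \<in> chart_dom c" using chart_cover by (auto simp: Y_def)
      define f where "f z = norm (k c (chart_inv c z)) - norm (m c (chart_inv c z))" for z
      have "continuous_on (coord c ` chart_dom c) f"
        unfolding f_def by (intro continuous_intros holomorphic_on_imp_continuous_on k_hol m_hol c)
      from continuous_open_preimage[OF this chart_open[OF chart[OF c(1)]] open_greaterThan[of 0]]
      have "open (f -` {0<..} \<inter> coord c ` chart_dom c)" by (simp only: Int_commute)
      from chart_preimage_open[OF chart[OF c(1)] this]
      have o: "openin X {p \<in> chart_dom c. coord c p \<in> f -` {0<..} \<inter> coord c ` chart_dom c}" .
      have e: "coord c p \<in> f -` {0<..} \<inter> coord c ` chart_dom c \<longleftrightarrow> norm (m c p) < norm (k c p)" if "p \<in> chart_dom c" for p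
        using that chart_inv_coord[OF chart[OF c(1)] that] by (simp add: f_def)
      show "\<exists>T. openin X T \<and> q \<in> T \<and> T \<subseteq> Y"
      proof (intro exI conjI)
        show "q \<in> {p \<in> chart_dom c. coord c p \<in> f -` {0<..} \<inter> coord c ` chart_dom c}"
          using c e[OF c(2)] Y_chart[OF c q] by blast
        show "{p \<in> chart_dom c. coord c p \<in> f -` {0<..} \<inter> coord c ` chart_dom c} \<subseteq> Y"
          using e c in_topspace[OF c(1)] unfolding Y_def by blast
      qed (rule o)
    qed
    have k0: "k c0 p0 = of_real K0" unfolding k_def K0_def by (rule ker_diagonal[OF c0 p0])
    have "m c0 p0 = 0" unfolding m_def k0 \<tau>_def using K0 by (simp add: dk_def z0_def)
    then have "p0 \<in> Y" using p0X c0 p0 k0 K0 unfolding Y_def by auto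
    then show "Y \<noteq> {}" by blast
    fix q assume q: "q \<in> topspace X" and near: "\<And>V. openin X V \<Longrightarrow> q \<in> V \<Longrightarrow> V \<inter> Y \<noteq> {}"
    obtain c where c: "c \<in> A" "q \<in> chart_dom c" using chart_cover[OF q] by blast
    obtain \<rho> where \<rho>: "\<rho> > 0" "ball (coord c q) \<rho> \<subseteq> coord c ` chart_dom c"
      using chart_open[OF chart[OF c(1)]] c(2) open_contains_ball by blast
    have inv: "chart_inv c (coord c q) = q" by (rule chart_inv_coord[OF chart[OF c(1)] c(2)])
    have "norm (m c (chart_inv c (coord c q))) < norm (k c (chart_inv c (coord c q)))"
    proof (rule no_zero_by_maximum_principle[of _ "coord c q" \<rho> _ "\<lambda>z. bergman_kernel X A c (chart_inv c z) * K0"])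
      show "(\<lambda>z. k c (chart_inv c z)) holomorphic_on ball (coord c q) \<rho>" "(\<lambda>z. m c (chart_inv c z)) holomorphic_on ball (coord c q) \<rho>"
        using k_hol[OF c(1)] m_hol[OF c(1)] \<rho>(2) holomorphic_on_subset by blast+
      show "\<rho> > 0" by (rule \<rho>)
      have in_dom: "chart_inv c z \<in> chart_dom c" if "z \<in> ball (coord c q) \<rho>" for z using chart_inv_in[of z c] that \<rho>(2) by blast
      show "continuous_on (ball (coord c q) \<rho>) (\<lambda>z. bergman_kernel X A c (chart_inv c z) * K0)"
      proof -
        have "continuous_on (coord c ` chart_dom c) ((\<lambda>(z, w). kernel c c z w) \<circ> (\<lambda>z. (z, cnj z)))"
          by (intro continuous_on_compose continuous_intros continuous_on_subset[OF hol2_continuous[OF kernel_hol2[OF c(1) c(1)]]]) auto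
        then have "continuous_on (coord c ` chart_dom c) (\<lambda>z. Re (kernel c c z (cnj z)))"
          by (auto intro!: continuous_intros simp: o_def)
        then have "continuous_on (ball (coord c q) \<rho>) (\<lambda>z. Re (kernel c c z (cnj z)) * K0)"
          by (intro continuous_on_mult_right) (rule continuous_on_subset[OF _ \<rho>(2)])
        moreover have "Re (kernel c c z (cnj z)) * K0 = bergman_kernel X A c (chart_inv c z) * K0" if "z \<in> ball (coord c q) \<rho>" for z
          using kernel_diagonal[OF c(1), of z] that \<rho>(2) by auto
        ultimately show ?thesis by (simp cong: continuous_on_cong_simp)
      qed
      show "0 < bergman_kernel X A c (chart_inv c z) * K0" if "z \<in> ball (coord c q) \<rho>" for z
        using kernel_pos[OF c(1) in_dom[OF that]] K0 by simp
      show "bergman_kernel X A c (chart_inv c z) * K0 * ((norm (k c (chart_inv c z)))\<^sup>2 - (norm (m c (chart_inv c z)))\<^sup>2)\<^sup>2 = norm (k c (chart_inv c z)) ^ 6"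
        if "z \<in> ball (coord c q) \<rho>" for z
        using Id[OF c(1) in_dom[OF that]] unfolding Id_def .
      fix s :: real assume s: "s > 0"
      have "openin X {p \<in> chart_dom c. coord c p \<in> ball (coord c q) s}" by (rule chart_preimage_open[OF chart[OF c(1)] open_ball])
      moreover have "q \<in> {p \<in> chart_dom c. coord c p \<in> ball (coord c q) s}" using c s by simp
      ultimately obtain p where p: "p \<in> chart_dom c" "coord c p \<in> ball (coord c q) s" "p \<in> Y" using near by blast
      show "\<exists>z\<in>ball (coord c q) s. norm (m c (chart_inv c z)) < norm (k c (chart_inv c z))"
        by (rule bexI[OF _ p(2)]) (use Y_chart[OF c(1) p(1,3)] chart_inv_coord[OF chart[OF c(1)] p(1)] in simp)
    qed
    then show "q \<in> Y" using q c unfolding inv Y_def by blast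
  qed
  then have lt: "norm (m c p) < norm (k c p)" if "c \<in> A" "p \<in> chart_dom c" for c p
    using Y_chart[OF that] in_topspace[OF that] by blast
  define T where "T p = (let c = (SOME c. c \<in> A \<and> p \<in> chart_dom c) in m c p / k c p)" for p
  have T: "T p = m c p / k c p" if c: "c \<in> A" "p \<in> chart_dom c" for c p
  proof -
    define d where "d = (SOME c. c \<in> A \<and> p \<in> chart_dom c)"
    have d: "d \<in> A" "p \<in> chart_dom d" using someI[of "\<lambda>c. c \<in> A \<and> p \<in> chart_dom c" c] c unfolding d_def by auto
    have "transition d c p \<noteq> 0"
      by (rule transition_nonzero[OF chart[OF d(1)] chart[OF c(1)] d(2) c(2) holomorphic_transition[OF d(1) c(1)]])
    then show ?thesis unfolding T_def d_def[symmetric] Let_def k_trans[OF d c] m_trans[OF d c] by simp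
  qed
  have T_hol: "(\<lambda>z. T (chart_inv c z)) holomorphic_on coord c ` chart_dom c" if c: "c \<in> A" for c
  proof -
    have "(\<lambda>z. m c (chart_inv c z) / k c (chart_inv c z)) holomorphic_on coord c ` chart_dom c"
      by (intro holomorphic_intros m_hol k_hol c) (use lt[OF c chart_inv_in] in fastforce)
    then show ?thesis by (rule holomorphic_transform) (simp add: T[OF c chart_inv_in])
  qed
  have T_lt: "norm (T p) < 1" if pX: "p \<in> topspace X" for p
  proof -
    obtain c where c: "c \<in> A" "p \<in> chart_dom c" using chart_cover[OF pX] by blast
    have "norm (k c p) > 0" using lt[OF c] norm_ge_zero[of "m c p"] by linarith
    then show ?thesis using lt[OF c] unfolding T[OF c] norm_divide by (simp add: divide_less_eq)
  qed
  have "k c0 p0 = of_real K0" unfolding k_def K0_def by (rule ker_diagonal[OF c0 p0])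
  then have "m c0 p0 = 0" unfolding m_def \<tau>_def using K0 by (simp add: dk_def z0_def)
  then have T0: "T p0 = 0" using T[OF c0 p0] by simp
  show thesis
  proof (rule that[OF p0X T0 T_hol T_lt])
    fix c p assume c: "c \<in> A" "p \<in> chart_dom c"
    have in_dom: "chart_inv c z \<in> chart_dom c" if "z \<in> coord c ` chart_dom c" for z by (rule chart_inv_in[OF that])
    have pU: "coord c p \<in> coord c ` chart_dom c" using c by blast
    have knz: "k c (chart_inv c z) \<noteq> 0" if "z \<in> coord c ` chart_dom c" for z
      using lt[OF c(1) in_dom[OF that]] by auto
    have "d2_dw_dwbar (\<lambda>z. ln (bergman_kernel X A c (chart_inv c z))) (coord c p)
      = 2 * (norm (deriv (\<lambda>z. T (chart_inv c z)) (coord c p)))\<^sup>2 / (1 - (norm (T (chart_inv c (coord c p))))\<^sup>2)\<^sup>2"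
    proof (rule d2_ln_pullback[where k = "\<lambda>z. k c (chart_inv c z)" and C = "1 / K0", OF k_hol[OF c(1)] T_hol[OF c(1)] chart_open[OF chart[OF c(1)]] pU knz])
      show "norm (T (chart_inv c z)) < 1" if "z \<in> coord c ` chart_dom c" for z
        by (rule T_lt[OF in_topspace[OF c(1) in_dom[OF that]]])
      show "0 < 1 / K0" using K0 by simp
      fix z assume z: "z \<in> coord c ` chart_dom c"
      let ?p = "chart_inv c z"
      have n: "norm (k c ?p) \<noteq> 0" using knz[OF z] by simp
      have lt1: "(norm (T ?p))\<^sup>2 < 1" using T_lt[OF in_topspace[OF c(1) in_dom[OF z]]] by (simp add: power_less_one_iff abs_square_less_1)
      have e: "(norm (k c ?p))\<^sup>2 - (norm (m c ?p))\<^sup>2 = (norm (k c ?p))\<^sup>2 * (1 - (norm (T ?p))\<^sup>2)"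
        using n unfolding T[OF c(1) in_dom[OF z]] norm_divide power_divide by (simp add: field_simps)
      have "(bergman_kernel X A c ?p * K0 * (1 - (norm (T ?p))\<^sup>2)\<^sup>2) * norm (k c ?p) ^ 4 = (norm (k c ?p))\<^sup>2 * norm (k c ?p) ^ 4"
        using Id[OF c(1) in_dom[OF z]] unfolding Id_def e by algebra
      moreover have "norm (k c ?p) ^ 4 \<noteq> 0" using n by simp
      ultimately have "bergman_kernel X A c ?p * K0 * (1 - (norm (T ?p))\<^sup>2)\<^sup>2 = (norm (k c ?p))\<^sup>2" by (metis mult_right_cancel)
      then show "bergman_kernel X A c ?p = 1 / K0 * (norm (k c ?p))\<^sup>2 / (1 - (norm (T ?p))\<^sup>2)\<^sup>2"
        using lt1 K0 by (simp add: field_simps)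
    qed
    then show "bergman_metric X A c p = 2 * (norm (deriv (\<lambda>z. T (chart_inv c z)) (coord c p)))\<^sup>2 / (1 - (norm (T p))\<^sup>2)\<^sup>2"
      unfolding bergman_metric_def chart_inv_coord[OF chart[OF c(1)] c(2)] .
  qed
qed

end

section \<open>Lengths of curves in the disc\<close>

lemma finite_AE_not_in: "finite S \<Longrightarrow> AE t in lborel. t \<notin> (S :: real set)"
  using AE_not_in[OF finite_imp_null_set_lborel] by blast

text \<open>Length for the metric \<open>2 |dz|\<^sup>2 / (1 - |z|\<^sup>2)\<^sup>2\<close>, which has curvature \<open>-2\<close>.\<close>

definition hlen :: "(real \<Rightarrow> complex) \<Rightarrow> ennreal" where
  "hlen \<eta> = (\<integral>\<^sup>+t\<in>{0..1}. ennreal (sqrt 2 * norm (vector_derivative \<eta> (at t)) / (1 - (norm (\<eta> t))\<^sup>2)) \<partial>lborel)"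

text \<open>Finite sets are null sets, so any derivative known off a finite set may replace
  \<open>vector_derivative\<close>.\<close>

lemma hlen_eq:
  assumes "finite S" "\<And>t. t \<in> {0..1} - S \<Longrightarrow> (\<eta> has_vector_derivative D t) (at t)"
  shows "hlen \<eta> = (\<integral>\<^sup>+t\<in>{0..1} - S. ennreal (sqrt 2 * norm (D t) / (1 - (norm (\<eta> t))\<^sup>2)) \<partial>lborel)"
  unfolding hlen_def
proof (rule nn_integral_cong_AE)
  show "AE t in lborel. ennreal (sqrt 2 * norm (vector_derivative \<eta> (at t)) / (1 - (norm (\<eta> t))\<^sup>2)) * indicator {0..1} t =
     ennreal (sqrt 2 * norm (D t) / (1 - (norm (\<eta> t))\<^sup>2)) * indicator ({0..1} - S) t"
    using finite_AE_not_in[OF assms(1)]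
  proof eventually_elim
    case (elim t)
    show ?case
    proof (cases "t \<in> {0..1}")
      case True
      then show ?thesis using elim vector_derivative_at[OF assms(2), of t] by simp
    qed (auto simp: indicator_def)
  qed
qed

lemma speed_measurable:
  fixes \<eta> D :: "real \<Rightarrow> complex"
  assumes S: "finite S" and D: "continuous_on ({0..1} - S) D" and \<eta>: "continuous_on {0..1} \<eta>" and lt: "\<forall>t\<in>{0..1}. norm (\<eta> t) < 1"
  shows "(\<lambda>t. ennreal (sqrt 2 * norm (D t) / (1 - (norm (\<eta> t))\<^sup>2)) * indicator ({0..1} - S) t) \<in> borel_measurable borel"
proof -
  have B: "{0..1} - S \<in> sets borel" using S by (simp add: finite_imp_closed)
  have "1 - (norm (\<eta> t))\<^sup>2 \<noteq> 0" if "t \<in> {0..1} - S" for t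
    using bspec[OF lt, of t] that abs_square_less_1[of "norm (\<eta> t)"] by auto
  then have "continuous_on ({0..1} - S) (\<lambda>t. sqrt 2 * norm (D t) / (1 - (norm (\<eta> t))\<^sup>2))"
    by (intro continuous_intros D continuous_on_subset[OF \<eta>]) auto
  then have "(\<lambda>t. indicator ({0..1} - S) t *\<^sub>R (sqrt 2 * norm (D t) / (1 - (norm (\<eta> t))\<^sup>2))) \<in> borel_measurable borel"
    by (rule borel_measurable_continuous_on_indicator[OF B])
  then have "(\<lambda>t. ennreal (indicator ({0..1} - S) t *\<^sub>R (sqrt 2 * norm (D t) / (1 - (norm (\<eta> t))\<^sup>2)))) \<in> borel_measurable borel"
    by (rule measurable_compose[OF _ measurable_ennreal])
  moreover have "ennreal (indicator ({0..1} - S) t *\<^sub>R (sqrt 2 * norm (D t) / (1 - (norm (\<eta> t))\<^sup>2)))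
      = ennreal (sqrt 2 * norm (D t) / (1 - (norm (\<eta> t))\<^sup>2)) * indicator ({0..1} - S) t" for t
    by (auto simp: indicator_def)
  ultimately show ?thesis by simp
qed

lemma piecewise_C1_obtain:
  assumes "\<eta> piecewise_C1_differentiable_on {a..b}"
  obtains S D where "finite S" "\<And>t. t \<in> {a..b} - S \<Longrightarrow> (\<eta> has_vector_derivative D t) (at t)" "continuous_on ({a..b} - S) D" "continuous_on {a..b} \<eta>"
  using assms unfolding piecewise_C1_differentiable_on_def C1_differentiable_on_def by blast

text \<open>One substitution serves both reversal, with \<open>u = 1\<close> and
  \<open>c = -1\<close>, and the two halves of a joined path, with \<open>c = 2\<close>. The
  exceptional set and the derivative are exhibited together with the integral so that they can be
  recombined afterwards.\<close>

lemma hlen_affine: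
  fixes c u :: real
  assumes \<eta>: "\<eta> piecewise_C1_differentiable_on {0..1}" and lt: "\<forall>t\<in>{0..1}. norm (\<eta> t) < 1" and c: "c \<noteq> 0"
  shows "\<exists>S D. finite S \<and> (\<forall>t. u + c * t \<in> {0..1} - S \<longrightarrow> ((\<lambda>t. \<eta> (u + c * t)) has_vector_derivative (c *\<^sub>R D (u + c * t))) (at t)) \<and>
    hlen \<eta> = (\<integral>\<^sup>+t. ennreal (sqrt 2 * norm (c *\<^sub>R D (u + c * t)) / (1 - (norm (\<eta> (u + c * t)))\<^sup>2)) * indicator ({0..1} - S) (u + c * t) \<partial>lborel) \<and>
    (\<lambda>t. ennreal (sqrt 2 * norm (c *\<^sub>R D (u + c * t)) / (1 - (norm (\<eta> (u + c * t)))\<^sup>2)) * indicator ({0..1} - S) (u + c * t)) \<in> borel_measurable lborel"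
proof -
  obtain S D where S: "finite S" and D: "\<And>t. t \<in> {0..1} - S \<Longrightarrow> (\<eta> has_vector_derivative D t) (at t)" "continuous_on ({0..1} - S) D" "continuous_on {0..1} \<eta>"
    using piecewise_C1_obtain[OF \<eta>] by metis
  define h where "h t = ennreal (sqrt 2 * norm (D t) / (1 - (norm (\<eta> t))\<^sup>2)) * indicator ({0..1} - S) t" for t
  have hm: "h \<in> borel_measurable borel" unfolding h_def by (rule speed_measurable[OF S D(2,3)]) (use lt in auto)
  have hc: "(\<lambda>t. h (u + c * t)) \<in> borel_measurable lborel"
    by (rule measurable_compose[OF _ hm]) simp
  have e: "ennreal (sqrt 2 * norm (c *\<^sub>R D (u + c * t)) / (1 - (norm (\<eta> (u + c * t)))\<^sup>2)) * indicator ({0..1} - S) (u + c * t) = ennreal \<bar>c\<bar> * h (u + c * t)" for t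
  proof -
    have "sqrt 2 * norm (c *\<^sub>R D (u + c * t)) / (1 - (norm (\<eta> (u + c * t)))\<^sup>2) = \<bar>c\<bar> * (sqrt 2 * norm (D (u + c * t)) / (1 - (norm (\<eta> (u + c * t)))\<^sup>2))"
      by simp
    then show ?thesis unfolding h_def by (simp only: ennreal_mult'[OF abs_ge_zero] mult.assoc)
  qed
  show ?thesis
  proof (intro exI conjI allI impI)
    show "finite S" by (rule S)
    show "((\<lambda>t. \<eta> (u + c * t)) has_vector_derivative (c *\<^sub>R D (u + c * t))) (at t)" if "u + c * t \<in> {0..1} - S" for t
    proof -
      have "((\<lambda>t. u + c * t) has_real_derivative c) (at t)" by (auto intro!: derivative_eq_intros)
      from vector_diff_chain_at[OF this[unfolded has_real_derivative_iff_has_vector_derivative] D(1)[OF that]]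
      show ?thesis by (simp add: o_def)
    qed
    have "hlen \<eta> = (\<integral>\<^sup>+t. h t \<partial>lborel)" unfolding h_def by (rule hlen_eq[OF S D(1)])
    also have "\<dots> = ennreal \<bar>c\<bar> * (\<integral>\<^sup>+t. h (u + c * t) \<partial>lborel)" by (rule nn_integral_real_affine[OF hm c])
    also have "\<dots> = (\<integral>\<^sup>+t. ennreal \<bar>c\<bar> * h (u + c * t) \<partial>lborel)" by (rule nn_integral_cmult[symmetric, OF hc])
    finally show "hlen \<eta> = (\<integral>\<^sup>+t. ennreal (sqrt 2 * norm (c *\<^sub>R D (u + c * t)) / (1 - (norm (\<eta> (u + c * t)))\<^sup>2)) * indicator ({0..1} - S) (u + c * t) \<partial>lborel)"
      by (simp only: e)
    show "(\<lambda>t. ennreal (sqrt 2 * norm (c *\<^sub>R D (u + c * t)) / (1 - (norm (\<eta> (u + c * t)))\<^sup>2)) * indicator ({0..1} - S) (u + c * t)) \<in> borel_measurable lborel"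
      unfolding e using hc by measurable
  qed
qed

lemma finite_affine_vimage: "finite S \<Longrightarrow> c \<noteq> 0 \<Longrightarrow> finite {t::real. u + c * t \<in> S}"
  using finite_vimageI[of S "\<lambda>t. u + c * t"] by (auto simp: vimage_def inj_on_def)

lemma hlen_reverse_le:
  assumes \<eta>: "\<eta> piecewise_C1_differentiable_on {0..1}" and lt: "\<forall>t\<in>{0..1}. norm (\<eta> t) < 1"
  shows "hlen (\<lambda>t. \<eta> (1 - t)) \<le> hlen \<eta>"
proof -
  have nz: "(- 1 :: real) \<noteq> 0" by simp
  obtain S D where S: "finite S" and D: "\<forall>t. 1 + - 1 * t \<in> {0..1} - S \<longrightarrow> ((\<lambda>t. \<eta> (1 + - 1 * t)) has_vector_derivative (- 1 *\<^sub>R D (1 + - 1 * t))) (at t)"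
    and h: "hlen \<eta> = (\<integral>\<^sup>+t. ennreal (sqrt 2 * norm (- 1 *\<^sub>R D (1 + - 1 * t)) / (1 - (norm (\<eta> (1 + - 1 * t)))\<^sup>2)) * indicator ({0..1} - S) (1 + - 1 * t) \<partial>lborel)"
    and m: "(\<lambda>t. ennreal (sqrt 2 * norm (- 1 *\<^sub>R D (1 + - 1 * t)) / (1 - (norm (\<eta> (1 + - 1 * t)))\<^sup>2)) * indicator ({0..1} - S) (1 + - 1 * t)) \<in> borel_measurable lborel"
    using hlen_affine[OF \<eta> lt nz, of 1] by (elim exE conjE) (rule that)
  have "hlen (\<lambda>t. \<eta> (1 - t)) = (\<integral>\<^sup>+t\<in>{0..1} - {t. 1 + - 1 * t \<in> S}. ennreal (sqrt 2 * norm (- 1 *\<^sub>R D (1 + - 1 * t)) / (1 - (norm (\<eta> (1 - t)))\<^sup>2)) \<partial>lborel)"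
  proof (rule hlen_eq[OF finite_affine_vimage[OF S]])
    show "((\<lambda>t. \<eta> (1 - t)) has_vector_derivative - 1 *\<^sub>R D (1 + - 1 * t)) (at t)" if "t \<in> {0..1} - {t. 1 + - 1 * t \<in> S}" for t
      using D[rule_format, of t] that by simp
  qed simp
  also have "\<dots> \<le> hlen \<eta>" unfolding h
    by (rule nn_integral_mono) (auto simp: indicator_def)
  finally show ?thesis .
qed

lemma hlen_join_le:
  assumes \<eta>1: "\<eta>1 piecewise_C1_differentiable_on {0..1}" and lt1: "\<forall>t\<in>{0..1}. norm (\<eta>1 t) < 1"
    and \<eta>2: "\<eta>2 piecewise_C1_differentiable_on {0..1}" and lt2: "\<forall>t\<in>{0..1}. norm (\<eta>2 t) < 1"
  shows "hlen (\<eta>1 +++ \<eta>2) \<le> hlen \<eta>1 + hlen \<eta>2"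
proof -
  have nz: "(2 :: real) \<noteq> 0" by simp
  obtain S1 D1 where S1: "finite S1" and D1: "\<forall>t. 0 + 2 * t \<in> {0..1} - S1 \<longrightarrow> ((\<lambda>t. \<eta>1 (0 + 2 * t)) has_vector_derivative (2 *\<^sub>R D1 (0 + 2 * t))) (at t)"
    and h1: "hlen \<eta>1 = (\<integral>\<^sup>+t. ennreal (sqrt 2 * norm (2 *\<^sub>R D1 (0 + 2 * t)) / (1 - (norm (\<eta>1 (0 + 2 * t)))\<^sup>2)) * indicator ({0..1} - S1) (0 + 2 * t) \<partial>lborel)"
    and m1: "(\<lambda>t. ennreal (sqrt 2 * norm (2 *\<^sub>R D1 (0 + 2 * t)) / (1 - (norm (\<eta>1 (0 + 2 * t)))\<^sup>2)) * indicator ({0..1} - S1) (0 + 2 * t)) \<in> borel_measurable lborel"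
    using hlen_affine[OF \<eta>1 lt1 nz, of 0] by (elim exE conjE) (rule that)
  obtain S2 D2 where S2: "finite S2" and D2: "\<forall>t. - 1 + 2 * t \<in> {0..1} - S2 \<longrightarrow> ((\<lambda>t. \<eta>2 (- 1 + 2 * t)) has_vector_derivative (2 *\<^sub>R D2 (- 1 + 2 * t))) (at t)"
    and h2: "hlen \<eta>2 = (\<integral>\<^sup>+t. ennreal (sqrt 2 * norm (2 *\<^sub>R D2 (- 1 + 2 * t)) / (1 - (norm (\<eta>2 (- 1 + 2 * t)))\<^sup>2)) * indicator ({0..1} - S2) (- 1 + 2 * t) \<partial>lborel)"
    and m2: "(\<lambda>t. ennreal (sqrt 2 * norm (2 *\<^sub>R D2 (- 1 + 2 * t)) / (1 - (norm (\<eta>2 (- 1 + 2 * t)))\<^sup>2)) * indicator ({0..1} - S2) (- 1 + 2 * t)) \<in> borel_measurable lborel"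
    using hlen_affine[OF \<eta>2 lt2 nz, of "- 1"] by (elim exE conjE) (rule that)
  define S where "S = {t. 0 + 2 * t \<in> S1} \<union> {t. - 1 + 2 * t \<in> S2} \<union> {1 / 2}"
  have S: "finite S" unfolding S_def by (intro finite_UnI finite_affine_vimage[OF S1] finite_affine_vimage[OF S2]) simp_all
  define D where "D t = (if t < 1 / 2 then 2 *\<^sub>R D1 (0 + 2 * t) else 2 *\<^sub>R D2 (- 1 + 2 * t))" for t
  have "hlen (\<eta>1 +++ \<eta>2) = (\<integral>\<^sup>+t\<in>{0..1} - S. ennreal (sqrt 2 * norm (D t) / (1 - (norm ((\<eta>1 +++ \<eta>2) t))\<^sup>2)) \<partial>lborel)"
  proof (rule hlen_eq[OF S])
    fix t assume t: "t \<in> {0..1} - S"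
    show "(\<eta>1 +++ \<eta>2 has_vector_derivative D t) (at t)"
    proof (cases "t < 1 / 2")
      case True
      have "((\<lambda>t. \<eta>1 (0 + 2 * t)) has_vector_derivative D t) (at t)" using D1[rule_format, of t] t True by (auto simp: S_def D_def)
      then show ?thesis
        by (rule has_vector_derivative_transform_within_open[of _ _ _ "{..<1/2}"]) (use True in \<open>auto simp: joinpaths_def\<close>)
    next
      case False
      then have t2: "t > 1 / 2" using t by (auto simp: S_def)
      have "((\<lambda>t. \<eta>2 (- 1 + 2 * t)) has_vector_derivative D t) (at t)" using D2[rule_format, of t] t t2 by (auto simp: S_def D_def)
      then show ?thesis
        by (rule has_vector_derivative_transform_within_open[of _ _ _ "{1/2<..}"]) (use t2 in \<open>auto simp: joinpaths_def\<close>)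
    qed
  qed
  also have "\<dots> \<le> (\<integral>\<^sup>+t. ennreal (sqrt 2 * norm (2 *\<^sub>R D1 (0 + 2 * t)) / (1 - (norm (\<eta>1 (0 + 2 * t)))\<^sup>2)) * indicator ({0..1} - S1) (0 + 2 * t)
       + ennreal (sqrt 2 * norm (2 *\<^sub>R D2 (- 1 + 2 * t)) / (1 - (norm (\<eta>2 (- 1 + 2 * t)))\<^sup>2)) * indicator ({0..1} - S2) (- 1 + 2 * t) \<partial>lborel)"
  proof (rule nn_integral_mono)
    fix t
    show "ennreal (sqrt 2 * norm (D t) / (1 - (norm ((\<eta>1 +++ \<eta>2) t))\<^sup>2)) * indicator ({0..1} - S) t
      \<le> ennreal (sqrt 2 * norm (2 *\<^sub>R D1 (0 + 2 * t)) / (1 - (norm (\<eta>1 (0 + 2 * t)))\<^sup>2)) * indicator ({0..1} - S1) (0 + 2 * t)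
       + ennreal (sqrt 2 * norm (2 *\<^sub>R D2 (- 1 + 2 * t)) / (1 - (norm (\<eta>2 (- 1 + 2 * t)))\<^sup>2)) * indicator ({0..1} - S2) (- 1 + 2 * t)"
    proof (cases "t \<in> {0..1} - S")
      case t: True
      show ?thesis
      proof (cases "t < 1 / 2")
        case True
        then show ?thesis using t by (auto simp: D_def joinpaths_def S_def)
      next
        case False
        then have "t > 1 / 2" using t by (auto simp: S_def)
        then show ?thesis using t by (auto simp: D_def joinpaths_def S_def)
      qed
    qed simp
  qed
  also have "\<dots> = hlen \<eta>1 + hlen \<eta>2" unfolding h1 h2 by (rule nn_integral_add[OF m1 m2])
  finally show ?thesis .
qed

section \<open>Upper and lower bounds for the length\<close>

lemma hlen_linepath:
  assumes "norm a \<le> \<rho>" "norm b \<le> \<rho>" "\<rho> < 1"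
  shows "hlen (linepath a b) \<le> ennreal (sqrt 2 * norm (b - a) / (1 - \<rho>\<^sup>2))"
proof -
  have \<rho>: "0 \<le> \<rho>" using norm_ge_zero[of a] assms(1) by linarith
  then have \<rho>2: "\<rho>\<^sup>2 < 1" using assms(3) by (simp add: abs_square_less_1)
  have "hlen (linepath a b) = (\<integral>\<^sup>+t\<in>{0..1} - {}. ennreal (sqrt 2 * norm (b - a) / (1 - (norm (linepath a b t))\<^sup>2)) \<partial>lborel)"
    by (rule hlen_eq) (auto intro: has_vector_derivative_linepath_within)
  also have "\<dots> \<le> (\<integral>\<^sup>+t\<in>{0..1::real}. ennreal (sqrt 2 * norm (b - a) / (1 - \<rho>\<^sup>2)) \<partial>lborel)"
  proof (rule nn_integral_mono)
    fix t :: real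
    have "ennreal (sqrt 2 * norm (b - a) / (1 - (norm (linepath a b t))\<^sup>2)) \<le> ennreal (sqrt 2 * norm (b - a) / (1 - \<rho>\<^sup>2))" if "t \<in> {0..1}"
    proof -
      have "linepath a b t \<in> closed_segment a b" using that by (metis imageI linepath_image_01)
      moreover have "closed_segment a b \<subseteq> cball 0 \<rho>" using assms by (intro closed_segment_subset) auto
      ultimately have "norm (linepath a b t) \<le> \<rho>" by auto
      then have "(norm (linepath a b t))\<^sup>2 \<le> \<rho>\<^sup>2" by (intro power_mono) auto
      then show ?thesis using \<rho>2 by (intro ennreal_leI divide_left_mono mult_pos_pos) auto
    qed
    then show "ennreal (sqrt 2 * norm (b - a) / (1 - (norm (linepath a b t))\<^sup>2)) * indicator ({0..1} - {}) t
      \<le> ennreal (sqrt 2 * norm (b - a) / (1 - \<rho>\<^sup>2)) * indicator {0..1} t" by (auto simp: indicator_def)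
  qed
  also have "\<dots> = ennreal (sqrt 2 * norm (b - a) / (1 - \<rho>\<^sup>2))" by (simp add: nn_integral_cmult_indicator)
  finally show ?thesis .
qed

text \<open>An infinite right side is trivial. A finite one makes \<open>D\<close> absolutely
  integrable, and the fundamental theorem of calculus with finitely many exceptions applies.\<close>

lemma path_lower_bound:
  fixes \<phi> :: "real \<Rightarrow> 'b :: euclidean_space"
  assumes S: "finite S" and ab: "a \<le> b" and cont: "continuous_on {a..b} \<phi>"
    and D: "\<And>t. t \<in> {a..b} - S \<Longrightarrow> (\<phi> has_vector_derivative D t) (at t)" "continuous_on ({a..b} - S) D"
    and h: "\<And>t. t \<in> {a..b} - S \<Longrightarrow> norm (D t) \<le> h t"
  shows "ennreal (norm (\<phi> b - \<phi> a)) \<le> (\<integral>\<^sup>+t\<in>{a..b} - S. ennreal (h t) \<partial>lborel)"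
proof (cases "(\<integral>\<^sup>+t\<in>{a..b} - S. ennreal (h t) \<partial>lborel) = \<infinity>")
  case False
  have B: "{a..b} - S \<in> sets borel" using S by (simp add: finite_imp_closed)
  have m: "(\<lambda>t. indicator ({a..b} - S) t *\<^sub>R D t) \<in> borel_measurable lborel"
    using borel_measurable_continuous_on_indicator[OF B D(2)] by simp
  have nle: "(\<integral>\<^sup>+t. ennreal (norm (indicator ({a..b} - S) t *\<^sub>R D t)) \<partial>lborel) \<le> (\<integral>\<^sup>+t\<in>{a..b} - S. ennreal (h t) \<partial>lborel)"
    by (rule nn_integral_mono) (auto simp: indicator_def intro!: ennreal_leI h)
  then have int: "set_integrable lborel ({a..b} - S) D"
    unfolding set_integrable_def integrable_iff_bounded using m False by (auto simp: less_top[symmetric] top_unique)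
  have "(D has_integral (\<phi> b - \<phi> a)) {a..b}"
    by (rule fundamental_theorem_of_calculus_interior_strong[OF S ab _ cont]) (use D in auto)
  then have "(D has_integral (\<phi> b - \<phi> a)) ({a..b} - S)"
  proof (subst has_integral_spike_set_eq)
    show "negligible {x \<in> ({a..b} - S) - {a..b}. D x \<noteq> 0}" "negligible {x \<in> {a..b} - ({a..b} - S). D x \<noteq> 0}"
      by (rule negligible_subset[OF negligible_finite[OF S]]; auto)+
  qed
  then have "(LINT t:{a..b} - S|lborel. D t) = \<phi> b - \<phi> a"
    using set_borel_integral_eq_integral(2)[OF int] by (simp add: integral_unique)
  then have "norm (\<phi> b - \<phi> a) \<le> (LINT t|lborel. norm (indicator ({a..b} - S) t *\<^sub>R D t))"
    unfolding set_lebesgue_integral_def by (metis integral_norm_bound)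
  then have "ennreal (norm (\<phi> b - \<phi> a)) \<le> ennreal (LINT t|lborel. norm (indicator ({a..b} - S) t *\<^sub>R D t))" by (rule ennreal_leI)
  also have "\<dots> = (\<integral>\<^sup>+t. ennreal (norm (indicator ({a..b} - S) t *\<^sub>R D t)) \<partial>lborel)"
    by (rule nn_integral_eq_integral[symmetric]) (use integrable_norm[OF int[unfolded set_integrable_def]] in auto)
  also note nle
  finally show ?thesis .
qed simp

text \<open>A function whose differential is dominated by the hyperbolic norm changes along a curve
  by at most its length. Two such functions are used: the inclusion scaled by \<open>sqrt 2\<close>,
  and half the logarithm of \<open>1 - |z|^2\<close>.\<close>

lemma hlen_lower_bound:
  fixes \<phi> :: "complex \<Rightarrow> 'b :: euclidean_space"
  assumes \<eta>: "\<eta> piecewise_C1_differentiable_on {0..1}" and lt: "\<forall>t\<in>{0..1}. norm (\<eta> t) < 1"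
    and \<phi>: "\<And>z. norm z < 1 \<Longrightarrow> (\<phi> has_derivative \<phi>' z) (at z)"
    and \<phi>': "\<And>v. continuous_on {z. norm z < 1} (\<lambda>z. \<phi>' z v)"
    and le: "\<And>z v. norm z < 1 \<Longrightarrow> norm (\<phi>' z v) \<le> sqrt 2 * norm v / (1 - (norm z)\<^sup>2)"
    and \<tau>: "\<tau> \<in> {0..1}"
  shows "ennreal (norm (\<phi> (\<eta> \<tau>) - \<phi> (\<eta> 0))) \<le> hlen \<eta>"
proof -
  obtain S D where S: "finite S" and D: "\<And>t. t \<in> {0..1} - S \<Longrightarrow> (\<eta> has_vector_derivative D t) (at t)" "continuous_on ({0..1} - S) D" "continuous_on {0..1} \<eta>"
    using piecewise_C1_obtain[OF \<eta>] by metis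
  have sub: "{0..\<tau>} \<subseteq> {0..1}" using \<tau> by auto
  \<comment> \<open>Only continuity in \<open>z\<close> for each fixed vector is assumed; splitting
    the velocity over the real basis gives continuity along the curve.\<close>
  have lin: "\<phi>' z v = Re v *\<^sub>R \<phi>' z 1 + Im v *\<^sub>R \<phi>' z \<i>" if "norm z < 1" for z v
  proof -
    have l: "linear (\<phi>' z)" using has_derivative_linear[OF \<phi>[OF that]] .
    have "v = Re v *\<^sub>R 1 + Im v *\<^sub>R \<i>" by (simp add: complex_eq_iff)
    then have "\<phi>' z v = \<phi>' z (Re v *\<^sub>R 1 + Im v *\<^sub>R \<i>)" by simp
    also have "\<dots> = Re v *\<^sub>R \<phi>' z 1 + Im v *\<^sub>R \<phi>' z \<i>" by (simp only: linear_add[OF l] linear_cmul[OF l])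
    finally show ?thesis .
  qed
  have "ennreal (norm ((\<phi> \<circ> \<eta>) \<tau> - (\<phi> \<circ> \<eta>) 0)) \<le> (\<integral>\<^sup>+t\<in>{0..\<tau>} - S. ennreal (sqrt 2 * norm (D t) / (1 - (norm (\<eta> t))\<^sup>2)) \<partial>lborel)"
  proof (rule path_lower_bound[OF S])
    show "0 \<le> \<tau>" using \<tau> by simp
    have "continuous_on {z. norm z < 1} \<phi>"
      by (rule continuous_at_imp_continuous_on) (use \<phi> has_derivative_continuous in blast)
    then show "continuous_on {0..\<tau>} (\<phi> \<circ> \<eta>)"
      by (intro continuous_on_compose continuous_on_subset[OF D(3) sub]) (rule continuous_on_subset, use lt sub in auto)
    fix t assume t: "t \<in> {0..\<tau>} - S"
    then have t1: "t \<in> {0..1} - S" "norm (\<eta> t) < 1" using sub lt by auto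
    show "(\<phi> \<circ> \<eta> has_vector_derivative \<phi>' (\<eta> t) (D t)) (at t)"
      using diff_chain_at[OF D(1)[OF t1(1), unfolded has_vector_derivative_def] \<phi>[OF t1(2)]] linear_cmul[OF has_derivative_linear[OF \<phi>[OF t1(2)]]]
      by (simp add: has_vector_derivative_def o_def)
    show "norm (\<phi>' (\<eta> t) (D t)) \<le> sqrt 2 * norm (D t) / (1 - (norm (\<eta> t))\<^sup>2)" by (rule le[OF t1(2)])
  next
    have c: "continuous_on ({0..\<tau>} - S) (\<lambda>t. \<phi>' (\<eta> t) v)" for v
      by (rule continuous_on_compose2[OF \<phi>' continuous_on_subset[OF D(3)]]) (use lt sub in auto)
    have "continuous_on ({0..\<tau>} - S) (\<lambda>t. Re (D t) *\<^sub>R \<phi>' (\<eta> t) 1 + Im (D t) *\<^sub>R \<phi>' (\<eta> t) \<i>)"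
      by (intro continuous_intros c continuous_on_subset[OF D(2)]) (use sub in auto)
    then show "continuous_on ({0..\<tau>} - S) (\<lambda>t. \<phi>' (\<eta> t) (D t))"
      by (rule continuous_on_eq) (rule lin[symmetric], use lt sub in auto)
  qed
  also have "\<dots> \<le> (\<integral>\<^sup>+t\<in>{0..1} - S. ennreal (sqrt 2 * norm (D t) / (1 - (norm (\<eta> t))\<^sup>2)) \<partial>lborel)"
    by (rule nn_integral_mono) (use sub in \<open>auto simp: indicator_def\<close>)
  also have "\<dots> = hlen \<eta>" by (rule hlen_eq[OF S D(1), symmetric])
  finally show ?thesis by simp
qed

lemma hlen_ge_dist:
  assumes \<eta>: "\<eta> piecewise_C1_differentiable_on {0..1}" and lt: "\<forall>t\<in>{0..1}. norm (\<eta> t) < 1" and \<tau>: "\<tau> \<in> {0..1}"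
  shows "ennreal (sqrt 2 * norm (\<eta> \<tau> - \<eta> 0)) \<le> hlen \<eta>"
proof -
  have "ennreal (norm (of_real (sqrt 2) * \<eta> \<tau> - of_real (sqrt 2) * \<eta> 0)) \<le> hlen \<eta>"
  proof (rule hlen_lower_bound[OF \<eta> lt _ _ _ \<tau>])
    show "((\<lambda>z. of_real (sqrt 2) * z) has_derivative (\<lambda>v. of_real (sqrt 2) * v)) (at z)" for z :: complex
      by (auto intro!: derivative_eq_intros)
    show "continuous_on {z. norm z < 1} (\<lambda>z::complex. of_real (sqrt 2) * v)" for v :: complex by (intro continuous_intros)
    fix z v :: complex assume "norm z < 1"
    then have p: "0 < 1 - (norm z)\<^sup>2" by (simp add: abs_square_less_1)
    have "sqrt 2 * norm v * (1 - (norm z)\<^sup>2) \<le> sqrt 2 * norm v * 1" by (intro mult_left_mono) auto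
    then show "norm (of_real (sqrt 2) * v) \<le> sqrt 2 * norm v / (1 - (norm z)\<^sup>2)"
      using p by (simp add: norm_mult pos_le_divide_eq)
  qed
  then show ?thesis by (simp add: norm_mult flip: right_diff_distrib)
qed

text \<open>The logarithm is unbounded at the unit circle, whereas \<open>hlen_ge_dist\<close>
  controls only the euclidean distance. Hence points within a bounded distance of each other stay
  inside a smaller disc.\<close>

lemma hlen_ge_log:
  assumes \<eta>: "\<eta> piecewise_C1_differentiable_on {0..1}" and lt: "\<forall>t\<in>{0..1}. norm (\<eta> t) < 1" and \<tau>: "\<tau> \<in> {0..1}"
  shows "ennreal \<bar>ln (1 - (norm (\<eta> \<tau>))\<^sup>2) / 2 - ln (1 - (norm (\<eta> 0))\<^sup>2) / 2\<bar> \<le> hlen \<eta>"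
proof -
  have "ennreal (norm (ln (1 - (norm (\<eta> \<tau>))\<^sup>2) / 2 - ln (1 - (norm (\<eta> 0))\<^sup>2) / 2)) \<le> hlen \<eta>"
  proof (rule hlen_lower_bound[where \<phi> = "\<lambda>z. ln (1 - (norm z)\<^sup>2) / 2" and \<phi>' = "\<lambda>z v. - (z \<bullet> v) / (1 - (norm z)\<^sup>2)", OF \<eta> lt _ _ _ \<tau>])
    fix z :: complex assume z: "norm z < 1"
    then have p: "0 < 1 - (norm z)\<^sup>2" by (simp add: abs_square_less_1)
    have "((\<lambda>z. ln (1 - z \<bullet> z) / 2) has_derivative (\<lambda>v. - (z \<bullet> v) / (1 - (norm z)\<^sup>2))) (at z)"
      using p by (auto intro!: derivative_eq_intros simp: power2_norm_eq_inner inner_commute field_simps)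
    then show "((\<lambda>z. ln (1 - (norm z)\<^sup>2) / 2) has_derivative (\<lambda>v. - (z \<bullet> v) / (1 - (norm z)\<^sup>2))) (at z)"
      by (simp add: power2_norm_eq_inner)
    fix v :: complex
    have "\<bar>z \<bullet> v\<bar> \<le> norm z * norm v" by (rule Cauchy_Schwarz_ineq2)
    also have "\<dots> \<le> sqrt 2 * norm v"
    proof (rule mult_right_mono)
      have "1 \<le> sqrt 2" by (rule real_le_rsqrt) simp
      then show "norm z \<le> sqrt 2" using z by linarith
    qed simp
    finally show "norm (- (z \<bullet> v) / (1 - (norm z)\<^sup>2)) \<le> sqrt 2 * norm v / (1 - (norm z)\<^sup>2)"
      using p by (simp add: divide_right_mono)
  next
    fix v :: complex
    have "1 - (norm z)\<^sup>2 \<noteq> 0" if "z \<in> {z. norm z < 1}" for z :: complex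
      using that abs_square_less_1[of "norm z"] by auto
    then show "continuous_on {z. norm z < 1} (\<lambda>z::complex. - (z \<bullet> v) / (1 - (norm z)\<^sup>2))"
      by (intro continuous_intros) auto
  qed
  then show ?thesis by simp
qed

lemma piecewise_C1_combine:
  fixes f :: "real \<Rightarrow> 'b :: real_normed_vector"
  assumes ab: "f piecewise_C1_differentiable_on {a..b}" and bc: "f piecewise_C1_differentiable_on {b..c}" and le: "a \<le> b" "b \<le> c"
  shows "f piecewise_C1_differentiable_on {a..c}"
proof -
  have U: "{a..c} = {a..b} \<union> {b..c}" using le by auto
  obtain S1 where S1: "finite S1" "f C1_differentiable_on ({a..b} - S1)" using ab unfolding piecewise_C1_differentiable_on_def by blast
  obtain S2 where S2: "finite S2" "f C1_differentiable_on ({b..c} - S2)" using bc unfolding piecewise_C1_differentiable_on_def by blast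
  have c: "continuous_on {a..c} f"
    unfolding U using ab bc unfolding piecewise_C1_differentiable_on_def by (intro continuous_on_closed_Un) auto
  \<comment> \<open>With \<open>b\<close> removed the two halves are relatively open in their union,
    so continuity of the derivative on each half gives continuity on both.\<close>
  let ?S = "S1 \<union> S2 \<union> {b}"
  have V: "{a..c} - ?S = ({a..b} - ?S) \<union> ({b..c} - ?S)" using U by auto
  have "f C1_differentiable_on ({a..c} - ?S)"
    unfolding C1_differentiable_on_eq
  proof (intro conjI)
    show "\<forall>x\<in>{a..c} - ?S. f differentiable at x"
      unfolding V using S1(2) S2(2) unfolding C1_differentiable_on_eq by blast
    show "continuous_on ({a..c} - ?S) (\<lambda>x. vector_derivative f (at x))"
      unfolding V
    proof (rule continuous_on_Un_local_open)
      have "{a..b} - ?S = (({a..b} - ?S) \<union> ({b..c} - ?S)) \<inter> {..<b}" by auto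
      then show "openin (top_of_set (({a..b} - ?S) \<union> ({b..c} - ?S))) ({a..b} - ?S)"
        unfolding openin_open using open_lessThan by blast
      have "{b..c} - ?S = (({a..b} - ?S) \<union> ({b..c} - ?S)) \<inter> {b<..}" by auto
      then show "openin (top_of_set (({a..b} - ?S) \<union> ({b..c} - ?S))) ({b..c} - ?S)"
        unfolding openin_open using open_greaterThan by blast
      show "continuous_on ({a..b} - ?S) (\<lambda>x. vector_derivative f (at x))"
        using S1(2) unfolding C1_differentiable_on_eq by (auto elim: continuous_on_subset)
      show "continuous_on ({b..c} - ?S) (\<lambda>x. vector_derivative f (at x))"
        using S2(2) unfolding C1_differentiable_on_eq by (auto elim: continuous_on_subset)
    qed
  qed
  then show ?thesis using c S1(1) S2(1) unfolding piecewise_C1_differentiable_on_def by (intro conjI exI[of _ ?S]) auto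
qed

section \<open>Immersions into the hyperbolic disc\<close>

text \<open>The metric is a parameter because two metrics are used in turn: on a surface already
  known to be a disc, \<open>hyp\<close> serves first, and the Bergman metric takes its place once
  it is known to have the same form.\<close>

locale disc_immersion = surface +
  fixes T :: "'a \<Rightarrow> complex" and g :: "'a conformal_metric"
  assumes T_holomorphic: "c \<in> A \<Longrightarrow> (\<lambda>z. T (chart_inv c z)) holomorphic_on coord c ` chart_dom c"
    and T_lt: "p \<in> topspace X \<Longrightarrow> norm (T p) < 1"
    and T_immersion: "c \<in> A \<Longrightarrow> p \<in> chart_dom c \<Longrightarrow> deriv (\<lambda>z. T (chart_inv c z)) (coord c p) \<noteq> 0"
    and g_pullback: "c \<in> A \<Longrightarrow> p \<in> chart_dom c \<Longrightarrow>
      g c p = 2 * (norm (deriv (\<lambda>z. T (chart_inv c z)) (coord c p)))\<^sup>2 / (1 - (norm (T p))\<^sup>2)\<^sup>2"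
begin

definition dT :: "'a chart \<Rightarrow> 'a \<Rightarrow> complex" where
  "dT c p = deriv (\<lambda>z. T (chart_inv c z)) (coord c p)"

lemma T_continuous: "continuous_map X euclidean T"
  unfolding continuous_map_def
proof (intro conjI allI impI)
  fix W :: "complex set" assume "openin euclidean W"
  then have W: "open W" by simp
  show "openin X {p \<in> topspace X. T p \<in> W}"
  proof (subst openin_subopen, intro ballI)
    fix p assume p: "p \<in> {p \<in> topspace X. T p \<in> W}"
    then obtain c where c: "c \<in> A" "p \<in> chart_dom c" using chart_cover by blast
    let ?V = "coord c ` chart_dom c \<inter> (\<lambda>z. T (chart_inv c z)) -` W"
    have "open ?V"
      by (rule continuous_open_preimage[OF holomorphic_on_imp_continuous_on[OF T_holomorphic[OF c(1)]] chart_open[OF chart[OF c(1)]] W])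
    then have "openin X {q \<in> chart_dom c. coord c q \<in> ?V}" by (rule chart_preimage_open[OF chart[OF c(1)]])
    moreover have "p \<in> {q \<in> chart_dom c. coord c q \<in> ?V}" using p c chart_inv_coord[OF chart[OF c(1)], of p] by auto
    moreover have "{q \<in> chart_dom c. coord c q \<in> ?V} \<subseteq> {p \<in> topspace X. T p \<in> W}"
    proof
      fix q assume "q \<in> {q \<in> chart_dom c. coord c q \<in> ?V}"
      then have "q \<in> chart_dom c" "T (chart_inv c (coord c q)) \<in> W" by simp_all
      then show "q \<in> {p \<in> topspace X. T p \<in> W}"
        using chart_inv_coord[OF chart[OF c(1)], of q] in_topspace[OF c(1), of q] by simp
    qed
    ultimately show "\<exists>Y. openin X Y \<and> p \<in> Y \<and> Y \<subseteq> {p \<in> topspace X. T p \<in> W}" by (intro exI conjI)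
  qed
qed simp

section \<open>Local inverses of \<open>T\<close> and their uniqueness\<close>

definition is_section :: "complex set \<Rightarrow> (complex \<Rightarrow> 'a) \<Rightarrow> bool" where
  "is_section B s \<longleftrightarrow> continuous_map (top_of_set B) X s \<and> (\<forall>t\<in>B. T (s t) = t)"

lemma section_subset: "is_section B s \<Longrightarrow> C \<subseteq> B \<Longrightarrow> is_section C s"
  unfolding is_section_def using continuous_map_from_subtopology_mono[of euclidean B X s C] by auto

lemma section_in: "is_section B s \<Longrightarrow> t \<in> B \<Longrightarrow> s t \<in> topspace X"
  unfolding is_section_def continuous_map_def by auto

lemma section_lt: "is_section B s \<Longrightarrow> t \<in> B \<Longrightarrow> norm t < 1"
  using section_in[of B s t] T_lt[of "s t"] unfolding is_section_def by auto

text \<open>The inverse function theorem for \<open>T\<close> in one chart. Openness of the image is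
  recorded so that a section also provides neighbourhoods in the surface.\<close>

lemma ex_section:
  assumes c: "c \<in> A" "p \<in> chart_dom c"
  obtains \<epsilon> s where "\<epsilon> > 0" "is_section (ball (T p) \<epsilon>) s" "s (T p) = p"
    "(\<lambda>t. coord c (s t)) holomorphic_on ball (T p) \<epsilon>" "openin X (s ` ball (T p) \<epsilon>)" "s ` ball (T p) \<epsilon> \<subseteq> chart_dom c"
proof -
  note ch = chart[OF c(1)]
  define F where "F z = T (chart_inv c z)" for z
  have hol: "F holomorphic_on coord c ` chart_dom c" using T_holomorphic[OF c(1)] by (simp add: F_def[abs_def])
  have Fp: "F (coord c p) = T p" using chart_inv_coord[OF ch c(2)] by (simp add: F_def)
  have pc: "coord c p \<in> coord c ` chart_dom c" using c(2) by blast
  have nz: "deriv F (coord c p) \<noteq> 0" using T_immersion[OF c] by (simp add: F_def[abs_def])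
  obtain r where r: "r > 0" "ball (coord c p) r \<subseteq> coord c ` chart_dom c" "open (F ` ball (coord c p) r)" "inj_on F (ball (coord c p) r)"
    by (rule has_complex_derivative_locally_invertible[OF hol pc chart_open[OF ch] nz])
  have holr: "F holomorphic_on ball (coord c p) r" using hol r(2) by (rule holomorphic_on_subset)
  obtain h where h: "h holomorphic_on (F ` ball (coord c p) r)" "\<And>z. z \<in> ball (coord c p) r \<Longrightarrow> h (F z) = z"
    by (rule holomorphic_has_inverse[OF holr open_ball r(4)]) blast
  have "T p \<in> F ` ball (coord c p) r" using r(1) Fp by (metis centre_in_ball imageI)
  then obtain \<epsilon> where \<epsilon>: "\<epsilon> > 0" "ball (T p) \<epsilon> \<subseteq> F ` ball (coord c p) r" using r(3) open_contains_ball by blast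
  define s where "s t = chart_inv c (h t)" for t
  have ht: "h t \<in> ball (coord c p) r \<and> F (h t) = t" if t: "t \<in> ball (T p) \<epsilon>" for t
  proof -
    obtain z where "z \<in> ball (coord c p) r" "t = F z" using t \<epsilon>(2) by blast
    then show ?thesis using h(2)[of z] by simp
  qed
  have hU: "h t \<in> coord c ` chart_dom c" if "t \<in> ball (T p) \<epsilon>" for t using ht[OF that] r(2) by blast
  have cs: "coord c (s t) = h t" "s t \<in> chart_dom c" if "t \<in> ball (T p) \<epsilon>" for t
    unfolding s_def using coord_chart_inv[OF hU[OF that]] chart_inv_in[OF hU[OF that]] by blast+
  have hh: "h holomorphic_on ball (T p) \<epsilon>" using h(1) \<epsilon>(2) by (rule holomorphic_on_subset)
  show thesis
  proof
    show "\<epsilon> > 0" by fact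
    show "is_section (ball (T p) \<epsilon>) s"
      unfolding is_section_def
    proof (intro conjI ballI)
      have "continuous_map (top_of_set (ball (T p) \<epsilon>)) (top_of_set (coord c ` chart_dom c)) h"
        using holomorphic_on_imp_continuous_on[OF hh] hU by (simp add: continuous_map_in_subtopology image_subset_iff del: mem_ball)
      from continuous_map_compose[OF this chart_inv_continuous[OF ch]]
      show "continuous_map (top_of_set (ball (T p) \<epsilon>)) X s" by (simp add: s_def[abs_def] o_def)
      show "T (s t) = t" if "t \<in> ball (T p) \<epsilon>" for t using ht[OF that] by (simp add: F_def s_def)
    qed
    have "h (T p) = coord c p" using h(2)[of "coord c p"] r(1) Fp by simp
    then show "s (T p) = p" using chart_inv_coord[OF ch c(2)] by (simp add: s_def)
    show "(\<lambda>t. coord c (s t)) holomorphic_on ball (T p) \<epsilon>"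
      by (rule holomorphic_transform[OF hh]) (simp only: cs)
    show "s ` ball (T p) \<epsilon> \<subseteq> chart_dom c" using cs(2) by blast
    have "q \<in> s ` ball (T p) \<epsilon> \<longleftrightarrow> q \<in> {q \<in> chart_dom c. coord c q \<in> ball (coord c p) r \<inter> F -` ball (T p) \<epsilon>}" for q
    proof
      assume "q \<in> s ` ball (T p) \<epsilon>"
      then obtain t where t: "q = s t" "t \<in> ball (T p) \<epsilon>" by blast
      show "q \<in> {q \<in> chart_dom c. coord c q \<in> ball (coord c p) r \<inter> F -` ball (T p) \<epsilon>}"
        using ht[OF t(2)] cs[OF t(2)] t by simp
    next
      assume "q \<in> {q \<in> chart_dom c. coord c q \<in> ball (coord c p) r \<inter> F -` ball (T p) \<epsilon>}"
      then have q: "q \<in> chart_dom c" "coord c q \<in> ball (coord c p) r" "F (coord c q) \<in> ball (T p) \<epsilon>" by auto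
      have "s (F (coord c q)) = q" using h(2)[OF q(2)] chart_inv_coord[OF ch q(1)] by (simp add: s_def)
      then show "q \<in> s ` ball (T p) \<epsilon>" using q(3) by (metis imageI)
    qed
    then have "s ` ball (T p) \<epsilon> = {q \<in> chart_dom c. coord c q \<in> ball (coord c p) r \<inter> F -` ball (T p) \<epsilon>}" by (rule set_eqI)
    moreover have "open (ball (coord c p) r \<inter> F -` ball (T p) \<epsilon>)"
      by (rule continuous_open_preimage[OF holomorphic_on_imp_continuous_on[OF holr] open_ball open_ball])
    ultimately show "openin X (s ` ball (T p) \<epsilon>)" using chart_preimage_open[OF ch] by (simp only:)
  qed
qed

lemma locally_injective:
  assumes "p \<in> topspace X"
  obtains N where "openin X N" "p \<in> N" "inj_on T N"
proof -
  obtain c where c: "c \<in> A" "p \<in> chart_dom c" using chart_cover assms by blast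
  obtain \<epsilon> s where s: "\<epsilon> > 0" "is_section (ball (T p) \<epsilon>) s" "s (T p) = p" "openin X (s ` ball (T p) \<epsilon>)"
    by (rule ex_section[OF c]) blast
  show thesis
  proof
    show "openin X (s ` ball (T p) \<epsilon>)" by fact
    show "p \<in> s ` ball (T p) \<epsilon>" using s(1,3) by (metis centre_in_ball imageI)
    show "inj_on T (s ` ball (T p) \<epsilon>)" using s(2) unfolding is_section_def inj_on_def by auto
  qed
qed

text \<open>The set of agreement is closed because the surface is Hausdorff, and open because
  \<open>T\<close> is locally injective.\<close>

lemma lift_unique:
  assumes Y: "connected_space Y" and f: "continuous_map Y X f" and h: "continuous_map Y X h"
    and T: "\<And>y. y \<in> topspace Y \<Longrightarrow> T (f y) = T (h y)" and y0: "y0 \<in> topspace Y" "f y0 = h y0" and y: "y \<in> topspace Y"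
  shows "f y = h y"
proof -
  let ?E = "{y \<in> topspace Y. f y = h y}"
  have "closedin Y ?E" by (rule closedin_continuous_maps_eq[OF Hausdorff f h])
  moreover have "openin Y ?E"
  proof (subst openin_subopen, intro ballI)
    fix z assume z: "z \<in> ?E"
    then have "f z \<in> topspace X" using f unfolding continuous_map_def by blast
    then obtain N where N: "openin X N" "f z \<in> N" "inj_on T N" by (rule locally_injective)
    let ?W = "{y \<in> topspace Y. f y \<in> N} \<inter> {y \<in> topspace Y. h y \<in> N}"
    have "openin Y ?W"
      by (intro openin_Int openin_continuous_map_preimage[OF f N(1)] openin_continuous_map_preimage[OF h N(1)])
    moreover have "z \<in> ?W" using z N(2) by auto
    moreover have "?W \<subseteq> ?E" using T inj_onD[OF N(3)] by blast
    ultimately show "\<exists>U. openin Y U \<and> z \<in> U \<and> U \<subseteq> ?E" by (intro exI conjI)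
  qed
  ultimately have "?E = {} \<or> ?E = topspace Y" using Y unfolding connected_space_clopen_in by blast
  then show ?thesis using y0 y by blast
qed

lemma sections_agree:
  assumes s: "is_section B s" and s': "is_section B s'" and B: "connected B" and b: "b \<in> B" "s b = s' b" and t: "t \<in> B"
  shows "s t = s' t"
proof (rule lift_unique[of "top_of_set B" s s' b])
  show "connected_space (top_of_set B)" using B by (simp add: connected_space_subtopology connectedin_iff_connected)
qed (use assms in \<open>auto simp: is_section_def\<close>)

text \<open>By uniqueness a continuous section coincides, near each point, with the holomorphic one
  of \<open>ex_section\<close>.\<close>

lemma section_holomorphic:
  assumes s: "is_section B s" and B: "open B" and c: "c \<in> A"
  shows "(\<lambda>t. coord c (s t)) holomorphic_on {t \<in> B. s t \<in> chart_dom c}"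
proof -
  have "(\<lambda>t. coord c (s t)) field_differentiable at t0" if t0: "t0 \<in> B" "s t0 \<in> chart_dom c" for t0
  proof -
    obtain \<epsilon> s' where s': "\<epsilon> > 0" "is_section (ball (T (s t0)) \<epsilon>) s'" "s' (T (s t0)) = s t0"
      "(\<lambda>t. coord c (s' t)) holomorphic_on ball (T (s t0)) \<epsilon>"
      by (rule ex_section[OF c t0(2)]) blast
    have Ts: "T (s t0) = t0" using s t0(1) by (simp add: is_section_def)
    obtain \<delta> where \<delta>: "\<delta> > 0" "ball t0 \<delta> \<subseteq> B" using B t0(1) open_contains_ball by blast
    let ?r = "min \<delta> \<epsilon>"
    have eq: "s t = s' t" if "t \<in> ball t0 ?r" for t
      by (rule sections_agree[of "ball t0 ?r" s s' t0])
         (use s' \<delta> Ts that in \<open>auto intro!: section_subset[OF s] section_subset[OF s'(2)]\<close>)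
    have "(\<lambda>t. coord c (s t)) holomorphic_on ball t0 ?r"
      by (rule holomorphic_transform[OF holomorphic_on_subset[OF s'(4)]]) (use eq Ts in auto)
    then show ?thesis
      by (rule holomorphic_on_imp_differentiable_at[OF _ open_ball]) (use \<delta>(1) s'(1) in auto)
  qed
  then show ?thesis unfolding holomorphic_on_def using field_differentiable_at_within by blast
qed

lemma glue_sections:
  assumes ope: "\<And>i. i \<in> I \<Longrightarrow> open (B i)" and s: "\<And>i. i \<in> I \<Longrightarrow> is_section (B i) (s i)"
    and agree: "\<And>i j t. i \<in> I \<Longrightarrow> j \<in> I \<Longrightarrow> t \<in> B i \<Longrightarrow> t \<in> B j \<Longrightarrow> s i t = s j t"
  obtains s' where "is_section (\<Union>i\<in>I. B i) s'" "\<And>i t. i \<in> I \<Longrightarrow> t \<in> B i \<Longrightarrow> s' t = s i t"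
proof -
  let ?U = "\<Union>i\<in>I. B i"
  obtain s' where s': "continuous_map (top_of_set ?U) X s'" "\<And>t i. i \<in> I \<Longrightarrow> t \<in> topspace (top_of_set ?U) \<inter> B i \<Longrightarrow> s' t = s i t"
  proof (rule pasting_lemma_exists[where X = "top_of_set ?U" and T = B and f = s and I = I and Y = X])
    show "openin (top_of_set ?U) (B i)" if "i \<in> I" for i using ope[OF that] that by (intro open_subset) auto
    show "continuous_map (subtopology (top_of_set ?U) (B i)) X (s i)" if "i \<in> I" for i
    proof -
      have "?U \<inter> B i = B i" using that by auto
      then show ?thesis using s[OF that] by (simp add: is_section_def subtopology_subtopology)
    qed
    show "s i t = s j t" if "i \<in> I" "j \<in> I" "t \<in> topspace (top_of_set ?U) \<inter> B i \<inter> B j" for i j t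
      by (rule agree[OF that(1,2)]) (use that(3) in simp_all)
    fix s' assume "continuous_map (top_of_set ?U) X s'" "\<And>t i. i \<in> I \<Longrightarrow> t \<in> topspace (top_of_set ?U) \<inter> B i \<Longrightarrow> s' t = s i t"
    then show thesis by (rule that)
  qed simp
  show thesis
  proof
    show eq: "s' t = s i t" if "i \<in> I" "t \<in> B i" for i t
      by (rule s'(2)[OF that(1)]) (use that in auto)
    show "is_section ?U s'" unfolding is_section_def
    proof (intro conjI ballI)
      fix t assume "t \<in> ?U"
      then obtain i where "i \<in> I" "t \<in> B i" by blast
      then show "T (s' t) = t" using eq[of i t] s[of i] by (simp add: is_section_def)
    qed (rule s'(1))
  qed
qed

subsection \<open>Curves\<close>

lemma pathin_preimage_open:
  assumes "pathin X \<gamma>" "openin X N" shows "open {t \<in> {0<..<1}. \<gamma> t \<in> N}"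
proof -
  have "openin (top_of_set {0..1}) {t \<in> topspace (top_of_set {0..1}). \<gamma> t \<in> N}"
    using assms unfolding pathin_def by (rule openin_continuous_map_preimage)
  then obtain W where W: "open W" "{t \<in> {0..1}. \<gamma> t \<in> N} = {0..1} \<inter> W" unfolding openin_open by auto
  have "{t \<in> {0<..<1}. \<gamma> t \<in> N} = {0<..<1} \<inter> {t \<in> {0..1}. \<gamma> t \<in> N}" by auto
  also have "\<dots> = {0<..<1} \<inter> W" unfolding W(2) by auto
  finally have "{t \<in> {0<..<1}. \<gamma> t \<in> N} = {0<..<1} \<inter> W" .
  then show ?thesis using W(1) by (simp add: open_Int)
qed

lemma dT_derivative:
  assumes "c \<in> A" "p \<in> chart_dom c"
  shows "((\<lambda>z. T (chart_inv c z)) has_field_derivative dT c p) (at (coord c p))"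
  unfolding dT_def by (rule holomorphic_derivI[OF T_holomorphic[OF assms(1)] chart_open[OF chart[OF assms(1)]]]) (use assms in auto)

text \<open>The chain rule through \<open>T\<close> in one direction; in the other, the coordinate
  is recovered from \<open>T\<close> by a local section, whose derivative is the reciprocal of
  \<open>dT\<close>.\<close>

lemma curve_derivative:
  assumes \<gamma>: "pathin X \<gamma>" and u: "u \<in> {0<..<1}" and c: "c \<in> A" "\<gamma> u \<in> chart_dom c"
  shows "(coord c \<circ> \<gamma> has_vector_derivative D) (at u) \<Longrightarrow> (T \<circ> \<gamma> has_vector_derivative (D * dT c (\<gamma> u))) (at u)"
    and "(T \<circ> \<gamma> has_vector_derivative D) (at u) \<Longrightarrow> (coord c \<circ> \<gamma> has_vector_derivative (D / dT c (\<gamma> u))) (at u)"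
proof -
  note ch = chart[OF c(1)]
  show "(T \<circ> \<gamma> has_vector_derivative (D * dT c (\<gamma> u))) (at u)" if D: "(coord c \<circ> \<gamma> has_vector_derivative D) (at u)"
  proof (rule has_vector_derivative_transform_within_open)
    show "((\<lambda>z. T (chart_inv c z)) \<circ> (coord c \<circ> \<gamma>) has_vector_derivative (D * dT c (\<gamma> u))) (at u)"
      by (rule field_vector_diff_chain_at[OF D]) (use dT_derivative[OF c] in simp)
    show "open {t \<in> {0<..<1}. \<gamma> t \<in> chart_dom c}" by (rule pathin_preimage_open[OF \<gamma> chart_openin[OF ch]])
    show "u \<in> {t \<in> {0<..<1}. \<gamma> t \<in> chart_dom c}" using u c by simp
    show "((\<lambda>z. T (chart_inv c z)) \<circ> (coord c \<circ> \<gamma>)) t = (T \<circ> \<gamma>) t" if "t \<in> {t \<in> {0<..<1}. \<gamma> t \<in> chart_dom c}" for t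
      using that chart_inv_coord[OF ch, of "\<gamma> t"] by simp
  qed
  show "(coord c \<circ> \<gamma> has_vector_derivative (D / dT c (\<gamma> u))) (at u)" if D: "(T \<circ> \<gamma> has_vector_derivative D) (at u)"
  proof -
    obtain \<epsilon> s where s: "\<epsilon> > 0" "is_section (ball (T (\<gamma> u)) \<epsilon>) s" "s (T (\<gamma> u)) = \<gamma> u"
      "(\<lambda>t. coord c (s t)) holomorphic_on ball (T (\<gamma> u)) \<epsilon>" "openin X (s ` ball (T (\<gamma> u)) \<epsilon>)" "s ` ball (T (\<gamma> u)) \<epsilon> \<subseteq> chart_dom c"
      by (rule ex_section[OF c]) blast
    let ?B = "ball (T (\<gamma> u)) \<epsilon>"
    define d where "d = deriv (\<lambda>t. coord c (s t)) (T (\<gamma> u))"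
    have d: "((\<lambda>t. coord c (s t)) has_field_derivative d) (at (T (\<gamma> u)))"
      unfolding d_def by (rule holomorphic_derivI[OF s(4) open_ball]) (use s(1) in simp)
    have "((\<lambda>z. T (chart_inv c z)) has_field_derivative dT c (\<gamma> u)) (at (coord c (s (T (\<gamma> u)))))"
      using dT_derivative[OF c] s(3) by simp
    from DERIV_chain[OF this d]
    have "(((\<lambda>z. T (chart_inv c z)) \<circ> (\<lambda>t. coord c (s t))) has_field_derivative dT c (\<gamma> u) * d) (at (T (\<gamma> u)))" .
    then have "((\<lambda>t. t) has_field_derivative dT c (\<gamma> u) * d) (at (T (\<gamma> u)))"
    proof (rule has_field_derivative_transform_within_open[OF _ open_ball])
      show "T (\<gamma> u) \<in> ?B" using s(1) by simp
      show "((\<lambda>z. T (chart_inv c z)) \<circ> (\<lambda>t. coord c (s t))) t = t" if "t \<in> ?B" for t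
      proof -
        have "s t \<in> chart_dom c" using s(6) that by blast
        then show ?thesis using chart_inv_coord[OF ch, of "s t"] s(2) that by (simp add: is_section_def)
      qed
    qed
    then have "dT c (\<gamma> u) * d = 1" using DERIV_unique DERIV_ident by blast
    then have dd: "D * d = D / dT c (\<gamma> u)" by (metis divide_inverse inverse_unique)
    show ?thesis unfolding dd[symmetric]
    proof (rule has_vector_derivative_transform_within_open)
      show "((\<lambda>t. coord c (s t)) \<circ> (T \<circ> \<gamma>) has_vector_derivative (D * d)) (at u)"
        by (rule field_vector_diff_chain_at[OF D]) (use d in simp)
      show "open {t \<in> {0<..<1}. \<gamma> t \<in> s ` ?B}" by (rule pathin_preimage_open[OF \<gamma> s(5)])
      show "u \<in> {t \<in> {0<..<1}. \<gamma> t \<in> s ` ?B}" using u s(1,3) by (auto simp: image_iff intro!: bexI[of _ "T (\<gamma> u)"])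
      show "((\<lambda>t. coord c (s t)) \<circ> (T \<circ> \<gamma>)) t = (coord c \<circ> \<gamma>) t" if "t \<in> {t \<in> {0<..<1}. \<gamma> t \<in> s ` ?B}" for t
        using that s(2) by (auto simp: is_section_def)
    qed
  qed
qed

lemma curve_coord_continuous:
  assumes \<gamma>: "pathin X \<gamma>" and c: "c \<in> A" and S: "S \<subseteq> {0..1}" "\<gamma> ` S \<subseteq> chart_dom c"
  shows "continuous_on S (coord c \<circ> \<gamma>)" "continuous_on S (\<lambda>t. dT c (\<gamma> t))"
proof -
  have "continuous_map (top_of_set S) X \<gamma>"
    using \<gamma> unfolding pathin_def by (rule continuous_map_from_subtopology_mono[OF _ S(1)])
  then have 1: "continuous_map (top_of_set S) (subtopology X (chart_dom c)) \<gamma>"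
    using S(2) by (simp add: continuous_map_in_subtopology image_subset_iff_funcset)
  have "continuous_map (subtopology X (chart_dom c)) (top_of_set (coord c ` chart_dom c)) (coord c)"
    using chart[OF c] unfolding chart_of_def by (blast intro: homeomorphic_imp_continuous_map)
  from continuous_map_compose[OF 1 this] show 2: "continuous_on S (coord c \<circ> \<gamma>)"
    by (simp add: continuous_map_in_subtopology)
  have "continuous_on (coord c ` chart_dom c) (deriv (\<lambda>z. T (chart_inv c z)))"
    by (intro holomorphic_on_imp_continuous_on holomorphic_deriv T_holomorphic[OF c] chart_open[OF chart[OF c]])
  from continuous_on_compose2[OF this 2] show "continuous_on S (\<lambda>t. dT c (\<gamma> t))"
    using S(2) unfolding dT_def by (simp add: image_subset_iff)
qed

lemma path_T_continuous: "pathin X \<gamma> \<Longrightarrow> continuous_on {0..1} (T \<circ> \<gamma>)"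
  using continuous_map_compose[OF _ T_continuous, of "top_of_set {0..1}" \<gamma>] by (simp add: pathin_def)

text \<open>This lets smoothness of curves be read off from \<open>T\<close> alone. Towards the
  charts, local sections invert \<open>T\<close>; conversely, bisection of the unit interval reduces
  to pieces that lie in one chart.\<close>

lemma curve_iff:
  assumes \<gamma>: "pathin X \<gamma>"
  shows "piecewise_C1_curve X A \<gamma> \<longleftrightarrow> (T \<circ> \<gamma>) piecewise_C1_differentiable_on {0..1}"
proof
  assume T: "(T \<circ> \<gamma>) piecewise_C1_differentiable_on {0..1}"
  obtain S D where S: "finite S" and D: "\<And>t. t \<in> {0..1} - S \<Longrightarrow> (T \<circ> \<gamma> has_vector_derivative D t) (at t)" "continuous_on ({0..1} - S) D"
    using piecewise_C1_obtain[OF T] by metis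
  show "piecewise_C1_curve X A \<gamma>"
    unfolding piecewise_C1_curve_def
  proof (intro conjI ballI allI impI \<gamma>)
    fix c s t assume c: "c \<in> A" and st: "{s..t} \<subseteq> {0..1} \<and> \<gamma> ` {s..t} \<subseteq> chart_dom c"
    \<comment> \<open>The endpoints join the exceptional set since \<open>curve_derivative\<close>
      speaks only of times inside the open unit interval.\<close>
    let ?S = "insert s (insert t S)"
    have in01: "u \<in> {0<..<1}" "u \<in> {0..1} - S" "\<gamma> u \<in> chart_dom c" if "u \<in> {s..t} - ?S" for u
    proof -
      have u: "s < u" "u < t" "u \<notin> S" using that by auto
      then have "s \<in> {s..t}" "t \<in> {s..t}" "u \<in> {s..t}" by auto
      then have "s \<in> {0..1}" "t \<in> {0..1}" "\<gamma> u \<in> chart_dom c" using st by blast+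
      then show "u \<in> {0<..<1}" "u \<in> {0..1} - S" "\<gamma> u \<in> chart_dom c" using u by auto
    qed
    have "(coord c \<circ> \<gamma>) C1_differentiable_on ({s..t} - ?S)"
      unfolding C1_differentiable_on_def
    proof (intro exI conjI ballI)
      fix u assume u: "u \<in> {s..t} - ?S"
      show "(coord c \<circ> \<gamma> has_vector_derivative D u / dT c (\<gamma> u)) (at u)"
        by (rule curve_derivative(2)[OF \<gamma> in01(1)[OF u] c in01(3)[OF u] D(1)[OF in01(2)[OF u]]])
    next
      have nz: "dT c (\<gamma> u) \<noteq> 0" if "u \<in> {s..t} - ?S" for u
        unfolding dT_def by (rule T_immersion[OF c in01(3)[OF that]])
      have "{s..t} - ?S \<subseteq> {0..1}" "\<gamma> ` ({s..t} - ?S) \<subseteq> chart_dom c" using st by auto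
      from curve_coord_continuous(2)[OF \<gamma> c this]
      show "continuous_on ({s..t} - ?S) (\<lambda>u. D u / dT c (\<gamma> u))"
        by (intro continuous_intros continuous_on_subset[OF D(2)]) (use nz in01(2) in auto)
    qed
    moreover have "continuous_on {s..t} (coord c \<circ> \<gamma>)" using curve_coord_continuous(1)[OF \<gamma> c] st by blast
    ultimately show "(coord c \<circ> \<gamma>) piecewise_C1_differentiable_on {s..t}"
      unfolding piecewise_C1_differentiable_on_def using S by (intro conjI exI[of _ ?S]) auto
  qed
next
  assume curve: "piecewise_C1_curve X A \<gamma>"
  have "{0..1} \<subseteq> {0..1::real} \<longrightarrow> (T \<circ> \<gamma>) piecewise_C1_differentiable_on {0..1}"
  proof (rule Bolzano[where P = "\<lambda>a b. {a..b} \<subseteq> {0..1} \<longrightarrow> (T \<circ> \<gamma>) piecewise_C1_differentiable_on {a..b}"])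
    fix x :: real assume x: "0 \<le> x" "x \<le> 1"
    then have "\<gamma> x \<in> topspace X" using \<gamma> unfolding pathin_def continuous_map_def by auto
    then obtain c where c: "c \<in> A" "\<gamma> x \<in> chart_dom c" using chart_cover by blast
    have "openin (top_of_set {0..1}) {t \<in> topspace (top_of_set {0..1}). \<gamma> t \<in> chart_dom c}"
      using \<gamma> chart_openin[OF chart[OF c(1)]] unfolding pathin_def by (rule openin_continuous_map_preimage)
    then obtain d where d: "d > 0" "\<And>t. t \<in> {0..1} \<Longrightarrow> dist t x < d \<Longrightarrow> \<gamma> t \<in> chart_dom c"
      unfolding openin_euclidean_subtopology_iff using x c(2) by auto
    have "(T \<circ> \<gamma>) piecewise_C1_differentiable_on {a..b}" if ab: "a \<le> x" "x \<le> b" "b - a < d" "{a..b} \<subseteq> {0..1}" for a b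
    proof -
      have "\<gamma> t \<in> chart_dom c" if "t \<in> {a..b}" for t
        by (rule d(2)) (use that ab in \<open>auto simp: dist_real_def\<close>)
      then have im: "\<gamma> ` {a..b} \<subseteq> chart_dom c" by blast
      then have pw: "(coord c \<circ> \<gamma>) piecewise_C1_differentiable_on {a..b}"
        using curve c(1) ab(4) unfolding piecewise_C1_curve_def by blast
      obtain S D where S: "finite S" and D: "\<And>t. t \<in> {a..b} - S \<Longrightarrow> (coord c \<circ> \<gamma> has_vector_derivative D t) (at t)" "continuous_on ({a..b} - S) D"
        using piecewise_C1_obtain[OF pw] by metis
      let ?S = "insert a (insert b S)"
      have in01: "u \<in> {0<..<1}" "u \<in> {a..b} - S" "\<gamma> u \<in> chart_dom c" if "u \<in> {a..b} - ?S" for u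
      proof -
        have u: "a < u" "u < b" "u \<notin> S" using that by auto
        then have "a \<in> {a..b}" "b \<in> {a..b}" "u \<in> {a..b}" by auto
        then have "a \<in> {0..1}" "b \<in> {0..1}" "\<gamma> u \<in> chart_dom c" using im ab(4) by blast+
        then show "u \<in> {0<..<1}" "u \<in> {a..b} - S" "\<gamma> u \<in> chart_dom c" using u by auto
      qed
      have "(T \<circ> \<gamma>) C1_differentiable_on ({a..b} - ?S)"
        unfolding C1_differentiable_on_def
      proof (intro exI conjI ballI)
        fix u assume u: "u \<in> {a..b} - ?S"
        show "(T \<circ> \<gamma> has_vector_derivative D u * dT c (\<gamma> u)) (at u)"
          by (rule curve_derivative(1)[OF \<gamma> in01(1)[OF u] c(1) in01(3)[OF u] D(1)[OF in01(2)[OF u]]])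
      next
        have "{a..b} - ?S \<subseteq> {0..1}" "\<gamma> ` ({a..b} - ?S) \<subseteq> chart_dom c" using ab(4) im by blast+
        from curve_coord_continuous(2)[OF \<gamma> c(1) this]
        show "continuous_on ({a..b} - ?S) (\<lambda>u. D u * dT c (\<gamma> u))"
          by (intro continuous_intros continuous_on_subset[OF D(2)]) auto
      qed
      then show ?thesis
        unfolding piecewise_C1_differentiable_on_def using S continuous_on_subset[OF path_T_continuous[OF \<gamma>] ab(4)]
        by (intro conjI exI[of _ ?S]) auto
    qed
    then show "\<exists>d>0. \<forall>a b. a \<le> x \<and> x \<le> b \<and> b - a < d \<longrightarrow> {a..b} \<subseteq> {0..1} \<longrightarrow> (T \<circ> \<gamma>) piecewise_C1_differentiable_on {a..b}"
      using d(1) by blast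
  next
    fix a b c :: real
    assume ab: "{a..b} \<subseteq> {0..1} \<longrightarrow> (T \<circ> \<gamma>) piecewise_C1_differentiable_on {a..b}"
      and bc: "{b..c} \<subseteq> {0..1} \<longrightarrow> (T \<circ> \<gamma>) piecewise_C1_differentiable_on {b..c}" and le: "a \<le> b" "b \<le> c"
    show "{a..c} \<subseteq> {0..1} \<longrightarrow> (T \<circ> \<gamma>) piecewise_C1_differentiable_on {a..c}"
    proof
      assume "{a..c} \<subseteq> {0..1}"
      moreover have "{a..b} \<subseteq> {a..c}" "{b..c} \<subseteq> {a..c}" using le by auto
      ultimately have "{a..b} \<subseteq> {0..1}" "{b..c} \<subseteq> {0..1}" by blast+
      then show "(T \<circ> \<gamma>) piecewise_C1_differentiable_on {a..c}"
        using piecewise_C1_combine[OF ab[rule_format] bc[rule_format] le] by blast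
    qed
  qed simp
  then show "(T \<circ> \<gamma>) piecewise_C1_differentiable_on {0..1}" by simp
qed

text \<open>The factor \<open>dT\<close> in the metric cancels against the one between the
  velocities of the coordinate and of \<open>T \<circ> \<gamma>\<close>, so the chart chosen in
  \<open>curve_speed\<close> drops out.\<close>

lemma curve_length_eq:
  assumes curve: "piecewise_C1_curve X A \<gamma>"
  shows "curve_length A g \<gamma> = hlen (T \<circ> \<gamma>)"
proof -
  have \<gamma>: "pathin X \<gamma>" using curve by (simp add: piecewise_C1_curve_def)
  obtain S D where S: "finite S" and D: "\<And>t. t \<in> {0..1} - S \<Longrightarrow> (T \<circ> \<gamma> has_vector_derivative D t) (at t)"
    using piecewise_C1_obtain[OF curve[unfolded curve_iff[OF \<gamma>]]] by metis
  show ?thesis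
    unfolding curve_length_def hlen_def
  proof (rule nn_integral_cong_AE)
    show "AE t in lborel. ennreal (curve_speed A g \<gamma> t) * indicator {0..1} t =
      ennreal (sqrt 2 * norm (vector_derivative (T \<circ> \<gamma>) (at t)) / (1 - (norm ((T \<circ> \<gamma>) t))\<^sup>2)) * indicator {0..1} t"
      using finite_AE_not_in[OF finite.insertI[OF finite.insertI[OF S]], of 0 1]
    proof eventually_elim
      case (elim t)
      then have t: "t \<noteq> 0 \<and> t \<noteq> 1 \<and> t \<notin> S" by auto
      show "ennreal (curve_speed A g \<gamma> t) * indicator {0..1} t =
        ennreal (sqrt 2 * norm (vector_derivative (T \<circ> \<gamma>) (at t)) / (1 - (norm ((T \<circ> \<gamma>) t))\<^sup>2)) * indicator {0..1} t"
      proof (cases "t \<in> {0..1}")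
        case True
        then have t01: "t \<in> {0<..<1}" "t \<in> {0..1} - S" and tX: "\<gamma> t \<in> topspace X"
          using t \<gamma> unfolding pathin_def continuous_map_def by auto
        define c where "c = (SOME c. c \<in> A \<and> \<gamma> t \<in> chart_dom c)"
        have "c \<in> A \<and> \<gamma> t \<in> chart_dom c"
          unfolding c_def by (rule someI_ex) (use chart_cover[OF tX] in blast)
        then have c: "c \<in> A" "\<gamma> t \<in> chart_dom c" by auto
        have nz: "dT c (\<gamma> t) \<noteq> 0" unfolding dT_def by (rule T_immersion[OF c])
        have pos: "0 < 1 - (norm (T (\<gamma> t)))\<^sup>2" using T_lt[OF tX] by (simp add: abs_square_less_1)
        have "sqrt (g c (\<gamma> t)) = sqrt 2 * norm (dT c (\<gamma> t)) / (1 - (norm (T (\<gamma> t)))\<^sup>2)"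
          unfolding g_pullback[OF c] dT_def[symmetric] using pos by (simp add: real_sqrt_divide real_sqrt_mult)
        moreover have "vector_derivative (coord c \<circ> \<gamma>) (at t) = D t / dT c (\<gamma> t)"
          by (rule vector_derivative_at[OF curve_derivative(2)[OF \<gamma> t01(1) c D[OF t01(2)]]])
        ultimately have "curve_speed A g \<gamma> t = sqrt 2 * norm (D t) / (1 - (norm (T (\<gamma> t)))\<^sup>2)"
          using nz by (simp add: curve_speed_def c_def[symmetric] norm_divide)
        then show ?thesis using vector_derivative_at[OF D[OF t01(2)]] by simp
      qed simp
    qed
  qed
qed

end

text \<open>The two functions may differ outside the unit interval, where a derivative at
  \<open>0\<close> or \<open>1\<close> would see them; these two times therefore join the
  exceptional set.\<close>

lemma hlen_cong:
  assumes \<eta>': "\<eta>' piecewise_C1_differentiable_on {0..1}" and eq: "\<And>t. t \<in> {0..1} \<Longrightarrow> \<eta> t = \<eta>' t"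
  shows "\<eta> piecewise_C1_differentiable_on {0..1}" "hlen \<eta> = hlen \<eta>'"
proof -
  obtain S D where S: "finite S" and D: "\<And>t. t \<in> {0..1} - S \<Longrightarrow> (\<eta>' has_vector_derivative D t) (at t)" "continuous_on ({0..1} - S) D" "continuous_on {0..1} \<eta>'"
    using piecewise_C1_obtain[OF \<eta>'] by metis
  let ?S = "insert 0 (insert 1 S)"
  have S': "finite ?S" using S by simp
  have D': "(\<eta> has_vector_derivative D t) (at t)" if "t \<in> {0..1} - ?S" for t
    by (rule has_vector_derivative_transform_within_open[of \<eta>' _ _ "{0<..<1}"]) (use D(1)[of t] that eq in auto)
  have "\<eta> C1_differentiable_on ({0..1} - ?S)"
    unfolding C1_differentiable_on_def by (intro exI[of _ D] conjI ballI D' continuous_on_subset[OF D(2)]) auto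
  moreover have "continuous_on {0..1} \<eta>" by (rule continuous_on_eq[OF D(3)]) (simp add: eq)
  ultimately show "\<eta> piecewise_C1_differentiable_on {0..1}"
    unfolding piecewise_C1_differentiable_on_def using S' by (intro conjI exI[of _ ?S])
  have "hlen \<eta> = (\<integral>\<^sup>+t\<in>{0..1} - ?S. ennreal (sqrt 2 * norm (D t) / (1 - (norm (\<eta> t))\<^sup>2)) \<partial>lborel)"
    by (rule hlen_eq[OF S' D'])
  also have "\<dots> = (\<integral>\<^sup>+t\<in>{0..1} - ?S. ennreal (sqrt 2 * norm (D t) / (1 - (norm (\<eta>' t))\<^sup>2)) \<partial>lborel)"
    by (rule nn_integral_cong) (auto simp: indicator_def eq)
  also have "\<dots> = hlen \<eta>'" by (rule hlen_eq[OF S' D(1), symmetric]) auto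
  finally show "hlen \<eta> = hlen \<eta>'" .
qed

context disc_immersion
begin

subsection \<open>The distance\<close>

definition curves :: "'a \<Rightarrow> 'a \<Rightarrow> (real \<Rightarrow> 'a) set" where
  "curves p q = {\<gamma>. pathin X \<gamma> \<and> (T \<circ> \<gamma>) piecewise_C1_differentiable_on {0..1} \<and> \<gamma> 0 = p \<and> \<gamma> 1 = q}"

text \<open>Kept in \<open>ennreal\<close>, where an infimum over no curves is \<open>top\<close>
  and the triangle inequality holds before finiteness is known; \<open>enn2real\<close> would turn
  \<open>top\<close> into \<open>0\<close>.\<close>

definition edist :: "'a \<Rightarrow> 'a \<Rightarrow> ennreal" where
  "edist p q = (INF \<gamma> \<in> curves p q. hlen (T \<circ> \<gamma>))"

abbreviation distance :: "'a \<Rightarrow> 'a \<Rightarrow> real" where "distance \<equiv> metric_dist X A g"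

lemma distance_eq: "distance p q = enn2real (edist p q)"
proof -
  have "{\<gamma>. piecewise_C1_curve X A \<gamma> \<and> \<gamma> 0 = p \<and> \<gamma> 1 = q} = curves p q"
    unfolding curves_def using curve_iff piecewise_C1_curve_def by blast
  moreover have "curve_length A g \<gamma> = hlen (T \<circ> \<gamma>)" if "\<gamma> \<in> curves p q" for \<gamma>
    using that curve_iff curve_length_eq unfolding curves_def by blast
  ultimately show ?thesis unfolding metric_dist_def edist_def by (simp cong: INF_cong)
qed

lemma curve_lt: "pathin X \<gamma> \<Longrightarrow> \<forall>t\<in>{0..1}. norm ((T \<circ> \<gamma>) t) < 1"
  using T_lt unfolding pathin_def continuous_map_def by auto

lemma curves_reverse:
  assumes \<gamma>: "\<gamma> \<in> curves p q" shows "(\<lambda>t. \<gamma> (1 - t)) \<in> curves q p"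
proof -
  have "continuous_map (top_of_set {0..1}) (top_of_set {0..1}) (\<lambda>t::real. 1 - t)"
    by (auto simp: continuous_map_in_subtopology intro!: continuous_intros)
  then have "pathin X (\<lambda>t. \<gamma> (1 - t))"
    using \<gamma> continuous_map_compose[of "top_of_set {0..1}" "top_of_set {0..1}" "\<lambda>t. 1 - t" X \<gamma>]
    by (simp add: curves_def pathin_def o_def)
  moreover have "(T \<circ> (\<lambda>t. \<gamma> (1 - t))) piecewise_C1_differentiable_on {0..1}"
    using valid_path_imp_reverse[of "T \<circ> \<gamma>"] \<gamma> by (simp add: curves_def valid_path_def reversepath_def o_def)
  ultimately show ?thesis using \<gamma> by (simp add: curves_def)
qed

lemma edist_le_swap: "edist q p \<le> edist p q"
proof -
  have "edist q p \<le> hlen (T \<circ> \<gamma>)" if \<gamma>: "\<gamma> \<in> curves p q" for \<gamma>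
  proof -
    have "edist q p \<le> hlen (T \<circ> (\<lambda>t. \<gamma> (1 - t)))"
      unfolding edist_def by (rule INF_lower[OF curves_reverse[OF \<gamma>]])
    also have "\<dots> \<le> hlen (T \<circ> \<gamma>)"
      using hlen_reverse_le[of "T \<circ> \<gamma>"] \<gamma> curve_lt by (simp add: curves_def o_def)
    finally show ?thesis .
  qed
  then show ?thesis unfolding edist_def[of p q] by (rule INF_greatest)
qed

text \<open>The operation \<open>+++\<close> belongs to topological types, whereas the points of
  \<open>X\<close> carry a topology only as a value.\<close>

definition join_curves :: "(real \<Rightarrow> 'a) \<Rightarrow> (real \<Rightarrow> 'a) \<Rightarrow> real \<Rightarrow> 'a" where
  "join_curves \<gamma>1 \<gamma>2 t = (if t \<le> 1/2 then \<gamma>1 (2 * t) else \<gamma>2 (2 * t - 1))"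

lemma pathin_join:
  assumes "pathin X \<gamma>1" "pathin X \<gamma>2" "\<gamma>1 1 = \<gamma>2 0" shows "pathin X (join_curves \<gamma>1 \<gamma>2)"
proof -
  let ?T01 = "top_of_set {0..1::real}"
  have "continuous_map ?T01 X (\<lambda>x. if x \<le> 1/2 then (\<gamma>1 \<circ> (\<lambda>t. 2 * t)) x else (\<gamma>2 \<circ> (\<lambda>t. 2 * t - 1)) x)"
  proof (intro continuous_map_cases_le continuous_map_compose, force, force)
    show "continuous_map (subtopology ?T01 {x \<in> topspace ?T01. x \<le> 1/2}) ?T01 ((*) 2)"
      by (auto simp: continuous_map_in_subtopology continuous_map_from_subtopology)
    have "continuous_map (subtopology (top_of_set {0..1}) {x. 0 \<le> x \<and> x \<le> 1 \<and> 1 \<le> x * 2}) euclideanreal (\<lambda>t. 2 * t - 1)"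
      by (intro continuous_intros) (force intro: continuous_map_from_subtopology)
    then show "continuous_map (subtopology ?T01 {x \<in> topspace ?T01. 1/2 \<le> x}) ?T01 (\<lambda>t. 2 * t - 1)"
      by (force simp: continuous_map_in_subtopology)
    show "(\<gamma>1 \<circ> (*) 2) x = (\<gamma>2 \<circ> (\<lambda>t. 2 * t - 1)) x" if "x \<in> topspace ?T01" "x = 1/2" for x
      unfolding that(2) using assms(3) by simp
  qed (use assms in \<open>auto simp: pathin_def\<close>)
  then show ?thesis by (simp only: pathin_def join_curves_def[abs_def] o_def)
qed

lemma edist_triangle: "edist p r \<le> edist p q + edist q r"
proof -
  have *: "edist p r \<le> hlen (T \<circ> \<gamma>1) + hlen (T \<circ> \<gamma>2)" if \<gamma>: "\<gamma>1 \<in> curves p q" "\<gamma>2 \<in> curves q r" for \<gamma>1 \<gamma>2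
  proof -
    have e: "T \<circ> (join_curves \<gamma>1 \<gamma>2) = (T \<circ> \<gamma>1) +++ (T \<circ> \<gamma>2)" by (auto simp: joinpaths_def join_curves_def)
    have "valid_path ((T \<circ> \<gamma>1) +++ (T \<circ> \<gamma>2))"
      by (rule valid_path_join) (use \<gamma> in \<open>auto simp: curves_def valid_path_def pathstart_def pathfinish_def\<close>)
    moreover have "pathin X (join_curves \<gamma>1 \<gamma>2)" by (rule pathin_join) (use \<gamma> in \<open>auto simp: curves_def\<close>)
    ultimately have "join_curves \<gamma>1 \<gamma>2 \<in> curves p r" using \<gamma> by (auto simp: curves_def e valid_path_def join_curves_def)
    then have "edist p r \<le> hlen (T \<circ> (join_curves \<gamma>1 \<gamma>2))" unfolding edist_def by (rule INF_lower)
    also have "\<dots> \<le> hlen (T \<circ> \<gamma>1) + hlen (T \<circ> \<gamma>2)"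
      unfolding e by (rule hlen_join_le) (use \<gamma> curve_lt in \<open>auto simp: curves_def\<close>)
    finally show ?thesis .
  qed
  show ?thesis
  proof (rule ennreal_le_epsilon)
    fix e :: real assume "edist p q + edist q r < top" and e: "0 < e"
    then have fin: "edist p q < top" "edist q r < top" by auto
    have "edist p q < edist p q + ennreal (e / 2)" "edist q r < edist q r + ennreal (e / 2)"
      using fin e ennreal_add_left_cancel_less[of "edist p q" 0 "ennreal (e / 2)"] ennreal_add_left_cancel_less[of "edist q r" 0 "ennreal (e / 2)"]
      by (auto simp: less_top)
    then obtain \<gamma>1 \<gamma>2 where \<gamma>: "\<gamma>1 \<in> curves p q" "hlen (T \<circ> \<gamma>1) < edist p q + ennreal (e / 2)"
      "\<gamma>2 \<in> curves q r" "hlen (T \<circ> \<gamma>2) < edist q r + ennreal (e / 2)"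
      unfolding edist_def[of p q] edist_def[of q r] by (auto simp: INF_less_iff)
    have "edist p r \<le> hlen (T \<circ> \<gamma>1) + hlen (T \<circ> \<gamma>2)" by (rule *[OF \<gamma>(1,3)])
    also have "\<dots> \<le> (edist p q + ennreal (e / 2)) + (edist q r + ennreal (e / 2))"
      using \<gamma>(2,4) by (intro add_mono) auto
    also have "\<dots> = edist p q + edist q r + ennreal e"
      using e ennreal_plus[of "e / 2" "e / 2"] by (simp add: ac_simps)
    finally show "edist p r \<le> edist p q + edist q r + ennreal e" .
  qed
qed

text \<open>The section lifts the segment to a curve in the surface with the same length.\<close>

lemma edist_section_le:
  assumes s: "is_section B s" and ab: "closed_segment a b \<subseteq> B" and \<rho>: "norm a \<le> \<rho>" "norm b \<le> \<rho>" "\<rho> < 1"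
  shows "edist (s a) (s b) \<le> ennreal (sqrt 2 * norm (b - a) / (1 - \<rho>\<^sup>2))"
proof -
  have im: "linepath a b t \<in> B" if "t \<in> {0..1}" for t using that ab linepath_image_01 by (metis imageI subsetD)
  have eq: "(T \<circ> (s \<circ> linepath a b)) t = linepath a b t" if "t \<in> {0..1}" for t
    using im[OF that] s by (simp add: is_section_def)
  have lp: "linepath a b piecewise_C1_differentiable_on {0..1}" using valid_path_linepath valid_path_def by blast
  have "continuous_map (top_of_set {0..1}) (top_of_set B) (linepath a b)"
    using im by (auto simp: continuous_map_in_subtopology continuous_on_linepath)
  then have "pathin X (s \<circ> linepath a b)"
    using s unfolding is_section_def pathin_def by (blast intro: continuous_map_compose)
  then have "s \<circ> linepath a b \<in> curves (s a) (s b)"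
    unfolding curves_def by (intro CollectI conjI hlen_cong(1)[OF lp eq]) (auto simp: linepath_0' linepath_1')
  then have "edist (s a) (s b) \<le> hlen (T \<circ> (s \<circ> linepath a b))" unfolding edist_def by (rule INF_lower)
  also have "\<dots> = hlen (linepath a b)" by (rule hlen_cong(2)[OF lp eq])
  also have "\<dots> \<le> ennreal (sqrt 2 * norm (b - a) / (1 - \<rho>\<^sup>2))" by (rule hlen_linepath[OF \<rho>])
  finally show ?thesis .
qed

lemma edist_section_finite:
  assumes s: "is_section B s" and ab: "closed_segment a b \<subseteq> B"
  shows "edist (s a) (s b) < top"
proof -
  have "norm a < 1" "norm b < 1" using section_lt[OF s] ab by auto
  then have "edist (s a) (s b) \<le> ennreal (sqrt 2 * norm (b - a) / (1 - (max (norm a) (norm b))\<^sup>2))"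
    by (intro edist_section_le[OF s ab]) auto
  then show ?thesis using ennreal_less_top le_less_trans by blast
qed

lemma section_at:
  assumes "p \<in> topspace X"
  obtains \<epsilon> s where "\<epsilon> > 0" "is_section (ball (T p) \<epsilon>) s" "s (T p) = p" "openin X (s ` ball (T p) \<epsilon>)" "p \<in> s ` ball (T p) \<epsilon>"
proof -
  obtain c where c: "c \<in> A" "p \<in> chart_dom c" using chart_cover[OF assms] by blast
  obtain \<epsilon> s where s: "\<epsilon> > 0" "is_section (ball (T p) \<epsilon>) s" "s (T p) = p" "openin X (s ` ball (T p) \<epsilon>)"
    by (rule ex_section[OF c]) blast
  moreover have "p \<in> s ` ball (T p) \<epsilon>" using s(1,3) by (metis centre_in_ball imageI)
  ultimately show thesis by (rule that)
qed

text \<open>The points at finite distance from \<open>p\<close> form an open and closed set, since a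
  local section joins all points of its image by lifted segments.\<close>

lemma edist_finite:
  assumes p: "p \<in> topspace X" and q: "q \<in> topspace X" shows "edist p q < top"
proof -
  have local: "edist (s a) (s b) < top" if "is_section (ball c \<epsilon>) s" "a \<in> ball c \<epsilon>" "b \<in> ball c \<epsilon>" for s a b c \<epsilon>
    by (rule edist_section_finite[OF that(1) closed_segment_subset[OF that(2,3) convex_ball]])
  let ?Z = "{q \<in> topspace X. edist p q < top}"
  have "?Z = topspace X"
  proof (rule connected_induct)
    show "openin X ?Z"
    proof (subst openin_subopen, intro ballI)
      fix q assume q: "q \<in> ?Z"
      then have "q \<in> topspace X" by simp
      then obtain \<epsilon> s where s: "\<epsilon> > 0" "is_section (ball (T q) \<epsilon>) s" "s (T q) = q" "openin X (s ` ball (T q) \<epsilon>)" "q \<in> s ` ball (T q) \<epsilon>"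
        by (rule section_at)
      have "s t \<in> ?Z" if t: "t \<in> ball (T q) \<epsilon>" for t
      proof -
        have "edist q (s t) < top" using local[OF s(2) _ t, of "T q"] s(1,3) by simp
        then have "edist p q + edist q (s t) < top" using q by simp
        then show ?thesis using edist_triangle[of p "s t" q] section_in[OF s(2) t] le_less_trans by blast
      qed
      then have "s ` ball (T q) \<epsilon> \<subseteq> ?Z" by blast
      then show "\<exists>U. openin X U \<and> q \<in> U \<and> U \<subseteq> ?Z" using s(4,5) by blast
    qed
    obtain \<epsilon> s where s: "\<epsilon> > 0" "is_section (ball (T p) \<epsilon>) s" "s (T p) = p"
      using section_at[OF p] by metis
    have "edist p p < top" using local[OF s(2), of "T p" "T p"] s(1,3) by simp
    then show "?Z \<noteq> {}" using p by blast
  next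
    fix q assume q: "q \<in> topspace X" and meet: "\<And>V. openin X V \<Longrightarrow> q \<in> V \<Longrightarrow> V \<inter> ?Z \<noteq> {}"
    obtain \<epsilon> s where s: "\<epsilon> > 0" "is_section (ball (T q) \<epsilon>) s" "s (T q) = q" "openin X (s ` ball (T q) \<epsilon>)" "q \<in> s ` ball (T q) \<epsilon>"
      using q by (rule section_at)
    obtain t where t: "t \<in> ball (T q) \<epsilon>" "edist p (s t) < top" using meet[OF s(4,5)] by blast
    have "edist (s t) q < top" using local[OF s(2) t(1), of "T q"] s(1,3) by simp
    then have "edist p (s t) + edist (s t) q < top" using t(2) by simp
    then show "q \<in> ?Z" using edist_triangle[of p q "s t"] q le_less_trans by blast
  qed
  then show ?thesis using q by blast
qed

lemma edist_ge: "ennreal (sqrt 2 * norm (T q - T p)) \<le> edist p q"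
  unfolding edist_def
proof (rule INF_greatest)
  fix \<gamma> assume "\<gamma> \<in> curves p q"
  then show "ennreal (sqrt 2 * norm (T q - T p)) \<le> hlen (T \<circ> \<gamma>)"
    using hlen_ge_dist[of "T \<circ> \<gamma>" 1] curve_lt[of \<gamma>] by (simp add: curves_def)
qed

lemma edist_ge_log: "ennreal \<bar>ln (1 - (norm (T q))\<^sup>2) / 2 - ln (1 - (norm (T p))\<^sup>2) / 2\<bar> \<le> edist p q"
  unfolding edist_def
proof (rule INF_greatest)
  fix \<gamma> assume "\<gamma> \<in> curves p q"
  then show "ennreal \<bar>ln (1 - (norm (T q))\<^sup>2) / 2 - ln (1 - (norm (T p))\<^sup>2) / 2\<bar> \<le> hlen (T \<circ> \<gamma>)"
    using hlen_ge_log[of "T \<circ> \<gamma>" 1] curve_lt[of \<gamma>] by (simp add: curves_def)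
qed

lemma ennreal_distance: "p \<in> topspace X \<Longrightarrow> q \<in> topspace X \<Longrightarrow> ennreal (distance p q) = edist p q"
  using edist_finite[of p q] by (simp add: distance_eq)

lemma distance_ge: "p \<in> topspace X \<Longrightarrow> q \<in> topspace X \<Longrightarrow> sqrt 2 * norm (T q - T p) \<le> distance p q"
  using edist_ge[of q p] ennreal_distance[of p q] by (metis distance_eq enn2real_nonneg ennreal_le_iff)

lemma distance_ge_log:
  "p \<in> topspace X \<Longrightarrow> q \<in> topspace X \<Longrightarrow> \<bar>ln (1 - (norm (T q))\<^sup>2) / 2 - ln (1 - (norm (T p))\<^sup>2) / 2\<bar> \<le> distance p q"
  using edist_ge_log[of q p] ennreal_distance[of p q] by (metis distance_eq enn2real_nonneg ennreal_le_iff)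

lemma distance_section_le:
  assumes "is_section B s" "closed_segment a b \<subseteq> B" "norm a \<le> \<rho>" "norm b \<le> \<rho>" "\<rho> < 1"
  shows "distance (s a) (s b) \<le> sqrt 2 * norm (b - a) / (1 - \<rho>\<^sup>2)"
proof -
  have "0 \<le> \<rho>" using norm_ge_zero[of a] assms(3) by linarith
  then have "\<rho>\<^sup>2 < 1" using assms(5) by (simp add: abs_square_less_1)
  then show ?thesis unfolding distance_eq by (intro enn2real_leI edist_section_le[OF assms]) auto
qed

text \<open>A short curve from \<open>p\<close> is mapped by \<open>T\<close> into the disc of the
  section; by unique lifting it is the image under \<open>s\<close> of its projection, so it ends on
  the sheet of \<open>s\<close>. This also separates distinct points with the same image under
  \<open>T\<close>.\<close>

lemma near_in_section:
  assumes s: "is_section (ball (T p) \<epsilon>) s" "s (T p) = p" and lt: "distance p q < sqrt 2 * \<epsilon>" and p: "p \<in> topspace X" and q: "q \<in> topspace X"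
  shows "T q \<in> ball (T p) \<epsilon>" "s (T q) = q"
proof -
  have "edist p q < ennreal (sqrt 2 * \<epsilon>)"
    using lt ennreal_distance[OF p q] by (metis distance_eq enn2real_nonneg ennreal_less_iff)
  then obtain \<gamma> where \<gamma>: "\<gamma> \<in> curves p q" "hlen (T \<circ> \<gamma>) < ennreal (sqrt 2 * \<epsilon>)"
    unfolding edist_def by (auto simp: INF_less_iff)
  have pa: "pathin X \<gamma>" and pw: "(T \<circ> \<gamma>) piecewise_C1_differentiable_on {0..1}" and e: "\<gamma> 0 = p" "\<gamma> 1 = q"
    using \<gamma>(1) by (auto simp: curves_def)
  have B: "T (\<gamma> t) \<in> ball (T p) \<epsilon>" if "t \<in> {0..1}" for t
  proof -
    have "ennreal (sqrt 2 * norm (T (\<gamma> t) - T p)) < ennreal (sqrt 2 * \<epsilon>)"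
      using le_less_trans[OF hlen_ge_dist[OF pw curve_lt[OF pa] that] \<gamma>(2)] e by simp
    then have "sqrt 2 * norm (T (\<gamma> t) - T p) < sqrt 2 * \<epsilon>" by (simp add: ennreal_less_iff)
    then show ?thesis by (simp add: dist_norm norm_minus_commute)
  qed
  have "\<gamma> 1 = (s \<circ> (T \<circ> \<gamma>)) 1"
  proof (rule lift_unique[of "top_of_set {0..1::real}" \<gamma> "s \<circ> (T \<circ> \<gamma>)" 0])
    show "connected_space (top_of_set {0..1::real})" by (simp add: connected_space_subtopology connectedin_iff_connected)
    show "continuous_map (top_of_set {0..1}) X \<gamma>" using pa by (simp add: pathin_def)
    have "continuous_map (top_of_set {0..1}) (top_of_set (ball (T p) \<epsilon>)) (T \<circ> \<gamma>)"
      using path_T_continuous[OF pa] B by (auto simp: continuous_map_in_subtopology)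
    then show "continuous_map (top_of_set {0..1}) X (s \<circ> (T \<circ> \<gamma>))"
      using s(1) unfolding is_section_def by (blast intro: continuous_map_compose)
    show "T (\<gamma> t) = T ((s \<circ> (T \<circ> \<gamma>)) t)" if "t \<in> topspace (top_of_set {0..1})" for t
      using B[of t] that s(1) by (simp add: is_section_def)
  qed (use e s(2) in auto)
  then show "s (T q) = q" using e by simp
  show "T q \<in> ball (T p) \<epsilon>" using B[of 1] e by simp
qed

lemma distance_metric: "Metric_space (topspace X) distance"
proof
  fix p q
  show "0 \<le> distance p q" by (simp add: distance_eq)
  show "distance p q = distance q p" unfolding distance_eq using edist_le_swap by (metis order_antisym)
next
  fix p q assume p: "p \<in> topspace X" and q: "q \<in> topspace X"
  obtain \<epsilon> s where s: "\<epsilon> > 0" "is_section (ball (T p) \<epsilon>) s" "s (T p) = p"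
    using section_at[OF p] by metis
  show "distance p q = 0 \<longleftrightarrow> p = q"
  proof
    assume d: "distance p q = 0"
    then have "s (T q) = q" using near_in_section(2)[OF s(2,3) _ p q] s(1) by simp
    moreover have "T q = T p" using distance_ge[OF p q] d by (simp add: mult_le_0_iff)
    ultimately show "p = q" using s(3) by simp
  next
    assume "p = q"
    then have "distance p q \<le> 0"
      using distance_section_le[OF s(2), of "T p" "T p" "norm (T p)"] s(1,3) T_lt[OF p] by simp
    then show "distance p q = 0" using enn2real_nonneg[of "edist p q"] unfolding distance_eq by linarith
  qed
  fix r assume r: "r \<in> topspace X"
  have "ennreal (distance p r) \<le> ennreal (distance p q) + ennreal (distance q r)"
    using edist_triangle ennreal_distance p q r by simp
  then show "distance p r \<le> distance p q + distance q r"
    by (simp add: distance_eq flip: ennreal_plus)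
qed

subsection \<open>Completeness\<close>

lemma limitin_distance:
  "limitin (Metric_space.mtopology (topspace X) distance) \<sigma> p sequentially \<longleftrightarrow>
     p \<in> topspace X \<and> (\<forall>\<epsilon>>0. \<exists>N. \<forall>n\<ge>N. \<sigma> n \<in> topspace X \<and> distance (\<sigma> n) p < \<epsilon>)"
  by (rule Metric_space.limit_metric_sequentially[OF distance_metric])

text \<open>The images of points tending radially to \<open>b\<close> form a Cauchy sequence; the local section through its limit
  extends \<open>s\<close>.\<close>

lemma boundary_extension:
  assumes complete: "complete_metric X A g" and s: "is_section (ball 0 R) s" and R: "0 < R" "R < 1" and b: "norm b = R"
  obtains \<epsilon> s' where "\<epsilon> > 0" "is_section (ball b \<epsilon>) s'" "\<And>t. t \<in> ball b \<epsilon> \<inter> ball 0 R \<Longrightarrow> s' t = s t"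
proof -
  interpret M: Metric_space "topspace X" distance by (rule distance_metric)
  define z where "z n = of_real (1 + - inverse (real (Suc n))) * b" for n
  have zR: "norm (z n) < R" for n
  proof -
    have "norm (z n) = \<bar>1 + - inverse (real (Suc n))\<bar> * R" by (simp only: z_def norm_mult norm_of_real b)
    also have "\<dots> < 1 * R" using R(1) using inverse_le_1_iff[of "real (Suc n)"] inverse_positive_iff_positive[of "real (Suc n)"]
      by (intro mult_strict_right_mono) (auto simp: abs_if)
    finally show ?thesis by simp
  qed
  then have zB: "z n \<in> ball 0 R" for n by simp
  have "(\<lambda>n. of_real (1 + - inverse (real (Suc n))) * b) \<longlonglongrightarrow> of_real 1 * b"
    by (intro tendsto_intros LIMSEQ_inverse_real_of_nat_add_minus)
  then have zlim: "z \<longlonglongrightarrow> b" by (simp add: z_def[abs_def])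
  \<comment> \<open>The Lipschitz constant of \<open>s\<close> from the euclidean distance to the
    metric, finite because the radius is less than \<open>1\<close>.\<close>
  define C where "C = sqrt 2 / (1 - R\<^sup>2)"
  have C: "C > 0" using R by (simp add: C_def abs_square_less_1)
  have dz: "distance (s (z n)) (s (z m)) \<le> C * dist (z n) (z m)" for n m
    using distance_section_le[OF s closed_segment_subset[OF zB[of n] zB[of m] convex_ball], of R] zR[of n] zR[of m] R(2)
    by (simp add: C_def dist_norm norm_minus_commute)
  have "M.MCauchy (\<lambda>n. s (z n))"
    unfolding M.MCauchy_def
  proof (intro conjI allI impI)
    show "range (\<lambda>n. s (z n)) \<subseteq> topspace X" using section_in[OF s zB] by blast
    fix e :: real assume e: "e > 0"
    have "Cauchy z" using zlim by (rule LIMSEQ_imp_Cauchy)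
    then obtain N where N: "\<And>m n. m \<ge> N \<Longrightarrow> n \<ge> N \<Longrightarrow> dist (z m) (z n) < e / C"
      using e C unfolding Cauchy_def by (meson divide_pos_pos)
    have "distance (s (z n)) (s (z n')) < e" if "N \<le> n" "N \<le> n'" for n n'
    proof -
      have "C * dist (z n) (z n') < e" using N[OF that] C by (simp add: field_simps)
      then show ?thesis using dz[of n n'] by linarith
    qed
    then show "\<exists>N. \<forall>n n'. N \<le> n \<longrightarrow> N \<le> n' \<longrightarrow> distance (s (z n)) (s (z n')) < e" by blast
  qed
  then obtain p where p: "limitin M.mtopology (\<lambda>n. s (z n)) p sequentially"
    using complete unfolding complete_metric_def M.mcomplete_def by blast
  then have pX: "p \<in> topspace X" and lim: "\<And>\<epsilon>. \<epsilon> > 0 \<Longrightarrow> \<exists>N. \<forall>n\<ge>N. distance (s (z n)) p < \<epsilon>"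
    unfolding limitin_distance by blast+
  have "T p = b"
  proof (rule LIMSEQ_unique[OF _ zlim])
    show "z \<longlonglongrightarrow> T p"
    proof (rule metric_LIMSEQ_I)
      fix e :: real assume "e > 0"
      then obtain N where N: "\<And>n. n \<ge> N \<Longrightarrow> distance (s (z n)) p < sqrt 2 * e" using lim[of "sqrt 2 * e"] by auto
      have "dist (z n) (T p) < e" if "n \<ge> N" for n
      proof -
        have "sqrt 2 * norm (T p - T (s (z n))) < sqrt 2 * e"
          using distance_ge[OF section_in[OF s zB[of n]] pX] N[OF that] by linarith
        then show ?thesis using s zB[of n] by (simp add: is_section_def dist_norm norm_minus_commute)
      qed
      then show "\<exists>no. \<forall>n\<ge>no. dist (z n) (T p) < e" by blast
    qed
  qed
  obtain \<epsilon> s' where s': "\<epsilon> > 0" "is_section (ball (T p) \<epsilon>) s'" "s' (T p) = p"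
    using section_at[OF pX] by metis
  \<comment> \<open>One member of the sequence suffices: \<open>near_in_section\<close> places it on
    the sheet of \<open>s'\<close>, and uniqueness on the convex overlap with the disc does the
    rest.\<close>
  obtain n where n: "distance (s (z n)) p < sqrt 2 * \<epsilon>" using lim[of "sqrt 2 * \<epsilon>"] s'(1) by auto
  then have n': "distance p (s (z n)) < sqrt 2 * \<epsilon>" using M.commute by simp
  have Tz: "T (s (z n)) = z n" using s zB[of n] by (simp add: is_section_def)
  have zn: "z n \<in> ball b \<epsilon>" "s' (z n) = s (z n)"
    using near_in_section[OF s'(2,3) n' pX section_in[OF s zB]] Tz \<open>T p = b\<close> by simp_all
  show thesis
  proof
    show "\<epsilon> > 0" "is_section (ball b \<epsilon>) s'" using s' \<open>T p = b\<close> by simp_all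
    fix t assume t: "t \<in> ball b \<epsilon> \<inter> ball 0 R"
    show "s' t = s t"
    proof (rule sections_agree[of "ball b \<epsilon> \<inter> ball 0 R" s' s "z n"])
      show "is_section (ball b \<epsilon> \<inter> ball 0 R) s'" "is_section (ball b \<epsilon> \<inter> ball 0 R) s"
        using s' s \<open>T p = b\<close> section_subset Int_lower1 Int_lower2 by metis+
      show "connected (ball b \<epsilon> \<inter> ball 0 R)" by (intro convex_connected convex_Int convex_ball)
      show "z n \<in> ball b \<epsilon> \<inter> ball 0 R" using zn(1) zB by blast
    qed (use t zn in auto)
  qed
qed

text \<open>Every point of the closed disc is the centre of a ball with a local extension. Two such
  balls that meet also meet the open disc, where both extensions equal \<open>s\<close>, so the
  extensions glue. Compactness of the closed disc leaves a uniform margin.\<close>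

lemma extend_section:
  assumes complete: "complete_metric X A g" and s: "is_section (ball 0 R) s" and R: "0 < R" "R < 1"
  obtains R' s' where "R' > R" "is_section (ball 0 R') s'" "s' 0 = s 0"
proof -
  have "\<exists>\<epsilon> s'. \<epsilon> > 0 \<and> is_section (ball b \<epsilon>) s' \<and> (\<forall>t \<in> ball b \<epsilon> \<inter> ball 0 R. s' t = s t)" if b: "b \<in> cball 0 R" for b
  proof (cases "norm b = R")
    case True
    show ?thesis by (rule boundary_extension[OF complete s R True]) blast
  next
    case False
    have "ball b (R - norm b) \<subseteq> ball 0 R"
    proof
      fix t assume "t \<in> ball b (R - norm b)"
      then show "t \<in> ball 0 R" using norm_triangle_ineq[of b "t - b"] by (simp add: dist_norm norm_minus_commute)
    qed
    then show ?thesis using False b section_subset[OF s] by (intro exI[of _ "R - norm b"] exI[of _ s]) auto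
  qed
  then obtain \<epsilon> \<sigma> where e: "\<And>b. b \<in> cball 0 R \<Longrightarrow> \<epsilon> b > 0" and \<sigma>: "\<And>b. b \<in> cball 0 R \<Longrightarrow> is_section (ball b (\<epsilon> b)) (\<sigma> b)"
    and eq: "\<And>b t. b \<in> cball 0 R \<Longrightarrow> t \<in> ball b (\<epsilon> b) \<Longrightarrow> t \<in> ball 0 R \<Longrightarrow> \<sigma> b t = s t"
    by (metis IntI)
  have agree: "\<sigma> b t = \<sigma> b' t" if b: "b \<in> cball 0 R" "b' \<in> cball 0 R" and t: "t \<in> ball b (\<epsilon> b)" "t \<in> ball b' (\<epsilon> b')" for b b' t
  proof -
    let ?W = "ball b (\<epsilon> b) \<inter> ball b' (\<epsilon> b')"
    have "\<exists>w \<in> ?W. w \<in> cball 0 R"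
    proof -
      \<comment> \<open>Divides the segment from \<open>b\<close> to \<open>b'\<close> in the ratio
        of the radii, so that the dividing point lies in both balls, and in the closed disc by
        convexity.\<close>
      define u where "u = \<epsilon> b / (\<epsilon> b + \<epsilon> b')"
      have ep: "\<epsilon> b > 0" "\<epsilon> b' > 0" using e b by auto
      have u: "0 \<le> u" "u \<le> 1" using ep by (auto simp: u_def)
      have d: "dist b b' < \<epsilon> b + \<epsilon> b'" using t dist_triangle[of b b' t] by (simp add: dist_commute)
      define w where "w = (1 - u) *\<^sub>R b + u *\<^sub>R b'"
      have "w \<in> cball 0 R" unfolding w_def by (rule convexD[OF convex_cball b]) (use u in auto)
      moreover have "b - w = u *\<^sub>R (b - b')" "b' - w = (1 - u) *\<^sub>R (b' - b)" by (simp_all add: w_def algebra_simps)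
      then have "dist b w = u * dist b b'" "dist b' w = (1 - u) * dist b b'"
        using u by (simp_all add: dist_norm norm_minus_commute[of b' b])
      moreover have "u * dist b b' < \<epsilon> b" "(1 - u) * dist b b' < \<epsilon> b'"
      proof -
        have u0: "0 < u" "0 < 1 - u" using ep by (simp_all add: u_def)
        have "u * dist b b' < u * (\<epsilon> b + \<epsilon> b')" "(1 - u) * dist b b' < (1 - u) * (\<epsilon> b + \<epsilon> b')"
          using d u0 by (simp_all add: mult_strict_left_mono)
        moreover have "u * (\<epsilon> b + \<epsilon> b') = \<epsilon> b" using ep by (simp add: u_def)
        ultimately show "u * dist b b' < \<epsilon> b" "(1 - u) * dist b b' < \<epsilon> b'" by (auto simp: left_diff_distrib)
      qed
      ultimately show ?thesis by auto
    qed
    \<comment> \<open>A point in the closure of the open disc; the overlap is open, so it meets the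
      disc itself.\<close>
    then obtain w where w: "w \<in> ?W" "w \<in> closure (ball 0 R)" using R by auto
    have "open ?W" by auto
    then obtain v where v: "v \<in> ?W" "v \<in> ball 0 R" using w open_Int_closure_eq_empty[of ?W "ball 0 R"] by blast
    show ?thesis
    proof (rule sections_agree[of ?W _ _ v])
      show "is_section ?W (\<sigma> b)" "is_section ?W (\<sigma> b')"
        using section_subset[OF \<sigma>[OF b(1)]] section_subset[OF \<sigma>[OF b(2)]] by auto
      show "connected ?W" by (intro convex_connected convex_Int convex_ball)
      show "\<sigma> b v = \<sigma> b' v" using eq[OF b(1), of v] eq[OF b(2), of v] v by simp
    qed (use v t in auto)
  qed
  let ?U = "\<Union>b\<in>cball 0 R. ball b (\<epsilon> b)"
  obtain s' where s': "is_section ?U s'" "\<And>b t. b \<in> cball 0 R \<Longrightarrow> t \<in> ball b (\<epsilon> b) \<Longrightarrow> s' t = \<sigma> b t"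
  proof (rule glue_sections[of "cball 0 R" "\<lambda>b. ball b (\<epsilon> b)" \<sigma>])
    fix s' assume "is_section ?U s'" "\<And>b t. b \<in> cball 0 R \<Longrightarrow> t \<in> ball b (\<epsilon> b) \<Longrightarrow> s' t = \<sigma> b t"
    then show thesis by (rule that)
  qed (use \<sigma> agree in blast)+
  have "cball 0 R \<subseteq> ?U" using e by force
  moreover have "open ?U" by auto
  ultimately obtain \<delta> where \<delta>: "\<delta> > 0" "(\<Union>b\<in>cball 0 R. ball b \<delta>) \<subseteq> ?U"
    using compact_subset_open_imp_ball_epsilon_subset[OF compact_cball] by metis
  have sub: "ball 0 (R + \<delta>) \<subseteq> ?U"
  proof
    fix t :: complex assume t: "t \<in> ball 0 (R + \<delta>)"
    have "t \<in> (\<Union>b\<in>cball 0 R. ball b \<delta>)"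
    proof (cases "norm t \<le> R")
      case True
      then show ?thesis using \<delta>(1) by (auto intro!: bexI[of _ t])
    next
      case False
      then have n: "norm t > 0" "norm t < R + \<delta>" using R t by auto
      let ?b = "(R / norm t) *\<^sub>R t"
      have "?b - t = (R / norm t - 1) *\<^sub>R t" by (simp add: algebra_simps)
      then have "dist ?b t = \<bar>R / norm t - 1\<bar> * norm t" by (simp add: dist_norm)
      also have "\<dots> = norm t - R" using False n by (simp add: abs_if field_simps)
      also have "\<dots> < \<delta>" using n by simp
      finally show ?thesis using n R by (intro UN_I[of ?b]) auto
    qed
    then show "t \<in> ?U" using \<delta>(2) by blast
  qed
  show thesis
  proof
    show "R + \<delta> > R" using \<delta>(1) by simp
    show "is_section (ball 0 (R + \<delta>)) s'" by (rule section_subset[OF s'(1) sub])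
    show "s' 0 = s 0" using s'(2)[of 0 0] eq[of 0 0] e[of 0] R by simp
  qed
qed

text \<open>The radii of discs carrying a section through \<open>p\<close> are at most
  \<open>1\<close>, because \<open>T\<close> takes values in the unit disc. Sections for different
  radii agree and glue up to the supremum, which \<open>extend_section\<close> forces to be
  \<open>1\<close>.\<close>

lemma complete_imp_section:
  assumes complete: "complete_metric X A g" and p: "p \<in> topspace X" "T p = 0"
  obtains s where "is_section (ball 0 1) s" "s 0 = p"
proof -
  define \<R> where "\<R> = {R. 0 < R \<and> (\<exists>s. is_section (ball 0 R) s \<and> s 0 = p)}"
  have le1: "R \<le> 1" if "R \<in> \<R>" for R
  proof (rule ccontr)
    assume "\<not> R \<le> 1"
    obtain s where "is_section (ball 0 R) s" using \<open>R \<in> \<R>\<close> by (auto simp: \<R>_def)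
    from section_lt[OF this, of 1] \<open>\<not> R \<le> 1\<close> show False by simp
  qed
  obtain \<epsilon> s0 where "\<epsilon> > 0" "is_section (ball (T p) \<epsilon>) s0" "s0 (T p) = p" using section_at[OF p(1)] by metis
  then have ne: "\<epsilon> \<in> \<R>" using p(2) by (auto simp: \<R>_def)
  define R where "R = Sup \<R>"
  have bdd: "bdd_above \<R>" using le1 by (auto simp: bdd_above_def)
  have R: "0 < R" "R \<le> 1" using cSup_upper[OF ne bdd] cSup_least[of \<R> 1] ne le1 \<open>\<epsilon> > 0\<close> by (auto simp: R_def)
  have "\<forall>r. \<exists>s. r \<in> \<R> \<longrightarrow> is_section (ball 0 r) s \<and> s 0 = p" by (auto simp: \<R>_def)
  then obtain \<sigma> where \<sigma>: "\<And>r. r \<in> \<R> \<Longrightarrow> is_section (ball 0 r) (\<sigma> r)" "\<And>r. r \<in> \<R> \<Longrightarrow> \<sigma> r 0 = p"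
    by metis
  have agree: "\<sigma> r t = \<sigma> r' t" if r: "r \<in> \<R>" "r' \<in> \<R>" and t: "t \<in> ball 0 r" "t \<in> ball 0 r'" for r r' t
  proof (rule sections_agree[of "ball 0 r \<inter> ball 0 r'" _ _ 0])
    show "is_section (ball 0 r \<inter> ball 0 r') (\<sigma> r)" "is_section (ball 0 r \<inter> ball 0 r') (\<sigma> r')"
      using section_subset[OF \<sigma>(1)[OF r(1)]] section_subset[OF \<sigma>(1)[OF r(2)]] by auto
    show "connected (ball (0::complex) r \<inter> ball 0 r')" by (intro convex_connected convex_Int convex_ball)
    show "\<sigma> r 0 = \<sigma> r' 0" using \<sigma>(2) r by simp
    show "0 \<in> ball 0 r \<inter> ball (0::complex) r'" using r by (auto simp: \<R>_def)
    show "t \<in> ball 0 r \<inter> ball 0 r'" using t by blast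
  qed
  obtain s where s: "is_section (\<Union>r\<in>\<R>. ball 0 r) s" "\<And>r t. r \<in> \<R> \<Longrightarrow> t \<in> ball 0 r \<Longrightarrow> s t = \<sigma> r t"
  proof (rule glue_sections[of \<R> "\<lambda>r. ball 0 r" \<sigma>])
    fix s assume "is_section (\<Union>r\<in>\<R>. ball 0 r) s" "\<And>r t. r \<in> \<R> \<Longrightarrow> t \<in> ball 0 r \<Longrightarrow> s t = \<sigma> r t"
    then show thesis by (rule that)
  qed (use \<sigma>(1) agree in blast)+
  have sub: "ball 0 R \<subseteq> (\<Union>r\<in>\<R>. ball (0::complex) r)"
    using less_cSup_iff[OF _ bdd] ne unfolding R_def by fastforce
  have sR: "is_section (ball 0 R) s" by (rule section_subset[OF s(1) sub])
  have s0: "s 0 = p" using s(2)[OF ne, of 0] \<sigma>(2)[OF ne] \<open>\<epsilon> > 0\<close> by simp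
  have "R = 1"
  proof (rule ccontr)
    assume "R \<noteq> 1"
    then have "R < 1" using R(2) by simp
    then obtain R' s' where "R' > R" "is_section (ball 0 R') s'" "s' 0 = s 0" by (rule extend_section[OF complete sR R(1)])
    then have "R' \<in> \<R>" using R(1) s0 by (auto simp: \<R>_def)
    then show False using cSup_upper[OF _ bdd, of R'] \<open>R' > R\<close> unfolding R_def by simp
  qed
  then show thesis using that sR s0 by blast
qed

text \<open>The identity and \<open>s \<circ> T\<close> lift the same map and agree at
  \<open>p0\<close>, and the surface is connected; so \<open>T\<close> is injective.\<close>

lemma section_inverse:
  assumes s: "is_section (ball 0 1) s" and p0: "p0 \<in> topspace X" "s (T p0) = p0" and p: "p \<in> topspace X"
  shows "s (T p) = p"
proof -
  have "id p = (s \<circ> T) p"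
  proof (rule lift_unique[of X id "s \<circ> T" p0])
    have "continuous_map X (top_of_set (ball 0 1)) T"
      using T_continuous T_lt by (auto simp: continuous_map_in_subtopology)
    then show "continuous_map X X (s \<circ> T)"
      using s unfolding is_section_def by (blast intro: continuous_map_compose)
    show "T (id y) = T ((s \<circ> T) y)" if "y \<in> topspace X" for y
      using s T_lt[OF that] by (simp add: is_section_def)
  qed (use connected p0 p in auto)
  then show ?thesis by simp
qed

section \<open>Consequences of a global inverse\<close>

lemma section_imp_biholomorphic:
  assumes s: "is_section (ball 0 1) s" and inv: "\<And>p. p \<in> topspace X \<Longrightarrow> s (T p) = p"
  shows "biholomorphic X A (top_of_set (ball 0 1)) (plane_atlas (ball 0 1))"
proof -
  have ci: "chart_inv (ball (0 :: complex) 1, id :: complex \<Rightarrow> complex) z = z" if "z \<in> ball (0::complex) 1" for z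
    using that inv_into_f_f[of id "ball 0 1" z] by (simp add: chart_inv_def)
  have "holomorphic_map X A (top_of_set (ball 0 1)) (plane_atlas (ball 0 1)) T"
    unfolding holomorphic_map_def plane_atlas_def
  proof (intro conjI ballI)
    show "continuous_map X (top_of_set (ball 0 1)) T"
      using T_continuous T_lt by (auto simp: continuous_map_in_subtopology)
    fix c d assume c: "c \<in> A" and d: "d \<in> {(ball (0 :: complex) 1, id :: complex \<Rightarrow> complex)}"
    have "(\<lambda>z. T (chart_inv c z)) holomorphic_on coord c ` {p \<in> chart_dom c. T p \<in> chart_dom d}"
      by (rule holomorphic_on_subset[OF T_holomorphic[OF c]]) auto
    then show "(coord d \<circ> T \<circ> chart_inv c) holomorphic_on coord c ` {p \<in> chart_dom c. T p \<in> chart_dom d}"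
      using d by (simp add: o_def)
  qed
  moreover have "holomorphic_map (top_of_set (ball 0 1)) (plane_atlas (ball 0 1)) X A s"
    unfolding holomorphic_map_def plane_atlas_def
  proof (intro conjI ballI)
    show "continuous_map (top_of_set (ball 0 1)) X s" using s by (simp add: is_section_def)
    fix c d assume c: "c \<in> {(ball (0 :: complex) 1, id :: complex \<Rightarrow> complex)}" and d: "d \<in> A"
    have "(\<lambda>z. coord d (s (chart_inv c z))) holomorphic_on {t \<in> ball 0 1. s t \<in> chart_dom d}"
      by (rule holomorphic_transform[OF section_holomorphic[OF s open_ball d]]) (use c ci in simp)
    then show "(coord d \<circ> s \<circ> chart_inv c) holomorphic_on coord c ` {p \<in> chart_dom c. s p \<in> chart_dom d}"
      using c by (simp add: o_def)
  qed
  ultimately show ?thesis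
    unfolding biholomorphic_def using s inv by (intro exI[of _ T] exI[of _ s]) (simp add: is_section_def)
qed

text \<open>The images of a Cauchy sequence under \<open>T\<close> converge in the plane. The
  logarithmic bound keeps them inside a smaller disc, where \<open>s\<close> is Lipschitz, so
  \<open>s\<close> carries the convergence back to the surface.\<close>

lemma section_imp_complete:
  assumes s: "is_section (ball 0 1) s" and inv: "\<And>p. p \<in> topspace X \<Longrightarrow> s (T p) = p"
  shows "complete_metric X A g"
proof -
  interpret M: Metric_space "topspace X" distance by (rule distance_metric)
  show ?thesis
    unfolding complete_metric_def M.mcomplete_def
  proof (intro allI impI)
    fix \<sigma> assume "M.MCauchy \<sigma>"
    then have \<sigma>: "\<sigma> n \<in> topspace X" and cau: "\<And>e. e > 0 \<Longrightarrow> \<exists>N. \<forall>n n'. N \<le> n \<longrightarrow> N \<le> n' \<longrightarrow> distance (\<sigma> n) (\<sigma> n') < e" for n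
      unfolding M.MCauchy_def by blast+
    have "Cauchy (\<lambda>n. T (\<sigma> n))"
    proof (rule metric_CauchyI)
      fix e :: real assume "e > 0"
      then obtain N where N: "\<And>n n'. N \<le> n \<Longrightarrow> N \<le> n' \<Longrightarrow> distance (\<sigma> n) (\<sigma> n') < sqrt 2 * e" using cau[of "sqrt 2 * e"] by auto
      have "dist (T (\<sigma> m)) (T (\<sigma> n)) < e" if "m \<ge> N" "n \<ge> N" for m n
      proof -
        have "sqrt 2 * norm (T (\<sigma> n) - T (\<sigma> m)) < sqrt 2 * e" using distance_ge[OF \<sigma> \<sigma>, of n m] N[OF that] by linarith
        then show ?thesis by (simp add: dist_norm norm_minus_commute)
      qed
      then show "\<exists>M. \<forall>m\<ge>M. \<forall>n\<ge>M. dist (T (\<sigma> m)) (T (\<sigma> n)) < e" by blast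
    qed
    then obtain w where w: "(\<lambda>n. T (\<sigma> n)) \<longlonglongrightarrow> w" using Cauchy_convergent_iff convergent_def by blast
    define h where "h p = ln (1 - (norm (T p))\<^sup>2) / 2" for p
    obtain N where N: "\<And>n. N \<le> n \<Longrightarrow> distance (\<sigma> n) (\<sigma> N) < 1" using cau[of 1] by auto
    \<comment> \<open>The radius at which \<open>ln (1 - \<rho>^2) / 2\<close> has dropped by
      \<open>1\<close> below its value at \<open>\<sigma> N\<close>; later terms, at distance less
      than \<open>1\<close>, cannot lie beyond it.\<close>
    define \<rho> where "\<rho> = sqrt (1 - exp (2 * (h (\<sigma> N) - 1)))"
    have le: "norm (T (\<sigma> n)) \<le> \<rho>" if "n \<ge> N" for n
    proof -
      have pos: "0 < 1 - (norm (T (\<sigma> n)))\<^sup>2" using T_lt[OF \<sigma>] by (simp add: abs_square_less_1)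
      have "\<bar>h (\<sigma> N) - h (\<sigma> n)\<bar> < 1"
        using distance_ge_log[OF \<sigma>[of n] \<sigma>[of N]] N[OF that] unfolding h_def by linarith
      then have "2 * (h (\<sigma> N) - 1) \<le> ln (1 - (norm (T (\<sigma> n)))\<^sup>2)" by (simp add: h_def abs_less_iff)
      then have "exp (2 * (h (\<sigma> N) - 1)) \<le> 1 - (norm (T (\<sigma> n)))\<^sup>2" using pos by (simp add: ln_ge_iff)
      then show ?thesis unfolding \<rho>_def by (intro real_le_rsqrt) simp
    qed
    have \<rho>1: "\<rho> < 1" unfolding \<rho>_def by (rule real_sqrt_lt_1_iff[THEN iffD2]) simp
    have w\<rho>: "norm w \<le> \<rho>"
      by (rule LIMSEQ_le_const2[OF tendsto_norm[OF w]]) (use le in blast)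
    define C where "C = sqrt 2 / (1 - \<rho>\<^sup>2)"
    have "0 \<le> \<rho>" using w\<rho> norm_ge_zero[of w] by linarith
    then have C: "C > 0" using \<rho>1 by (simp add: C_def abs_square_less_1)
    have w1: "w \<in> ball 0 1" using w\<rho> \<rho>1 by simp
    have d: "distance (\<sigma> n) (s w) \<le> C * dist (T (\<sigma> n)) w" if "n \<ge> N" for n
    proof -
      have "T (\<sigma> n) \<in> ball 0 1" using T_lt[OF \<sigma>] by simp
      from distance_section_le[OF s closed_segment_subset[OF this w1 convex_ball] le[OF that] w\<rho> \<rho>1]
      show ?thesis using inv[OF \<sigma>] by (simp add: C_def dist_norm norm_minus_commute)
    qed
    have "limitin M.mtopology \<sigma> (s w) sequentially"
      unfolding limitin_distance
    proof (intro conjI allI impI)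
      show "s w \<in> topspace X" by (rule section_in[OF s w1])
      fix e :: real assume "e > 0"
      then obtain N' where N': "\<And>n. n \<ge> N' \<Longrightarrow> dist (T (\<sigma> n)) w < e / C"
        using metric_LIMSEQ_D[OF w, of "e / C"] C by auto
      have "distance (\<sigma> n) (s w) < e" if "n \<ge> max N N'" for n
      proof -
        have "C * dist (T (\<sigma> n)) w < e" using N'[of n] that C by (simp add: field_simps)
        then show ?thesis using d[of n] that by linarith
      qed
      then show "\<exists>N. \<forall>n\<ge>N. \<sigma> n \<in> topspace X \<and> distance (\<sigma> n) (s w) < e" using \<sigma> by blast
    qed
    then show "\<exists>x. limitin M.mtopology \<sigma> x sequentially" by blast
  qed
qed

end

section \<open>The Bergman kernel of the disc\<close>

locale disc_surface = partitioned_surface +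
  fixes T :: "'a \<Rightarrow> complex" and s :: "complex \<Rightarrow> 'a"
  assumes T_holomorphic: "c \<in> A \<Longrightarrow> (\<lambda>z. T (chart_inv c z)) holomorphic_on coord c ` chart_dom c"
    and T_lt: "p \<in> topspace X \<Longrightarrow> norm (T p) < 1"
    and s_continuous: "continuous_map (top_of_set (ball 0 1)) X s"
    and T_s: "t \<in> ball 0 1 \<Longrightarrow> T (s t) = t"
    and s_T: "p \<in> topspace X \<Longrightarrow> s (T p) = p"
begin

lemma T_immersion:
  assumes "c \<in> A" "p \<in> chart_dom c" shows "deriv (\<lambda>z. T (chart_inv c z)) (coord c p) \<noteq> 0"
proof (rule holomorphic_injective_imp_regular[OF T_holomorphic[OF assms(1)] chart_open[OF chart[OF assms(1)]]])
  show "inj_on (\<lambda>z. T (chart_inv c z)) (coord c ` chart_dom c)"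
  proof (rule inj_onI)
    fix z w assume zw: "z \<in> coord c ` chart_dom c" "w \<in> coord c ` chart_dom c" "T (chart_inv c z) = T (chart_inv c w)"
    have "chart_inv c z = chart_inv c w"
      using zw(3) s_T[OF in_topspace[OF assms(1) chart_inv_in[OF zw(1)]]] s_T[OF in_topspace[OF assms(1) chart_inv_in[OF zw(2)]]] by metis
    then show "z = w" using coord_chart_inv[OF zw(1)] coord_chart_inv[OF zw(2)] by metis
  qed
qed (use assms in blast)

definition hyp :: "'a conformal_metric" where
  "hyp c p = 2 * (norm (deriv (\<lambda>z. T (chart_inv c z)) (coord c p)))\<^sup>2 / (1 - (norm (T p))\<^sup>2)\<^sup>2"

sublocale D: disc_immersion X A T hyp
  by unfold_locales (use T_holomorphic T_lt T_immersion in \<open>auto simp: hyp_def\<close>)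

text \<open>A chart of the maximal atlas that need not belong to \<open>A\<close>; hence integration
  in charts is formulated for admissible charts.\<close>

definition global_chart :: "'a chart" where "global_chart = (topspace X, T)"

lemma T_image: "T ` topspace X = ball 0 1"
proof
  show "T ` topspace X \<subseteq> ball 0 1" using T_lt by auto
  show "ball 0 1 \<subseteq> T ` topspace X"
  proof
    fix t :: complex assume t: "t \<in> ball 0 1"
    have "s t \<in> topspace X" using s_continuous t unfolding continuous_map_def by auto
    then show "t \<in> T ` topspace X" using T_s[OF t] by (metis imageI)
  qed
qed

lemma global_chart: "chart_of X global_chart"
proof -
  have "continuous_map X (top_of_set (ball 0 1)) T"
    using D.T_continuous T_lt by (auto simp: continuous_map_in_subtopology)
  then have "homeomorphic_maps X (top_of_set (ball 0 1)) T s"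
    using s_continuous T_s s_T by (simp add: homeomorphic_maps_def)
  then show ?thesis
    unfolding chart_of_def global_chart_def fst_conv snd_conv T_image subtopology_topspace
    using homeomorphic_map_maps by auto
qed

lemma transition_global: "transition c global_chart p = D.dT c p"
  by (simp add: transition_def global_chart_def D.dT_def o_def)

lemma global_holomorphic:
  assumes "c \<in> A"
  shows "(coord global_chart \<circ> chart_inv c) holomorphic_on coord c ` (chart_dom c \<inter> chart_dom global_chart)"
  using holomorphic_on_subset[OF T_holomorphic[OF assms], of "coord c ` (chart_dom c \<inter> topspace X)"]
  by (auto simp: global_chart_def o_def)

lemma global_admissible: "admissible global_chart"
  unfolding admissible_def using global_chart global_holomorphic by blast

lemma dT_nonzero: "c \<in> A \<Longrightarrow> p \<in> chart_dom c \<Longrightarrow> D.dT c p \<noteq> 0"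
  unfolding D.dT_def by (rule T_immersion)

lemma dT_transition:
  assumes "c \<in> A" "d \<in> A" "p \<in> chart_dom c" "p \<in> chart_dom d"
  shows "D.dT c p = D.dT d p * transition c d p"
  unfolding transition_global[symmetric]
  by (rule transition_chain[OF chart[OF assms(1)] chart[OF assms(2)] global_chart assms(3,4) _
        holomorphic_transition[OF assms(1,2)] global_holomorphic[OF assms(2)]])
     (simp add: global_chart_def in_topspace[OF assms(1,3)])

section \<open>Coefficients of forms with respect to \<open>dT\<close>\<close>

definition coef :: "'a form \<Rightarrow> complex \<Rightarrow> complex" where
  "coef \<alpha> z = (let c = (SOME c. c \<in> A \<and> s z \<in> chart_dom c) in \<alpha> c (s z) / D.dT c (s z))"

lemma form_eq_coef:
  assumes \<alpha>: "holomorphic_form A \<alpha>" and c: "c \<in> A" "p \<in> chart_dom c"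
  shows "\<alpha> c p = coef \<alpha> (T p) * D.dT c p"
proof -
  have s: "s (T p) = p" by (rule s_T[OF in_topspace[OF c]])
  define d where "d = (SOME d. d \<in> A \<and> p \<in> chart_dom d)"
  have "d \<in> A \<and> p \<in> chart_dom d" unfolding d_def by (rule someI[of _ c]) (use c in blast)
  then have d: "d \<in> A" "p \<in> chart_dom d" by auto
  have "coef \<alpha> (T p) = \<alpha> d p / D.dT d p" by (simp add: coef_def s d_def[symmetric] Let_def)
  moreover have "\<alpha> c p = \<alpha> d p * transition c d p" by (rule form_transition[OF \<alpha> c(1) d(1) c(2) d(2)])
  moreover have "D.dT c p = D.dT d p * transition c d p" by (rule dT_transition[OF c(1) d(1) c(2) d(2)])
  ultimately show ?thesis using dT_nonzero[OF d] by simp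
qed

lemma s_in: "t \<in> ball 0 1 \<Longrightarrow> s t \<in> topspace X"
  using s_continuous unfolding continuous_map_def by auto

text \<open>Near a point the coefficient is a quotient of two holomorphic functions of one chart's
  coordinate, and that coordinate is holomorphic along the section.\<close>

lemma coef_holomorphic:
  assumes \<alpha>: "holomorphic_form A \<alpha>" shows "coef \<alpha> holomorphic_on ball 0 1"
proof -
  have "coef \<alpha> field_differentiable at z0" if z0: "z0 \<in> ball 0 1" for z0
  proof -
    obtain c where c: "c \<in> A" "s z0 \<in> chart_dom c" using chart_cover s_in[OF z0] by blast
    let ?W = "{z \<in> ball 0 1. s z \<in> chart_dom c}"
    have "openin (top_of_set (ball 0 1)) {z \<in> topspace (top_of_set (ball 0 1)). s z \<in> chart_dom c}"
      by (rule openin_continuous_map_preimage[OF s_continuous chart_openin[OF chart[OF c(1)]]])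
    then have W: "open ?W" using openin_open_trans[OF _ open_ball] by simp
    have sec: "D.is_section (ball 0 1) s" unfolding D.is_section_def using s_continuous T_s by blast
    have cs: "(\<lambda>z. coord c (s z)) holomorphic_on ?W" by (rule D.section_holomorphic[OF sec open_ball c(1)])
    have im: "(\<lambda>z. coord c (s z)) ` ?W \<subseteq> coord c ` chart_dom c" by blast
    have d: "deriv (\<lambda>z. T (chart_inv c z)) holomorphic_on coord c ` chart_dom c"
      by (rule holomorphic_deriv[OF T_holomorphic[OF c(1)] chart_open[OF chart[OF c(1)]]])
    have nz: "D.dT c (s z) \<noteq> 0" if "z \<in> ?W" for z using dT_nonzero[OF c(1), of "s z"] that by blast
    have "(\<lambda>z. \<alpha> c (chart_inv c (coord c (s z))) / D.dT c (s z)) holomorphic_on ?W"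
    proof (rule holomorphic_on_divide)
      show "(\<lambda>z. \<alpha> c (chart_inv c (coord c (s z)))) holomorphic_on ?W"
        using holomorphic_on_compose_gen[OF cs form_holomorphic[OF \<alpha> c(1)] im] by (simp add: o_def)
      show "(\<lambda>z. D.dT c (s z)) holomorphic_on ?W"
        using holomorphic_on_compose_gen[OF cs d im] by (simp add: o_def D.dT_def)
    qed (rule nz)
    then have "coef \<alpha> holomorphic_on ?W"
    proof (rule holomorphic_transform)
      fix z assume z: "z \<in> ?W"
      then show "\<alpha> c (chart_inv c (coord c (s z))) / D.dT c (s z) = coef \<alpha> z"
        using form_eq_coef[OF \<alpha> c(1), of "s z"] nz[OF z] T_s[of z] chart_inv_coord[OF chart[OF c(1)], of "s z"] by simp
    qed
    then show ?thesis by (rule holomorphic_on_imp_differentiable_at[OF _ W]) (use z0 c in simp)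
  qed
  then show ?thesis unfolding holomorphic_on_def using field_differentiable_at_within by blast
qed

lemma global_integral:
  fixes h :: "complex \<Rightarrow> complex"
  assumes h: "continuous_on (ball 0 1) h"
  shows "set_integrable lborel (ball 0 1) h \<longleftrightarrow> integrable \<mu> (\<lambda>x. jac global_chart x *\<^sub>R h (T x))"
    and "(LINT z:ball 0 1|lborel. h z) = (LINT x|\<mu>. jac global_chart x *\<^sub>R h (T x))"
proof -
  have G: "chart_dom global_chart = topspace X" "coord global_chart = T" by (simp_all add: global_chart_def)
  have "set_borel_measurable lborel (ball 0 1) h"
    unfolding set_borel_measurable_def using borel_measurable_continuous_on_indicator[OF _ h] by simp
  then have m: "set_borel_measurable lborel (coord global_chart ` topspace X) h" by (simp add: G T_image)
  have X: "topspace X \<in> sets (borel_space X)" by (rule openin_borel_space) simp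
  have i: "indicator (topspace X) x *\<^sub>R (jac global_chart x *\<^sub>R h (T x)) = jac global_chart x *\<^sub>R h (T x)" if "x \<in> space \<mu>" for x
    using that by simp
  show "set_integrable lborel (ball 0 1) h \<longleftrightarrow> integrable \<mu> (\<lambda>x. jac global_chart x *\<^sub>R h (T x))"
    using chart_integral(1)[OF global_admissible X _ m] Bochner_Integration.integrable_cong[of \<mu> \<mu>, OF refl i]
    by (simp add: G T_image set_integrable_def)
  show "(LINT z:ball 0 1|lborel. h z) = (LINT x|\<mu>. jac global_chart x *\<^sub>R h (T x))"
    using chart_integral(2)[OF global_admissible X _ m] Bochner_Integration.integral_cong[of \<mu> \<mu>, OF refl i]
    by (simp add: G T_image set_lebesgue_integral_def)
qed

abbreviation \<omega> :: "'a form" where "\<omega> \<equiv> D.dT"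

lemma omega_holomorphic: "holomorphic_form A \<omega>"
  unfolding holomorphic_form_def
proof (intro conjI ballI)
  fix c assume c: "c \<in> A"
  have "deriv (\<lambda>z. T (chart_inv c z)) holomorphic_on coord c ` chart_dom c"
    by (rule holomorphic_deriv[OF T_holomorphic[OF c] chart_open[OF chart[OF c]]])
  then show "(\<omega> c \<circ> chart_inv c) holomorphic_on coord c ` chart_dom c"
    by (rule holomorphic_transform) (use coord_chart_inv[of _ c] in \<open>simp add: D.dT_def del: image_iff\<close>)
next
  fix c d p assume "c \<in> A" "d \<in> A" "p \<in> chart_dom c \<inter> chart_dom d"
  then show "\<omega> c p = \<omega> d p * deriv (coord d \<circ> chart_inv c) (coord c p)"
    using dT_transition[of c d p] by (simp add: transition_def)
qed

lemma jac_global: "jac global_chart x = (norm (pull \<omega> x))\<^sup>2"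
  by (simp add: jac_def pull_def transition_global)

lemma pull_coef:
  assumes "holomorphic_form A \<alpha>" "x \<in> topspace X" shows "pull \<alpha> x = coef \<alpha> (T x) * pull \<omega> x"
  unfolding pull_def using piece_dom[OF assms(2)] by (intro form_eq_coef[OF assms(1) P_atlas]) blast

lemma omega_L2: "\<omega> \<in> L2_forms X A"
proof -
  have "set_integrable lborel (ball 0 1) (\<lambda>_::complex. 1 :: complex)"
    unfolding set_integrable_def by (intro integrable_scaleR_left integrable_real_indicator) (use emeasure_bounded_finite[OF bounded_ball] in auto)
  then have "integrable \<mu> (\<lambda>x. jac global_chart x *\<^sub>R (1::complex))"
    using global_integral(1)[of "\<lambda>_. 1"] by simp
  then have "integrable \<mu> (\<lambda>x. norm (jac global_chart x *\<^sub>R (1::complex)))" by (rule integrable_norm)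
  then show ?thesis unfolding L2_iff using omega_holomorphic by (simp add: jac_global)
qed

lemma inner_omega:
  assumes \<alpha>: "\<alpha> \<in> L2_forms X A"
  shows "form_inner X A \<alpha> \<omega> = of_real pi * coef \<alpha> 0"
proof -
  have hol: "holomorphic_form A \<alpha>" using \<alpha> by (simp add: L2_forms_def)
  note ch = coef_holomorphic[OF hol]
  have eq: "pull \<alpha> x * cnj (pull \<omega> x) = jac global_chart x *\<^sub>R coef \<alpha> (T x)" if "x \<in> space \<mu>" for x
    using pull_coef[OF hol, of x] that complex_norm_square[of "pull \<omega> x"] by (simp add: jac_global scaleR_conv_of_real)
  have "integrable \<mu> (\<lambda>x. jac global_chart x *\<^sub>R coef \<alpha> (T x))"
    using L2_product_integrable[OF \<alpha> omega_L2] Bochner_Integration.integrable_cong[of \<mu> \<mu>, OF refl eq] by simp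
  then have int: "set_integrable lborel (ball 0 1) (coef \<alpha>)"
    using global_integral(1)[OF holomorphic_on_imp_continuous_on[OF ch]] by simp
  have "form_inner X A \<alpha> \<omega> = (LINT x|\<mu>. jac global_chart x *\<^sub>R coef \<alpha> (T x))"
    unfolding form_inner_eq[OF \<alpha> omega_L2] by (rule Bochner_Integration.integral_cong[OF refl eq])
  also have "\<dots> = (LINT z:ball 0 1|lborel. coef \<alpha> z)"
    by (rule global_integral(2)[OF holomorphic_on_imp_continuous_on[OF ch], symmetric])
  also have "\<dots> = of_real (pi * 1\<^sup>2) * coef \<alpha> 0" by (rule mean_value_ball[OF ch _ int]) simp
  finally show ?thesis by simp
qed

text \<open>The squared norm of \<open>\<omega>\<close> is \<open>pi\<close>, and its inner product
  with a basis element \<open>e\<close> has norm \<open>pi\<close> times that of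
  \<open>coef e 0\<close>. Parseval's identity therefore makes the squared norms of
  \<open>coef e 0\<close> sum to \<open>1 / pi\<close>.\<close>

lemma kernel_origin:
  assumes c: "c \<in> A" "s 0 \<in> chart_dom c"
  shows "bergman_kernel X A c (s 0) = (norm (D.dT c (s 0)))\<^sup>2 / pi"
proof -
  have T0: "T (s 0) = 0" by (rule T_s) simp
  have "coef \<omega> 0 = 1" using form_eq_coef[OF omega_holomorphic c] dT_nonzero[OF c] T0 by simp
  then have sq: "H.sqn \<omega> = pi" using inner_omega[OF omega_L2] by (simp add: H.sqn_def)
  have "((\<lambda>e. (norm (form_inner X A \<omega> e))\<^sup>2) has_sum H.sqn \<omega>) basis"
    using H.parseval[OF _ omega_L2] basis complete_orthonormal_basis_iff by blast
  moreover have "(norm (form_inner X A \<omega> e))\<^sup>2 = pi\<^sup>2 * (norm (coef e 0))\<^sup>2" if "e \<in> basis" for e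
  proof -
    have "form_inner X A \<omega> e = cnj (form_inner X A e \<omega>)" by (rule H.hermitian[OF omega_L2 basis_L2[OF that]])
    then show ?thesis using inner_omega[OF basis_L2[OF that]] by (simp add: norm_mult power_mult_distrib)
  qed
  ultimately have "((\<lambda>e. pi\<^sup>2 * (norm (coef e 0))\<^sup>2) has_sum pi) basis"
    unfolding sq by (simp cong: has_sum_cong)
  from has_sum_cmult_right[OF this, of "(norm (D.dT c (s 0)))\<^sup>2 / pi\<^sup>2"]
  have "((\<lambda>e. (norm (D.dT c (s 0)))\<^sup>2 * (norm (coef e 0))\<^sup>2) has_sum ((norm (D.dT c (s 0)))\<^sup>2 / pi)) basis"
    by (simp add: field_simps power2_eq_square)
  moreover have "(norm (e c (s 0)))\<^sup>2 = (norm (D.dT c (s 0)))\<^sup>2 * (norm (coef e 0))\<^sup>2" if "e \<in> basis" for e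
    using form_eq_coef[OF basis_form[OF that] c] T0 by (simp add: norm_mult power_mult_distrib)
  ultimately have "((\<lambda>e. (norm (e c (s 0)))\<^sup>2) has_sum ((norm (D.dT c (s 0)))\<^sup>2 / pi)) basis"
    by (simp cong: has_sum_cong)
  then show ?thesis unfolding bergman_kernel_basis by (rule infsumI)
qed

lemma bergman_kernel_disc:
  assumes c: "c \<in> A" "p \<in> chart_dom c"
  shows "bergman_kernel X A c p = 1 / pi * (norm (D.dT c p))\<^sup>2 / (1 - (norm (T p))\<^sup>2)\<^sup>2"
proof -
  define w where "w = T p"
  have pX: "p \<in> topspace X" by (rule in_topspace[OF c])
  have w: "norm w < 1" unfolding w_def by (rule T_lt[OF pX])
  let ?\<phi> = "Moebius_function 0 w" and ?\<psi> = "Moebius_function 0 (- w)"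
  have \<psi>: "?\<psi> z \<in> ball 0 1" if "z \<in> ball 0 1" for z using Moebius_function_norm_lt_1[of "- w" z 0] w that by simp
  \<comment> \<open>A second identification of the same surface with the disc, with \<open>p\<close>
    in the place of the origin.\<close>
  interpret Q: disc_surface X A S P "\<lambda>x. ?\<phi> (T x)" "\<lambda>z. s (?\<psi> z)"
  proof
    fix c assume c: "c \<in> A"
    have "(\<lambda>z. T (chart_inv c z)) ` coord c ` chart_dom c \<subseteq> ball 0 1"
    proof
      fix t assume "t \<in> (\<lambda>z. T (chart_inv c z)) ` coord c ` chart_dom c"
      then obtain z where z: "z \<in> coord c ` chart_dom c" "t = T (chart_inv c z)" by blast
      then show "t \<in> ball 0 1" using T_lt[OF in_topspace[OF c chart_inv_in[OF z(1)]]] by simp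
    qed
    from holomorphic_on_compose_gen[OF T_holomorphic[OF c] Moebius_function_holomorphic[OF w] this]
    show "(\<lambda>z. ?\<phi> (T (chart_inv c z))) holomorphic_on coord c ` chart_dom c" by (simp add: o_def)
  next
    show "norm (?\<phi> (T x)) < 1" if "x \<in> topspace X" for x by (rule Moebius_function_norm_lt_1[OF w T_lt[OF that]])
    show "?\<phi> (T (s (?\<psi> t))) = t" if "t \<in> ball 0 1" for t
      using T_s[OF \<psi>[OF that]] Moebius_function_compose[of w "- w" t] w that by simp
    show "s (?\<psi> (?\<phi> (T x))) = x" if "x \<in> topspace X" for x
      using s_T[OF that] Moebius_function_compose[of "- w" w "T x"] w T_lt[OF that] by simp
    have "continuous_on (ball 0 1) ?\<psi>"
      by (rule holomorphic_on_imp_continuous_on[OF Moebius_function_holomorphic]) (use w in simp)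
    then have "continuous_map (top_of_set (ball 0 1)) (top_of_set (ball 0 1)) ?\<psi>"
      using \<psi> by (auto simp: continuous_map_in_subtopology)
    from continuous_map_compose[OF this s_continuous]
    show "continuous_map (top_of_set (ball 0 1)) X (\<lambda>z. s (?\<psi> z))" by (simp add: o_def)
  qed
  have s0: "s (?\<psi> 0) = p" using s_T[OF pX] by (simp add: Moebius_function_of_zero w_def)
  have nz: "1 - cnj w * w \<noteq> 0"
  proof
    assume "1 - cnj w * w = 0"
    then have "norm (cnj w * w) = 1" by simp
    moreover have "norm w * norm w < 1" using w by (metis norm_ge_zero mult_less_cancel_left2 mult.right_neutral less_trans not_less_iff_gr_or_eq abs_square_less_1 power2_eq_square abs_norm_cancel)
    ultimately show False by (simp add: norm_mult)
  qed
  \<comment> \<open>The squared norm of this derivative is the source of the denominator in the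
    kernel.\<close>
  have "(?\<phi> has_field_derivative 1 / (1 - cnj w * w)) (at w)"
  proof -
    have "((\<lambda>z. (z - w) / (1 - cnj w * z)) has_field_derivative (1 * (1 - cnj w * w) - (w - w) * (- cnj w)) / ((1 - cnj w * w) * (1 - cnj w * w))) (at w)"
      by (rule DERIV_divide) (use nz in \<open>auto intro!: derivative_eq_intros\<close>)
    then show ?thesis unfolding Moebius_function_simple[abs_def] using nz by simp
  qed
  then have "(?\<phi> has_field_derivative 1 / (1 - cnj w * w)) (at (T (chart_inv c (coord c p))))"
    using chart_inv_coord[OF chart[OF c(1)] c(2)] by (simp add: w_def)
  from DERIV_chain2[OF this D.dT_derivative[OF c]]
  have "Q.D.dT c p = 1 / (1 - cnj w * w) * D.dT c p" unfolding Q.D.dT_def by (rule DERIV_imp_deriv)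
  moreover have "1 - cnj w * w = of_real (1 - (norm w)\<^sup>2)"
    using complex_norm_square[of w] by (simp add: mult.commute)
  ultimately have "(norm (Q.D.dT c p))\<^sup>2 = (norm (D.dT c p))\<^sup>2 / (1 - (norm w)\<^sup>2)\<^sup>2"
    by (simp add: norm_mult norm_divide power_divide power_mult_distrib del: of_real_diff of_real_power)
  then show ?thesis using Q.kernel_origin[OF c(1)] c(2) s0 by (simp add: w_def mult.commute)
qed

text \<open>Used twice: with \<open>C = 1 / pi\<close> for the kernel, which gives the metric, and
  with \<open>C = 2\<close> for the metric itself, which gives the curvature.\<close>

lemma pullback_laplacian:
  assumes c: "c \<in> A" "p \<in> chart_dom c" and C: "C > 0"
    and K: "\<And>q. q \<in> chart_dom c \<Longrightarrow> K q = C * (norm (D.dT c q))\<^sup>2 / (1 - (norm (T q))\<^sup>2)\<^sup>2"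
  shows "d2_dw_dwbar (\<lambda>z. ln (K (chart_inv c z))) (coord c p) = hyp c p"
proof -
  note ch = chart[OF c(1)]
  let ?U = "coord c ` chart_dom c" and ?F = "\<lambda>z. T (chart_inv c z)"
  have "d2_dw_dwbar (\<lambda>z. ln (K (chart_inv c z))) (coord c p)
      = 2 * (norm (deriv ?F (coord c p)))\<^sup>2 / (1 - (norm (?F (coord c p)))\<^sup>2)\<^sup>2"
  proof (rule d2_ln_pullback[where U = ?U and k = "deriv ?F" and C = C])
    show "?F holomorphic_on ?U" by (rule T_holomorphic[OF c(1)])
    show "deriv ?F holomorphic_on ?U" by (rule holomorphic_deriv[OF T_holomorphic[OF c(1)] chart_open[OF ch]])
    show "open ?U" by (rule chart_open[OF ch])
    show "coord c p \<in> ?U" using c(2) by blast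
    fix z assume z: "z \<in> ?U"
    note q = chart_inv_in[OF z] and e = coord_chart_inv[OF z]
    show "deriv ?F z \<noteq> 0" using T_immersion[OF c(1) q] by (simp add: e)
    show "norm (?F z) < 1" by (rule T_lt[OF in_topspace[OF c(1) q]])
    show "K (chart_inv c z) = C * (norm (deriv ?F z))\<^sup>2 / (1 - (norm (?F z))\<^sup>2)\<^sup>2"
      using K[OF q] by (simp add: D.dT_def e)
  qed (rule C)
  then show ?thesis using chart_inv_coord[OF ch c(2)] by (simp add: hyp_def)
qed

lemma hyp_pos: "c \<in> A \<Longrightarrow> p \<in> chart_dom c \<Longrightarrow> hyp c p > 0"
  unfolding hyp_def using T_immersion[of c p] T_lt[OF in_topspace[of c p]]
  by (intro divide_pos_pos mult_pos_pos zero_less_power) (simp_all add: abs_square_less_1)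

lemma bergman_metric_disc: "c \<in> A \<Longrightarrow> p \<in> chart_dom c \<Longrightarrow> bergman_metric X A c p = hyp c p"
  unfolding bergman_metric_def by (rule pullback_laplacian[of _ _ "1 / pi"]) (use bergman_kernel_disc in auto)

theorem bergman_disc:
  shows "bergman_metric_exists X A"
    and "c \<in> A \<Longrightarrow> p \<in> chart_dom c \<Longrightarrow> gaussian_curvature (bergman_metric X A) c p = - 2"
    and "complete_metric X A (bergman_metric X A)"
proof -
  have pos: "0 < 1 - (norm (T p))\<^sup>2" if "c \<in> A" "p \<in> chart_dom c" for c p
    using T_lt[OF in_topspace[OF that]] by (simp add: abs_square_less_1)
  have "bergman_kernel X A c p > 0" if "c \<in> A" "p \<in> chart_dom c" for c p
    unfolding bergman_kernel_disc[OF that] using dT_nonzero[OF that] pos[OF that] by (intro divide_pos_pos mult_pos_pos) auto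
  then show "bergman_metric_exists X A"
    unfolding bergman_metric_exists_def using bergman_metric_disc hyp_pos by simp
  show "gaussian_curvature (bergman_metric X A) c p = - 2" if c: "c \<in> A" "p \<in> chart_dom c"
  proof -
    have "d2_dw_dwbar (\<lambda>z. ln (bergman_metric X A c (chart_inv c z))) (coord c p) = hyp c p"
      by (rule pullback_laplacian[OF c, of 2]) (use bergman_metric_disc[OF c(1)] in \<open>simp_all add: hyp_def D.dT_def\<close>)
    then show ?thesis unfolding gaussian_curvature_def using bergman_metric_disc[OF c] hyp_pos[OF c] by simp
  qed
  interpret M: disc_immersion X A T "bergman_metric X A"
    by unfold_locales (use T_holomorphic T_lt T_immersion bergman_metric_disc in \<open>auto simp: hyp_def\<close>)
  show "complete_metric X A (bergman_metric X A)"
    by (rule M.section_imp_complete[of s]) (use s_continuous T_s s_T in \<open>auto simp: M.is_section_def\<close>)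
qed

end

section \<open>The characterization of the disc\<close>

text \<open>The preimages of chart domains cover an open set of the plane, so countably many of them
  suffice by Lindeloef's theorem; surjectivity of \<open>s\<close> carries the countable cover to
  the surface, where it is made disjoint.\<close>

lemma (in surface) ex_borel_partition:
  assumes s: "continuous_map (top_of_set B) X s" and B: "open (B :: complex set)" and onto: "topspace X \<subseteq> s ` B"
  shows "\<exists>S P. borel_partition X A S P"
proof -
  define W where "W c = {z \<in> B. s z \<in> chart_dom c}" for c
  have W: "open (W c)" if "c \<in> A" for c
    using openin_continuous_map_preimage[OF s chart_openin[OF chart[OF that]]] openin_open_trans[OF _ B] by (simp add: W_def)
  obtain \<F> where \<F>: "\<F> \<subseteq> W ` A" "countable \<F>" "\<Union>\<F> = \<Union>(W ` A)"
    using Lindelof[of "W ` A"] W by (metis imageE)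
  then obtain A' where A': "countable A'" "A' \<subseteq> A" "\<F> = W ` A'"
    using countable_subset_image[of \<F> W A] by blast
  have cover: "\<exists>c\<in>A'. p \<in> chart_dom c" if p: "p \<in> topspace X" for p
  proof -
    obtain z where z: "z \<in> B" "p = s z" using onto p by blast
    obtain c where "c \<in> A" "p \<in> chart_dom c" using chart_cover[OF p] by blast
    then have "z \<in> \<Union>(W ` A)" using z by (auto simp: W_def)
    then have "z \<in> \<Union>(W ` A')" using \<F>(3) A'(3) by simp
    then show ?thesis using z by (auto simp: W_def)
  qed
  then have "A' \<noteq> {}" using nonempty by blast
  define P where "P = from_nat_into A'"
  have PA': "range P = A'" unfolding P_def using range_from_nat_into[OF \<open>A' \<noteq> {}\<close> A'(1)] .
  then have PA: "P n \<in> A" for n using A'(2) by blast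
  define S where "S = disjointed (\<lambda>n. chart_dom (P n))"
  have sub: "S n \<subseteq> chart_dom (P n)" for n unfolding S_def by (rule disjointed_subset)
  have "(\<Union>n. S n) = (\<Union>n. chart_dom (P n))" unfolding S_def by (rule UN_disjointed_eq)
  also have "\<dots> = (\<Union>c\<in>A'. chart_dom c)" using PA' by blast
  also have "\<dots> = topspace X" using cover chart_subset[OF chart] A'(2) by blast
  finally have "(\<Union>n. S n) = topspace X" .
  moreover have "coord (P n) ` S n \<in> sets borel" for n
  proof -
    have "chart_dom (P m) \<in> sets (borel_space X)" for m by (rule openin_borel_space[OF chart_openin[OF chart[OF PA]]])
    then have "S n \<in> sets (borel_space X)" unfolding S_def disjointed_def by auto
    then show ?thesis using chart_borel_iff[OF chart[OF PA] sub] by simp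
  qed
  ultimately have "borel_partition X A S P"
    unfolding borel_partition_def using PA sub disjoint_family_disjointed by (simp add: S_def)
  then show ?thesis by blast
qed

text \<open>Without a partition no 2-form has an integral, not even \<open>0\<close>, so there are no square integrable forms at all.\<close>

lemma no_partition_no_kernel:
  assumes "\<nexists>S P. borel_partition X A S P" shows "bergman_kernel X A c p = 0"
proof -
  have "L2_forms X A = {}" using assms by (auto simp: L2_forms_def has_form_integral_def)
  then have "complete_orthonormal_basis X A E \<longleftrightarrow> E = {}" for E by (auto simp: complete_orthonormal_basis_def)
  then show ?thesis by (simp add: bergman_kernel_def)
qed

lemma (in surface) hyperbolic_imp_disc:
  assumes ex: "bergman_metric_exists X A" and complete: "complete_metric X A (bergman_metric X A)"
    and curv: "\<forall>c\<in>A. \<forall>p\<in>chart_dom c. gaussian_curvature (bergman_metric X A) c p = - 2"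
  shows "biholomorphic X A (top_of_set (ball 0 1)) (plane_atlas (ball 0 1))"
proof -
  obtain p where "p \<in> topspace X" using nonempty by blast
  then obtain c where "c \<in> A" "p \<in> chart_dom c" using chart_cover by blast
  \<comment> \<open>A single positive value of the kernel already produces a partition.\<close>
  then have "bergman_kernel X A c p > 0" using ex by (auto simp: bergman_metric_exists_def)
  then obtain S P where SP: "borel_partition X A S P" using no_partition_no_kernel[of X A c p] by auto
  interpret bergman_hyperbolic X A S P
    by unfold_locales (use SP ex curv in auto)
  obtain T p0 where p0: "p0 \<in> topspace X" "T p0 = 0"
    and T: "\<And>c. c \<in> A \<Longrightarrow> (\<lambda>z. T (chart_inv c z)) holomorphic_on coord c ` chart_dom c"
      "\<And>p. p \<in> topspace X \<Longrightarrow> norm (T p) < 1"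
      "\<And>c p. c \<in> A \<Longrightarrow> p \<in> chart_dom c \<Longrightarrow>
       bergman_metric X A c p = 2 * (norm (deriv (\<lambda>z. T (chart_inv c z)) (coord c p)))\<^sup>2 / (1 - (norm (T p))\<^sup>2)\<^sup>2"
    by (rule ex_disc_map) blast
  interpret disc_immersion X A T "bergman_metric X A"
  proof
    show "deriv (\<lambda>z. T (chart_inv c z)) (coord c p) \<noteq> 0" if "c \<in> A" "p \<in> chart_dom c" for c p
      using T(3)[OF that] ex that by (force simp: bergman_metric_exists_def)
  qed (use T in auto)
  obtain s where s: "is_section (ball 0 1) s" "s 0 = p0" by (rule complete_imp_section[OF complete p0])
  have "s (T p) = p" if "p \<in> topspace X" for p
    by (rule section_inverse[OF s(1) p0(1) _ that]) (simp add: s p0)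
  then show ?thesis by (rule section_imp_biholomorphic[OF s(1)])
qed

lemma (in surface) disc_imp_hyperbolic:
  assumes r: "0 < r" and bih: "biholomorphic X A (top_of_set (ball a r)) (plane_atlas (ball a r))"
  shows "bergman_metric_exists X A" "complete_metric X A (bergman_metric X A)"
    "\<forall>c\<in>A. \<forall>p\<in>chart_dom c. gaussian_curvature (bergman_metric X A) c p = - 2"
proof -
  obtain f h where f: "holomorphic_map X A (top_of_set (ball a r)) (plane_atlas (ball a r)) f"
    and h: "continuous_map (top_of_set (ball a r)) X h"
    and hf: "\<And>p. p \<in> topspace X \<Longrightarrow> h (f p) = p" and fh: "\<And>q. q \<in> ball a r \<Longrightarrow> f (h q) = q"
    using bih unfolding biholomorphic_def holomorphic_map_def by auto
  have fB: "f p \<in> ball a r" if "p \<in> topspace X" for p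
    using f that unfolding holomorphic_map_def continuous_map_def by auto
  have f_hol: "(\<lambda>z. f (chart_inv c z)) holomorphic_on coord c ` chart_dom c" if c: "c \<in> A" for c
  proof -
    have eq: "{p \<in> chart_dom c. f p \<in> ball a r} = chart_dom c" using fB in_topspace[OF c] by blast
    have "(\<lambda>z. f (chart_inv c z)) holomorphic_on coord c ` {p \<in> chart_dom c. f p \<in> ball a r}"
      using f c unfolding holomorphic_map_def plane_atlas_def by (simp add: o_def)
    then show ?thesis unfolding eq .
  qed
  define T where "T p = (f p - a) / of_real r" for p
  define s where "s t = h (a + of_real r * t)" for t
  have aff: "a + of_real r * t \<in> ball a r" if "t \<in> ball 0 1" for t
    using that r by (simp add: dist_norm norm_mult)
  have Ts: "T (s t) = t" if "t \<in> ball 0 1" for t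
    using fh[OF aff[OF that]] r by (simp add: T_def s_def)
  have sT: "s (T p) = p" if "p \<in> topspace X" for p
    using hf[OF that] r by (simp add: T_def s_def)
  have Tlt: "norm (T p) < 1" if "p \<in> topspace X" for p
    using fB[OF that] r by (simp add: T_def norm_divide dist_norm norm_minus_commute)
  have "continuous_map (top_of_set (ball 0 1)) (top_of_set (ball a r)) (\<lambda>t. a + of_real r * t)"
    using aff by (auto simp: continuous_map_in_subtopology intro!: continuous_intros)
  from continuous_map_compose[OF this h]
  have sc: "continuous_map (top_of_set (ball 0 1)) X s" by (simp add: s_def[abs_def] o_def)
  have "topspace X \<subseteq> s ` ball 0 1" using sT Tlt by (metis image_eqI mem_ball_0 subsetI)
  then obtain S P where SP: "borel_partition X A S P" using ex_borel_partition[OF sc open_ball] by blast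
  interpret disc_surface X A S P T s
  proof
    show "(\<lambda>z. T (chart_inv c z)) holomorphic_on coord c ` chart_dom c" if "c \<in> A" for c
      unfolding T_def using r by (intro holomorphic_intros f_hol[OF that]) simp
  qed (fact SP Tlt sc Ts sT)+
  show "bergman_metric_exists X A" "complete_metric X A (bergman_metric X A)"
    "\<forall>c\<in>A. \<forall>p\<in>chart_dom c. gaussian_curvature (bergman_metric X A) c p = - 2"
    using bergman_disc by blast+
qed

theorem corollary1p5:
  fixes X :: "'a topology" and A :: "'a chart set"
  assumes "riemann_surface X A"
  shows "(bergman_metric_exists X A \<and>
          complete_metric X A (bergman_metric X A) \<and>
          (\<forall>c\<in>A. \<forall>p\<in>chart_dom c. gaussian_curvature (bergman_metric X A) c p = - 2))
     \<longleftrightarrow> (\<exists>a r. 0 < r \<and>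
          biholomorphic X A (top_of_set (ball a r)) (plane_atlas (ball a r)))"
proof -
  interpret surface X A by unfold_locales (rule assms)
  show ?thesis
  proof
    assume "bergman_metric_exists X A \<and> complete_metric X A (bergman_metric X A) \<and>
      (\<forall>c\<in>A. \<forall>p\<in>chart_dom c. gaussian_curvature (bergman_metric X A) c p = - 2)"
    then have "biholomorphic X A (top_of_set (ball 0 1)) (plane_atlas (ball 0 1))"
      using hyperbolic_imp_disc by blast
    then show "\<exists>a r. 0 < r \<and> biholomorphic X A (top_of_set (ball a r)) (plane_atlas (ball a r))"
      by (intro exI[of _ 0] exI[of _ 1]) simp
  next
    assume "\<exists>a r. 0 < r \<and> biholomorphic X A (top_of_set (ball a r)) (plane_atlas (ball a r))"
    then show "bergman_metric_exists X A \<and> complete_metric X A (bergman_metric X A) \<and>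
      (\<forall>c\<in>A. \<forall>p\<in>chart_dom c. gaussian_curvature (bergman_metric X A) c p = - 2)"
      using disc_imp_hyperbolic by blast
  qed
qed

end
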